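(* Let $\mathfrak g=(\mathfrak g^{\mathbb C})^\sigma$ be a real form of inner type (i.e. $\sigma|_R=-\mathrm{Id}$) of a complex semisimple Lie algebra $\mathfrak g^{\mathbb C}$, with the root data described in the context, and let $G$ be a Lie group with Lie algebra $\mathfrak g$. Consider a triple $(\mathfrak k,\mathcal D^0,\epsilon)$ with $\mathfrak k=\mathfrak h_{\mathfrak k}+\sum_{\alpha\in R_0}\mathfrak g_\alpha$ a regular subalgebra of $\mathfrak g^{\mathbb C}$, $\mathcal D^0$ the bilinear map defined in the context, and $\epsilon\in\mathfrak k^*\otimes\bar{\mathfrak k}^*$ skew-Hermitian. Then $(\mathfrak k,\mathcal D^0,\epsilon)$ is a symmetric $\mathfrak g$-admissible triple (and the associated pair $(\mathcal J,D^0)$ defines a complex structure $J^{\mathcal J,D^0}$ on $T^*G$) if and only if: (i) $R_0$ is a positive root system ($R_0=R^+$) and $\mathfrak h_{\mathfrak k}+\bar{\mathfrak h}_{\mathfrak k}=\mathfrak h$; (ii) $\epsilon$ is of the form $$\epsilon=\epsilon_0+\sum_{\alpha\in R^+}\mu_\alpha\big(\alpha\otimes\omega_{-\alpha}-a_\alpha\,\omega_\alpha\otimes\alpha\big)+\sum_{\alpha,\beta,\alpha+\beta\in R^+}a_\alpha\mu_{\alpha+\beta}N_{\alpha\beta}\,\omega_\alpha\otimes\omega_{-\beta},$$ where $\epsilon_0\in\mathfrak h_{\mathfrak k}^*\otimes\bar{\mathfrak h}_{\mathfrak k}^*$ is skew-Hermitian (trivially extended to $\mathfrak k$) and $\mu_\alpha$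 ($\alpha\in R^+$) are arbitrary real constants; (iii) $\mathrm{Im}(\epsilon|_{\mathfrak h_{\mathfrak k}\cap i\mathfrak h_{\mathbb R}})$ is non-degenerate.
   Context: Root data. $\mathfrak g^{\mathbb C}=\mathfrak h+\sum_{\alpha\in R}\mathfrak g_\alpha$ is a complex semisimple Lie algebra with Cartan subalgebra $\mathfrak h$ and roots $R$. $H_\alpha\in\mathfrak h$ corresponds to $\alpha\in R$ under the identification $\mathfrak h\cong\mathfrak h^*$ given by the Killing form $B$; $\mathfrak h_{\mathbb R}$ is the real span of the $H_\alpha$. $\{E_\alpha\}_{\alpha\in R}$ is a Weyl basis: $E_\alpha\in\mathfrak g_\alpha$, $[E_\alpha,E_{-\alpha}]=H_\alpha$, $B(E_\alpha,E_{-\alpha})=1$, $[E_\alpha,E_\beta]=N_{\alpha\beta}E_{\alpha+\beta}$ when $\alpha,\beta,\alpha+\beta\in R$, with $N_{\alpha\beta}\in\mathbb R$, $N_{-\alpha,-\beta}=-N_{\alpha\beta}$. $\sigma$ is an antilinear involutive automorphism of the real Lie algebra underlying $\mathfrak g^{\mathbb C}$ (written also $x\mapsto\bar x$) which preserves $\mathfrak h$ and acts on $R$ by $\sigma(\alpha)=\overline{\alpha\circ\sigma}$; inner type means $\sigma(\alpha)=-\alpha$ for all $\alpha\in R$. Moreover $\sigma(E_\alpha)=-a_\alpha E_{\sigma(\alpha)}=-a_\alpha E_{-\alpha}$ with $a_\alpha=a_{-\alpha}\in\{\pm1\}$ and $a_{\alpha+\beta}=-a_\alpha a_\beta N_{\alpha\beta}^{-1}N_{\sigma(\alpha)\sigma(\beta)}$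 ($=a_\alpha a_\beta$) when $\alpha,\beta,\alpha+\beta\in R$. $\mathfrak g=(\mathfrak g^{\mathbb C})^\sigma$ is the real form, with Cartan subalgebra $\mathfrak h_{\mathfrak g}=\mathfrak h^\sigma=i\mathfrak h_{\mathbb R}$. A complex subalgebra $\mathfrak k\subset\mathfrak g^{\mathbb C}$ is regular if it is normalized by $\mathfrak h_{\mathfrak g}$; then $\mathfrak k=\mathfrak h_{\mathfrak k}+\sum_{\alpha\in R_0}\mathfrak g_\alpha$ with $\mathfrak h_{\mathfrak k}=\mathfrak k\cap\mathfrak h$ and $R_0\subset R$ closed (if $\alpha,\beta\in R_0$ and $\alpha+\beta\in R$ then $\alpha+\beta\in R_0$). $\bar{\mathfrak k}=\sigma(\mathfrak k)$, $\bar{\mathfrak h}_{\mathfrak k}=\sigma(\mathfrak h_{\mathfrak k})$. $\omega_\alpha\in(\mathfrak g^{\mathbb C})^*$ is defined by $\omega_\alpha(E_\beta)=\delta_{\alpha\beta}$, $\omega_\alpha|_{\mathfrak h}=0$; roots are extended by zero on root vectors. A form $\epsilon\in\mathfrak k^*\otimes\bar{\mathfrak k}^*$ (complex bilinear on $\mathfrak k\times\bar{\mathfrak k}$) is skew-Hermitian if $\epsilon(X,\bar Y)+\overline{\epsilon(Y,\bar X)}=0$ for $X,Y\in\mathfrak k$; similarly for $\epsilon_0$. The map $\mathcal D^0:\mathfrak g^{\mathbb C}\times\mathfrak g^{\mathbb C}\to\mathfrak g^{\mathbb C}$ is complex bilinear with $\mathcal D^0_{E_\alpha}(E_\beta)=-a_\alpha[E_{\sigma(\alpha)},E_\beta]$,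 $\mathcal D^0_H(E_\beta)=\sigma(\beta)(H)E_\beta$, $\mathcal D^0_{E_\beta}(H)=\sigma(\beta)(H)a_\beta E_{\sigma(\beta)}$, $\mathcal D^0_H(\tilde H)=0$ for $\alpha,\beta\in R$, $H,\tilde H\in\mathfrak h$ (here $\sigma(\alpha)=-\alpha$). It maps $\mathfrak g\times\mathfrak g$ to $\mathfrak g$; $D^0$ is the left-invariant connection on $G$ equal to $\mathcal D^0$ on left-invariant vector fields. A symmetric $\mathfrak g$-admissible triple $(\mathfrak k,\mathcal D,\epsilon)$ consists of: (1) a complex subalgebra $\mathfrak k\subset\mathfrak g^{\mathbb C}$ with $\mathfrak k+\bar{\mathfrak k}=\mathfrak g^{\mathbb C}$; (2) a bilinear map $\mathcal D:\mathfrak g\times\mathfrak g\to\mathfrak g$ whose complex linear extension satisfies $\mathcal D_{\mathfrak k}\bar{\mathfrak k}\subset\bar{\mathfrak k}$ and $-\mathcal D_X\mathcal D_YZ+\mathcal D_Y\mathcal D_XZ+\mathcal D_{[X,Y]}Z=0$ for $X,Y\in\mathfrak k$, $Z\in\bar{\mathfrak k}$; (3) a skew-Hermitian $\epsilon\in\mathfrak k^*\otimes\bar{\mathfrak k}^*$ with $\epsilon(X,\mathcal D_Y\bar Z)-\epsilon(Y,\mathcal D_X\bar Z)=\epsilon([X,Y],\bar Z)$ for $X,Y,Z\in\mathfrak k$, such that $g_\Delta=\mathrm{Im}(\epsilon|_\Delta)$ is non-degenerate on $\Delta=(\mathfrak k\cap\bar{\mathfrak k})^\sigma=\mathfrak k\cap\mathfrak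 g$. Associated structure: $\mathcal J$ is the left-invariant field of endomorphisms of $TG\oplus T^*G$ with $\mathcal J^2=-\mathrm{Id}$ whose $i$-eigenspace at $e\in G$ is $\{X+\xi\in\mathfrak k\oplus(\mathfrak g^{\mathbb C})^*:\xi|_{\bar{\mathfrak k}}=\epsilon(X,\cdot)\}$; it is symmetric with respect to the pairing $\frac12(\xi(Y)+\eta(X))$. $J^{\mathcal J,D^0}=\pi^*\mathcal J$ under the identification $T(T^*G)=H^{D^0}\oplus T^{\mathrm{vert}}(T^*G)\cong\pi^*(TG\oplus T^*G)$ given by the $D^0$-horizontal/vertical splitting, $\pi:T^*G\to G$. *)

theory Defs
  imports "HOL-Analysis.Analysis" "HOL-Algebra.Group" "HOL-Library.Function_Algebras"
begin

section \<open>Complex Lie algebras\<close>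

class complex_lie_algebra = ab_group_add +
  fixes scaleC :: "complex \<Rightarrow> 'a \<Rightarrow> 'a" (infixr "*\<^sub>C" 75)
    and lie_bracket :: "'a \<Rightarrow> 'a \<Rightarrow> 'a" ("[_, _]\<^sub>L")
  assumes scaleC_add_right: "c *\<^sub>C (x + y) = c *\<^sub>C x + c *\<^sub>C y"
    and scaleC_add_left: "(c + d) *\<^sub>C x = c *\<^sub>C x + d *\<^sub>C x"
    and scaleC_scaleC: "c *\<^sub>C d *\<^sub>C x = (c * d) *\<^sub>C x"
    and scaleC_one: "1 *\<^sub>C x = x"
    and lie_add_left: "[x + y, z]\<^sub>L = [x, z]\<^sub>L + [y, z]\<^sub>L"
    and lie_scaleC_left: "[c *\<^sub>C x, z]\<^sub>L = c *\<^sub>C [x, z]\<^sub>L"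
    and lie_self: "[x, x]\<^sub>L = 0"
    and lie_jacobi: "[x, [y, z]\<^sub>L]\<^sub>L + [y, [z, x]\<^sub>L]\<^sub>L + [z, [x, y]\<^sub>L]\<^sub>L = 0"

interpretation cvec: vector_space "scaleC :: complex \<Rightarrow> 'a \<Rightarrow> 'a::complex_lie_algebra"
  by unfold_locales (simp_all add: scaleC_add_right scaleC_add_left scaleC_scaleC scaleC_one)

abbreviation clinear_map :: "('g::complex_lie_algebra \<Rightarrow> 'g) \<Rightarrow> bool" where
  "clinear_map \<equiv> Vector_Spaces.linear scaleC scaleC"

abbreviation cfunctional :: "('g::complex_lie_algebra \<Rightarrow> complex) \<Rightarrow> bool" where
  "cfunctional \<equiv> Vector_Spaces.linear scaleC (*)"

definition cbilinear_map :: "('g::complex_lie_algebra \<Rightarrow> 'g \<Rightarrow> 'g) \<Rightarrow> bool" where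
  "cbilinear_map D \<longleftrightarrow> (\<forall>X. clinear_map (D X)) \<and> (\<forall>Y. clinear_map (\<lambda>X. D X Y))"

definition cbilinear_form_on ::
    "'g::complex_lie_algebra set \<Rightarrow> 'g set \<Rightarrow> ('g \<Rightarrow> 'g \<Rightarrow> complex) \<Rightarrow> bool" where
  "cbilinear_form_on V W f \<longleftrightarrow>
     (\<forall>x\<in>V. \<forall>x'\<in>V. \<forall>y\<in>W. f (x + x') y = f x y + f x' y) \<and>
     (\<forall>c. \<forall>x\<in>V. \<forall>y\<in>W. f (c *\<^sub>C x) y = c * f x y) \<and>
     (\<forall>x\<in>V. \<forall>y\<in>W. \<forall>y'\<in>W. f x (y + y') = f x y + f x y') \<and>
     (\<forall>c. \<forall>x\<in>V. \<forall>y\<in>W. f x (c *\<^sub>C y) = c * f x y)"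

definition lie_subalgebra :: "'g::complex_lie_algebra set \<Rightarrow> bool" where
  "lie_subalgebra k \<longleftrightarrow> cvec.subspace k \<and> (\<forall>x\<in>k. \<forall>y\<in>k. [x, y]\<^sub>L \<in> k)"

definition lie_ideal :: "'g::complex_lie_algebra set \<Rightarrow> bool" where
  "lie_ideal I \<longleftrightarrow> cvec.subspace I \<and> (\<forall>x. \<forall>y\<in>I. [x, y]\<^sub>L \<in> I)"

definition derived_algebra :: "'g::complex_lie_algebra set \<Rightarrow> 'g set" where
  "derived_algebra I = cvec.span {[x, y]\<^sub>L | x y. x \<in> I \<and> y \<in> I}"

definition solvable :: "'g::complex_lie_algebra set \<Rightarrow> bool" where
  "solvable I \<longleftrightarrow> (\<exists>n. (derived_algebra ^^ n) I = {0})"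

definition semisimple :: "'g::complex_lie_algebra itself \<Rightarrow> bool" where
  "semisimple _ \<longleftrightarrow>
     (\<exists>B :: 'g set. finite B \<and> cvec.span B = UNIV) \<and>
     (\<forall>I :: 'g set. lie_ideal I \<and> solvable I \<longrightarrow> I = {0})"

definition ctrace :: "('g::complex_lie_algebra \<Rightarrow> 'g) \<Rightarrow> complex" where
  "ctrace f = (let B = (SOME B. finite B \<and> cvec.independent B \<and> cvec.span B = UNIV)
               in \<Sum>b\<in>B. cvec.representation B (f b) b)"

definition killing_form :: "'g::complex_lie_algebra \<Rightarrow> 'g \<Rightarrow> complex" where
  "killing_form x y = ctrace (\<lambda>z. [x, [y, z]\<^sub>L]\<^sub>L)"

text \<open>The usual definition of a Cartan subalgebra in the semisimple case; over a general Lie algebra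
  the notion is a different one.\<close>

definition cartan_subalgebra :: "'g::complex_lie_algebra set \<Rightarrow> bool" where
  "cartan_subalgebra h \<longleftrightarrow>
     lie_subalgebra h \<and> (\<forall>x\<in>h. \<forall>y\<in>h. [x, y]\<^sub>L = 0) \<and>
     (\<forall>x. (\<forall>y\<in>h. [x, y]\<^sub>L = 0) \<longrightarrow> x \<in> h) \<and>
     (\<forall>H\<in>h. cvec.span {x. \<exists>c. [H, x]\<^sub>L = c *\<^sub>C x} = UNIV)"

section \<open>Root data\<close>

text \<open>A functional on \<open>h\<close> is represented by a function on the whole algebra that vanishes
  outside \<open>h\<close>, so that sums and negatives of roots are pointwise.\<close>

definition root_space ::
    "'g::complex_lie_algebra set \<Rightarrow> ('g \<Rightarrow> complex) \<Rightarrow> 'g set" where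
  "root_space h \<alpha> = {x. \<forall>H\<in>h. [H, x]\<^sub>L = \<alpha> H *\<^sub>C x}"

definition roots :: "'g::complex_lie_algebra set \<Rightarrow> ('g \<Rightarrow> complex) set" where
  "roots h = {\<alpha>. (\<forall>H\<in>h. \<forall>H'\<in>h. \<alpha> (H + H') = \<alpha> H + \<alpha> H') \<and>
                 (\<forall>c. \<forall>H\<in>h. \<alpha> (c *\<^sub>C H) = c * \<alpha> H) \<and>
                 (\<forall>x. x \<notin> h \<longrightarrow> \<alpha> x = 0) \<and>
                 \<alpha> \<noteq> 0 \<and> root_space h \<alpha> \<noteq> {0}}"

definition root_dual :: "'g::complex_lie_algebra set \<Rightarrow> ('g \<Rightarrow> complex) \<Rightarrow> 'g" where
  "root_dual h \<alpha> = (THE H. H \<in> h \<and> (\<forall>H'\<in>h. killing_form H H' = \<alpha> H'))"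

definition real_cartan :: "'g::complex_lie_algebra set \<Rightarrow> 'g set" where
  "real_cartan h = {\<Sum>\<alpha>\<in>roots h. complex_of_real (c \<alpha>) *\<^sub>C root_dual h \<alpha> | c :: ('g \<Rightarrow> complex) \<Rightarrow> real. True}"

definition weyl_basis ::
    "'g::complex_lie_algebra set \<Rightarrow> (('g \<Rightarrow> complex) \<Rightarrow> 'g) \<Rightarrow>
     (('g \<Rightarrow> complex) \<Rightarrow> ('g \<Rightarrow> complex) \<Rightarrow> real) \<Rightarrow> bool" where
  "weyl_basis h E N \<longleftrightarrow>
     (\<forall>\<alpha>\<in>roots h. root_space h \<alpha> = cvec.span {E \<alpha>} \<and>
        [E \<alpha>, E (- \<alpha>)]\<^sub>L = root_dual h \<alpha> \<and> killing_form (E \<alpha>) (E (- \<alpha>)) = 1) \<and>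
     (\<forall>\<alpha>\<in>roots h. \<forall>\<beta>\<in>roots h. \<alpha> + \<beta> \<in> roots h \<longrightarrow>
        [E \<alpha>, E \<beta>]\<^sub>L = complex_of_real (N \<alpha> \<beta>) *\<^sub>C E (\<alpha> + \<beta>) \<and> N (- \<alpha>) (- \<beta>) = - N \<alpha> \<beta>)"

definition conjugation :: "('g::complex_lie_algebra \<Rightarrow> 'g) \<Rightarrow> bool" where
  "conjugation \<sigma> \<longleftrightarrow>
     (\<forall>x y. \<sigma> (x + y) = \<sigma> x + \<sigma> y) \<and> (\<forall>c x. \<sigma> (c *\<^sub>C x) = cnj c *\<^sub>C \<sigma> x) \<and>
     (\<forall>x y. \<sigma> [x, y]\<^sub>L = [\<sigma> x, \<sigma> y]\<^sub>L) \<and> (\<forall>x. \<sigma> (\<sigma> x) = x)"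

definition real_form :: "('g::complex_lie_algebra \<Rightarrow> 'g) \<Rightarrow> 'g set" where
  "real_form \<sigma> = {x. \<sigma> x = x}"

definition conj_root ::
    "('g::complex_lie_algebra \<Rightarrow> 'g) \<Rightarrow> ('g \<Rightarrow> complex) \<Rightarrow> ('g \<Rightarrow> complex)" where
  "conj_root \<sigma> \<alpha> = (\<lambda>H. cnj (\<alpha> (\<sigma> H)))"

locale inner_real_form =
  fixes h :: "'g::complex_lie_algebra set"
    and E :: "('g \<Rightarrow> complex) \<Rightarrow> 'g"
    and N :: "('g \<Rightarrow> complex) \<Rightarrow> ('g \<Rightarrow> complex) \<Rightarrow> real"
    and a :: "('g \<Rightarrow> complex) \<Rightarrow> real"
    and \<sigma> :: "'g \<Rightarrow> 'g"
  assumes semisimple: "semisimple TYPE('g)"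
    and cartan: "cartan_subalgebra h"
    and root_decomposition: "cvec.span (h \<union> (\<Union>\<alpha>\<in>roots h. root_space h \<alpha>)) = UNIV"
    and weyl_basis: "weyl_basis h E N"
    and conjugation: "conjugation \<sigma>"
    and sigma_cartan: "\<sigma> ` h = h"
    and inner_type: "\<And>\<alpha>. \<alpha> \<in> roots h \<Longrightarrow> conj_root \<sigma> \<alpha> = - \<alpha>"
    and sigma_E: "\<And>\<alpha>. \<alpha> \<in> roots h \<Longrightarrow>
      \<sigma> (E \<alpha>) = - (complex_of_real (a \<alpha>) *\<^sub>C E (conj_root \<sigma> \<alpha>))"
    and a_sign: "\<And>\<alpha>. \<alpha> \<in> roots h \<Longrightarrow> a \<alpha> \<in> {1, -1} \<and> a (- \<alpha>) = a \<alpha>"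
    and a_add: "\<And>\<alpha> \<beta>. \<alpha> \<in> roots h \<Longrightarrow> \<beta> \<in> roots h \<Longrightarrow> \<alpha> + \<beta> \<in> roots h \<Longrightarrow>
      a (\<alpha> + \<beta>) = - a \<alpha> * a \<beta> * inverse (N \<alpha> \<beta>) * N (conj_root \<sigma> \<alpha>) (conj_root \<sigma> \<beta>)"

definition cartan_proj ::
    "'g::complex_lie_algebra set \<Rightarrow> (('g \<Rightarrow> complex) \<Rightarrow> 'g) \<Rightarrow> 'g \<Rightarrow> 'g" where
  "cartan_proj h E =
     (THE f. clinear_map f \<and> (\<forall>H\<in>h. f H = H) \<and> (\<forall>\<beta>\<in>roots h. f (E \<beta>) = 0))"

definition omega ::
    "'g::complex_lie_algebra set \<Rightarrow> (('g \<Rightarrow> complex) \<Rightarrow> 'g) \<Rightarrow> ('g \<Rightarrow> complex) \<Rightarrow> 'g \<Rightarrow> complex" where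
  "omega h E \<alpha> =
     (THE f. cfunctional f \<and> (\<forall>H\<in>h. f H = 0) \<and>
             (\<forall>\<beta>\<in>roots h. f (E \<beta>) = (if \<beta> = \<alpha> then 1 else 0)))"

definition root_ext ::
    "'g::complex_lie_algebra set \<Rightarrow> (('g \<Rightarrow> complex) \<Rightarrow> 'g) \<Rightarrow> ('g \<Rightarrow> complex) \<Rightarrow> 'g \<Rightarrow> complex" where
  "root_ext h E \<alpha> =
     (THE f. cfunctional f \<and> (\<forall>H\<in>h. f H = \<alpha> H) \<and> (\<forall>\<beta>\<in>roots h. f (E \<beta>) = 0))"

definition D_zero ::
    "'g::complex_lie_algebra set \<Rightarrow> (('g \<Rightarrow> complex) \<Rightarrow> 'g) \<Rightarrow> (('g \<Rightarrow> complex) \<Rightarrow> real) \<Rightarrow>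
     ('g \<Rightarrow> 'g) \<Rightarrow> 'g \<Rightarrow> 'g \<Rightarrow> 'g" where
  "D_zero h E a \<sigma> = (THE D. cbilinear_map D \<and>
     (\<forall>\<alpha>\<in>roots h. \<forall>\<beta>\<in>roots h.
        D (E \<alpha>) (E \<beta>) = - (complex_of_real (a \<alpha>) *\<^sub>C [E (conj_root \<sigma> \<alpha>), E \<beta>]\<^sub>L)) \<and>
     (\<forall>H\<in>h. \<forall>\<beta>\<in>roots h. D H (E \<beta>) = conj_root \<sigma> \<beta> H *\<^sub>C E \<beta>) \<and>
     (\<forall>H\<in>h. \<forall>\<beta>\<in>roots h.
        D (E \<beta>) H = (conj_root \<sigma> \<beta> H * complex_of_real (a \<beta>)) *\<^sub>C E (conj_root \<sigma> \<beta>)) \<and>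
     (\<forall>H\<in>h. \<forall>H'\<in>h. D H H' = 0))"

definition regular_subalgebra ::
    "'g::complex_lie_algebra set \<Rightarrow> ('g \<Rightarrow> 'g) \<Rightarrow> 'g set \<Rightarrow> bool" where
  "regular_subalgebra h \<sigma> k \<longleftrightarrow>
     lie_subalgebra k \<and> (\<forall>H\<in>h \<inter> real_form \<sigma>. \<forall>X\<in>k. [H, X]\<^sub>L \<in> k)"

definition roots_of ::
    "'g::complex_lie_algebra set \<Rightarrow> 'g set \<Rightarrow> ('g \<Rightarrow> complex) set" where
  "roots_of h k = {\<alpha> \<in> roots h. root_space h \<alpha> \<subseteq> k}"

definition positive_root_system ::
    "('g::complex_lie_algebra \<Rightarrow> complex) set \<Rightarrow> ('g \<Rightarrow> complex) set \<Rightarrow> bool" where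
  "positive_root_system R P \<longleftrightarrow>
     P \<union> uminus ` P = R \<and> P \<inter> uminus ` P = {} \<and>
     (\<forall>\<alpha>\<in>P. \<forall>\<beta>\<in>P. \<alpha> + \<beta> \<in> R \<longrightarrow> \<alpha> + \<beta> \<in> P)"

section \<open>Symmetric admissible triples\<close>

definition skew_hermitian_on ::
    "('g::complex_lie_algebra \<Rightarrow> 'g) \<Rightarrow> 'g set \<Rightarrow> ('g \<Rightarrow> 'g \<Rightarrow> complex) \<Rightarrow> bool" where
  "skew_hermitian_on \<sigma> k \<epsilon> \<longleftrightarrow>
     cbilinear_form_on k (\<sigma> ` k) \<epsilon> \<and> (\<forall>X\<in>k. \<forall>Y\<in>k. \<epsilon> X (\<sigma> Y) + cnj (\<epsilon> Y (\<sigma> X)) = 0)"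

text \<open>For a symmetric real bilinear form, as is \<open>Im \<epsilon>\<close> on real vectors when \<open>\<epsilon>\<close> is
  skew-Hermitian, the one-sided condition suffices.\<close>

definition nondegenerate_on ::
    "'g::complex_lie_algebra set \<Rightarrow> ('g \<Rightarrow> 'g \<Rightarrow> real) \<Rightarrow> bool" where
  "nondegenerate_on V b \<longleftrightarrow> (\<forall>X\<in>V. (\<forall>Y\<in>V. b X Y = 0) \<longrightarrow> X = 0)"

text \<open>A real bilinear map on the real form is identified with its complex bilinear extension,
  i.e. with a complex bilinear map \<open>D\<close> preserving the real form.\<close>

definition symmetric_admissible ::
    "('g::complex_lie_algebra \<Rightarrow> 'g) \<Rightarrow> 'g set \<Rightarrow> ('g \<Rightarrow> 'g \<Rightarrow> 'g) \<Rightarrow>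
     ('g \<Rightarrow> 'g \<Rightarrow> complex) \<Rightarrow> bool" where
  "symmetric_admissible \<sigma> k D \<epsilon> \<longleftrightarrow>
     lie_subalgebra k \<and> {X + Y | X Y. X \<in> k \<and> Y \<in> \<sigma> ` k} = UNIV \<and>
     cbilinear_map D \<and>
     (\<forall>X\<in>real_form \<sigma>. \<forall>Y\<in>real_form \<sigma>. D X Y \<in> real_form \<sigma>) \<and>
     (\<forall>X\<in>k. \<forall>Y\<in>\<sigma> ` k. D X Y \<in> \<sigma> ` k) \<and>
     (\<forall>X\<in>k. \<forall>Y\<in>k. \<forall>Z\<in>\<sigma> ` k. - D X (D Y Z) + D Y (D X Z) + D [X, Y]\<^sub>L Z = 0) \<and>
     skew_hermitian_on \<sigma> k \<epsilon> \<and>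
     (\<forall>X\<in>k. \<forall>Y\<in>k. \<forall>Z\<in>k.
        \<epsilon> X (D Y (\<sigma> Z)) - \<epsilon> Y (D X (\<sigma> Z)) = \<epsilon> [X, Y]\<^sub>L (\<sigma> Z)) \<and>
     nondegenerate_on (k \<inter> real_form \<sigma>) (\<lambda>X Y. Im (\<epsilon> X Y))"

section \<open>Smooth manifolds given by atlases\<close>

primrec Ck_on ::
    "nat \<Rightarrow> 'a::real_normed_vector set \<Rightarrow> ('a \<Rightarrow> 'b::real_normed_vector) \<Rightarrow> bool" where
  "Ck_on 0 S f \<longleftrightarrow> continuous_on S f"
| "Ck_on (Suc n) S f \<longleftrightarrow>
     f differentiable_on S \<and> (\<forall>v. Ck_on n S (\<lambda>x. frechet_derivative f (at x) v))"

definition smooth_on ::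
    "'a::euclidean_space set \<Rightarrow> ('a \<Rightarrow> 'b::euclidean_space) \<Rightarrow> bool" where
  "smooth_on S f \<longleftrightarrow> open S \<and> (\<forall>n. Ck_on n S f)"

text \<open>A chart is a domain together with a coordinate map, whose values off the domain are
  irrelevant.\<close>

type_synonym ('m, 'e) chart = "'m set \<times> ('m \<Rightarrow> 'e)"

definition chart_inv :: "('m, 'e) chart \<Rightarrow> 'e \<Rightarrow> 'm" where
  "chart_inv c = inv_into (fst c) (snd c)"

definition points :: "('m, 'e) chart set \<Rightarrow> 'm set" where
  "points A = (\<Union>c\<in>A. fst c)"

definition charts_at :: "('m, 'e) chart set \<Rightarrow> 'm \<Rightarrow> ('m, 'e) chart set" where
  "charts_at A x = {c \<in> A. x \<in> fst c}"

definition atlas_topology :: "('m, 'e::euclidean_space) chart set \<Rightarrow> 'm topology" where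
  "atlas_topology A =
     topology (\<lambda>W. W \<subseteq> points A \<and> (\<forall>c\<in>A. open (snd c ` (W \<inter> fst c))))"

definition smooth_manifold :: "'m set \<Rightarrow> ('m, 'e::euclidean_space) chart set \<Rightarrow> bool" where
  "smooth_manifold M A \<longleftrightarrow>
     points A = M \<and> (\<forall>c\<in>A. inj_on (snd c) (fst c)) \<and>
     (\<forall>c\<in>A. \<forall>d\<in>A. smooth_on (snd c ` (fst c \<inter> fst d)) (snd d \<circ> chart_inv c)) \<and>
     Hausdorff_space (atlas_topology A) \<and> second_countable (atlas_topology A)"

definition smooth_map ::
    "('m, 'e::euclidean_space) chart set \<Rightarrow> ('n, 'f::euclidean_space) chart set \<Rightarrow>
     ('m \<Rightarrow> 'n) \<Rightarrow> bool" where
  "smooth_map A B f \<longleftrightarrow>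
     f ` points A \<subseteq> points B \<and>
     (\<forall>c\<in>A. \<forall>d\<in>B. smooth_on (snd c ` (fst c \<inter> f -` fst d)) (snd d \<circ> f \<circ> chart_inv c))"

definition smooth_fun :: "('m, 'e::euclidean_space) chart set \<Rightarrow> ('m \<Rightarrow> real) \<Rightarrow> bool" where
  "smooth_fun A f \<longleftrightarrow> (\<forall>c\<in>A. smooth_on (snd c ` fst c) (f \<circ> chart_inv c))"

definition prod_atlas ::
    "('m, 'e) chart set \<Rightarrow> ('n, 'f) chart set \<Rightarrow> ('m \<times> 'n, 'e \<times> 'f) chart set" where
  "prod_atlas A B = {(fst c \<times> fst d, map_prod (snd c) (snd d)) | c d. c \<in> A \<and> d \<in> B}"

text \<open>A tangent vector is the family of its coordinate vectors in all charts around the base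
  point, transforming under coordinate changes by the derivative; it is zero at all other
  charts.\<close>

type_synonym ('m, 'e) tvec = "('m, 'e) chart \<Rightarrow> 'e"

definition coord_change_deriv ::
    "('m, 'e::euclidean_space) chart \<Rightarrow> ('m, 'e) chart \<Rightarrow> 'm \<Rightarrow> 'e \<Rightarrow> 'e" where
  "coord_change_deriv c d x = frechet_derivative (snd d \<circ> chart_inv c) (at (snd c x))"

definition tangent_space ::
    "('m, 'e::euclidean_space) chart set \<Rightarrow> 'm \<Rightarrow> ('m, 'e) tvec set" where
  "tangent_space A x =
     {v. (\<forall>c. c \<notin> charts_at A x \<longrightarrow> v c = 0) \<and>
         (\<forall>c\<in>charts_at A x. \<forall>d\<in>charts_at A x. v d = coord_change_deriv c d x (v c))}"

definition coord_vec ::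
    "('m, 'e::euclidean_space) chart set \<Rightarrow> ('m, 'e) chart \<Rightarrow> 'm \<Rightarrow> 'e \<Rightarrow> ('m, 'e) tvec" where
  "coord_vec A c x w = (\<lambda>d. if d \<in> charts_at A x then coord_change_deriv c d x w else 0)"

definition pushforward ::
    "('m, 'e::euclidean_space) chart set \<Rightarrow> ('n, 'f::euclidean_space) chart set \<Rightarrow>
     ('m \<Rightarrow> 'n) \<Rightarrow> 'm \<Rightarrow> ('m, 'e) tvec \<Rightarrow> ('n, 'f) tvec" where
  "pushforward A B f x v =
     (\<lambda>d. if d \<in> charts_at B (f x)
          then (let c = (SOME c. c \<in> charts_at A x)
                in frechet_derivative (snd d \<circ> f \<circ> chart_inv c) (at (snd c x)) (v c))
          else 0)"

definition dir_deriv ::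
    "('m, 'e::euclidean_space) chart set \<Rightarrow> ('m \<Rightarrow> real) \<Rightarrow> 'm \<Rightarrow> ('m, 'e) tvec \<Rightarrow> real" where
  "dir_deriv A f x v =
     (let c = (SOME c. c \<in> charts_at A x)
      in frechet_derivative (f \<circ> chart_inv c) (at (snd c x)) (v c))"

definition velocity ::
    "('m, 'e::euclidean_space) chart set \<Rightarrow> (real \<Rightarrow> 'm) \<Rightarrow> real \<Rightarrow> ('m, 'e) tvec" where
  "velocity A \<gamma> t =
     (\<lambda>d. if d \<in> charts_at A (\<gamma> t) then vector_derivative (snd d \<circ> \<gamma>) (at t) else 0)"

definition local_rep ::
    "('m, 'e) chart \<Rightarrow> ('m \<Rightarrow> ('m, 'e) tvec) \<Rightarrow> 'e \<Rightarrow> 'e" where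
  "local_rep c X = (\<lambda>u. X (chart_inv c u) c)"

definition vector_field ::
    "('m, 'e::euclidean_space) chart set \<Rightarrow> ('m \<Rightarrow> ('m, 'e) tvec) \<Rightarrow> bool" where
  "vector_field A X \<longleftrightarrow>
     (\<forall>x\<in>points A. X x \<in> tangent_space A x) \<and> (\<forall>x. x \<notin> points A \<longrightarrow> X x = 0) \<and>
     (\<forall>c\<in>A. smooth_on (snd c ` fst c) (local_rep c X))"

definition vf_bracket ::
    "('m, 'e::euclidean_space) chart set \<Rightarrow> ('m \<Rightarrow> ('m, 'e) tvec) \<Rightarrow> ('m \<Rightarrow> ('m, 'e) tvec) \<Rightarrow>
     ('m \<Rightarrow> ('m, 'e) tvec)" where
  "vf_bracket A X Y =
     (\<lambda>x c. if c \<in> charts_at A x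
            then frechet_derivative (local_rep c Y) (at (snd c x)) (X x c)
               - frechet_derivative (local_rep c X) (at (snd c x)) (Y x c)
            else 0)"

definition endo_apply ::
    "('m, 'e::euclidean_space) chart set \<Rightarrow> ('m \<Rightarrow> ('m, 'e) tvec \<Rightarrow> ('m, 'e) tvec) \<Rightarrow>
     ('m \<Rightarrow> ('m, 'e) tvec) \<Rightarrow> ('m \<Rightarrow> ('m, 'e) tvec)" where
  "endo_apply A J X = (\<lambda>x. if x \<in> points A then J x (X x) else 0)"

definition almost_complex_structure ::
    "('m, 'e::euclidean_space) chart set \<Rightarrow> ('m \<Rightarrow> ('m, 'e) tvec \<Rightarrow> ('m, 'e) tvec) \<Rightarrow> bool" where
  "almost_complex_structure A J \<longleftrightarrow>
     (\<forall>x\<in>points A. \<forall>v\<in>tangent_space A x.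
        J x v \<in> tangent_space A x \<and> J x (J x v) = - v \<and>
        (\<forall>r::real. J x (\<lambda>c. r *\<^sub>R v c) = (\<lambda>c. r *\<^sub>R J x v c)) \<and>
        (\<forall>w\<in>tangent_space A x. J x (v + w) = J x v + J x w)) \<and>
     (\<forall>c\<in>A. \<forall>w. smooth_on (snd c ` fst c)
        (\<lambda>u. J (chart_inv c u) (coord_vec A c (chart_inv c u) w) c))"

text \<open>A complex structure is an integrable almost complex structure, i.e. one with vanishing
  Nijenhuis tensor.\<close>

definition complex_structure ::
    "('m, 'e::euclidean_space) chart set \<Rightarrow> ('m \<Rightarrow> ('m, 'e) tvec \<Rightarrow> ('m, 'e) tvec) \<Rightarrow> bool" where
  "complex_structure A J \<longleftrightarrow>
     almost_complex_structure A J \<and>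
     (\<forall>X Y. vector_field A X \<longrightarrow> vector_field A Y \<longrightarrow>
        vf_bracket A (endo_apply A J X) (endo_apply A J Y)
        - endo_apply A J (vf_bracket A (endo_apply A J X) Y)
        - endo_apply A J (vf_bracket A X (endo_apply A J Y))
        - vf_bracket A X Y = 0)"

section \<open>The cotangent bundle and connections\<close>

type_synonym ('m, 'e) covec = "('m, 'e) tvec \<Rightarrow> real"

text \<open>Covectors are linear functionals on the tangent space, extended by zero outside it.\<close>

definition cotangent_space ::
    "('m, 'e::euclidean_space) chart set \<Rightarrow> 'm \<Rightarrow> ('m, 'e) covec set" where
  "cotangent_space A x =
     {\<xi>. (\<forall>v. v \<notin> tangent_space A x \<longrightarrow> \<xi> v = 0) \<and>
         (\<forall>v\<in>tangent_space A x. \<forall>w\<in>tangent_space A x. \<xi> (v + w) = \<xi> v + \<xi> w) \<and>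
         (\<forall>r. \<forall>v\<in>tangent_space A x. \<xi> (\<lambda>c. r *\<^sub>R v c) = r * \<xi> v)}"

text \<open>The chart \<open>(x, p)\<close> of the cotangent bundle; the covector components \<open>p\<close> are collected in
  a vector via the standard basis.\<close>

definition cotangent_chart ::
    "('m, 'e::euclidean_space) chart set \<Rightarrow> ('m, 'e) chart \<Rightarrow>
     ('m \<times> ('m, 'e) covec, 'e \<times> 'e) chart" where
  "cotangent_chart A c =
     ({(x, \<xi>). x \<in> fst c \<and> \<xi> \<in> cotangent_space A x},
      \<lambda>(x, \<xi>). (snd c x, \<Sum>b\<in>Basis. \<xi> (coord_vec A c x b) *\<^sub>R b))"

definition cotangent_atlas ::
    "('m, 'e::euclidean_space) chart set \<Rightarrow> ('m \<times> ('m, 'e) covec, 'e \<times> 'e) chart set" where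
  "cotangent_atlas A = cotangent_chart A ` A"

text \<open>\<open>nab x v Y\<close> is the covariant derivative of the vector field \<open>Y\<close> in direction of the tangent
  vector \<open>v\<close> at \<open>x\<close>.\<close>

type_synonym ('m, 'e) covderiv =
  "'m \<Rightarrow> ('m, 'e) tvec \<Rightarrow> ('m \<Rightarrow> ('m, 'e) tvec) \<Rightarrow> ('m, 'e) tvec"

definition affine_connection ::
    "('m, 'e::euclidean_space) chart set \<Rightarrow> ('m, 'e) covderiv \<Rightarrow> bool" where
  "affine_connection A nab \<longleftrightarrow>
     (\<forall>Y. vector_field A Y \<longrightarrow>
       (\<forall>x\<in>points A. \<forall>v\<in>tangent_space A x.
          nab x v Y \<in> tangent_space A x \<and>
          (\<forall>r::real. nab x (\<lambda>c. r *\<^sub>R v c) Y = (\<lambda>c. r *\<^sub>R nab x v Y c)) \<and>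
          (\<forall>w\<in>tangent_space A x. nab x (v + w) Y = nab x v Y + nab x w Y) \<and>
          (\<forall>Z. vector_field A Z \<longrightarrow> nab x v (Y + Z) = nab x v Y + nab x v Z) \<and>
          (\<forall>f. smooth_fun A f \<longrightarrow>
             nab x v (\<lambda>y c. f y *\<^sub>R Y y c) =
               (\<lambda>c. dir_deriv A f x v *\<^sub>R Y x c + f x *\<^sub>R nab x v Y c))) \<and>
       (\<forall>X. vector_field A X \<longrightarrow>
          vector_field A (\<lambda>x. if x \<in> points A then nab x (X x) Y else 0)))"

text \<open>If \<open>s\<close> is a 1-form with \<open>s(x) = \<xi>\<close> that is parallel at \<open>x\<close> for the dual connection, then
  \<open>v (s Y) = \<xi> (nab x v Y)\<close> for all \<open>Y\<close>. So the horizontal lift of \<open>v\<close> to \<open>\<xi>\<close>, which is the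
  image of \<open>v\<close> under the differential of \<open>s\<close>, is the vector over \<open>v\<close> along which each
  fibrewise linear function \<open>\<eta> \<mapsto> \<eta> (Y y)\<close> has derivative \<open>\<xi> (nab x v Y)\<close>.\<close>

definition horizontal_lift ::
    "('m, 'e::euclidean_space) chart set \<Rightarrow> ('m, 'e) covderiv \<Rightarrow> 'm \<times> ('m, 'e) covec \<Rightarrow>
     ('m, 'e) tvec \<Rightarrow> ('m \<times> ('m, 'e) covec, 'e \<times> 'e) tvec" where
  "horizontal_lift A nab p v =
     (THE w. w \<in> tangent_space (cotangent_atlas A) p \<and>
        pushforward (cotangent_atlas A) A fst p w = v \<and>
        (\<forall>Y. vector_field A Y \<longrightarrow>
           dir_deriv (cotangent_atlas A) (\<lambda>(y, \<eta>). \<eta> (Y y)) p w = snd p (nab (fst p) v Y)))"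

definition vertical_lift ::
    "('m, 'e::euclidean_space) chart set \<Rightarrow> 'm \<times> ('m, 'e) covec \<Rightarrow> ('m, 'e) covec \<Rightarrow>
     ('m \<times> ('m, 'e) covec, 'e \<times> 'e) tvec" where
  "vertical_lift A p \<eta> = velocity (cotangent_atlas A) (\<lambda>t. (fst p, \<lambda>v. snd p v + t * \<eta> v)) 0"

definition splitting_iso ::
    "('m, 'e::euclidean_space) chart set \<Rightarrow> ('m, 'e) covderiv \<Rightarrow> 'm \<times> ('m, 'e) covec \<Rightarrow>
     ('m, 'e) tvec \<times> ('m, 'e) covec \<Rightarrow> ('m \<times> ('m, 'e) covec, 'e \<times> 'e) tvec" where
  "splitting_iso A nab p u = horizontal_lift A nab p (fst u) + vertical_lift A p (snd u)"

definition cotangent_structure ::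
    "('m, 'e::euclidean_space) chart set \<Rightarrow> ('m, 'e) covderiv \<Rightarrow>
     ('m \<Rightarrow> ('m, 'e) tvec \<times> ('m, 'e) covec \<Rightarrow> ('m, 'e) tvec \<times> ('m, 'e) covec) \<Rightarrow>
     'm \<times> ('m, 'e) covec \<Rightarrow> ('m \<times> ('m, 'e) covec, 'e \<times> 'e) tvec \<Rightarrow>
     ('m \<times> ('m, 'e) covec, 'e \<times> 'e) tvec" where
  "cotangent_structure A nab \<J> p w =
     splitting_iso A nab p
       (\<J> (fst p) (inv_into (tangent_space A (fst p) \<times> cotangent_space A (fst p))
                    (splitting_iso A nab p) w))"

section \<open>Lie groups and left-invariant objects\<close>

definition lie_group ::
    "('m, 'b) monoid_scheme \<Rightarrow> ('m, 'e::euclidean_space) chart set \<Rightarrow> bool" where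
  "lie_group G A \<longleftrightarrow>
     group G \<and> smooth_manifold (carrier G) A \<and>
     smooth_map (prod_atlas A A) A (\<lambda>(x, y). x \<otimes>\<^bsub>G\<^esub> y) \<and>
     smooth_map A A (\<lambda>x. inv\<^bsub>G\<^esub> x)"

definition left_invariant_field ::
    "('m, 'b) monoid_scheme \<Rightarrow> ('m, 'e::euclidean_space) chart set \<Rightarrow>
     ('m \<Rightarrow> ('m, 'e) tvec) \<Rightarrow> bool" where
  "left_invariant_field G A X \<longleftrightarrow>
     vector_field A X \<and>
     (\<forall>g\<in>carrier G. \<forall>x\<in>carrier G.
        X (g \<otimes>\<^bsub>G\<^esub> x) = pushforward A A (\<lambda>y. g \<otimes>\<^bsub>G\<^esub> y) x (X x))"

definition lie_algebra_iso ::
    "('m, 'b) monoid_scheme \<Rightarrow> ('m, 'e::euclidean_space) chart set \<Rightarrow>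
     ('g::complex_lie_algebra \<Rightarrow> 'g) \<Rightarrow> ('g \<Rightarrow> 'm \<Rightarrow> ('m, 'e) tvec) \<Rightarrow> bool" where
  "lie_algebra_iso G A \<sigma> L \<longleftrightarrow>
     bij_betw L (real_form \<sigma>) {X. left_invariant_field G A X} \<and>
     (\<forall>X\<in>real_form \<sigma>. \<forall>Y\<in>real_form \<sigma>. L (X + Y) = L X + L Y) \<and>
     (\<forall>r. \<forall>X\<in>real_form \<sigma>. L (complex_of_real r *\<^sub>C X) = (\<lambda>x c. r *\<^sub>R L X x c)) \<and>
     (\<forall>X\<in>real_form \<sigma>. \<forall>Y\<in>real_form \<sigma>. L [X, Y]\<^sub>L = vf_bracket A (L X) (L Y))"

text \<open>Left-invariance of \<open>nab\<close> is a consequence, as left-invariant fields frame the tangent bundle.\<close>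

definition left_invariant_connection ::
    "('m, 'b) monoid_scheme \<Rightarrow> ('m, 'e::euclidean_space) chart set \<Rightarrow>
     ('g::complex_lie_algebra \<Rightarrow> 'g) \<Rightarrow> ('g \<Rightarrow> 'm \<Rightarrow> ('m, 'e) tvec) \<Rightarrow> ('g \<Rightarrow> 'g \<Rightarrow> 'g) \<Rightarrow>
     ('m, 'e) covderiv \<Rightarrow> bool" where
  "left_invariant_connection G A \<sigma> L D nab \<longleftrightarrow>
     affine_connection A nab \<and>
     (\<forall>X\<in>real_form \<sigma>. \<forall>Y\<in>real_form \<sigma>. \<forall>x\<in>carrier G. nab x (L X x) (L Y) = L (D X Y) x)"

text \<open>The dual of the real form is represented inside the complex dual, as the functionals
  that are real on the real form. Accordingly a real endomorphism of the real form plus its dual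
  is represented by its complex linear extension \<open>\<J>\<close> to the complex algebra plus its dual:
  a complex linear map commuting with the conjugation.\<close>

definition real_dual :: "('g::complex_lie_algebra \<Rightarrow> 'g) \<Rightarrow> ('g \<Rightarrow> complex) set" where
  "real_dual \<sigma> = {\<theta>. cfunctional \<theta> \<and> (\<forall>X\<in>real_form \<sigma>. \<theta> X \<in> \<real>)}"

definition generalized_scale ::
    "complex \<Rightarrow> 'g::complex_lie_algebra \<times> ('g \<Rightarrow> complex) \<Rightarrow> 'g \<times> ('g \<Rightarrow> complex)" where
  "generalized_scale c u = (c *\<^sub>C fst u, \<lambda>Y. c * snd u Y)"

definition generalized_conj ::
    "('g::complex_lie_algebra \<Rightarrow> 'g) \<Rightarrow> 'g \<times> ('g \<Rightarrow> complex) \<Rightarrow> 'g \<times> ('g \<Rightarrow> complex)" where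
  "generalized_conj \<sigma> u = (\<sigma> (fst u), \<lambda>Y. cnj (snd u (\<sigma> Y)))"

definition generalized_pairing ::
    "'g \<times> ('g \<Rightarrow> complex) \<Rightarrow> 'g \<times> ('g \<Rightarrow> complex) \<Rightarrow> complex" where
  "generalized_pairing u v = (snd u (fst v) + snd v (fst u)) / 2"

definition associated_generalized_structure ::
    "('g::complex_lie_algebra \<Rightarrow> 'g) \<Rightarrow> 'g set \<Rightarrow> ('g \<Rightarrow> 'g \<Rightarrow> complex) \<Rightarrow>
     ('g \<times> ('g \<Rightarrow> complex) \<Rightarrow> 'g \<times> ('g \<Rightarrow> complex)) \<Rightarrow> bool" where
  "associated_generalized_structure \<sigma> k \<epsilon> \<J> \<longleftrightarrow>
     (let V = UNIV \<times> {\<xi>. cfunctional \<xi>} in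
       (\<forall>u\<in>V. \<J> u \<in> V \<and> \<J> (\<J> u) = - u \<and>
          \<J> (generalized_conj \<sigma> u) = generalized_conj \<sigma> (\<J> u) \<and>
          (\<forall>c. \<J> (generalized_scale c u) = generalized_scale c (\<J> u)) \<and>
          (\<forall>v\<in>V. \<J> (u + v) = \<J> u + \<J> v \<and>
                 generalized_pairing (\<J> u) v = generalized_pairing u (\<J> v))) \<and>
       {u \<in> V. \<J> u = generalized_scale \<i> u} =
         {(X, \<xi>). X \<in> k \<and> cfunctional \<xi> \<and> (\<forall>Y\<in>\<sigma> ` k. \<xi> Y = \<epsilon> X Y)})"

text \<open>The covector attached to \<open>\<theta>\<close> at \<open>x\<close> is the one with value \<open>\<theta> Y\<close> on \<open>L Y x\<close>.\<close>

definition left_trivialization ::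
    "('m, 'e::euclidean_space) chart set \<Rightarrow> ('g::complex_lie_algebra \<Rightarrow> 'g) \<Rightarrow>
     ('g \<Rightarrow> 'm \<Rightarrow> ('m, 'e) tvec) \<Rightarrow> 'm \<Rightarrow> 'g \<times> ('g \<Rightarrow> complex) \<Rightarrow>
     ('m, 'e) tvec \<times> ('m, 'e) covec" where
  "left_trivialization A \<sigma> L x u =
     (L (fst u) x,
      \<lambda>v. if v \<in> tangent_space A x then Re (snd u (inv_into (real_form \<sigma>) (\<lambda>Y. L Y x) v)) else 0)"

definition left_invariant_endo ::
    "('m, 'e::euclidean_space) chart set \<Rightarrow> ('g::complex_lie_algebra \<Rightarrow> 'g) \<Rightarrow>
     ('g \<Rightarrow> 'm \<Rightarrow> ('m, 'e) tvec) \<Rightarrow> ('g \<times> ('g \<Rightarrow> complex) \<Rightarrow> 'g \<times> ('g \<Rightarrow> complex)) \<Rightarrow>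
     'm \<Rightarrow> ('m, 'e) tvec \<times> ('m, 'e) covec \<Rightarrow> ('m, 'e) tvec \<times> ('m, 'e) covec" where
  "left_invariant_endo A \<sigma> L \<J> x u =
     left_trivialization A \<sigma> L x
       (\<J> (inv_into (real_form \<sigma> \<times> real_dual \<sigma>) (left_trivialization A \<sigma> L x) u))"

text \<open>The generalized structure and the connection in this definition are uniquely determined
  (the latter on smooth vector fields) whenever they exist.\<close>

definition defines_complex_structure ::
    "('m, 'b) monoid_scheme \<Rightarrow> ('m, 'e::euclidean_space) chart set \<Rightarrow>
     ('g::complex_lie_algebra \<Rightarrow> 'g) \<Rightarrow> ('g \<Rightarrow> 'm \<Rightarrow> ('m, 'e) tvec) \<Rightarrow> 'g set \<Rightarrow>
     ('g \<Rightarrow> 'g \<Rightarrow> 'g) \<Rightarrow> ('g \<Rightarrow> 'g \<Rightarrow> complex) \<Rightarrow> bool" where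
  "defines_complex_structure G A \<sigma> L k D \<epsilon> \<longleftrightarrow>
     (\<exists>\<J> nab. associated_generalized_structure \<sigma> k \<epsilon> \<J> \<and>
        left_invariant_connection G A \<sigma> L D nab \<and>
        complex_structure (cotangent_atlas A)
          (cotangent_structure A nab (left_invariant_endo A \<sigma> L \<J>)))"

end

theory Submission
  imports Defs
begin

text \<open>Let \<open>\<tau>\<close> be the complex linear automorphism that is \<open>-1\<close> on \<open>h\<close> and maps \<open>E \<alpha>\<close> to \<open>- a \<alpha> E (- \<alpha>)\<close>. Then
  \<open>D_zero X Y = [\<tau> X, Y]\<close>, so flatness is the Jacobi identity and only the cocycle condition on \<open>\<epsilon>\<close>
  and the nondegeneracy matter. Evaluated on weight vectors the cocycle condition determines \<open>\<epsilon>\<close>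
  up to its restriction to the Cartan subalgebra and the constants \<open>\<mu>\<close>; conversely the sum in (ii) is the
  coboundary \<open>\<phi> [\<tau> X, Y]\<close> with \<open>\<phi> (E (- \<beta>)) = \<mu> \<beta>\<close>. If \<open>R0\<close> contained \<open>n\<close> pairs of opposite
  roots, there would be an isotropic space for \<open>Im \<epsilon>\<close> of dimension \<open>n + 1\<close> subject to only \<open>n\<close> further
  equations for lying in the kernel, contrary to nondegeneracy.

  On the cotangent bundle, the horizontal lifts of the left-invariant fields and the vertical lifts of
  the left-invariant forms can be completed to a frame with constant structure coefficients, namely
  those of the semidirect product of the Lie algebra with its dual along the flat connection. The
  Nijenhuis tensor is thereby reduced to algebra: the \<open>\<i>\<close>-eigenspace must be closed under the semidirect
  product bracket, which is again the cocycle condition.\<close>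

section \<open>Smooth functions on open sets\<close>

text \<open>The group already enters the equivalence of the algebraic conditions: the bracket of the
  class is linear in its first argument only, and its antisymmetry on the real form is read off from
  left-invariant fields. The automorphism \<tau> is \<sigma> composed with the conjugation that
  fixes every \<open>E \<alpha>\<close> (that of the split real form). It sends the root vectors of
  k to multiples of those of the conjugate of k, and Cartan elements to their negatives, which
  normalize that conjugate. Hence the stability condition on \<open>D_zero\<close> holds for every
  regular k. The constants \<mu> are real because skew-Hermitian symmetry exchanges the two mixed
  components of \<epsilon>. The same symmetry makes \<epsilon> real on pairs of root vectors, and
  this reality is the source of the isotropic vectors in the count that excludes opposite roots. On
  the cotangent bundle, position and the components of the covector in the left-invariant frame
  replace the canonical coordinates. There the frame fields are affine in the momentum, so that
  their brackets involve only the brackets on the group and commutators of matrices.\<close>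

lemma Ck_on_cong_open:
  assumes "open S" "\<And>x. x \<in> S \<Longrightarrow> f x = g x" "Ck_on n S f"
  shows "Ck_on n S g"
  using assms(2,3)
proof (induction n arbitrary: f g)
  case 0
  then show ?case by (simp cong: continuous_on_cong)
next
  case (Suc n)
  have diff: "f differentiable at x" if "x \<in> S" for x
  proof -
    have "f differentiable_on S" using Suc.prems(2) by simp
    then show ?thesis using that by (metis assms(1) at_within_open differentiable_on_def)
  qed
  have "g differentiable_on S"
    unfolding differentiable_on_def
  proof
    fix x assume x: "x \<in> S"
    show "g differentiable at x within S"
      by (rule differentiable_transform_within[OF differentiable_at_withinI[OF diff[OF x]] zero_less_one x])
        (rule Suc.prems(1))
  qed
  moreover have "Ck_on n S (\<lambda>x. frechet_derivative g (at x) v)" for v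
  proof (rule Suc.IH)
    show "Ck_on n S (\<lambda>x. frechet_derivative f (at x) v)" using Suc.prems by simp
    show "frechet_derivative f (at x) v = frechet_derivative g (at x) v" if "x \<in> S" for x
      using frechet_derivative_transform_within_open[OF diff[OF that] assms(1) that Suc.prems(1)]
      by (rule fun_cong)
  qed
  ultimately show ?case by simp
qed

text \<open>The recursion of \<open>Ck_on\<close> speaks of the derivative chosen by
  \<open>frechet_derivative\<close>. On an open set any family of derivatives may take its place, so
  the inductions below can run on the usual differentiation rules.\<close>

lemma Ck_on_Suc_iff:
  assumes "open S"
  shows "Ck_on (Suc n) S f \<longleftrightarrow> (\<exists>f'. (\<forall>x\<in>S. (f has_derivative f' x) (at x)) \<and> (\<forall>v. Ck_on n S (\<lambda>x. f' x v)))"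
proof
  assume "Ck_on (Suc n) S f"
  then show "\<exists>f'. (\<forall>x\<in>S. (f has_derivative f' x) (at x)) \<and> (\<forall>v. Ck_on n S (\<lambda>x. f' x v))"
    using assms
    by (intro exI[of _ "\<lambda>x. frechet_derivative f (at x)"])
      (auto simp: differentiable_on_def at_within_open_NO_MATCH frechet_derivative_works[symmetric])
next
  assume "\<exists>f'. (\<forall>x\<in>S. (f has_derivative f' x) (at x)) \<and> (\<forall>v. Ck_on n S (\<lambda>x. f' x v))"
  then obtain f' where f': "\<And>x. x \<in> S \<Longrightarrow> (f has_derivative f' x) (at x)"
      "\<And>v. Ck_on n S (\<lambda>x. f' x v)" by auto
  have "f differentiable_on S"
    using f'(1) by (auto simp: differentiable_on_def differentiable_def intro: has_derivative_at_withinI)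
  moreover have "Ck_on n S (\<lambda>x. frechet_derivative f (at x) v)" for v
    by (rule Ck_on_cong_open[OF assms _ f'(2)]) (simp add: frechet_derivative_at[OF f'(1), symmetric])
  ultimately show "Ck_on (Suc n) S f" by simp
qed

lemma Ck_on_SucI:
  assumes "open S" "\<And>x. x \<in> S \<Longrightarrow> (f has_derivative f' x) (at x)" "\<And>v. Ck_on n S (\<lambda>x. f' x v)"
  shows "Ck_on (Suc n) S f"
  using assms Ck_on_Suc_iff by blast

lemma Ck_on_SucD:
  assumes "open S" "Ck_on (Suc n) S f"
  shows "Ck_on n S f"
  using assms(2)
proof (induction n arbitrary: f)
  case 0
  then show ?case by (simp add: differentiable_imp_continuous_on)
next
  case (Suc n)
  from Suc.prems Suc.IH show ?case by (metis Ck_on.simps(2))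
qed

lemma Ck_on_subset_open:
  assumes "Ck_on n S f" "T \<subseteq> S"
  shows "Ck_on n T f"
  using assms
proof (induction n arbitrary: f)
  case 0
  then show ?case by (simp add: continuous_on_subset)
next
  case (Suc n)
  then show ?case using differentiable_on_subset by (metis Ck_on.simps(2))
qed

lemma Ck_on_local:
  assumes "\<And>x. x \<in> S \<Longrightarrow> \<exists>T. open T \<and> x \<in> T \<and> Ck_on n T f"
  shows "Ck_on n S f"
  using assms
proof (induction n arbitrary: f)
  case 0
  have "continuous_on S f"
    unfolding continuous_on_eq_continuous_within
  proof
    fix x assume "x \<in> S"
    then obtain T where "open T" "x \<in> T" "continuous_on T f" using 0 by auto
    then show "continuous (at x within S) f"
      using continuous_at_imp_continuous_at_within continuous_on_eq_continuous_at by blast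
  qed
  then show ?case by simp
next
  case (Suc n)
  have "f differentiable_on S"
    unfolding differentiable_on_def
  proof
    fix x assume "x \<in> S"
    then obtain T where "open T" "x \<in> T" "f differentiable_on T" using Suc.prems by force
    then show "f differentiable at x within S"
      using differentiable_at_withinI by (metis at_within_open differentiable_on_def)
  qed
  moreover have "Ck_on n S (\<lambda>x. frechet_derivative f (at x) v)" for v
    by (rule Suc.IH) (use Suc.prems in force)
  ultimately show ?case by simp
qed

lemma Ck_on_const: "open S \<Longrightarrow> Ck_on n S (\<lambda>x. c)"
proof (induction n arbitrary: c)
  case (Suc n)
  show ?case by (rule Ck_on_SucI[where f' = "\<lambda>_ _. 0"]) (use Suc in auto)
qed simp

lemma Ck_on_bounded_linear:
  assumes "open S" "bounded_linear l" "Ck_on n S f"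
  shows "Ck_on n S (\<lambda>x. l (f x))"
  using assms(3)
proof (induction n arbitrary: f)
  case 0
  then show ?case using assms(2) by (simp add: bounded_linear.continuous_on)
next
  case (Suc n)
  obtain f' where f': "\<forall>x\<in>S. (f has_derivative f' x) (at x)"
      "\<forall>v. Ck_on n S (\<lambda>x. f' x v)"
    using iffD1[OF Ck_on_Suc_iff[OF assms(1)] Suc.prems] by (elim exE conjE)
  note f' = f'[rule_format]
  show ?case
    by (rule Ck_on_SucI[OF assms(1), where f' = "\<lambda>x v. l (f' x v)"])
      (erule bounded_linear.has_derivative[OF assms(2) f'(1)], rule Suc.IH[OF f'(2)])
qed

lemma Ck_on_id: "open S \<Longrightarrow> Ck_on n S (\<lambda>x. x)"
proof (cases n)
  case (Suc m)
  assume "open S"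
  then show ?thesis unfolding Suc
    by (intro Ck_on_SucI[where f' = "\<lambda>_ v. v"] Ck_on_const) (auto intro: derivative_eq_intros)
qed simp

lemma Ck_on_add:
  assumes "open S" "Ck_on n S f" "Ck_on n S g"
  shows "Ck_on n S (\<lambda>x. f x + g x)"
  using assms(2,3)
proof (induction n arbitrary: f g)
  case 0
  then show ?case by (simp add: continuous_on_add)
next
  case (Suc n)
  obtain f' where f': "\<forall>x\<in>S. (f has_derivative f' x) (at x)"
      "\<forall>v. Ck_on n S (\<lambda>x. f' x v)"
    using iffD1[OF Ck_on_Suc_iff[OF assms(1)] Suc.prems(1)] by (elim exE conjE)
  note f' = f'[rule_format]
  obtain g' where g': "\<forall>x\<in>S. (g has_derivative g' x) (at x)"
      "\<forall>v. Ck_on n S (\<lambda>x. g' x v)"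
    using iffD1[OF Ck_on_Suc_iff[OF assms(1)] Suc.prems(2)] by (elim exE conjE)
  note g' = g'[rule_format]
  show ?case
    by (rule Ck_on_SucI[OF assms(1), where f' = "\<lambda>x v. f' x v + g' x v"])
      (rule has_derivative_add[OF f'(1) g'(1)], assumption, assumption, rule Suc.IH[OF f'(2) g'(2)])
qed

lemma Ck_on_sum:
  assumes "open S" "finite I" "\<And>i. i \<in> I \<Longrightarrow> Ck_on n S (f i)"
  shows "Ck_on n S (\<lambda>x. \<Sum>i\<in>I. f i x)"
  using assms(2,3)
  by (induction rule: finite_induct) (auto simp: Ck_on_const Ck_on_add assms(1))

lemma Ck_on_bilinear:
  assumes "open S" "bounded_bilinear p" "Ck_on n S f" "Ck_on n S g"
  shows "Ck_on n S (\<lambda>x. p (f x) (g x))"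
  using assms(3,4)
proof (induction n arbitrary: f g)
  case 0
  then show ?case by (simp add: bounded_bilinear.continuous_on[OF assms(2)])
next
  case (Suc n)
  obtain f' where f': "\<forall>x\<in>S. (f has_derivative f' x) (at x)"
      "\<forall>v. Ck_on n S (\<lambda>x. f' x v)"
    using iffD1[OF Ck_on_Suc_iff[OF assms(1)] Suc.prems(1)] by (elim exE conjE)
  note f' = f'[rule_format]
  obtain g' where g': "\<forall>x\<in>S. (g has_derivative g' x) (at x)"
      "\<forall>v. Ck_on n S (\<lambda>x. g' x v)"
    using iffD1[OF Ck_on_Suc_iff[OF assms(1)] Suc.prems(2)] by (elim exE conjE)
  note g' = g'[rule_format]
  \<comment> \<open>The product rule leaves one factor undifferentiated in each summand, so the
    induction hypothesis also needs the lower order smoothness of f and g themselves.\<close>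
  have "Ck_on n S f" "Ck_on n S g" using Suc.prems Ck_on_SucD assms(1) by blast+
  then show ?case
    by (intro Ck_on_SucI[OF assms(1), where f' = "\<lambda>x v. p (f x) (g' x v) + p (f' x v) (g x)"])
      (rule bounded_bilinear.FDERIV[OF assms(2) f'(1) g'(1)], assumption, assumption,
        intro Ck_on_add assms(1) Suc.IH f'(2) g'(2))
qed

lemma linear_basis_expansion:
  fixes f :: "'a::euclidean_space \<Rightarrow> 'b::real_normed_vector"
  assumes "linear f"
  shows "f x = (\<Sum>b\<in>Basis. (x \<bullet> b) *\<^sub>R f b)"
proof -
  have "f x = f (\<Sum>b\<in>Basis. (x \<bullet> b) *\<^sub>R b)" by (simp only: euclidean_representation)
  also have "\<dots> = (\<Sum>b\<in>Basis. (x \<bullet> b) *\<^sub>R f b)"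
    by (simp only: linear_sum[OF assms] linear_cmul[OF assms])
  finally show ?thesis .
qed

text \<open>In the derivative \<open>g' (f x) (f' x v)\<close> the direction depends on x as well.
  Expanding it in the basis gives products of scalars with \<open>g' (f x) b\<close>, where b is
  fixed, and to these the induction hypothesis applies.\<close>

lemma Ck_on_compose:
  fixes f :: "'a::euclidean_space \<Rightarrow> 'b::euclidean_space"
    and g :: "'b \<Rightarrow> 'c::euclidean_space"
  assumes "open S" "open T" "Ck_on n S f" "Ck_on n T g" "f ` S \<subseteq> T"
  shows "Ck_on n S (\<lambda>x. g (f x))"
  using assms(3-5)
proof (induction n arbitrary: f g)
  case 0
  then show ?case using continuous_on_compose2[of T g S f] by simp
next
  case (Suc n)
  obtain f' where f': "\<forall>x\<in>S. (f has_derivative f' x) (at x)"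
      "\<forall>v. Ck_on n S (\<lambda>x. f' x v)"
    using iffD1[OF Ck_on_Suc_iff[OF assms(1)] Suc.prems(1)] by (elim exE conjE)
  note f' = f'[rule_format]
  obtain g' where g': "\<forall>x\<in>T. (g has_derivative g' x) (at x)"
      "\<forall>v. Ck_on n T (\<lambda>x. g' x v)"
    using iffD1[OF Ck_on_Suc_iff[OF assms(2)] Suc.prems(2)] by (elim exE conjE)
  note g' = g'[rule_format]
  have cf: "Ck_on n S f" using Suc.prems Ck_on_SucD assms(1) by blast
  have der: "((\<lambda>x. g (f x)) has_derivative (\<lambda>v. g' (f x) (f' x v))) (at x)" if "x \<in> S" for x
    using has_derivative_compose[OF f'(1)[OF that], of g "g' (f x)"] g'(1)[of "f x"] Suc.prems(3) that by blast
  have "Ck_on n S (\<lambda>x. \<Sum>b\<in>Basis. (f' x v \<bullet> b) *\<^sub>R g' (f x) b)" for v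
  proof (rule Ck_on_sum[OF assms(1) finite_Basis])
    fix b :: 'b assume "b \<in> Basis"
    show "Ck_on n S (\<lambda>x. (f' x v \<bullet> b) *\<^sub>R g' (f x) b)"
      by (rule Ck_on_bilinear[OF assms(1) bounded_bilinear_scaleR
            Ck_on_bounded_linear[OF assms(1) bounded_linear_inner_left f'(2)]
            Suc.IH[OF cf g'(2) Suc.prems(3)]])
  qed
  moreover have "(\<Sum>b\<in>Basis. (f' x v \<bullet> b) *\<^sub>R g' (f x) b) = g' (f x) (f' x v)" if "x \<in> S" for x v
  proof -
    have "f x \<in> T" using Suc.prems(3) that by blast
    then show ?thesis by (rule linear_basis_expansion[OF has_derivative_linear[OF g'(1)], symmetric])
  qed
  ultimately have "Ck_on n S (\<lambda>x. g' (f x) (f' x v))" for v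
    by (rule Ck_on_cong_open[OF assms(1), rotated]) simp
  then show ?case by (intro Ck_on_SucI[OF assms(1), where f' = "\<lambda>x v. g' (f x) (f' x v)"] der)
qed

lemma smooth_on_open: "smooth_on S f \<Longrightarrow> open S"
  by (simp add: smooth_on_def)

lemma smooth_on_cong:
  "smooth_on S f \<Longrightarrow> (\<And>x. x \<in> S \<Longrightarrow> f x = g x) \<Longrightarrow> smooth_on S g"
  unfolding smooth_on_def using Ck_on_cong_open by blast

lemma smooth_on_subset: "smooth_on S f \<Longrightarrow> open T \<Longrightarrow> T \<subseteq> S \<Longrightarrow> smooth_on T f"
  unfolding smooth_on_def using Ck_on_subset_open by blast

lemma smooth_on_local:
  assumes "\<And>x. x \<in> S \<Longrightarrow> \<exists>T. x \<in> T \<and> T \<subseteq> S \<and> smooth_on T f"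
  shows "smooth_on S f"
proof -
  have "open S" using assms smooth_on_open by (subst open_subopen) blast
  then show ?thesis using assms unfolding smooth_on_def using Ck_on_local by meson
qed

lemma smooth_on_const: "open S \<Longrightarrow> smooth_on S (\<lambda>x. c)"
  by (simp add: smooth_on_def Ck_on_const)

lemma smooth_on_id: "open S \<Longrightarrow> smooth_on S (\<lambda>x. x)"
  by (simp add: smooth_on_def Ck_on_id)

lemma smooth_on_linear:
  fixes l :: "'b::euclidean_space \<Rightarrow> 'c::euclidean_space"
  shows "linear l \<Longrightarrow> smooth_on S f \<Longrightarrow> smooth_on S (\<lambda>x. l (f x))"
  by (simp add: smooth_on_def Ck_on_bounded_linear linear_conv_bounded_linear)

lemma smooth_on_add: "smooth_on S f \<Longrightarrow> smooth_on S g \<Longrightarrow> smooth_on S (\<lambda>x. f x + g x)"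
  by (simp add: smooth_on_def Ck_on_add)

lemma smooth_on_minus: "smooth_on S f \<Longrightarrow> smooth_on S (\<lambda>x. - f x)"
  by (rule smooth_on_linear) (auto intro: linearI)

lemma smooth_on_diff: "smooth_on S f \<Longrightarrow> smooth_on S g \<Longrightarrow> smooth_on S (\<lambda>x. f x - g x)"
  using smooth_on_add[OF _ smooth_on_minus] by fastforce

lemma smooth_on_sum:
  "open S \<Longrightarrow> finite I \<Longrightarrow> (\<And>i. i \<in> I \<Longrightarrow> smooth_on S (f i)) \<Longrightarrow> smooth_on S (\<lambda>x. \<Sum>i\<in>I. f i x)"
  by (simp add: smooth_on_def Ck_on_sum)

lemma smooth_on_bilinear:
  "bounded_bilinear p \<Longrightarrow> smooth_on S f \<Longrightarrow> smooth_on S g \<Longrightarrow> smooth_on S (\<lambda>x. p (f x) (g x))"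
  by (simp add: smooth_on_def Ck_on_bilinear)

lemma smooth_on_compose:
  assumes "smooth_on T g" "smooth_on S f" "f ` S \<subseteq> T"
  shows "smooth_on S (\<lambda>x. g (f x))"
  using assms by (auto simp: smooth_on_def intro: Ck_on_compose)

lemma smooth_on_Pair:
  assumes "smooth_on S f" "smooth_on S g"
  shows "smooth_on S (\<lambda>x. (f x, g x))"
proof -
  have "smooth_on S (\<lambda>x. (f x, 0) + (0, g x))"
    by (intro smooth_on_add smooth_on_linear[OF _ assms(1), where l = "\<lambda>y. (y, 0)"]
        smooth_on_linear[OF _ assms(2), where l = "\<lambda>y. (0, y)"]) (auto intro!: linearI)
  then show ?thesis by simp
qed

lemma smooth_on_fst: "smooth_on S f \<Longrightarrow> smooth_on S (\<lambda>x. fst (f x))"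
  by (rule smooth_on_linear) (auto intro: linearI)

lemma smooth_on_snd: "smooth_on S f \<Longrightarrow> smooth_on S (\<lambda>x. snd (f x))"
  by (rule smooth_on_linear) (auto intro: linearI)

lemma smooth_on_has_derivative:
  "smooth_on S f \<Longrightarrow> x \<in> S \<Longrightarrow> (f has_derivative frechet_derivative f (at x)) (at x)"
  unfolding smooth_on_def frechet_derivative_works[symmetric]
  by (metis Ck_on.simps(2) at_within_open differentiable_on_def)

lemma smooth_on_continuous_on: "smooth_on S f \<Longrightarrow> continuous_on S f"
  by (metis Ck_on.simps(1) smooth_on_def)

lemma smooth_on_frechet_const:
  "smooth_on S f \<Longrightarrow> smooth_on S (\<lambda>x. frechet_derivative f (at x) v)"
  by (metis Ck_on.simps(2) smooth_on_def)

text \<open>Families of linear maps are handled through their values on fixed vectors, without a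
  topology on operators; the basis expansion carries smoothness over to arguments that move with
  x.\<close>

lemma smooth_on_linear_family:
  fixes F :: "'a::euclidean_space \<Rightarrow> 'b::euclidean_space \<Rightarrow> 'c::euclidean_space"
  assumes "\<And>x. x \<in> S \<Longrightarrow> linear (F x)" "\<And>b. b \<in> Basis \<Longrightarrow> smooth_on S (\<lambda>x. F x b)" "smooth_on S g"
  shows "smooth_on S (\<lambda>x. F x (g x))"
proof -
  have "smooth_on S (\<lambda>x. \<Sum>b\<in>Basis. (g x \<bullet> b) *\<^sub>R F x b)"
    by (intro smooth_on_sum smooth_on_open[OF assms(3)] finite_Basis assms(2)
        smooth_on_bilinear[OF bounded_bilinear_scaleR]
        smooth_on_linear[OF bounded_linear.linear[OF bounded_linear_inner_left] assms(3)])
  then show ?thesis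
    by (rule smooth_on_cong) (use linear_basis_expansion[OF assms(1)] in auto)
qed

lemma smooth_on_frechet:
  assumes "smooth_on S f" "smooth_on S g"
  shows "smooth_on S (\<lambda>x. frechet_derivative f (at x) (g x))"
  by (rule smooth_on_linear_family)
    (auto intro: assms smooth_on_frechet_const has_derivative_linear[OF smooth_on_has_derivative])

text \<open>The Leibniz rule for a moving linear map applied to a moving vector. Only the values of
  the family on fixed vectors are differentiated.\<close>

lemma has_derivative_linear_family:
  fixes F :: "'a::euclidean_space \<Rightarrow> 'b::euclidean_space \<Rightarrow> 'c::euclidean_space"
  assumes "smooth_on S g" "u \<in> S" "\<And>x. x \<in> S \<Longrightarrow> linear (F x)"
    "\<And>b. smooth_on S (\<lambda>x. F x b)"
  shows "((\<lambda>x. F x (g x)) has_derivative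
           (\<lambda>v. frechet_derivative (\<lambda>x. F x (g u)) (at u) v + F u (frechet_derivative g (at u) v))) (at u)"
proof -
  let ?D = "\<lambda>b. frechet_derivative (\<lambda>x. F x b) (at u)"
  let ?g = "frechet_derivative g (at u)"
  have D: "((\<lambda>x. F x b) has_derivative ?D b) (at u)" for b
    by (rule smooth_on_has_derivative[OF assms(4,2)])
  have g: "(g has_derivative ?g) (at u)" by (rule smooth_on_has_derivative[OF assms(1,2)])
  have eq: "F x (h x) = (\<Sum>b\<in>Basis. (h x \<bullet> b) *\<^sub>R F x b)" if "x \<in> S" for x and h :: "'a \<Rightarrow> 'b"
    using linear_basis_expansion[OF assms(3)[OF that]] .
  have S: "open S" by (rule smooth_on_open[OF assms(1)])
  have 1: "((\<lambda>x. \<Sum>b\<in>Basis. (g x \<bullet> b) *\<^sub>R F x b) has_derivative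
      (\<lambda>v. \<Sum>b\<in>Basis. (g u \<bullet> b) *\<^sub>R ?D b v + (?g v \<bullet> b) *\<^sub>R F u b)) (at u)"
    by (intro has_derivative_sum has_derivative_scaleR D has_derivative_inner_left g)
  have 2: "((\<lambda>x. \<Sum>b\<in>Basis. (g u \<bullet> b) *\<^sub>R F x b) has_derivative
      (\<lambda>v. \<Sum>b\<in>Basis. (g u \<bullet> b) *\<^sub>R ?D b v)) (at u)"
    by (intro has_derivative_sum has_derivative_scaleR_right D)
  have 3: "((\<lambda>x. F x (g u)) has_derivative (\<lambda>v. \<Sum>b\<in>Basis. (g u \<bullet> b) *\<^sub>R ?D b v)) (at u)"
    by (rule has_derivative_transform_within_open[OF 2 S assms(2)]) (simp add: eq[of _ "\<lambda>_. g u"])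
  have 4: "((\<lambda>x. F x (g x)) has_derivative
      (\<lambda>v. \<Sum>b\<in>Basis. (g u \<bullet> b) *\<^sub>R ?D b v + (?g v \<bullet> b) *\<^sub>R F u b)) (at u)"
    by (rule has_derivative_transform_within_open[OF 1 S assms(2)]) (simp add: eq[of _ g])
  show ?thesis
    using 4 by (simp add: frechet_derivative_at[OF 3, symmetric] sum.distrib
        linear_basis_expansion[OF assms(3)[OF assms(2)], symmetric])
qed

section \<open>Symmetry of second derivatives and brackets of related vector fields\<close>

lemma second_difference_mvt:
  fixes f :: "'a::euclidean_space \<Rightarrow> real"
  assumes f: "smooth_on S f" and t: "0 < t"
    and S: "\<And>s r. 0 \<le> s \<Longrightarrow> s \<le> t \<Longrightarrow> 0 \<le> r \<Longrightarrow> r \<le> t \<Longrightarrow> x + s *\<^sub>R v + r *\<^sub>R w \<in> S"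
  obtains s r where "0 < s" "s < t" "0 < r" "r < t"
    "f (x + t *\<^sub>R v + t *\<^sub>R w) - f (x + t *\<^sub>R v) - f (x + t *\<^sub>R w) + f x =
     t * (t * frechet_derivative (\<lambda>y. frechet_derivative f (at y) v) (at (x + s *\<^sub>R v + r *\<^sub>R w)) w)"
proof -
  have line: "((\<lambda>s. g (p + s *\<^sub>R d)) has_real_derivative frechet_derivative g (at (p + s *\<^sub>R d)) d) (at s)"
    if "smooth_on S g" "p + s *\<^sub>R d \<in> S" for g :: "'a \<Rightarrow> real" and p d s
  proof -
    have l: "((\<lambda>s. p + s *\<^sub>R d) has_derivative (\<lambda>r. r *\<^sub>R d)) (at s)"
      by (auto intro!: derivative_eq_intros)
    note D = smooth_on_has_derivative[OF that]
    show ?thesis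
      using has_derivative_compose[OF l D] has_derivative_linear[OF D]
      by (simp add: has_field_derivative_def linear_cmul mult_commute_abs)
  qed
  \<comment> \<open>The increment of \<open>?g\<close> over the interval from 0 to t is the second
    difference; one mean value in direction v and then one in direction w evaluate it.\<close>
  let ?g = "\<lambda>s. f (x + t *\<^sub>R w + s *\<^sub>R v) - f (x + s *\<^sub>R v)"
  have S': "x + t *\<^sub>R w + s *\<^sub>R v \<in> S" "x + s *\<^sub>R v \<in> S" if "0 \<le> s" "s \<le> t" for s
    using S[of s t] S[of s 0] that t by (auto simp: algebra_simps)
  have "\<exists>s. 0 < s \<and> s < t \<and> ?g t - ?g 0 = (t - 0) * (frechet_derivative f (at (x + t *\<^sub>R w + s *\<^sub>R v)) v - frechet_derivative f (at (x + s *\<^sub>R v)) v)"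
    by (rule MVT2[OF t]) (intro DERIV_diff line f S'; assumption)
  then obtain s where s: "0 < s" "s < t" and eq: "?g t - ?g 0 =
      t * (frechet_derivative f (at (x + t *\<^sub>R w + s *\<^sub>R v)) v - frechet_derivative f (at (x + s *\<^sub>R v)) v)"
    by auto
  let ?h = "\<lambda>r. frechet_derivative f (at (x + s *\<^sub>R v + r *\<^sub>R w)) v"
  have "\<exists>r. 0 < r \<and> r < t \<and> ?h t - ?h 0 = (t - 0) * frechet_derivative (\<lambda>y. frechet_derivative f (at y) v) (at (x + s *\<^sub>R v + r *\<^sub>R w)) w"
    by (rule MVT2[OF t]) (intro line smooth_on_frechet_const f S; use s in simp)
  then obtain r where r: "0 < r" "r < t" and eq2: "?h t - ?h 0 =
      t * frechet_derivative (\<lambda>y. frechet_derivative f (at y) v) (at (x + s *\<^sub>R v + r *\<^sub>R w)) w"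
    by auto
  have ac: "x + t *\<^sub>R w + s *\<^sub>R v = x + s *\<^sub>R v + t *\<^sub>R w" "x + t *\<^sub>R w + t *\<^sub>R v = x + t *\<^sub>R v + t *\<^sub>R w"
    by (simp_all add: algebra_simps)
  show thesis
    by (rule that[OF s r]) (use eq eq2 in \<open>simp add: ac\<close>)
qed

text \<open>The second difference does not change when v and w are exchanged. So the two mixed
  derivatives agree at two points arbitrarily close to x, and both are continuous.\<close>

lemma frechet_derivative_symmetric_real:
  fixes f :: "'a::euclidean_space \<Rightarrow> real"
  assumes f: "smooth_on S f" and x: "x \<in> S"
  shows "frechet_derivative (\<lambda>y. frechet_derivative f (at y) v) (at x) w =
         frechet_derivative (\<lambda>y. frechet_derivative f (at y) w) (at x) v"
proof -
  let ?A = "\<lambda>v w z. frechet_derivative (\<lambda>y. frechet_derivative f (at y) v) (at z) w"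
  have "\<bar>?A v w x - ?A w v x\<bar> \<le> 2 * e" if e: "e > 0" for e
  proof -
    have "smooth_on S (?A v w)" "smooth_on S (?A w v)" by (intro smooth_on_frechet_const f)+
    then have cont: "isCont (?A v w) x" "isCont (?A w v) x"
      using has_derivative_continuous[OF smooth_on_has_derivative[OF _ x]] by blast+
    obtain d1 where d1: "d1 > 0" "\<forall>y. dist y x < d1 \<longrightarrow> dist (?A v w y) (?A v w x) < e"
      using cont(1) e unfolding continuous_at_eps_delta by blast
    obtain d2 where d2: "d2 > 0" "\<forall>y. dist y x < d2 \<longrightarrow> dist (?A w v y) (?A w v x) < e"
      using cont(2) e unfolding continuous_at_eps_delta by blast
    obtain d3 where d3: "d3 > 0" "ball x d3 \<subseteq> S"
      using smooth_on_open[OF f] x open_contains_ball by blast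
    define d where "d = min (min d1 d2) d3"
    \<comment> \<open>The summand 1 keeps the denominator positive and leaves room for a strict
      inequality: the parallelogram with sides t v and t w stays inside the ball of radius
      d.\<close>
    define t where "t = d / (norm v + norm w + 1)"
    have n: "0 < norm v + norm w + 1" by (simp add: add_nonneg_pos)
    have dpos: "d > 0" using d1 d2 d3 by (simp add: d_def)
    have t: "t > 0" unfolding t_def using dpos n by simp
    have near: "dist (x + s *\<^sub>R v + r *\<^sub>R w) x < d" if "0 \<le> s" "s \<le> t" "0 \<le> r" "r \<le> t" for s r
    proof -
      have "norm (s *\<^sub>R v + r *\<^sub>R w) \<le> s * norm v + r * norm w"
        using norm_triangle_ineq[of "s *\<^sub>R v" "r *\<^sub>R w"] that by simp
      also have "\<dots> \<le> t * norm v + t * norm w" using that by (intro add_mono mult_right_mono) auto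
      also have "\<dots> < t * (norm v + norm w + 1)" using t by (simp add: algebra_simps)
      also have "\<dots> = d" using n by (simp add: t_def)
      finally show ?thesis by (simp add: dist_norm algebra_simps)
    qed
    have inS: "x + s *\<^sub>R v + r *\<^sub>R w \<in> S" "x + s *\<^sub>R w + r *\<^sub>R v \<in> S"
      if "0 \<le> s" "s \<le> t" "0 \<le> r" "r \<le> t" for s r
      using near[OF that] near[OF that(3,4,1,2)] d3(2) by (auto simp: d_def dist_commute algebra_simps subset_eq)
    obtain s r where 1: "0 < s" "s < t" "0 < r" "r < t"
      "f (x + t *\<^sub>R v + t *\<^sub>R w) - f (x + t *\<^sub>R v) - f (x + t *\<^sub>R w) + f x =
       t * (t * ?A v w (x + s *\<^sub>R v + r *\<^sub>R w))"
      by (rule second_difference_mvt[OF f t inS(1)])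
    obtain s' r' where 2: "0 < s'" "s' < t" "0 < r'" "r' < t"
      "f (x + t *\<^sub>R w + t *\<^sub>R v) - f (x + t *\<^sub>R w) - f (x + t *\<^sub>R v) + f x =
       t * (t * ?A w v (x + s' *\<^sub>R w + r' *\<^sub>R v))"
      by (rule second_difference_mvt[OF f t inS(2)])
    have ac: "x + t *\<^sub>R w + t *\<^sub>R v = x + t *\<^sub>R v + t *\<^sub>R w" by (simp add: algebra_simps)
    have "t * (t * ?A v w (x + s *\<^sub>R v + r *\<^sub>R w)) = t * (t * ?A w v (x + s' *\<^sub>R w + r' *\<^sub>R v))"
      unfolding 1(5)[symmetric] 2(5)[symmetric] ac by linarith
    then have eq: "?A v w (x + s *\<^sub>R v + r *\<^sub>R w) = ?A w v (x + s' *\<^sub>R w + r' *\<^sub>R v)"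
      using t by simp
    have "dist (x + s *\<^sub>R v + r *\<^sub>R w) x < d" "dist (x + r' *\<^sub>R v + s' *\<^sub>R w) x < d"
      using 1 2 by (auto intro: near)
    then have "dist (?A v w (x + s *\<^sub>R v + r *\<^sub>R w)) (?A v w x) < e"
      "dist (?A w v (x + s' *\<^sub>R w + r' *\<^sub>R v)) (?A w v x) < e"
      using d1 d2 by (auto simp: d_def algebra_simps)
    then show ?thesis using eq by (simp add: dist_real_def)
  qed
  then have "\<bar>?A v w x - ?A w v x\<bar> \<le> e" if "e > 0" for e
    using that[THEN half_gt_zero] by fastforce
  then show ?thesis by (metis abs_le_zero_iff dense_ge eq_iff_diff_eq_0)
qed

lemma frechet_derivative_symmetric:
  fixes f :: "'a::euclidean_space \<Rightarrow> 'b::euclidean_space"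
  assumes f: "smooth_on S f" and x: "x \<in> S"
  shows "frechet_derivative (\<lambda>y. frechet_derivative f (at y) v) (at x) w =
         frechet_derivative (\<lambda>y. frechet_derivative f (at y) w) (at x) v"
proof (rule euclidean_eqI)
  fix b :: 'b assume b: "b \<in> Basis"
  have inner: "frechet_derivative (\<lambda>y. g y \<bullet> b) (at z) u = frechet_derivative g (at z) u \<bullet> b"
    if "smooth_on S g" "z \<in> S" for g :: "'a \<Rightarrow> 'b" and z u
    using frechet_derivative_at[OF has_derivative_inner_left[OF smooth_on_has_derivative[OF that]]]
    by metis
  have fb: "smooth_on S (\<lambda>y. f y \<bullet> b)"
    by (rule smooth_on_linear[OF _ f]) (simp add: bounded_linear.linear bounded_linear_inner_left)
  have "frechet_derivative (\<lambda>y. frechet_derivative f (at y) v) (at x) w \<bullet> b =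
        frechet_derivative (\<lambda>y. frechet_derivative (\<lambda>y. f y \<bullet> b) (at y) v) (at x) w" for v w
  proof -
    have sm: "smooth_on S (\<lambda>y. frechet_derivative f (at y) v \<bullet> b)"
      by (rule smooth_on_linear[OF _ smooth_on_frechet_const[OF f]])
        (simp add: bounded_linear.linear bounded_linear_inner_left)
    have "frechet_derivative (\<lambda>y. frechet_derivative f (at y) v \<bullet> b) (at x) =
        frechet_derivative (\<lambda>y. frechet_derivative (\<lambda>y. f y \<bullet> b) (at y) v) (at x)"
      by (rule frechet_derivative_transform_within_open[OF _ smooth_on_open[OF f] x])
        (use smooth_on_has_derivative[OF sm x] inner[OF f] in \<open>auto simp: differentiable_def\<close>)
    then show ?thesis using inner[OF smooth_on_frechet_const[OF f] x] by metis
  qed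
  then show "frechet_derivative (\<lambda>y. frechet_derivative f (at y) v) (at x) w \<bullet> b =
      frechet_derivative (\<lambda>y. frechet_derivative f (at y) w) (at x) v \<bullet> b"
    using frechet_derivative_symmetric_real[OF fb x] by simp
qed

text \<open>Differentiating the two relations produces second derivatives of f, which cancel in the
  difference by symmetry. It is used for coordinate changes, and later for the passage from
  canonical coordinates to position and momentum.\<close>

lemma lie_bracket_related:
  fixes f :: "'a::euclidean_space \<Rightarrow> 'b::euclidean_space"
  assumes f: "smooth_on S f" and X: "smooth_on S X" and Y: "smooth_on S Y"
    and X': "smooth_on T X'" and Y': "smooth_on T Y'" and fST: "f ` S \<subseteq> T" and u: "u \<in> S"
    and relX: "\<And>z. z \<in> S \<Longrightarrow> frechet_derivative f (at z) (X z) = X' (f z)"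
    and relY: "\<And>z. z \<in> S \<Longrightarrow> frechet_derivative f (at z) (Y z) = Y' (f z)"
  shows "frechet_derivative f (at u)
           (frechet_derivative Y (at u) (X u) - frechet_derivative X (at u) (Y u)) =
         frechet_derivative Y' (at (f u)) (X' (f u)) - frechet_derivative X' (at (f u)) (Y' (f u))"
proof -
  let ?D = "\<lambda>z. frechet_derivative f (at z)"
  have lin: "linear (?D z)" if "z \<in> S" for z
    by (rule has_derivative_linear[OF smooth_on_has_derivative[OF f that]])
  \<comment> \<open>The field \<open>Z' \<circ> f\<close> is differentiated in two ways, by the
    chain rule and, through the relation, by the Leibniz rule. The first summand holds the second
    derivative of f.\<close>
  have key: "frechet_derivative (\<lambda>z. ?D z (Z u)) (at u) v + ?D u (frechet_derivative Z (at u) v) =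
      frechet_derivative Z' (at (f u)) (?D u v)"
    if Z: "smooth_on S Z" and Z': "smooth_on T Z'" and rel: "\<And>z. z \<in> S \<Longrightarrow> ?D z (Z z) = Z' (f z)"
    for Z Z' v
  proof -
    have 1: "((\<lambda>z. ?D z (Z z)) has_derivative
        (\<lambda>v. frechet_derivative (\<lambda>z. ?D z (Z u)) (at u) v + ?D u (frechet_derivative Z (at u) v))) (at u)"
      by (rule has_derivative_linear_family[OF Z u lin smooth_on_frechet_const[OF f]])
    have fu: "f u \<in> T" using fST u by auto
    have 2: "((\<lambda>z. Z' (f z)) has_derivative (\<lambda>v. frechet_derivative Z' (at (f u)) (?D u v))) (at u)"
      by (rule has_derivative_compose[OF smooth_on_has_derivative[OF f u] smooth_on_has_derivative[OF Z' fu]])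
    have 3: "((\<lambda>z. ?D z (Z z)) has_derivative (\<lambda>v. frechet_derivative Z' (at (f u)) (?D u v))) (at u)"
      by (rule has_derivative_transform_within_open[OF 2 smooth_on_open[OF f] u]) (simp add: rel)
    show ?thesis using has_derivative_unique[OF 1 3] by metis
  qed
  have "frechet_derivative (\<lambda>z. ?D z (Y u)) (at u) (X u) = frechet_derivative (\<lambda>z. ?D z (X u)) (at u) (Y u)"
    by (rule frechet_derivative_symmetric[OF f u])
  moreover have "frechet_derivative Y' (at (f u)) (X' (f u)) =
      frechet_derivative (\<lambda>z. ?D z (Y u)) (at u) (X u) + ?D u (frechet_derivative Y (at u) (X u))"
    using key[OF Y Y' relY, of "X u"] relX[OF u] by simp
  moreover have "frechet_derivative X' (at (f u)) (Y' (f u)) =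
      frechet_derivative (\<lambda>z. ?D z (X u)) (at u) (Y u) + ?D u (frechet_derivative X (at u) (Y u))"
    using key[OF X X' relX, of "Y u"] relY[OF u] by simp
  ultimately show ?thesis by (simp add: linear_diff[OF lin[OF u]])
qed

section \<open>Manifolds given by atlases\<close>

locale smooth_atlas =
  fixes A :: "('m, 'e::euclidean_space) chart set"
  assumes chart_inj: "c \<in> A \<Longrightarrow> inj_on (snd c) (fst c)"
    and transition_smooth: "c \<in> A \<Longrightarrow> d \<in> A \<Longrightarrow>
      smooth_on (snd c ` (fst c \<inter> fst d)) (snd d \<circ> chart_inv c)"

lemma pointsI: "c \<in> A \<Longrightarrow> x \<in> fst c \<Longrightarrow> x \<in> points A"
  by (simp only: points_def UN_iff) blast

lemma smooth_manifold_atlas: "smooth_manifold M A \<Longrightarrow> smooth_atlas A"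
  by (simp add: smooth_manifold_def smooth_atlas_def)

definition vdir_deriv ::
    "('m, 'e::euclidean_space) chart set \<Rightarrow> ('m \<Rightarrow> 'v::real_normed_vector) \<Rightarrow> 'm \<Rightarrow> ('m, 'e) tvec \<Rightarrow> 'v" where
  "vdir_deriv A F x v =
     (let c = (SOME c. c \<in> charts_at A x)
      in frechet_derivative (F \<circ> chart_inv c) (at (snd c x)) (v c))"

context smooth_atlas
begin

lemma charts_atD: "c \<in> charts_at A x \<Longrightarrow> c \<in> A" "c \<in> charts_at A x \<Longrightarrow> x \<in> fst c"
  by (auto simp: charts_at_def)

lemma charts_at_nonempty: "x \<in> points A \<Longrightarrow> \<exists>c. c \<in> charts_at A x"
  by (auto simp: charts_at_def points_def)

lemma charts_at_point: "c \<in> charts_at A x \<Longrightarrow> x \<in> points A"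
  by (auto simp: charts_at_def points_def)

lemma some_chart: "x \<in> points A \<Longrightarrow> (SOME c. c \<in> charts_at A x) \<in> charts_at A x"
  using charts_at_nonempty by (rule someI_ex)

lemma chart_inv_coord: "c \<in> A \<Longrightarrow> x \<in> fst c \<Longrightarrow> chart_inv c (snd c x) = x"
  unfolding chart_inv_def by (rule inv_into_f_f[OF chart_inj])

lemma chart_inv_at: "c \<in> charts_at A x \<Longrightarrow> chart_inv c (snd c x) = x"
  by (simp add: chart_inv_coord charts_atD)

lemma coord_chart_inv: "u \<in> snd c ` fst c \<Longrightarrow> snd c (chart_inv c u) = u"
  unfolding chart_inv_def by (rule f_inv_into_f)

lemma chart_inv_in: "u \<in> snd c ` fst c \<Longrightarrow> chart_inv c u \<in> fst c"
  unfolding chart_inv_def by (rule inv_into_into)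

lemma chart_inv_charts_at: "c \<in> A \<Longrightarrow> u \<in> snd c ` fst c \<Longrightarrow> c \<in> charts_at A (chart_inv c u)"
  by (simp add: charts_at_def chart_inv_in)

lemma open_overlap: "c \<in> A \<Longrightarrow> d \<in> A \<Longrightarrow> open (snd c ` (fst c \<inter> fst d))"
  using transition_smooth smooth_on_open by blast

lemma open_chart: "c \<in> A \<Longrightarrow> open (snd c ` fst c)"
  using open_overlap[of c c] by simp

lemma image_chart_Int:
  "c \<in> A \<Longrightarrow> snd c ` (fst c \<inter> U \<inter> (fst c \<inter> V)) = snd c ` (fst c \<inter> U) \<inter> snd c ` (fst c \<inter> V)"
  by (rule inj_on_image_Int[OF chart_inj]) auto

text \<open>The transformation law of tangent vectors in the form needed for functions on the
  manifold; every independence of the chart picked by \<open>SOME\<close> rests on it.\<close>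

lemma chart_change_derivative:
  assumes c: "c \<in> charts_at A x" and d: "d \<in> charts_at A x"
    and D: "((F \<circ> chart_inv d) has_derivative D) (at (snd d x))"
  shows "((F \<circ> chart_inv c) has_derivative (\<lambda>v. D (coord_change_deriv c d x v))) (at (snd c x))"
proof -
  let ?S = "snd c ` (fst c \<inter> fst d)"
  have sm: "smooth_on ?S (snd d \<circ> chart_inv c)"
    using c d charts_atD transition_smooth by blast
  have xS: "snd c x \<in> ?S" using c d charts_atD by blast
  have 1: "((snd d \<circ> chart_inv c) has_derivative coord_change_deriv c d x) (at (snd c x))"
    unfolding coord_change_deriv_def by (rule smooth_on_has_derivative[OF sm xS])
  have 2: "((F \<circ> chart_inv d) has_derivative D) (at ((snd d \<circ> chart_inv c) (snd c x)))"
    using D by (simp add: chart_inv_at[OF c])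
  note 3 = has_derivative_compose[OF 1 2]
  show ?thesis
  proof (rule has_derivative_transform_within_open[OF 3 smooth_on_open[OF sm] xS])
    fix u assume "u \<in> ?S"
    then obtain y where y: "y \<in> fst c" "y \<in> fst d" "u = snd c y" by auto
    then show "(F \<circ> chart_inv d) ((snd d \<circ> chart_inv c) u) = (F \<circ> chart_inv c) u"
      using c d charts_atD by (simp add: chart_inv_coord)
  qed
qed

lemma transition_derivative:
  assumes "c \<in> charts_at A x" "d \<in> charts_at A x"
  shows "((snd d \<circ> chart_inv c) has_derivative coord_change_deriv c d x) (at (snd c x))"
  unfolding coord_change_deriv_def
  by (rule smooth_on_has_derivative[OF transition_smooth]) (use assms charts_atD in auto)

lemma coord_change_linear:
  "c \<in> charts_at A x \<Longrightarrow> d \<in> charts_at A x \<Longrightarrow> linear (coord_change_deriv c d x)"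
  by (rule has_derivative_linear[OF transition_derivative])

lemma coord_change_self: "c \<in> charts_at A x \<Longrightarrow> coord_change_deriv c c x = (\<lambda>v. v)"
proof -
  assume c: "c \<in> charts_at A x"
  have "((snd c \<circ> chart_inv c) has_derivative (\<lambda>v. v)) (at (snd c x))"
    by (rule has_derivative_transform_within_open[OF has_derivative_ident open_chart[OF charts_atD(1)[OF c]]])
      (use charts_atD[OF c] in \<open>auto simp: chart_inv_coord\<close>)
  then show ?thesis using has_derivative_unique transition_derivative[OF c c] by blast
qed

lemma coord_change_comp:
  assumes "c \<in> charts_at A x" "d \<in> charts_at A x" "e \<in> charts_at A x"
  shows "coord_change_deriv d e x (coord_change_deriv c d x v) = coord_change_deriv c e x v"
  using has_derivative_unique[OF chart_change_derivative[OF assms(1,2) transition_derivative[OF assms(2,3)]]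
      transition_derivative[OF assms(1,3)]]
  by (rule fun_cong)

lemma tangent_coord:
  "v \<in> tangent_space A x \<Longrightarrow> c \<in> charts_at A x \<Longrightarrow> d \<in> charts_at A x \<Longrightarrow> v d = coord_change_deriv c d x (v c)"
  unfolding tangent_space_def by blast

lemma tangentI:
  "(\<And>c. c \<notin> charts_at A x \<Longrightarrow> v c = 0) \<Longrightarrow>
   (\<And>c d. c \<in> charts_at A x \<Longrightarrow> d \<in> charts_at A x \<Longrightarrow> v d = coord_change_deriv c d x (v c)) \<Longrightarrow>
   v \<in> tangent_space A x"
  unfolding tangent_space_def by blast

lemma tangent_off: "v \<in> tangent_space A x \<Longrightarrow> c \<notin> charts_at A x \<Longrightarrow> v c = 0"
  unfolding tangent_space_def by blast

lemma coord_vec_tangent: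
  assumes "c \<in> charts_at A x"
  shows "coord_vec A c x w \<in> tangent_space A x"
  by (rule tangentI) (simp_all add: coord_vec_def coord_change_comp assms)

lemma coord_vec_self: "c \<in> charts_at A x \<Longrightarrow> coord_vec A c x w c = w"
  by (simp add: coord_vec_def coord_change_self)

text \<open>One chart decides: the transformation law fixes the coordinates in the other charts
  around x, and in all remaining charts both vectors are zero by convention.\<close>

lemma tangent_eqI:
  assumes "v \<in> tangent_space A x" "w \<in> tangent_space A x" "c \<in> charts_at A x" "v c = w c"
  shows "v = w"
proof
  fix d
  show "v d = w d"
  proof (cases "d \<in> charts_at A x")
    case True
    then show ?thesis using tangent_coord[of v x c d] tangent_coord[of w x c d] assms by simp
  next
    case False
    then show ?thesis using assms(1,2) by (simp add: tangent_off)
  qed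
qed

lemma coord_vec_eq:
  "v \<in> tangent_space A x \<Longrightarrow> c \<in> charts_at A x \<Longrightarrow> coord_vec A c x (v c) = v"
  by (rule tangent_eqI[of _ x _ c]) (simp_all add: coord_vec_tangent coord_vec_self)

lemma tangent_add:
  assumes "v \<in> tangent_space A x" "w \<in> tangent_space A x"
  shows "v + w \<in> tangent_space A x"
  by (rule tangentI)
    (simp_all add: tangent_off[OF assms(1)] tangent_off[OF assms(2)] linear_add[OF coord_change_linear]
      tangent_coord[OF assms(1), symmetric] tangent_coord[OF assms(2), symmetric])

lemma tangent_scale:
  assumes "v \<in> tangent_space A x"
  shows "(\<lambda>c. r *\<^sub>R v c) \<in> tangent_space A x"
  by (rule tangentI)
    (simp_all add: tangent_off[OF assms] linear_cmul[OF coord_change_linear] tangent_coord[OF assms, symmetric])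

lemma tangent_minus: "v \<in> tangent_space A x \<Longrightarrow> - v \<in> tangent_space A x"
  using tangent_scale[of v x "-1"] by (simp add: fun_Compl_def)

lemma tangent_diff: "v \<in> tangent_space A x \<Longrightarrow> w \<in> tangent_space A x \<Longrightarrow> v - w \<in> tangent_space A x"
  using tangent_add[OF _ tangent_minus, of v x w] by simp

lemma coord_vec_add: "c \<in> charts_at A x \<Longrightarrow> coord_vec A c x (v + w) = coord_vec A c x v + coord_vec A c x w"
  by (rule tangent_eqI[of _ x _ c]) (simp_all add: coord_vec_tangent coord_vec_self tangent_add)

lemma coord_vec_scale: "c \<in> charts_at A x \<Longrightarrow> coord_vec A c x (r *\<^sub>R v) = (\<lambda>d. r *\<^sub>R coord_vec A c x v d)"
  by (rule tangent_eqI[of _ x _ c]) (simp_all add: coord_vec_tangent coord_vec_self tangent_scale)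

lemma vdir_deriv_coord:
  assumes "v \<in> tangent_space A x" "c \<in> charts_at A x"
    and D: "((F \<circ> chart_inv c) has_derivative D) (at (snd c x))"
  shows "vdir_deriv A F x v = D (v c)"
proof -
  define d where "d = (SOME c. c \<in> charts_at A x)"
  have d: "d \<in> charts_at A x" unfolding d_def by (rule some_chart[OF charts_at_point[OF assms(2)]])
  have "vdir_deriv A F x v = frechet_derivative (F \<circ> chart_inv d) (at (snd d x)) (v d)"
    by (simp add: vdir_deriv_def Let_def d_def)
  also have "\<dots> = D (coord_change_deriv d c x (v d))"
    using frechet_derivative_at[OF chart_change_derivative[OF d assms(2) D]] by metis
  also have "\<dots> = D (v c)" using tangent_coord[OF assms(1) d assms(2)] by simp
  finally show ?thesis .
qed

lemma dir_deriv_coord: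
  assumes "v \<in> tangent_space A x" "c \<in> charts_at A x"
    and "((F \<circ> chart_inv c) has_derivative D) (at (snd c x))"
  shows "dir_deriv A F x v = D (v c)"
  using vdir_deriv_coord[OF assms] by (simp add: vdir_deriv_def dir_deriv_def)

lemma smooth_map_derivative:
  assumes "smooth_map A B f" "c \<in> charts_at A x" "d \<in> charts_at B (f x)"
  shows "((snd d \<circ> f \<circ> chart_inv c) has_derivative
          frechet_derivative (snd d \<circ> f \<circ> chart_inv c) (at (snd c x))) (at (snd c x))"
  by (rule smooth_on_has_derivative[where S = "snd c ` (fst c \<inter> f -` fst d)"])
    (use assms in \<open>auto simp: smooth_map_def charts_at_def\<close>)

lemma pushforward_coord:
  assumes "smooth_map A B f" "v \<in> tangent_space A x" "c \<in> charts_at A x" "d \<in> charts_at B (f x)"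
  shows "pushforward A B f x v d = frechet_derivative (snd d \<circ> f \<circ> chart_inv c) (at (snd c x)) (v c)"

proof -
  define e where "e = (SOME c. c \<in> charts_at A x)"
  have e: "e \<in> charts_at A x" unfolding e_def by (rule some_chart[OF charts_at_point[OF assms(3)]])
  have "pushforward A B f x v d = frechet_derivative (snd d \<circ> f \<circ> chart_inv e) (at (snd e x)) (v e)"
    using assms(4) by (simp add: pushforward_def Let_def e_def)
  also have "\<dots> = frechet_derivative (snd d \<circ> f \<circ> chart_inv c) (at (snd c x)) (coord_change_deriv e c x (v e))"
    using frechet_derivative_at[OF chart_change_derivative[OF e assms(3) smooth_map_derivative[OF assms(1,3,4)]]]
    by metis
  also have "\<dots> = frechet_derivative (snd d \<circ> f \<circ> chart_inv c) (at (snd c x)) (v c)"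
    using tangent_coord[OF assms(2) e assms(3)] by simp
  finally show ?thesis .
qed

end

section \<open>Chain rule, pushforwards and composition of smooth maps\<close>

lemma smooth_map_point: "smooth_map A B f \<Longrightarrow> x \<in> points A \<Longrightarrow> f x \<in> points B"
  by (auto simp: smooth_map_def)

lemma smooth_map_smooth_on:
  "smooth_map A B f \<Longrightarrow> c \<in> A \<Longrightarrow> d \<in> B \<Longrightarrow> smooth_on (snd c ` (fst c \<inter> f -` fst d)) (snd d \<circ> f \<circ> chart_inv c)"
  by (simp add: smooth_map_def)

lemma compose_chart_derivative:
  assumes A: "smooth_atlas A" and B: "smooth_atlas B"
    and f: "smooth_map A B f" and c: "c \<in> charts_at A x" and d: "d \<in> charts_at B (f x)"
    and D: "((F \<circ> chart_inv d) has_derivative D) (at (snd d (f x)))"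
  shows "((F \<circ> f \<circ> chart_inv c) has_derivative
    (\<lambda>v. D (frechet_derivative (snd d \<circ> f \<circ> chart_inv c) (at (snd c x)) v))) (at (snd c x))"
proof -
  interpret A: smooth_atlas A by fact
  interpret B: smooth_atlas B by fact
  let ?S = "snd c ` (fst c \<inter> f -` fst d)"
  have cA: "c \<in> A" "x \<in> fst c" and dB: "d \<in> B" "f x \<in> fst d"
    using A.charts_atD[OF c] B.charts_atD[OF d] by auto
  note 1 = A.smooth_map_derivative[OF f c d]
  have 2: "((F \<circ> chart_inv d) has_derivative D) (at ((snd d \<circ> f \<circ> chart_inv c) (snd c x)))"
    using D by (simp add: A.chart_inv_at[OF c])
  note 3 = has_derivative_compose[OF 1 2]
  show ?thesis
  proof (rule has_derivative_transform_within_open[OF 3 smooth_on_open[OF smooth_map_smooth_on[OF f cA(1) dB(1)]]])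
    show "snd c x \<in> ?S" using cA dB by auto
    fix u assume "u \<in> ?S"
    then obtain y where y: "y \<in> fst c" "f y \<in> fst d" "u = snd c y" by auto
    then show "(F \<circ> chart_inv d) ((snd d \<circ> f \<circ> chart_inv c) u) = (F \<circ> f \<circ> chart_inv c) u"
      using cA dB by (simp add: A.chart_inv_coord B.chart_inv_coord)
  qed
qed

lemma pushforward_tangent:
  assumes A: "smooth_atlas A" and B: "smooth_atlas B"
    and f: "smooth_map A B f" and x: "x \<in> points A" and v: "v \<in> tangent_space A x"
  shows "pushforward A B f x v \<in> tangent_space B (f x)"
proof -
  interpret A: smooth_atlas A by fact
  interpret B: smooth_atlas B by fact
  obtain c where c: "c \<in> charts_at A x" using A.charts_at_nonempty[OF x] by blast
  have coord: "pushforward A B f x v e = coord_change_deriv d e (f x) (pushforward A B f x v d)"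
    if d: "d \<in> charts_at B (f x)" and e: "e \<in> charts_at B (f x)" for d e
    using frechet_derivative_at[OF compose_chart_derivative[OF A B f c d B.transition_derivative[OF d e]]]
    unfolding A.pushforward_coord[OF f v c d] A.pushforward_coord[OF f v c e] by metis
  show ?thesis by (rule B.tangentI) (simp add: pushforward_def, rule coord)
qed

lemma pushforward_compose:
  assumes A: "smooth_atlas A" and B: "smooth_atlas B" and C: "smooth_atlas C"
    and f: "smooth_map A B f" and g: "smooth_map B C g" and h: "smooth_map A C h"
    and hgf: "\<And>y. y \<in> points A \<Longrightarrow> h y = g (f y)"
    and x: "x \<in> points A" and v: "v \<in> tangent_space A x"
  shows "pushforward B C g (f x) (pushforward A B f x v) = pushforward A C h x v"
proof -
  interpret A: smooth_atlas A by fact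
  interpret B: smooth_atlas B by fact
  interpret C: smooth_atlas C by fact
  obtain c where c: "c \<in> charts_at A x" using A.charts_at_nonempty[OF x] by blast
  obtain d where d: "d \<in> charts_at B (f x)" using B.charts_at_nonempty smooth_map_point[OF f x] by blast
  obtain e where e: "e \<in> charts_at C (g (f x))"
    using C.charts_at_nonempty smooth_map_point[OF g smooth_map_point[OF f x]] by blast
  have e': "e \<in> charts_at C (h x)" using e hgf[OF x] by simp
  note T = pushforward_tangent[OF A B f x v]
  have "((snd e \<circ> g \<circ> f \<circ> chart_inv c) has_derivative
    (\<lambda>v. frechet_derivative (snd e \<circ> g \<circ> chart_inv d) (at (snd d (f x)))
        (frechet_derivative (snd d \<circ> f \<circ> chart_inv c) (at (snd c x)) v))) (at (snd c x))"
    by (rule compose_chart_derivative[OF A B f c d B.smooth_map_derivative[OF g d e]])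
  then have "((snd e \<circ> h \<circ> chart_inv c) has_derivative
    (\<lambda>v. frechet_derivative (snd e \<circ> g \<circ> chart_inv d) (at (snd d (f x)))
        (frechet_derivative (snd d \<circ> f \<circ> chart_inv c) (at (snd c x)) v))) (at (snd c x))"
    by (rule has_derivative_transform_within_open[OF _ A.open_chart[OF A.charts_atD(1)[OF c]]])
      (use A.charts_atD[OF c] in \<open>auto simp: A.chart_inv_coord hgf[OF pointsI]\<close>)
  from frechet_derivative_at[OF this]
  have "pushforward B C g (f x) (pushforward A B f x v) e = pushforward A C h x v e"
    unfolding A.pushforward_coord[OF h v c e'] B.pushforward_coord[OF g T d e] A.pushforward_coord[OF f v c d]
    by metis
  moreover have "pushforward A C h x v \<in> tangent_space C (g (f x))"
    using pushforward_tangent[OF A C h x v] hgf[OF x] by simp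
  ultimately show ?thesis
    using C.tangent_eqI[OF pushforward_tangent[OF B C g smooth_map_point[OF f x] T] _ e] by blast
qed

lemma pushforward_id:
  assumes A: "smooth_atlas A" and h: "smooth_map A A h" and id: "\<And>y. y \<in> points A \<Longrightarrow> h y = y"
    and x: "x \<in> points A" and v: "v \<in> tangent_space A x"
  shows "pushforward A A h x v = v"
proof -
  interpret A: smooth_atlas A by fact
  obtain c where c: "c \<in> charts_at A x" using A.charts_at_nonempty[OF x] by blast
  have c': "c \<in> charts_at A (h x)" using c id x by simp
  have "((snd c \<circ> h \<circ> chart_inv c) has_derivative (\<lambda>v. v)) (at (snd c x))"
    by (rule has_derivative_transform_within_open[OF has_derivative_ident A.open_chart[OF A.charts_atD(1)[OF c]]])
      (use A.charts_atD[OF c] in \<open>auto simp: A.chart_inv_coord id[OF pointsI]\<close>)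
  then have "pushforward A A h x v c = v c"
    unfolding A.pushforward_coord[OF h v c c'] using frechet_derivative_at by metis
  then show ?thesis
    using A.tangent_eqI[OF _ v c] pushforward_tangent[OF A A h x v] id[OF x] by simp
qed

lemma pushforward_linear:
  assumes A: "smooth_atlas A" and B: "smooth_atlas B"
    and f: "smooth_map A B f" and x: "x \<in> points A"
    and v: "v \<in> tangent_space A x" and w: "w \<in> tangent_space A x"
  shows "pushforward A B f x (v + w) = pushforward A B f x v + pushforward A B f x w"
    and "pushforward A B f x (\<lambda>c. r *\<^sub>R v c) = (\<lambda>c. r *\<^sub>R pushforward A B f x v c)"
proof -
  interpret A: smooth_atlas A by fact
  interpret B: smooth_atlas B by fact
  obtain c where c: "c \<in> charts_at A x" using A.charts_at_nonempty[OF x] by blast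
  have lin: "linear (frechet_derivative (snd d \<circ> f \<circ> chart_inv c) (at (snd c x)))"
    if "d \<in> charts_at B (f x)" for d
    by (rule has_derivative_linear[OF A.smooth_map_derivative[OF f c that]])
  show "pushforward A B f x (v + w) = pushforward A B f x v + pushforward A B f x w"
  proof
    fix d
    show "pushforward A B f x (v + w) d = (pushforward A B f x v + pushforward A B f x w) d"
    proof (cases "d \<in> charts_at B (f x)")
      case True
      then show ?thesis
        by (simp add: A.pushforward_coord[OF f _ c True] A.tangent_add v w linear_add[OF lin])
    next
      case False
      then show ?thesis by (simp add: pushforward_def)
    qed
  qed
  show "pushforward A B f x (\<lambda>c. r *\<^sub>R v c) = (\<lambda>c. r *\<^sub>R pushforward A B f x v c)"
  proof
    fix d
    show "pushforward A B f x (\<lambda>c. r *\<^sub>R v c) d = r *\<^sub>R pushforward A B f x v d"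
    proof (cases "d \<in> charts_at B (f x)")
      case True
      then show ?thesis
        by (simp add: A.pushforward_coord[OF f _ c True] A.tangent_scale v linear_cmul[OF lin])
    next
      case False
      then show ?thesis by (simp add: pushforward_def)
    qed
  qed
qed

lemma smooth_map_compose:
  assumes A: "smooth_atlas A" and B: "smooth_atlas B"
    and f: "smooth_map A B f" and g: "smooth_map B C g"
    and hgf: "\<And>y. y \<in> points A \<Longrightarrow> h y = g (f y)"
  shows "smooth_map A C h"
  unfolding smooth_map_def
proof (intro conjI ballI)
  show "h ` points A \<subseteq> points C" using f g hgf by (force simp: smooth_map_def)
  interpret A: smooth_atlas A by fact
  interpret B: smooth_atlas B by fact
  fix c e assume c: "c \<in> A" and e: "e \<in> C"
  show "smooth_on (snd c ` (fst c \<inter> h -` fst e)) (snd e \<circ> h \<circ> chart_inv c)"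
  proof (rule smooth_on_local)
    fix u assume "u \<in> snd c ` (fst c \<inter> h -` fst e)"
    then obtain x where x: "x \<in> fst c" "h x \<in> fst e" "u = snd c x" by auto
    have xA: "x \<in> points A" using x c by (auto simp: points_def)
    obtain d where d: "d \<in> B" "f x \<in> fst d"
      using B.charts_at_nonempty[OF smooth_map_point[OF f xA]] B.charts_atD by blast
    let ?S = "snd c ` (fst c \<inter> f -` fst d)" and ?T = "snd d ` (fst d \<inter> g -` fst e)"
    let ?f = "snd d \<circ> f \<circ> chart_inv c"
    have sf: "smooth_on ?S ?f" and sg: "smooth_on ?T (snd e \<circ> g \<circ> chart_inv d)"
      using f g c d e by (auto simp: smooth_map_def)
    \<comment> \<open>A single chart d of B covers only part of the image of f, so smoothness is
      shown near u, on the coordinates that f sends into the domain on which g is expressed in d and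
      e.\<close>
    let ?U = "?S \<inter> ?f -` ?T"
    have U: "open ?U"
      using continuous_open_preimage[OF smooth_on_continuous_on[OF sf] smooth_on_open[OF sf] smooth_on_open[OF sg]] .
    have gf: "h y = g (f y)" if "y \<in> fst c" for y using hgf c that by (auto simp: points_def)
    have "u \<in> ?U" using x d gf c by (auto simp: A.chart_inv_coord)
    moreover have "?U \<subseteq> snd c ` (fst c \<inter> h -` fst e)"
    proof
      fix z assume "z \<in> ?U"
      then obtain y y' where y: "y \<in> fst c" "f y \<in> fst d" "z = snd c y" and
        y': "y' \<in> fst d" "g y' \<in> fst e" "snd d (f y) = snd d y'"
        using c by (auto simp: A.chart_inv_coord)
      have "f y = y'" using B.chart_inj[OF d(1)] y(2) y'(1,3) unfolding inj_on_def by blast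
      then show "z \<in> snd c ` (fst c \<inter> h -` fst e)" using y y' gf by auto
    qed
    moreover have "smooth_on ?U (snd e \<circ> h \<circ> chart_inv c)"
    proof (rule smooth_on_cong)
      show "smooth_on ?U (\<lambda>u. (snd e \<circ> g \<circ> chart_inv d) (?f u))"
        by (rule smooth_on_compose[OF sg smooth_on_subset[OF sf U]]) auto
      fix z assume "z \<in> ?U"
      then obtain y where y: "y \<in> fst c" "f y \<in> fst d" "z = snd c y" by auto
      then show "(snd e \<circ> g \<circ> chart_inv d) (?f z) = (snd e \<circ> h \<circ> chart_inv c) z"
        using c d gf by (simp add: A.chart_inv_coord B.chart_inv_coord)
    qed
    ultimately show "\<exists>T. u \<in> T \<and> T \<subseteq> snd c ` (fst c \<inter> h -` fst e) \<and> smooth_on T (snd e \<circ> h \<circ> chart_inv c)"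
      by (intro exI[of _ ?U] conjI)
  qed
qed

lemma smooth_map_const:
  assumes "smooth_atlas A" "y \<in> points B"
  shows "smooth_map A B (\<lambda>_. y)"
proof -
  interpret A: smooth_atlas A by fact
  show ?thesis
    unfolding smooth_map_def
  proof (intro conjI ballI)
    show "(\<lambda>_. y) ` points A \<subseteq> points B" using assms by auto
    fix c d assume c: "c \<in> A" and "d \<in> B"
    have "fst c \<inter> (\<lambda>_. y) -` fst d = (if y \<in> fst d then fst c else {})" by auto
    then have "open (snd c ` (fst c \<inter> (\<lambda>_. y) -` fst d))" using A.open_chart[OF c] by simp
    then show "smooth_on (snd c ` (fst c \<inter> (\<lambda>_. y) -` fst d)) (snd d \<circ> (\<lambda>_. y) \<circ> chart_inv c)"
      by (simp add: comp_def smooth_on_const)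
  qed
qed

lemma smooth_map_ident:
  assumes "smooth_atlas A"
  shows "smooth_map A A (\<lambda>x. x)"
  using smooth_atlas.transition_smooth[OF assms] by (auto simp: smooth_map_def comp_def)

section \<open>Products of manifolds\<close>

lemma chart_inv_prod:
  assumes "inj_on (snd c) (fst c)" "inj_on (snd d) (fst d)"
    "u \<in> snd c ` fst c" "w \<in> snd d ` fst d"
  shows "chart_inv (fst c \<times> fst d, map_prod (snd c) (snd d)) (u, w) = (chart_inv c u, chart_inv d w)"
proof -
  obtain x y where xy: "x \<in> fst c" "u = snd c x" "y \<in> fst d" "w = snd d y" using assms by auto
  have "inj_on (map_prod (snd c) (snd d)) (fst c \<times> fst d)" using assms by (rule_tac map_prod_inj_on)
  then have "inv_into (fst c \<times> fst d) (map_prod (snd c) (snd d)) (map_prod (snd c) (snd d) (x, y)) = (x, y)"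
    by (rule inv_into_f_f) (use xy in auto)
  then show ?thesis using assms xy by (simp add: chart_inv_def)
qed

lemma prod_atlasI:
  "a \<in> A \<Longrightarrow> b \<in> B \<Longrightarrow> (fst a \<times> fst b, map_prod (snd a) (snd b)) \<in> prod_atlas A B"
  unfolding prod_atlas_def by blast

lemma prod_atlasE:
  assumes "e \<in> prod_atlas A B"
  obtains a b where "a \<in> A" "b \<in> B" "e = (fst a \<times> fst b, map_prod (snd a) (snd b))"
  using assms unfolding prod_atlas_def by blast

lemma points_prod: "points (prod_atlas A B) = points A \<times> points B"
proof (intro equalityI subsetI)
  fix z assume "z \<in> points (prod_atlas A B)"
  then obtain e where e: "e \<in> prod_atlas A B" "z \<in> fst e" unfolding points_def by blast
  from e(1) obtain a b where ab: "a \<in> A" "b \<in> B" "e = (fst a \<times> fst b, map_prod (snd a) (snd b))"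
    by (rule prod_atlasE)
  then show "z \<in> points A \<times> points B"
    using e(2) pointsI[OF ab(1), of "fst z"] pointsI[OF ab(2), of "snd z"] by (simp add: mem_Times_iff)
next
  fix z assume "z \<in> points A \<times> points B"
  then obtain a b where ab: "a \<in> A" "b \<in> B" "fst z \<in> fst a" "snd z \<in> fst b" unfolding points_def by fastforce
  then show "z \<in> points (prod_atlas A B)"
    by (intro pointsI[OF prod_atlasI[OF ab(1,2)]]) (simp add: mem_Times_iff)
qed

lemma smooth_on_prod_mapI:
  assumes "smooth_on S f" "smooth_on T g"
  shows "smooth_on (S \<times> T) (\<lambda>(x, y). (f x, g y))"
proof -
  have o: "open (S \<times> T)" by (intro open_Times smooth_on_open[OF assms(1)] smooth_on_open[OF assms(2)])
  have "smooth_on (S \<times> T) (\<lambda>z. (f (fst z), g (snd z)))"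
    by (intro smooth_on_Pair smooth_on_compose[OF assms(1)] smooth_on_compose[OF assms(2)]
        smooth_on_fst smooth_on_snd smooth_on_id o) auto
  then show ?thesis by (simp add: case_prod_unfold)
qed

lemma prod_atlas_smooth:
  assumes "smooth_atlas A" "smooth_atlas B"
  shows "smooth_atlas (prod_atlas A B)"
proof -
  interpret A: smooth_atlas A by fact
  interpret B: smooth_atlas B by fact
  show ?thesis
  proof
    fix c assume c: "c \<in> prod_atlas A B"
    then show "inj_on (snd c) (fst c)"
      by (elim prod_atlasE) (simp add: map_prod_inj_on A.chart_inj B.chart_inj)
    fix c' assume c': "c' \<in> prod_atlas A B"
    obtain a b where ab1: "a \<in> A" "b \<in> B" "c = (fst a \<times> fst b, map_prod (snd a) (snd b))"
      using c by (rule prod_atlasE)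
    obtain a' b' where ab2: "a' \<in> A" "b' \<in> B" "c' = (fst a' \<times> fst b', map_prod (snd a') (snd b'))"
      using c' by (rule prod_atlasE)
    note ab = ab1(1,2) ab2(1,2) ab1(3) ab2(3)
    have eq: "snd c ` (fst c \<inter> fst c') = snd a ` (fst a \<inter> fst a') \<times> snd b ` (fst b \<inter> fst b')"
      by (simp add: ab Times_Int_Times map_prod_surj_on[OF refl refl])
    show "smooth_on (snd c ` (fst c \<inter> fst c')) (snd c' \<circ> chart_inv c)"
      unfolding eq
      by (rule smooth_on_cong[OF smooth_on_prod_mapI[OF A.transition_smooth[OF ab1(1) ab2(1)] B.transition_smooth[OF ab1(2) ab2(2)]]])
        (auto simp: ab chart_inv_prod A.chart_inj B.chart_inj A.chart_inv_coord B.chart_inv_coord)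
  qed
qed

lemma smooth_map_Pair:
  assumes "smooth_atlas A" and "smooth_map A B f" and "smooth_map A C g"
  shows "smooth_map A (prod_atlas B C) (\<lambda>x. (f x, g x))"
proof -
  interpret A: smooth_atlas A by fact
  show ?thesis
    unfolding smooth_map_def points_prod
  proof (intro conjI ballI)
    show "(\<lambda>x. (f x, g x)) ` points A \<subseteq> points B \<times> points C" using assms by (auto simp: smooth_map_def)
    fix c e assume c: "c \<in> A" and "e \<in> prod_atlas B C"
    then obtain b d where bd: "b \<in> B" "d \<in> C" "e = (fst b \<times> fst d, map_prod (snd b) (snd d))"
      by (elim prod_atlasE) blast
    have "fst c \<inter> (\<lambda>x. (f x, g x)) -` fst e = (fst c \<inter> f -` fst b) \<inter> (fst c \<inter> g -` fst d)"
      by (auto simp: bd)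
    then have eq: "snd c ` (fst c \<inter> (\<lambda>x. (f x, g x)) -` fst e) =
        snd c ` (fst c \<inter> f -` fst b) \<inter> snd c ` (fst c \<inter> g -` fst d)"
      using A.image_chart_Int[OF c] by metis
    have s: "smooth_on (snd c ` (fst c \<inter> f -` fst b)) (snd b \<circ> f \<circ> chart_inv c)"
      "smooth_on (snd c ` (fst c \<inter> g -` fst d)) (snd d \<circ> g \<circ> chart_inv c)"
      using assms c bd by (auto simp: smooth_map_def)
    have o: "open (snd c ` (fst c \<inter> f -` fst b) \<inter> snd c ` (fst c \<inter> g -` fst d))"
      using s[THEN smooth_on_open] by blast
    have "smooth_on (snd c ` (fst c \<inter> f -` fst b) \<inter> snd c ` (fst c \<inter> g -` fst d))
        (\<lambda>u. ((snd b \<circ> f \<circ> chart_inv c) u, (snd d \<circ> g \<circ> chart_inv c) u))"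
      by (intro smooth_on_Pair smooth_on_subset[OF s(1) o] smooth_on_subset[OF s(2) o]) auto
    then show "smooth_on (snd c ` (fst c \<inter> (\<lambda>x. (f x, g x)) -` fst e)) (snd e \<circ> (\<lambda>x. (f x, g x)) \<circ> chart_inv c)"
      unfolding eq by (simp add: bd comp_def)
  qed
qed

lemma smooth_map_fst:
  assumes "smooth_atlas A" "smooth_atlas B"
  shows "smooth_map (prod_atlas A B) A fst"
proof -
  interpret A: smooth_atlas A by fact
  interpret B: smooth_atlas B by fact
  show ?thesis
    unfolding smooth_map_def points_prod
  proof (intro conjI ballI)
    show "fst ` (points A \<times> points B) \<subseteq> points A" by auto
    fix e a' assume "e \<in> prod_atlas A B" and a': "a' \<in> A"
    then obtain a b where ab: "a \<in> A" "b \<in> B" "e = (fst a \<times> fst b, map_prod (snd a) (snd b))"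
      by (elim prod_atlasE) blast
    have "fst e \<inter> fst -` fst a' = (fst a \<inter> fst a') \<times> fst b" by (auto simp: ab)
    then have eq: "snd e ` (fst e \<inter> fst -` fst a') = snd a ` (fst a \<inter> fst a') \<times> snd b ` fst b"
      by (simp add: ab map_prod_surj_on[OF refl refl])
    have o: "open (snd a ` (fst a \<inter> fst a') \<times> snd b ` fst b)"
      by (intro open_Times A.open_overlap B.open_chart ab a')
    show "smooth_on (snd e ` (fst e \<inter> fst -` fst a')) (snd a' \<circ> fst \<circ> chart_inv e)"
      unfolding eq
    proof (rule smooth_on_cong)
      show "smooth_on (snd a ` (fst a \<inter> fst a') \<times> snd b ` fst b) (\<lambda>z. (snd a' \<circ> chart_inv a) (fst z))"
        by (intro smooth_on_compose[OF A.transition_smooth[OF ab(1) a']] smooth_on_fst smooth_on_id o) auto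
    qed (auto simp: ab chart_inv_prod A.chart_inj B.chart_inj)
  qed
qed

lemma smooth_map_snd:
  assumes "smooth_atlas A" "smooth_atlas B"
  shows "smooth_map (prod_atlas A B) B snd"
proof -
  interpret A: smooth_atlas A by fact
  interpret B: smooth_atlas B by fact
  show ?thesis
    unfolding smooth_map_def points_prod
  proof (intro conjI ballI)
    show "snd ` (points A \<times> points B) \<subseteq> points B" by auto
    fix e b' assume "e \<in> prod_atlas A B" and b': "b' \<in> B"
    then obtain a b where ab: "a \<in> A" "b \<in> B" "e = (fst a \<times> fst b, map_prod (snd a) (snd b))"
      by (elim prod_atlasE) blast
    have "fst e \<inter> snd -` fst b' = fst a \<times> (fst b \<inter> fst b')" by (auto simp: ab)
    then have eq: "snd e ` (fst e \<inter> snd -` fst b') = snd a ` fst a \<times> snd b ` (fst b \<inter> fst b')"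
      by (simp add: ab map_prod_surj_on[OF refl refl])
    have o: "open (snd a ` fst a \<times> snd b ` (fst b \<inter> fst b'))"
      by (intro open_Times B.open_overlap A.open_chart ab b')
    show "smooth_on (snd e ` (fst e \<inter> snd -` fst b')) (snd b' \<circ> snd \<circ> chart_inv e)"
      unfolding eq
    proof (rule smooth_on_cong)
      show "smooth_on (snd a ` fst a \<times> snd b ` (fst b \<inter> fst b')) (\<lambda>z. (snd b' \<circ> chart_inv b) (snd z))"
        by (intro smooth_on_compose[OF B.transition_smooth[OF ab(2) b']] smooth_on_snd smooth_on_id o) auto
    qed (auto simp: ab chart_inv_prod A.chart_inj B.chart_inj)
  qed
qed

text \<open>The pushforward in the second variable is the derivative of the joint coordinate
  expression in a direction (0, w), so joint smoothness of f yields smooth dependence on the first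
  variable. A constant \<phi> gives the smoothness of left-invariant fields, the identity that of
  the Maurer-Cartan form.\<close>

lemma smooth_partial_pushforward:
  fixes A :: "('m, 'a::euclidean_space) chart set" and B :: "('n, 'b::euclidean_space) chart set"
    and C :: "('k, 'c::euclidean_space) chart set"
  assumes A: "smooth_atlas A" and B: "smooth_atlas B" and C: "smooth_atlas C"
    and f: "smooth_map (prod_atlas A B) C f" and \<phi>: "smooth_map A B \<phi>"
    and c: "c \<in> A" and b: "b \<in> B" and d: "d \<in> C"
  shows "smooth_on (snd c ` (fst c \<inter> \<phi> -` fst b \<inter> (fst c \<inter> (\<lambda>x. f (x, \<phi> x)) -` fst d)))
    (\<lambda>u. pushforward B C (\<lambda>y. f (chart_inv c u, y)) (\<phi> (chart_inv c u))
           (coord_vec B b (\<phi> (chart_inv c u)) w) d)"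
proof -
  interpret A: smooth_atlas A by fact
  interpret B: smooth_atlas B by fact
  note P = prod_atlas_smooth[OF A B]
  interpret P: smooth_atlas "prod_atlas A B" by (rule P)
  let ?U = "snd c ` (fst c \<inter> \<phi> -` fst b \<inter> (fst c \<inter> (\<lambda>x. f (x, \<phi> x)) -` fst d))"
  let ?p = "(fst c \<times> fst b, map_prod (snd c) (snd b))"
  let ?M = "snd d \<circ> f \<circ> chart_inv ?p"
  let ?W = "map_prod (snd c) (snd b) ` (fst c \<times> fst b \<inter> f -` fst d)"
  have p: "?p \<in> prod_atlas A B" using prod_atlasI[OF c b] .
  have M: "smooth_on ?W ?M" using smooth_map_smooth_on[OF f p d] by simp
  have graph: "smooth_map A (prod_atlas A B) (\<lambda>x. (x, \<phi> x))"
    by (rule smooth_map_Pair[OF A smooth_map_ident[OF A] \<phi>])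
  have comp: "smooth_map A C (\<lambda>x. f (x, \<phi> x))" by (rule smooth_map_compose[OF A P graph f]) simp
  have oU: "open ?U"
    unfolding A.image_chart_Int[OF c]
    using smooth_on_open[OF smooth_map_smooth_on[OF \<phi> c b]] smooth_on_open[OF smooth_map_smooth_on[OF comp c d]]
    by blast
  have "smooth_on ?U (\<lambda>u. frechet_derivative ?M (at (u, (snd b \<circ> \<phi> \<circ> chart_inv c) u)) (0, w))"
  proof (rule smooth_on_compose[OF smooth_on_frechet_const[OF M]])
    show "smooth_on ?U (\<lambda>u. (u, (snd b \<circ> \<phi> \<circ> chart_inv c) u))"
      by (intro smooth_on_Pair smooth_on_id oU smooth_on_subset[OF smooth_map_smooth_on[OF \<phi> c b]]) auto
    show "(\<lambda>u. (u, (snd b \<circ> \<phi> \<circ> chart_inv c) u)) ` ?U \<subseteq> ?W"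
      using c by (auto simp: A.chart_inv_coord)
  qed
  then show ?thesis
  proof (rule smooth_on_cong)
    fix u assume "u \<in> ?U"
    then obtain x where x: "x \<in> fst c" "\<phi> x \<in> fst b" "f (x, \<phi> x) \<in> fst d" "u = snd c x" by auto
    have inv: "chart_inv c u = x" using x c by (simp add: A.chart_inv_coord)
    have xA: "x \<in> points A" using x c by (auto simp: points_def)
    have fx: "smooth_map B C (\<lambda>y. f (x, y))"
      by (rule smooth_map_compose[OF B P smooth_map_Pair[OF B smooth_map_const[OF B xA] smooth_map_ident[OF B]] f]) simp
    have b': "b \<in> charts_at B (\<phi> x)" and d': "d \<in> charts_at C (f (x, \<phi> x))"
      using b d x by (auto simp: charts_at_def)
    let ?z = "snd b (\<phi> x)"
    have 1: "((\<lambda>z. (u, z)) has_derivative (\<lambda>v. (0, v))) (at ?z)"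
      by (auto intro!: derivative_eq_intros)
    have zW: "(u, ?z) \<in> ?W" using x by auto
    note 2 = has_derivative_compose[OF 1 smooth_on_has_derivative[OF M zW]]
    have oS: "open (snd b ` (fst b \<inter> (\<lambda>y. f (x, y)) -` fst d))"
      by (rule smooth_on_open[OF smooth_map_smooth_on[OF fx b d]])
    have 3: "((snd d \<circ> (\<lambda>y. f (x, y)) \<circ> chart_inv b) has_derivative (\<lambda>v. frechet_derivative ?M (at (u, ?z)) (0, v))) (at ?z)"
      by (rule has_derivative_transform_within_open[OF 2 oS])
        (use x c b in \<open>auto simp: chart_inv_prod A.chart_inj B.chart_inj A.chart_inv_coord B.chart_inv_coord\<close>)
    show "frechet_derivative ?M (at (u, (snd b \<circ> \<phi> \<circ> chart_inv c) u)) (0, w) =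
      pushforward B C (\<lambda>y. f (chart_inv c u, y)) (\<phi> (chart_inv c u)) (coord_vec B b (\<phi> (chart_inv c u)) w) d"
      unfolding inv B.pushforward_coord[OF fx B.coord_vec_tangent[OF b'] b' d'] B.coord_vec_self[OF b']
      using frechet_derivative_at[OF 3] by (simp add: inv) metis
  qed
qed

subsection \<open>Vector fields and the Nijenhuis tensor\<close>

lemma vector_field_tangent: "vector_field A X \<Longrightarrow> x \<in> points A \<Longrightarrow> X x \<in> tangent_space A x"
  by (simp add: vector_field_def)

lemma vector_field_off: "vector_field A X \<Longrightarrow> x \<notin> points A \<Longrightarrow> X x = 0"
  by (simp add: vector_field_def)

lemma vector_field_smooth: "vector_field A X \<Longrightarrow> c \<in> A \<Longrightarrow> smooth_on (snd c ` fst c) (local_rep c X)"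
  by (simp add: vector_field_def)

lemma vector_fieldI:
  "(\<And>x. x \<in> points A \<Longrightarrow> X x \<in> tangent_space A x) \<Longrightarrow> (\<And>x. x \<notin> points A \<Longrightarrow> X x = 0) \<Longrightarrow>
   (\<And>c. c \<in> A \<Longrightarrow> smooth_on (snd c ` fst c) (local_rep c X)) \<Longrightarrow> vector_field A X"
  by (simp only: vector_field_def) blast

context smooth_atlas
begin

lemma local_rep_at: "c \<in> charts_at A x \<Longrightarrow> local_rep c X (snd c x) = X x c"
  by (simp add: local_rep_def chart_inv_at)

text \<open>The coordinate change relates the representatives of a field in two charts, and related
  fields have related brackets; the second derivatives that could spoil the transformation law have
  cancelled there.\<close>

lemma bracket_tangent:
  assumes X: "vector_field A X" and Y: "vector_field A Y"
  shows "vf_bracket A X Y x \<in> tangent_space A x"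
proof (rule tangentI)
  fix c d assume c: "c \<in> charts_at A x" and d: "d \<in> charts_at A x"
  have cA: "c \<in> A" "x \<in> fst c" and dA: "d \<in> A" "x \<in> fst d" using c d charts_atD by blast+
  let ?S = "snd c ` (fst c \<inter> fst d)" and ?T = "snd d ` fst d" and ?f = "snd d \<circ> chart_inv c"
  have sub: "smooth_on ?S (local_rep c Z)" if "vector_field A Z" for Z
    by (rule smooth_on_subset[OF vector_field_smooth[OF that cA(1)] open_overlap[OF cA(1) dA(1)]]) auto
  have rel: "frechet_derivative ?f (at z) (local_rep c Z z) = local_rep d Z (?f z)"
    if Z: "vector_field A Z" and z: "z \<in> ?S" for Z z
  proof -
    obtain y where y: "y \<in> fst c" "y \<in> fst d" "z = snd c y" using z by auto
    have yc: "c \<in> charts_at A y" "d \<in> charts_at A y" using y cA dA by (simp_all add: charts_at_def)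
    have inv: "chart_inv c z = y" "chart_inv d (snd d y) = y" using y cA dA by (simp_all add: chart_inv_coord)
    have "Z y d = coord_change_deriv c d y (Z y c)"
      by (rule tangent_coord[OF vector_field_tangent[OF Z charts_at_point[OF yc(1)]] yc])
    then show ?thesis by (simp add: local_rep_def inv coord_change_deriv_def y(3)[symmetric])
  qed
  have fST: "?f ` ?S \<subseteq> ?T" using cA by (auto simp: chart_inv_coord)
  have u: "snd c x \<in> ?S" using cA dA by auto
  have fu: "?f (snd c x) = snd d x" using cA by (simp add: chart_inv_coord)
  have "coord_change_deriv c d x (frechet_derivative (local_rep c Y) (at (snd c x)) (local_rep c X (snd c x))
         - frechet_derivative (local_rep c X) (at (snd c x)) (local_rep c Y (snd c x))) =
    frechet_derivative (local_rep d Y) (at (snd d x)) (local_rep d X (snd d x))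
     - frechet_derivative (local_rep d X) (at (snd d x)) (local_rep d Y (snd d x))"
    using lie_bracket_related[OF transition_smooth[OF cA(1) dA(1)] sub[OF X] sub[OF Y]
        vector_field_smooth[OF X dA(1)] vector_field_smooth[OF Y dA(1)] fST u rel[OF X] rel[OF Y]]
    unfolding fu coord_change_deriv_def by blast
  then show "vf_bracket A X Y x d = coord_change_deriv c d x (vf_bracket A X Y x c)"
    using c d by (simp add: vf_bracket_def local_rep_at)
qed (simp add: vf_bracket_def)

lemma bracket_off: "x \<notin> points A \<Longrightarrow> vf_bracket A X Y x = 0"
  by (rule ext) (use charts_at_point in \<open>auto simp: vf_bracket_def\<close>)

end

definition nijenhuis ::
  "('m, 'e::euclidean_space) chart set \<Rightarrow> ('m \<Rightarrow> ('m, 'e) tvec \<Rightarrow> ('m, 'e) tvec) \<Rightarrow>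
   ('m \<Rightarrow> ('m, 'e) tvec) \<Rightarrow> ('m \<Rightarrow> ('m, 'e) tvec) \<Rightarrow> ('m \<Rightarrow> ('m, 'e) tvec)" where
  "nijenhuis A J X Y =
     vf_bracket A (endo_apply A J X) (endo_apply A J Y)
     - endo_apply A J (vf_bracket A (endo_apply A J X) Y)
     - endo_apply A J (vf_bracket A X (endo_apply A J Y))
     - vf_bracket A X Y"

locale almost_complex_atlas = smooth_atlas A for A :: "('m, 'e::euclidean_space) chart set" +
  fixes J :: "'m \<Rightarrow> ('m, 'e) tvec \<Rightarrow> ('m, 'e) tvec"
  assumes J: "almost_complex_structure A J"
begin

lemma J_tangent: "x \<in> points A \<Longrightarrow> v \<in> tangent_space A x \<Longrightarrow> J x v \<in> tangent_space A x"
  using J unfolding almost_complex_structure_def by blast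

lemma J_square: "x \<in> points A \<Longrightarrow> v \<in> tangent_space A x \<Longrightarrow> J x (J x v) = - v"
  using J unfolding almost_complex_structure_def by blast

lemma J_add: "x \<in> points A \<Longrightarrow> v \<in> tangent_space A x \<Longrightarrow> w \<in> tangent_space A x \<Longrightarrow> J x (v + w) = J x v + J x w"
  using J unfolding almost_complex_structure_def by blast

lemma J_scale: "x \<in> points A \<Longrightarrow> v \<in> tangent_space A x \<Longrightarrow> J x (\<lambda>c. r *\<^sub>R v c) = (\<lambda>c. r *\<^sub>R J x v c)"
  using J unfolding almost_complex_structure_def by blast

definition J_coord :: "('m, 'e) chart \<Rightarrow> 'e \<Rightarrow> 'e \<Rightarrow> 'e" where
  "J_coord c u w = J (chart_inv c u) (coord_vec A c (chart_inv c u) w) c"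

lemma J_coord_smooth: "c \<in> A \<Longrightarrow> smooth_on (snd c ` fst c) (\<lambda>u. J_coord c u w)"
  using J unfolding almost_complex_structure_def J_coord_def by blast

lemma J_coord_linear: "c \<in> A \<Longrightarrow> u \<in> snd c ` fst c \<Longrightarrow> linear (J_coord c u)"
proof -
  assume c: "c \<in> A" and u: "u \<in> snd c ` fst c"
  note at = chart_inv_charts_at[OF c u]
  note pt = charts_at_point[OF at]
  show ?thesis
  proof (rule linearI)
    fix v w :: 'e and r :: real
    show "J_coord c u (v + w) = J_coord c u v + J_coord c u w"
      by (simp add: J_coord_def coord_vec_add[OF at] J_add[OF pt] coord_vec_tangent[OF at])
    show "J_coord c u (r *\<^sub>R v) = r *\<^sub>R J_coord c u v"
      by (simp add: J_coord_def coord_vec_scale[OF at] J_scale[OF pt coord_vec_tangent[OF at]])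
  qed
qed

lemma J_coord_at:
  assumes "c \<in> charts_at A x" "v \<in> tangent_space A x"
  shows "J x v c = J_coord c (snd c x) (v c)"
  by (simp add: J_coord_def chart_inv_at[OF assms(1)] coord_vec_eq[OF assms(2,1)])

lemma J_coord_square:
  assumes c: "c \<in> charts_at A x"
  shows "J_coord c (snd c x) (J_coord c (snd c x) w) = - w"
proof -
  note T = coord_vec_tangent[OF c, of w] and pt = charts_at_point[OF c]
  have "J x (J x (coord_vec A c x w)) c = J_coord c (snd c x) (J_coord c (snd c x) w)"
    by (simp add: J_coord_at[OF c J_tangent[OF pt T]] J_coord_at[OF c T] coord_vec_self[OF c])
  then show ?thesis by (simp add: J_square[OF pt T] coord_vec_self[OF c])
qed

lemma local_rep_endo:
  assumes c: "c \<in> A" and u: "u \<in> snd c ` fst c" and X: "vector_field A X"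
  shows "local_rep c (endo_apply A J X) u = J_coord c u (local_rep c X u)"
proof -
  note at = chart_inv_charts_at[OF c u]
  note pt = charts_at_point[OF at]
  show ?thesis
    using J_coord_at[OF at vector_field_tangent[OF X pt]] u pt
    by (simp add: local_rep_def endo_apply_def coord_chart_inv)
qed

lemma endo_vector_field:
  assumes X: "vector_field A X"
  shows "vector_field A (endo_apply A J X)"
proof (rule vector_fieldI)
  show "endo_apply A J X x \<in> tangent_space A x" if "x \<in> points A" for x
    using that J_tangent vector_field_tangent[OF X] by (simp add: endo_apply_def)
  show "endo_apply A J X x = 0" if "x \<notin> points A" for x using that by (simp add: endo_apply_def)
  fix c assume c: "c \<in> A"
  show "smooth_on (snd c ` fst c) (local_rep c (endo_apply A J X))"
  proof (rule smooth_on_cong)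
    show "smooth_on (snd c ` fst c) (\<lambda>u. J_coord c u (local_rep c X u))"
      by (rule smooth_on_linear_family[OF J_coord_linear[OF c] J_coord_smooth[OF c] vector_field_smooth[OF X c]])
    show "J_coord c u (local_rep c X u) = local_rep c (endo_apply A J X) u" if "u \<in> snd c ` fst c" for u
      by (rule local_rep_endo[OF c that X, symmetric])
  qed
qed

lemma endo_derivative:
  assumes c: "c \<in> A" and u: "u \<in> snd c ` fst c" and X: "vector_field A X"
  shows "frechet_derivative (local_rep c (endo_apply A J X)) (at u) v =
    frechet_derivative (\<lambda>z. J_coord c z (local_rep c X u)) (at u) v
    + J_coord c u (frechet_derivative (local_rep c X) (at u) v)"
proof -
  note 1 = has_derivative_linear_family[OF vector_field_smooth[OF X c] u J_coord_linear[OF c] J_coord_smooth[OF c]]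
  have 2: "(local_rep c (endo_apply A J X) has_derivative
      (\<lambda>v. frechet_derivative (\<lambda>z. J_coord c z (local_rep c X u)) (at u) v
      + J_coord c u (frechet_derivative (local_rep c X) (at u) v))) (at u)"
    by (rule has_derivative_transform_within_open[OF 1 open_chart[OF c] u])
      (assumption, rule local_rep_endo[OF c _ X, symmetric], assumption)
  show ?thesis using frechet_derivative_at[OF 2] by metis
qed

text \<open>All derivatives of X and Y drop out, because j is linear and its square is -1. What
  remains are derivatives of J alone, evaluated on the values of X and Y at x.\<close>

lemma nijenhuis_coord:
  assumes X: "vector_field A X" and Y: "vector_field A Y" and c: "c \<in> charts_at A x"
  shows "nijenhuis A J X Y x c =
    (let j = J_coord c (snd c x); d = (\<lambda>v w. frechet_derivative (\<lambda>z. J_coord c z w) (at (snd c x)) v)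
     in d (j (X x c)) (Y x c) - d (j (Y x c)) (X x c) + j (d (Y x c) (X x c)) - j (d (X x c) (Y x c)))"
proof -
  have cA: "c \<in> A" "x \<in> fst c" using c charts_atD by blast+
  have u: "snd c x \<in> snd c ` fst c" using cA by auto
  note pt = charts_at_point[OF c]
  let ?j = "J_coord c (snd c x)"
  let ?D = "\<lambda>X. frechet_derivative (local_rep c X) (at (snd c x))"
  note EX = endo_vector_field[OF X] and EY = endo_vector_field[OF Y]
  have e: "endo_apply A J Z x c = ?j (Z x c)" if "Z x \<in> tangent_space A x" for Z
    using J_coord_at[OF c that] pt by (simp add: endo_apply_def)
  have b: "vf_bracket A Z W x c = ?D W (Z x c) - ?D Z (W x c)" for Z W
    using c by (simp add: vf_bracket_def)
  note D = endo_derivative[OF cA(1) u X, unfolded local_rep_at[OF c]] endo_derivative[OF cA(1) u Y, unfolded local_rep_at[OF c]]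
  note lin = J_coord_linear[OF cA(1) u]
  note sq = J_coord_square[OF c]
  show ?thesis
    unfolding nijenhuis_def Let_def
    by (simp add: e[of "vf_bracket A (endo_apply A J X) Y", OF bracket_tangent[OF EX Y]]
        e[of "vf_bracket A X (endo_apply A J Y)", OF bracket_tangent[OF X EY]] b D
        e[of X, OF vector_field_tangent[OF X pt]] e[of Y, OF vector_field_tangent[OF Y pt]]
        linear_diff[OF lin] linear_add[OF lin] sq)
qed

lemma nijenhuis_off: "x \<notin> points A \<Longrightarrow> nijenhuis A J X Y x = 0"
  by (simp add: nijenhuis_def bracket_off endo_apply_def)

lemma nijenhuis_tangent:
  assumes X: "vector_field A X" and Y: "vector_field A Y" and x: "x \<in> points A"
  shows "nijenhuis A J X Y x \<in> tangent_space A x"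
proof -
  have e: "endo_apply A J (vf_bracket A Z W) x \<in> tangent_space A x"
    if "vector_field A Z" "vector_field A W" for Z W
    using J_tangent[OF x bracket_tangent[OF that]] x by (simp add: endo_apply_def)
  show ?thesis
    unfolding nijenhuis_def fun_diff_def
    by (intro tangent_diff[unfolded fun_diff_def] bracket_tangent e X Y endo_vector_field)
qed

text \<open>Allows any field to be replaced by the frame field with the same value at x, whose
  brackets are known.\<close>

lemma nijenhuis_tensorial:
  assumes X: "vector_field A X" and Y: "vector_field A Y"
    and X': "vector_field A X'" and Y': "vector_field A Y'"
    and eq: "X x = X' x" "Y x = Y' x"
  shows "nijenhuis A J X Y x = nijenhuis A J X' Y' x"
proof (cases "x \<in> points A")
  case True
  obtain c where c: "c \<in> charts_at A x" using charts_at_nonempty[OF True] by blast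
  show ?thesis
    by (rule tangent_eqI[OF nijenhuis_tangent[OF X Y True] nijenhuis_tangent[OF X' Y' True] c])
      (simp add: nijenhuis_coord[OF X Y c] nijenhuis_coord[OF X' Y' c] eq)
qed (simp add: nijenhuis_off)

end

section \<open>Global frames, indexed linearly by a Euclidean space, with their coframes\<close>

locale framed_atlas = smooth_atlas A for A :: "('m, 'e::euclidean_space) chart set" +
  fixes S :: "'f::euclidean_space \<Rightarrow> 'm \<Rightarrow> ('m, 'e) tvec"
    and \<Phi> :: "'m \<Rightarrow> ('m, 'e) tvec \<Rightarrow> 'f"
  assumes frame_field: "vector_field A (S s)"
    and frame_add: "x \<in> points A \<Longrightarrow> S (s + t) x = S s x + S t x"
    and frame_scale: "x \<in> points A \<Longrightarrow> S (r *\<^sub>R s) x = (\<lambda>c. r *\<^sub>R S s x c)"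
    and frame_coframe: "x \<in> points A \<Longrightarrow> v \<in> tangent_space A x \<Longrightarrow> S (\<Phi> x v) x = v"
    and coframe_frame: "x \<in> points A \<Longrightarrow> \<Phi> x (S s x) = s"
    and coframe_smooth: "c \<in> A \<Longrightarrow>
      smooth_on (snd c ` fst c) (\<lambda>u. \<Phi> (chart_inv c u) (coord_vec A c (chart_inv c u) w))"
begin

lemma frame_tangent: "x \<in> points A \<Longrightarrow> S s x \<in> tangent_space A x"
  by (rule vector_field_tangent[OF frame_field])

lemma coframe_add:
  assumes "x \<in> points A" "v \<in> tangent_space A x" "w \<in> tangent_space A x"
  shows "\<Phi> x (v + w) = \<Phi> x v + \<Phi> x w"
  using assms coframe_frame[of x "\<Phi> x v + \<Phi> x w"] by (simp add: frame_add frame_coframe)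

lemma coframe_scale:
  assumes "x \<in> points A" "v \<in> tangent_space A x"
  shows "\<Phi> x (\<lambda>c. r *\<^sub>R v c) = r *\<^sub>R \<Phi> x v"
  using assms coframe_frame[of x "r *\<^sub>R \<Phi> x v"] by (simp add: frame_scale frame_coframe)

lemma frame_minus: "x \<in> points A \<Longrightarrow> S (- s) x = - S s x"
  using frame_scale[of x "-1" s] by (simp add: fun_Compl_def)

lemma frame_diff: "x \<in> points A \<Longrightarrow> S (s - t) x = S s x - S t x"
  using frame_add[of x s "- t"] by (simp add: frame_minus)

lemma frame_coord_linear: "c \<in> A \<Longrightarrow> u \<in> snd c ` fst c \<Longrightarrow> linear (\<lambda>s. local_rep c (S s) u)"
proof (rule linearI)
  assume c: "c \<in> A" and u: "u \<in> snd c ` fst c"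
  have pt: "chart_inv c u \<in> points A" by (rule pointsI[OF c chart_inv_in[OF u]])
  fix s t r
  show "local_rep c (S (s + t)) u = local_rep c (S s) u + local_rep c (S t) u"
    by (simp add: local_rep_def frame_add[OF pt])
  show "local_rep c (S (r *\<^sub>R s)) u = r *\<^sub>R local_rep c (S s) u"
    by (simp add: local_rep_def frame_scale[OF pt])
qed

lemma frame_combination_smooth:
  assumes "c \<in> A" "smooth_on (snd c ` fst c) g"
  shows "smooth_on (snd c ` fst c) (\<lambda>u. local_rep c (S (g u)) u)"
  by (rule smooth_on_linear_family[OF frame_coord_linear[OF assms(1)] vector_field_smooth[OF frame_field assms(1)] assms(2)])

text \<open>In the frame, J is the constant matrix K and the brackets are given by \<beta>, so the
  Nijenhuis tensor of two frame fields is the frame field of the expression in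
  \<open>integrable\<close>. Tensoriality extends its vanishing to all fields.\<close>

lemma frame_complex_structure:
  fixes \<beta> :: "'f \<Rightarrow> 'f \<Rightarrow> 'f"
  assumes JS: "\<And>x s. x \<in> points A \<Longrightarrow> J x (S s x) = S (K s) x"
    and K: "linear K" and KK: "\<And>s. K (K s) = - s"
    and bracket: "\<And>s t. vf_bracket A (S s) (S t) = S (\<beta> s t)"
    and integrable: "\<And>s t. \<beta> (K s) (K t) - K (\<beta> (K s) t) - K (\<beta> s (K t)) - \<beta> s t = 0"
  shows "complex_structure A J"
proof -
  have Jv: "J x v = S (K (\<Phi> x v)) x" if "x \<in> points A" "v \<in> tangent_space A x" for x v
    using JS[OF that(1), of "\<Phi> x v"] frame_coframe[OF that] by simp
  have ac: "almost_complex_structure A J"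
    unfolding almost_complex_structure_def
  proof (intro conjI ballI allI)
    fix x v assume x: "x \<in> points A" and v: "v \<in> tangent_space A x"
    show "J x v \<in> tangent_space A x" by (simp add: Jv[OF x v] frame_tangent[OF x])
    show "J x (J x v) = - v" by (simp add: Jv[OF x v] JS[OF x] KK frame_minus[OF x] frame_coframe[OF x v])
    show "J x (\<lambda>c. r *\<^sub>R v c) = (\<lambda>c. r *\<^sub>R J x v c)" for r
      by (simp add: Jv[OF x] v tangent_scale coframe_scale[OF x v] linear_cmul[OF K] frame_scale[OF x])
    fix w assume w: "w \<in> tangent_space A x"
    show "J x (v + w) = J x v + J x w"
      by (simp add: Jv[OF x] v w tangent_add coframe_add[OF x v w] linear_add[OF K] frame_add[OF x])
  next
    fix c w assume c: "c \<in> A"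
    show "smooth_on (snd c ` fst c) (\<lambda>u. J (chart_inv c u) (coord_vec A c (chart_inv c u) w) c)"
    proof (rule smooth_on_cong[OF frame_combination_smooth[OF c smooth_on_linear[OF K coframe_smooth[OF c]]]])
      fix u assume u: "u \<in> snd c ` fst c"
      note at = chart_inv_charts_at[OF c u]
      show "local_rep c (S (K (\<Phi> (chart_inv c u) (coord_vec A c (chart_inv c u) w)))) u =
        J (chart_inv c u) (coord_vec A c (chart_inv c u) w) c"
        by (simp add: local_rep_def Jv[OF charts_at_point[OF at] coord_vec_tangent[OF at]])
    qed
  qed
  interpret almost_complex_atlas A J by unfold_locales (rule ac)
  have endo: "endo_apply A J (S s) = S (K s)" for s
    by (rule ext) (simp add: endo_apply_def JS vector_field_off[OF frame_field])
  have frame: "nijenhuis A J (S s) (S t) x = 0" if x: "x \<in> points A" for s t x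
  proof -
    have "nijenhuis A J (S s) (S t) x = S (\<beta> (K s) (K t) - K (\<beta> (K s) t) - K (\<beta> s (K t)) - \<beta> s t) x"
      by (simp add: nijenhuis_def endo bracket frame_diff[OF x])
    also have "\<dots> = 0" using frame_diff[OF x, of s s] by (simp add: integrable)
    finally show ?thesis .
  qed
  have "nijenhuis A J X Y = 0" if X: "vector_field A X" and Y: "vector_field A Y" for X Y
  proof
    fix x
    show "nijenhuis A J X Y x = 0 x"
    proof (cases "x \<in> points A")
      case True
      then show ?thesis
        using nijenhuis_tensorial[OF X Y frame_field frame_field, of x "\<Phi> x (X x)" "\<Phi> x (Y x)"]
          frame_coframe[OF True] vector_field_tangent[OF X True] vector_field_tangent[OF Y True] frame[OF True]
        by simp
    qed (simp add: nijenhuis_off)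
  qed
  then show ?thesis using ac unfolding complex_structure_def nijenhuis_def by blast
qed

end

section \<open>The left-invariant frame of a Lie group\<close>

locale lie_group_atlas =
  fixes G :: "('m, 'b) monoid_scheme" (structure) and A :: "('m, 'e::euclidean_space) chart set"
  assumes lie_group: "lie_group G A"
begin

sublocale group G
  using lie_group by (simp add: lie_group_def)

sublocale smooth_atlas A
  using lie_group smooth_manifold_atlas by (auto simp: lie_group_def)

lemma points_carrier: "points A = carrier G"
  using lie_group by (simp add: lie_group_def smooth_manifold_def)

lemma mult_smooth: "smooth_map (prod_atlas A A) A (\<lambda>(x, y). x \<otimes> y)"
  using lie_group by (simp add: lie_group_def)

lemma inv_smooth: "smooth_map A A (\<lambda>x. inv x)"
  using lie_group by (simp add: lie_group_def)

lemma atlas: "smooth_atlas A" ..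

lemma translation_smooth: "g \<in> carrier G \<Longrightarrow> smooth_map A A (\<lambda>y. g \<otimes> y)"
  by (rule smooth_map_compose[OF atlas prod_atlas_smooth[OF atlas atlas]
        smooth_map_Pair[OF atlas smooth_map_const[OF atlas] smooth_map_ident[OF atlas]] mult_smooth, of g])
    (simp_all add: points_carrier)

lemma left_division_smooth: "smooth_map (prod_atlas A A) A (\<lambda>(x, y). inv x \<otimes> y)"
proof -
  note P = prod_atlas_smooth[OF atlas atlas]
  note 1 = smooth_map_compose[OF P atlas smooth_map_fst[OF atlas atlas] inv_smooth, of "\<lambda>z. inv (fst z)", OF refl]
  show ?thesis
    by (rule smooth_map_compose[OF P P smooth_map_Pair[OF P 1 smooth_map_snd[OF atlas atlas]] mult_smooth])
      (simp add: case_prod_unfold)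
qed

definition unit_chart :: "('m, 'e) chart" where
  "unit_chart = (SOME c. c \<in> charts_at A \<one>)"

lemma unit_chart: "unit_chart \<in> charts_at A \<one>"
  unfolding unit_chart_def by (rule some_chart) (simp add: points_carrier)

text \<open>Indexed by the coordinates at the unit in one fixed chart, so that the model space
  itself parametrizes the left-invariant fields and can serve as index space of the frame.\<close>

definition linv :: "'e \<Rightarrow> 'm \<Rightarrow> ('m, 'e) tvec" where
  "linv w x = (if x \<in> carrier G
     then pushforward A A (\<lambda>y. x \<otimes> y) \<one> (coord_vec A unit_chart \<one> w) else 0)"

text \<open>The Maurer-Cartan form, read in the chart at the unit.\<close>

definition mc_form :: "'m \<Rightarrow> ('m, 'e) tvec \<Rightarrow> 'e" where
  "mc_form x v = pushforward A A (\<lambda>y. inv x \<otimes> y) x v unit_chart"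

lemma translation_pushforward:
  assumes "g \<in> carrier G" "x \<in> carrier G" "y \<in> carrier G" "v \<in> tangent_space A y"
  shows "pushforward A A (\<lambda>z. g \<otimes> z) (x \<otimes> y) (pushforward A A (\<lambda>z. x \<otimes> z) y v) =
    pushforward A A (\<lambda>z. (g \<otimes> x) \<otimes> z) y v"
  by (rule pushforward_compose[OF atlas atlas atlas translation_smooth translation_smooth translation_smooth])
    (use assms in \<open>auto simp: points_carrier m_assoc\<close>)

lemma one_pushforward:
  "x \<in> carrier G \<Longrightarrow> v \<in> tangent_space A x \<Longrightarrow> pushforward A A (\<lambda>y. \<one> \<otimes> y) x v = v"
  by (rule pushforward_id[OF atlas translation_smooth]) (simp_all add: points_carrier)

lemma linv_tangent: "x \<in> carrier G \<Longrightarrow> linv w x \<in> tangent_space A x"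
  using pushforward_tangent[OF atlas atlas translation_smooth[of x], of \<one> "coord_vec A unit_chart \<one> w"]
  by (simp add: linv_def points_carrier coord_vec_tangent[OF unit_chart])

lemma linv_add: "x \<in> carrier G \<Longrightarrow> linv (v + w) x = linv v x + linv w x"
  by (simp add: linv_def coord_vec_add[OF unit_chart] pushforward_linear(1)[OF atlas atlas translation_smooth]
      points_carrier coord_vec_tangent[OF unit_chart])

lemma linv_scale: "x \<in> carrier G \<Longrightarrow> linv (r *\<^sub>R v) x = (\<lambda>c. r *\<^sub>R linv v x c)"
  by (simp add: linv_def coord_vec_scale[OF unit_chart] points_carrier coord_vec_tangent[OF unit_chart]
      pushforward_linear(2)[OF atlas atlas translation_smooth _ coord_vec_tangent[OF unit_chart] coord_vec_tangent[OF unit_chart]])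

lemma linv_field: "vector_field A (linv w)"
proof (rule vector_fieldI)
  show "linv w x \<in> tangent_space A x" if "x \<in> points A" for x
    using that by (simp add: linv_tangent points_carrier)
  show "linv w x = 0" if "x \<notin> points A" for x
    using that by (simp add: linv_def points_carrier)
  fix c assume c: "c \<in> A"
  have cG: "x \<in> carrier G" if "x \<in> fst c" for x using pointsI[OF c that] by (simp add: points_carrier)
  have one: "\<one> \<in> points A" by (simp add: points_carrier)
  \<comment> \<open>Along the constant map to the unit, the domain delivered by
    \<open>smooth_partial_pushforward\<close> is the whole chart.\<close>
  have "fst c \<inter> (\<lambda>_. \<one>) -` fst unit_chart \<inter> (fst c \<inter> (\<lambda>x. (\<lambda>(x, y). x \<otimes> y) (x, \<one>)) -` fst c) = fst c"
    using charts_atD(2)[OF unit_chart] cG by auto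
  then have "smooth_on (snd c ` fst c) (\<lambda>u. pushforward A A (\<lambda>y. (\<lambda>(x, y). x \<otimes> y) (chart_inv c u, y)) \<one>
      (coord_vec A unit_chart \<one> w) c)"
    using smooth_partial_pushforward[OF atlas atlas atlas mult_smooth smooth_map_const[OF atlas one] c
        charts_atD(1)[OF unit_chart] c, of w] by simp
  then show "smooth_on (snd c ` fst c) (local_rep c (linv w))"
    by (rule smooth_on_cong) (simp add: local_rep_def linv_def cG chart_inv_in)
qed

lemma mc_form_linv:
  assumes "x \<in> carrier G"
  shows "mc_form x (linv w x) = w"
proof -
  have "pushforward A A (\<lambda>z. inv x \<otimes> z) x (linv w x) = pushforward A A (\<lambda>z. (inv x \<otimes> x) \<otimes> z) \<one> (coord_vec A unit_chart \<one> w)"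
    using translation_pushforward[of "inv x" x \<one> "coord_vec A unit_chart \<one> w"] assms
    by (simp add: linv_def coord_vec_tangent[OF unit_chart])
  also have "\<dots> = coord_vec A unit_chart \<one> w"
    using assms by (simp add: one_pushforward coord_vec_tangent[OF unit_chart])
  finally show ?thesis by (simp add: mc_form_def coord_vec_self[OF unit_chart])
qed

lemma linv_mc_form:
  assumes x: "x \<in> carrier G" and v: "v \<in> tangent_space A x"
  shows "linv (mc_form x v) x = v"
proof -
  let ?u = "pushforward A A (\<lambda>y. inv x \<otimes> y) x v"
  have u: "?u \<in> tangent_space A \<one>"
    using pushforward_tangent[OF atlas atlas translation_smooth[of "inv x"], of x v] x v by (simp add: points_carrier)
  have "linv (mc_form x v) x = pushforward A A (\<lambda>y. x \<otimes> y) \<one> ?u"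
    using x by (simp add: linv_def mc_form_def coord_vec_eq[OF u unit_chart])
  also have "\<dots> = pushforward A A (\<lambda>z. (x \<otimes> inv x) \<otimes> z) x v"
    using translation_pushforward[of x "inv x" x v] x v by simp
  also have "\<dots> = v"
    using x v by (simp add: one_pushforward)
  finally show ?thesis .
qed

lemma mc_form_smooth:
  assumes c: "c \<in> A"
  shows "smooth_on (snd c ` fst c) (\<lambda>u. mc_form (chart_inv c u) (coord_vec A c (chart_inv c u) w))"
proof -
  have cG: "x \<in> carrier G" if "x \<in> fst c" for x using pointsI[OF c that] by (simp add: points_carrier)
  have "fst c \<inter> (\<lambda>x. x) -` fst c \<inter> (fst c \<inter> (\<lambda>x. (\<lambda>(x, y). inv x \<otimes> y) (x, x)) -` fst unit_chart) = fst c"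
    using charts_atD(2)[OF unit_chart] cG by auto
  then show ?thesis
    using smooth_partial_pushforward[OF atlas atlas atlas left_division_smooth smooth_map_ident[OF atlas] c
        c charts_atD(1)[OF unit_chart], of w] by (simp add: mc_form_def)
qed

sublocale frame: framed_atlas A linv mc_form
  by unfold_locales
    (simp_all add: linv_field points_carrier linv_add linv_scale linv_mc_form mc_form_linv mc_form_smooth)

lemma linv_left_invariant: "left_invariant_field G A (linv w)"
  unfolding left_invariant_field_def
proof (intro conjI ballI)
  fix g x assume "g \<in> carrier G" "x \<in> carrier G"
  then show "linv w (g \<otimes> x) = pushforward A A (\<lambda>y. g \<otimes> y) x (linv w x)"
    using translation_pushforward[of g x \<one> "coord_vec A unit_chart \<one> w"]
    by (simp add: linv_def coord_vec_tangent[OF unit_chart])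
qed (rule linv_field)

lemma left_invariant_field_eq:
  assumes X: "left_invariant_field G A X"
  shows "X = linv (X \<one> unit_chart)"
proof
  fix x
  have f: "vector_field A X" using X by (simp add: left_invariant_field_def)
  have X1: "X \<one> \<in> tangent_space A \<one>" by (rule vector_field_tangent[OF f]) (simp add: points_carrier)
  show "X x = linv (X \<one> unit_chart) x"
  proof (cases "x \<in> carrier G")
    case True
    then have "X (x \<otimes> \<one>) = pushforward A A (\<lambda>y. x \<otimes> y) \<one> (X \<one>)"
      using X unfolding left_invariant_field_def by blast
    then show ?thesis using True by (simp add: linv_def coord_vec_eq[OF X1 unit_chart])
  next
    case False
    then show ?thesis by (simp add: linv_def vector_field_off[OF f] points_carrier)
  qed
qed

end

section \<open>The cotangent bundle\<close>

lemma cotangent_spaceI: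
  "(\<And>v. v \<notin> tangent_space A x \<Longrightarrow> \<xi> v = 0) \<Longrightarrow>
   (\<And>v w. v \<in> tangent_space A x \<Longrightarrow> w \<in> tangent_space A x \<Longrightarrow> \<xi> (v + w) = \<xi> v + \<xi> w) \<Longrightarrow>
   (\<And>r v. v \<in> tangent_space A x \<Longrightarrow> \<xi> (\<lambda>c. r *\<^sub>R v c) = r * \<xi> v) \<Longrightarrow> \<xi> \<in> cotangent_space A x"
  unfolding cotangent_space_def by blast

lemma cotangent_off: "\<xi> \<in> cotangent_space A x \<Longrightarrow> v \<notin> tangent_space A x \<Longrightarrow> \<xi> v = 0"
  unfolding cotangent_space_def by blast

lemma cotangent_add:
  "\<xi> \<in> cotangent_space A x \<Longrightarrow> v \<in> tangent_space A x \<Longrightarrow> w \<in> tangent_space A x \<Longrightarrow> \<xi> (v + w) = \<xi> v + \<xi> w"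
  unfolding cotangent_space_def by blast

lemma cotangent_scale:
  "\<xi> \<in> cotangent_space A x \<Longrightarrow> v \<in> tangent_space A x \<Longrightarrow> \<xi> (\<lambda>c. r *\<^sub>R v c) = r * \<xi> v"
  unfolding cotangent_space_def by blast

definition cot_coord ::
    "('m, 'e::euclidean_space) chart set \<Rightarrow> ('m, 'e) chart \<Rightarrow> 'm \<Rightarrow> ('m, 'e) covec \<Rightarrow> 'e" where
  "cot_coord A c x \<xi> = (\<Sum>b\<in>Basis. \<xi> (coord_vec A c x b) *\<^sub>R b)"

definition coord_covec ::
    "('m, 'e::euclidean_space) chart set \<Rightarrow> ('m, 'e) chart \<Rightarrow> 'm \<Rightarrow> 'e \<Rightarrow> ('m, 'e) covec" where
  "coord_covec A c x p = (\<lambda>v. if v \<in> tangent_space A x then p \<bullet> v c else 0)"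

text \<open>The transpose of f for the inner product. The formula is linear in p for every f; the
  defining property of a transpose needs f to be linear.\<close>

definition dual_map :: "('e::euclidean_space \<Rightarrow> 'e) \<Rightarrow> 'e \<Rightarrow> 'e" where
  "dual_map f p = (\<Sum>b\<in>Basis. (p \<bullet> f b) *\<^sub>R b)"

lemma basis_sum_inner: "linear g \<Longrightarrow> (\<Sum>b\<in>Basis. g b *\<^sub>R b) \<bullet> w = (g w :: real)"
  for g :: "'e::euclidean_space \<Rightarrow> real"
  using linear_basis_expansion[of g w]
  by (simp only: inner_sum_left inner_scaleR_left inner_commute[of w] real_scaleR_def mult.commute)

lemma dual_map_inner: "linear f \<Longrightarrow> dual_map f p \<bullet> w = p \<bullet> f w"
  unfolding dual_map_def
  by (rule basis_sum_inner) (simp add: linear_iff inner_add_right)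

lemma dual_map_linear: "linear (dual_map f)"
  by (rule linearI) (simp_all add: dual_map_def inner_add_left scaleR_add_left sum.distrib scaleR_sum_right)

lemma dual_map_tr_inverse:
  assumes "linear f" "linear g" "\<And>w. f (g w) = w"
  shows "dual_map g (dual_map f p) = p"
  by (rule vector_eq_rdot[THEN iffD1]) (simp add: dual_map_inner assms)

lemma smooth_on_tr:
  fixes f :: "'a::euclidean_space \<Rightarrow> 'e::euclidean_space \<Rightarrow> 'e"
  assumes "\<And>b. smooth_on S (\<lambda>z. f z b)" "smooth_on S p"
  shows "smooth_on S (\<lambda>z. dual_map (f z) (p z))"
  unfolding dual_map_def
proof (rule smooth_on_sum[OF smooth_on_open[OF assms(2)] finite_Basis])
  fix b :: 'e
  have "linear (\<lambda>r. r *\<^sub>R b)" by (simp add: linear_iff scaleR_add_left)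
  then show "smooth_on S (\<lambda>z. (p z \<bullet> f z b) *\<^sub>R b)"
    by (rule smooth_on_linear[OF _ smooth_on_bilinear[OF bounded_bilinear_inner assms(2) assms(1)]])
qed

context smooth_atlas
begin

lemma atlas: "smooth_atlas A" ..

lemma cotangent_linear:
  assumes "\<xi> \<in> cotangent_space A x" "c \<in> charts_at A x"
  shows "linear (\<lambda>w. \<xi> (coord_vec A c x w))"
  by (rule linearI)
    (simp_all add: coord_vec_add[OF assms(2)] coord_vec_scale[OF assms(2)] cotangent_add[OF assms(1)]
      cotangent_scale[OF assms(1)] coord_vec_tangent[OF assms(2)])

lemma cot_coord_inner:
  assumes "\<xi> \<in> cotangent_space A x" "c \<in> charts_at A x"
  shows "cot_coord A c x \<xi> \<bullet> w = \<xi> (coord_vec A c x w)"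
  unfolding cot_coord_def by (rule basis_sum_inner[OF cotangent_linear[OF assms]])

lemma cotangent_eval:
  assumes "\<xi> \<in> cotangent_space A x" "c \<in> charts_at A x" "v \<in> tangent_space A x"
  shows "\<xi> v = cot_coord A c x \<xi> \<bullet> v c"
  by (simp add: cot_coord_inner[OF assms(1,2)] coord_vec_eq[OF assms(3,2)])

lemma coord_covec_cotangent: "coord_covec A c x p \<in> cotangent_space A x"
  by (rule cotangent_spaceI) (simp_all add: coord_covec_def tangent_add tangent_scale inner_add_right)

lemma coord_covec_coord:
  assumes "\<xi> \<in> cotangent_space A x" "c \<in> charts_at A x"
  shows "coord_covec A c x (cot_coord A c x \<xi>) = \<xi>"
  by (rule ext) (simp add: coord_covec_def cotangent_off[OF assms(1)] cotangent_eval[OF assms, symmetric])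

lemma cot_coord_covec:
  assumes "c \<in> charts_at A x"
  shows "cot_coord A c x (coord_covec A c x p) = p"
  by (simp add: cot_coord_def coord_covec_def coord_vec_tangent[OF assms] coord_vec_self[OF assms]
      euclidean_representation)

lemma cotangent_chart_dom:
  "(x, \<xi>) \<in> fst (cotangent_chart A c) \<longleftrightarrow> x \<in> fst c \<and> \<xi> \<in> cotangent_space A x"
  by (simp add: cotangent_chart_def)

lemma cotangent_chart_map: "snd (cotangent_chart A c) (x, \<xi>) = (snd c x, cot_coord A c x \<xi>)"
  by (simp add: cotangent_chart_def cot_coord_def)

text \<open>Every p is the coordinate vector of a covector, namely of \<open>coord_covec\<close>, so
  the image over U is a full product. The domains of all transition maps of the cotangent atlas are
  computed from this.\<close>

lemma cotangent_chart_image: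
  assumes c: "c \<in> A" and U: "U \<subseteq> fst c"
  shows "snd (cotangent_chart A c) ` (fst (cotangent_chart A c) \<inter> fst -` U) = (snd c ` U) \<times> UNIV"
proof (intro equalityI subsetI)
  fix z assume "z \<in> snd (cotangent_chart A c) ` (fst (cotangent_chart A c) \<inter> fst -` U)"
  then obtain y where y: "y \<in> fst (cotangent_chart A c)" "fst y \<in> U" "z = snd (cotangent_chart A c) y" by blast
  then show "z \<in> (snd c ` U) \<times> UNIV"
    using cotangent_chart_map[of c "fst y" "snd y"] by simp
next
  fix z assume "z \<in> (snd c ` U) \<times> (UNIV :: 'e set)"
  then obtain x p where xp: "x \<in> U" "z = (snd c x, p)" by blast
  then have x: "x \<in> fst c" and at: "c \<in> charts_at A x" using U c by (auto simp: charts_at_def)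
  have "z = snd (cotangent_chart A c) (x, coord_covec A c x p)"
    using xp by (simp add: cotangent_chart_map cot_coord_covec[OF at])
  moreover have "(x, coord_covec A c x p) \<in> fst (cotangent_chart A c) \<inter> fst -` U"
    using xp x by (simp add: cotangent_chart_dom coord_covec_cotangent)
  ultimately show "z \<in> snd (cotangent_chart A c) ` (fst (cotangent_chart A c) \<inter> fst -` U)" by blast
qed

lemma cotangent_chart_range:
  "c \<in> A \<Longrightarrow> snd (cotangent_chart A c) ` fst (cotangent_chart A c) = (snd c ` fst c) \<times> UNIV"
proof -
  assume c: "c \<in> A"
  have "fst (cotangent_chart A c) \<inter> fst -` fst c = fst (cotangent_chart A c)"
    by (auto simp: cotangent_chart_dom)
  then show ?thesis using cotangent_chart_image[OF c order_refl] by simp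
qed

lemma cotangent_chart_inj:
  assumes c: "c \<in> A"
  shows "inj_on (snd (cotangent_chart A c)) (fst (cotangent_chart A c))"
proof (rule inj_onI)
  fix y z assume y: "y \<in> fst (cotangent_chart A c)" and z: "z \<in> fst (cotangent_chart A c)"
    and eq: "snd (cotangent_chart A c) y = snd (cotangent_chart A c) z"
  obtain x \<xi> x' \<eta> where yz: "y = (x, \<xi>)" "z = (x', \<eta>)" by (metis prod.exhaust)
  have x: "x \<in> fst c" "x' \<in> fst c" and cot: "\<xi> \<in> cotangent_space A x" "\<eta> \<in> cotangent_space A x'"
    using y z by (simp_all add: yz cotangent_chart_dom)
  have "x = x'" using eq inj_onD[OF chart_inj[OF c] _ x] by (simp add: yz cotangent_chart_map)
  moreover have at: "c \<in> charts_at A x" using c x by (simp add: charts_at_def)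
  ultimately have "\<xi> = \<eta>"
    using eq coord_covec_coord[OF cot(1) at] coord_covec_coord[OF cot(2)] by (simp add: yz cotangent_chart_map)
  then show "y = z" using \<open>x = x'\<close> by (simp add: yz)
qed

lemma cotangent_chart_inv:
  assumes c: "c \<in> A" and u: "u \<in> snd c ` fst c"
  shows "chart_inv (cotangent_chart A c) (u, p) = (chart_inv c u, coord_covec A c (chart_inv c u) p)"
proof -
  have at: "c \<in> charts_at A (chart_inv c u)" by (rule chart_inv_charts_at[OF c u])
  have dom: "(chart_inv c u, coord_covec A c (chart_inv c u) p) \<in> fst (cotangent_chart A c)"
    by (simp add: cotangent_chart_dom chart_inv_in[OF u] coord_covec_cotangent)
  have "snd (cotangent_chart A c) (chart_inv c u, coord_covec A c (chart_inv c u) p) = (u, p)"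
    by (simp add: cotangent_chart_map coord_chart_inv[OF u] cot_coord_covec[OF at])
  then show ?thesis
    using inv_into_f_f[OF cotangent_chart_inj[OF c] dom] by (simp add: chart_inv_def)
qed

text \<open>Covectors change by the transpose of the derivative of the backward coordinate change,
  from d to c, taken at the image point.\<close>

lemma cotangent_transition:
  assumes c: "c \<in> A" and d: "d \<in> A" and u: "u \<in> snd c ` (fst c \<inter> fst d)"
  shows "snd (cotangent_chart A d) (chart_inv (cotangent_chart A c) (u, p)) =
    ((snd d \<circ> chart_inv c) u,
     dual_map (frechet_derivative (snd c \<circ> chart_inv d) (at ((snd d \<circ> chart_inv c) u))) p)"
proof -
  obtain x where x: "x \<in> fst c" "x \<in> fst d" "u = snd c x" using u by blast
  have inv: "chart_inv c u = x" using x c by (simp add: chart_inv_coord)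
  have at: "c \<in> charts_at A x" "d \<in> charts_at A x" using x c d by (simp_all add: charts_at_def)
  have u': "u \<in> snd c ` fst c" using x by blast
  have "cot_coord A d x (coord_covec A c x p) = dual_map (coord_change_deriv d c x) p"
    unfolding cot_coord_def dual_map_def
    by (rule sum.cong[OF refl])
      (simp add: coord_covec_def coord_vec_tangent[OF at(2)], simp add: coord_vec_def at)
  then show ?thesis
    by (simp add: cotangent_chart_inv[OF c u'] cotangent_chart_map inv coord_change_deriv_def)
qed

lemma cotangent_atlas_smooth: "smooth_atlas (cotangent_atlas A)"
proof
  fix cc assume "cc \<in> cotangent_atlas A"
  then obtain c where c: "c \<in> A" "cc = cotangent_chart A c" unfolding cotangent_atlas_def by blast
  show "inj_on (snd cc) (fst cc)" using c cotangent_chart_inj by simp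
  fix dd assume "dd \<in> cotangent_atlas A"
  then obtain d where d: "d \<in> A" "dd = cotangent_chart A d" unfolding cotangent_atlas_def by blast
  have "fst cc \<inter> fst dd = fst cc \<inter> fst -` (fst c \<inter> fst d)"
    by (auto simp: c d cotangent_chart_dom)
  then have eq: "snd cc ` (fst cc \<inter> fst dd) = snd c ` (fst c \<inter> fst d) \<times> UNIV"
    using cotangent_chart_image[OF c(1), of "fst c \<inter> fst d"] by (simp add: c)
  let ?U = "snd c ` (fst c \<inter> fst d)"
  have o: "open (?U \<times> (UNIV :: 'e set))" by (intro open_Times open_overlap c(1) d(1) open_UNIV)
  have t: "smooth_on (?U \<times> (UNIV :: 'e set)) (\<lambda>z. (snd d \<circ> chart_inv c) (fst z))"
    by (rule smooth_on_compose[OF transition_smooth[OF c(1) d(1)] smooth_on_fst[OF smooth_on_id[OF o]]]) auto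
  have im: "(snd d \<circ> chart_inv c) (fst z) \<in> snd d ` (fst d \<inter> fst c)" if "z \<in> ?U \<times> (UNIV :: 'e set)" for z
    using that c(1) by (auto simp: chart_inv_coord)
  have "smooth_on (?U \<times> (UNIV :: 'e set))
    (\<lambda>z. ((snd d \<circ> chart_inv c) (fst z),
      dual_map (frechet_derivative (snd c \<circ> chart_inv d) (at ((snd d \<circ> chart_inv c) (fst z)))) (snd z)))"
    by (intro smooth_on_Pair t smooth_on_tr smooth_on_snd[OF smooth_on_id[OF o]]
        smooth_on_compose[OF smooth_on_frechet_const[OF transition_smooth[OF d(1) c(1)]] t])
      (use im in blast)
  then show "smooth_on (snd cc ` (fst cc \<inter> fst dd)) (snd dd \<circ> chart_inv cc)"
    unfolding eq
  proof (rule smooth_on_cong)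
    fix z assume "z \<in> ?U \<times> (UNIV :: 'e set)"
    then show "((snd d \<circ> chart_inv c) (fst z),
      dual_map (frechet_derivative (snd c \<circ> chart_inv d) (at ((snd d \<circ> chart_inv c) (fst z)))) (snd z)) =
      (snd dd \<circ> chart_inv cc) z"
      using cotangent_transition[OF c(1) d(1), of "fst z" "snd z"] by (auto simp: c(2) d(2))
  qed
qed

lemma cotangent_points: "(x, \<xi>) \<in> points (cotangent_atlas A) \<longleftrightarrow> x \<in> points A \<and> \<xi> \<in> cotangent_space A x"
  by (auto simp: points_def cotangent_atlas_def cotangent_chart_dom)

lemma cotangent_charts_at:
  assumes "z \<in> points (cotangent_atlas A)"
  shows "charts_at (cotangent_atlas A) z = cotangent_chart A ` charts_at A (fst z)"
proof -
  obtain x \<xi> where z: "z = (x, \<xi>)" by (rule prod.exhaust)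
  have "\<xi> \<in> cotangent_space A x" using assms by (simp add: z cotangent_points)
  then show ?thesis
    unfolding charts_at_def cotangent_atlas_def z fst_conv by (auto simp: cotangent_chart_dom simp del: split_paired_All)
qed

lemma cotangent_fst_smooth: "smooth_map (cotangent_atlas A) A fst"
  unfolding smooth_map_def
proof (intro conjI ballI)
  show "fst ` points (cotangent_atlas A) \<subseteq> points A" using cotangent_points by fastforce
  fix cc d assume "cc \<in> cotangent_atlas A" and d: "d \<in> A"
  then obtain c where c: "c \<in> A" "cc = cotangent_chart A c" unfolding cotangent_atlas_def by blast
  let ?U = "snd c ` (fst c \<inter> fst d)"
  have "fst cc \<inter> fst -` fst d = fst cc \<inter> fst -` (fst c \<inter> fst d)"
    by (auto simp: c cotangent_chart_dom)
  then have eq: "snd cc ` (fst cc \<inter> fst -` fst d) = ?U \<times> UNIV"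
    using cotangent_chart_image[OF c(1), of "fst c \<inter> fst d"] by (simp add: c)
  have o: "open (?U \<times> (UNIV :: 'e set))" by (intro open_Times open_overlap c(1) d open_UNIV)
  have t: "smooth_on (?U \<times> (UNIV :: 'e set)) (\<lambda>z. (snd d \<circ> chart_inv c) (fst z))"
    by (rule smooth_on_compose[OF transition_smooth[OF c(1) d] smooth_on_fst[OF smooth_on_id[OF o]]]) auto
  show "smooth_on (snd cc ` (fst cc \<inter> fst -` fst d)) (snd d \<circ> fst \<circ> chart_inv cc)"
    unfolding eq
  proof (rule smooth_on_cong[OF t])
    fix z assume "z \<in> ?U \<times> (UNIV :: 'e set)"
    then have "fst z \<in> snd c ` fst c" by auto
    from cotangent_chart_inv[OF c(1) this, of "snd z"]
    show "(snd d \<circ> chart_inv c) (fst z) = (snd d \<circ> fst \<circ> chart_inv cc) z" by (simp add: c(2))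
  qed
qed

end

subsection \<open>Connections on parallelized manifolds\<close>

text \<open>Here the frame is indexed by the model space, and \<open>D a b\<close> holds the components of the
  covariant derivative of the frame field \<open>F b\<close> in direction of \<open>F a\<close>.\<close>

locale parallelized_connection = framed_atlas A F \<Theta>
  for A :: "('m, 'e::euclidean_space) chart set" and F :: "'e \<Rightarrow> 'm \<Rightarrow> ('m, 'e) tvec" and \<Theta> +
  fixes D :: "'e \<Rightarrow> 'e \<Rightarrow> 'e"
  assumes D: "bilinear D"
begin

definition frame_at where "frame_at c u a = local_rep c (F a) u"
definition coframe_at where "coframe_at c u w = \<Theta> (chart_inv c u) (coord_vec A c (chart_inv c u) w)"

text \<open>The connection for which the frame is parallel, corrected by the tensor with constant
  components D.\<close>

definition nab :: "('m, 'e) covderiv" where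
  "nab x v Y = F (vdir_deriv A (\<lambda>y. \<Theta> y (Y y)) x v + D (\<Theta> x v) (\<Theta> x (Y x))) x"

lemma frame_at_linear: "c \<in> A \<Longrightarrow> u \<in> snd c ` fst c \<Longrightarrow> linear (frame_at c u)"
  using frame_coord_linear unfolding frame_at_def .

lemma frame_at_smooth: "c \<in> A \<Longrightarrow> smooth_on (snd c ` fst c) (\<lambda>u. frame_at c u a)"
  using vector_field_smooth[OF frame_field] by (simp add: frame_at_def)

lemma coframe_at_smooth: "c \<in> A \<Longrightarrow> smooth_on (snd c ` fst c) (\<lambda>u. coframe_at c u w)"
  using coframe_smooth by (simp add: coframe_at_def)

lemma coframe_at_linear:
  assumes c: "c \<in> A" and u: "u \<in> snd c ` fst c"
  shows "linear (coframe_at c u)"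
proof -
  note at = chart_inv_charts_at[OF c u]
  note pt = charts_at_point[OF at] and T = coord_vec_tangent[OF at]
  show ?thesis
    by (rule linearI)
      (simp_all add: coframe_at_def coord_vec_add[OF at] coord_vec_scale[OF at] coframe_add[OF pt T T] coframe_scale[OF pt T])
qed

lemma frame_at_coframe_at:
  assumes c: "c \<in> A" and u: "u \<in> snd c ` fst c"
  shows "frame_at c u (coframe_at c u w) = w" "coframe_at c u (frame_at c u a) = a"
proof -
  note at = chart_inv_charts_at[OF c u]
  note pt = charts_at_point[OF at] and T = coord_vec_tangent[OF at]
  show "frame_at c u (coframe_at c u w) = w"
    by (simp add: frame_at_def coframe_at_def local_rep_def frame_coframe[OF pt T] coord_vec_self[OF at])
  show "coframe_at c u (frame_at c u a) = a"
    by (simp add: frame_at_def coframe_at_def local_rep_def coord_vec_eq[OF frame_tangent[OF pt] at] coframe_frame[OF pt])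
qed

lemma coframe_coord:
  assumes "c \<in> charts_at A x" "v \<in> tangent_space A x"
  shows "\<Theta> x v = coframe_at c (snd c x) (v c)"
  by (simp add: coframe_at_def chart_inv_at[OF assms(1)] coord_vec_eq[OF assms(2,1)])

lemma frame_coord: "c \<in> charts_at A x \<Longrightarrow> F a x c = frame_at c (snd c x) a"
  by (simp add: frame_at_def local_rep_at)

lemma coframe_field_at:
  assumes Y: "vector_field A Y" and c: "c \<in> A" and u: "u \<in> snd c ` fst c"
  shows "((\<lambda>x. \<Theta> x (Y x)) \<circ> chart_inv c) u = coframe_at c u (local_rep c Y u)"
proof -
  note at = chart_inv_charts_at[OF c u]
  show ?thesis
    using coframe_coord[OF at vector_field_tangent[OF Y charts_at_point[OF at]]]
    by (simp add: local_rep_def coord_chart_inv[OF u])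
qed

lemma coframe_field_smooth:
  assumes Y: "vector_field A Y" and c: "c \<in> A"
  shows "smooth_on (snd c ` fst c) ((\<lambda>x. \<Theta> x (Y x)) \<circ> chart_inv c)"
  by (rule smooth_on_cong[OF smooth_on_linear_family[OF coframe_at_linear[OF c] coframe_at_smooth[OF c]
          vector_field_smooth[OF Y c]]])
    (simp_all add: coframe_field_at[OF Y c] del: comp_apply)

lemma coframe_field_derivative:
  assumes Y: "vector_field A Y" and c: "c \<in> charts_at A x"
  shows "(((\<lambda>x. \<Theta> x (Y x)) \<circ> chart_inv c) has_derivative
    frechet_derivative ((\<lambda>x. \<Theta> x (Y x)) \<circ> chart_inv c) (at (snd c x))) (at (snd c x))"
  by (rule smooth_on_has_derivative[OF coframe_field_smooth[OF Y charts_atD(1)[OF c]]])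
    (use charts_atD[OF c] in blast)

lemma coframe_field_vdir:
  assumes Y: "vector_field A Y" and c: "c \<in> charts_at A x" and v: "v \<in> tangent_space A x"
  shows "vdir_deriv A (\<lambda>x. \<Theta> x (Y x)) x v = frechet_derivative ((\<lambda>x. \<Theta> x (Y x)) \<circ> chart_inv c) (at (snd c x)) (v c)"
  by (rule vdir_deriv_coord[OF v c coframe_field_derivative[OF Y c]])

lemma vdir_deriv_cong_coord:
  assumes c: "c \<in> charts_at A x" and v: "v \<in> tangent_space A x"
    and "\<And>y. y \<in> points A \<Longrightarrow> g y = f y"
    and "((f \<circ> chart_inv c) has_derivative f') (at (snd c x))"
  shows "vdir_deriv A g x v = f' (v c)"
proof (rule vdir_deriv_coord[OF v c])
  show "((g \<circ> chart_inv c) has_derivative f') (at (snd c x))"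
  proof (rule has_derivative_transform_within_open[OF assms(4) open_chart[OF charts_atD(1)[OF c]]])
    show "snd c x \<in> snd c ` fst c" using charts_atD[OF c] by blast
    show "(f \<circ> chart_inv c) u = (g \<circ> chart_inv c) u" if "u \<in> snd c ` fst c" for u
      using assms(3) pointsI[OF charts_atD(1)[OF c] chart_inv_in[OF that]] by simp
  qed
qed

text \<open>A frame field has constant components, so only the correction by D is left.\<close>

lemma nab_frame: 
  assumes x: "x \<in> points A" and v: "v \<in> tangent_space A x"
  shows "nab x v (F b) = F (D (\<Theta> x v) b) x"
proof -
  obtain c where c: "c \<in> charts_at A x" using charts_at_nonempty[OF x] by blast
  have "vdir_deriv A (\<lambda>y. \<Theta> y (F b y)) x v = 0"
    using vdir_deriv_cong_coord[OF c v, of "\<lambda>y. \<Theta> y (F b y)" "\<lambda>_. b" "\<lambda>_. 0"] coframe_frame by (simp add: comp_def)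
  then show ?thesis by (simp add: nab_def coframe_frame[OF x])
qed

lemma affine_connection_nab: "affine_connection A nab"
  unfolding affine_connection_def
proof (intro allI impI conjI ballI)
  fix Y x v assume Y: "vector_field A Y" and x: "x \<in> points A" and v: "v \<in> tangent_space A x"
  obtain c where c: "c \<in> charts_at A x" using charts_at_nonempty[OF x] by blast
  note lin = has_derivative_linear[OF coframe_field_derivative[OF Y c]]
  show "nab x v Y \<in> tangent_space A x" by (simp add: nab_def frame_tangent[OF x])
  show "nab x (\<lambda>c. r *\<^sub>R v c) Y = (\<lambda>c. r *\<^sub>R nab x v Y c)" for r
    by (simp add: nab_def coframe_field_vdir[OF Y c] v tangent_scale coframe_scale[OF x v] linear_cmul[OF lin]
        bilinear_lmul[OF D] scaleR_add_right[symmetric] frame_scale[OF x] del: scaleR_add_right)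
  show "nab x (v + w) Y = nab x v Y + nab x w Y" if w: "w \<in> tangent_space A x" for w
    by (simp add: nab_def coframe_field_vdir[OF Y c] v w tangent_add coframe_add[OF x v w] linear_add[OF lin]
        bilinear_ladd[OF D] frame_add[OF x])
  show "nab x v (Y + Z) = nab x v Y + nab x v Z" if Z: "vector_field A Z" for Z
  proof -
    have "vdir_deriv A (\<lambda>y. \<Theta> y ((Y + Z) y)) x v =
       vdir_deriv A (\<lambda>y. \<Theta> y (Y y)) x v + vdir_deriv A (\<lambda>y. \<Theta> y (Z y)) x v"
      unfolding coframe_field_vdir[OF Y c v] coframe_field_vdir[OF Z c v]
    proof (rule vdir_deriv_cong_coord[OF c v])
      show "\<Theta> y ((Y + Z) y) = \<Theta> y (Y y) + \<Theta> y (Z y)" if "y \<in> points A" for y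
        using coframe_add[OF that vector_field_tangent[OF Y that] vector_field_tangent[OF Z that]] by simp
      show "((\<lambda>y. \<Theta> y (Y y) + \<Theta> y (Z y)) \<circ> chart_inv c has_derivative
        (\<lambda>v. frechet_derivative ((\<lambda>x. \<Theta> x (Y x)) \<circ> chart_inv c) (at (snd c x)) v +
         frechet_derivative ((\<lambda>x. \<Theta> x (Z x)) \<circ> chart_inv c) (at (snd c x)) v)) (at (snd c x))"
        using has_derivative_add[OF coframe_field_derivative[OF Y c] coframe_field_derivative[OF Z c]]
        by (simp add: comp_def)
    qed
    then show ?thesis
      using coframe_add[OF x vector_field_tangent[OF Y x] vector_field_tangent[OF Z x]]
      by (simp add: nab_def bilinear_radd[OF D] frame_add[OF x])
  qed
  show "nab x v (\<lambda>y c. f y *\<^sub>R Y y c) = (\<lambda>c. dir_deriv A f x v *\<^sub>R Y x c + f x *\<^sub>R nab x v Y c)"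
    if f: "smooth_fun A f" for f
  proof -
    have "smooth_on (snd c ` fst c) (f \<circ> chart_inv c)"
      using f charts_atD(1)[OF c] unfolding smooth_fun_def by blast
    then have fd: "((f \<circ> chart_inv c) has_derivative frechet_derivative (f \<circ> chart_inv c) (at (snd c x))) (at (snd c x))"
      by (rule smooth_on_has_derivative) (use charts_atD[OF c] in blast)
    have "vdir_deriv A (\<lambda>y. \<Theta> y (\<lambda>c. f y *\<^sub>R Y y c)) x v =
       f x *\<^sub>R vdir_deriv A (\<lambda>y. \<Theta> y (Y y)) x v + dir_deriv A f x v *\<^sub>R \<Theta> x (Y x)"
      unfolding coframe_field_vdir[OF Y c v] dir_deriv_coord[OF v c fd]
    proof (rule vdir_deriv_cong_coord[OF c v])
      show "\<Theta> y (\<lambda>c. f y *\<^sub>R Y y c) = f y *\<^sub>R \<Theta> y (Y y)" if "y \<in> points A" for y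
        using coframe_scale[OF that vector_field_tangent[OF Y that]] by simp
      show "((\<lambda>y. f y *\<^sub>R \<Theta> y (Y y)) \<circ> chart_inv c has_derivative
        (\<lambda>v. f x *\<^sub>R frechet_derivative ((\<lambda>x. \<Theta> x (Y x)) \<circ> chart_inv c) (at (snd c x)) v +
         frechet_derivative (f \<circ> chart_inv c) (at (snd c x)) v *\<^sub>R \<Theta> x (Y x))) (at (snd c x))"
        using has_derivative_scaleR[OF fd coframe_field_derivative[OF Y c]]
        by (simp add: comp_def chart_inv_at[OF c])
    qed
    then have "nab x v (\<lambda>y c. f y *\<^sub>R Y y c) =
        F (dir_deriv A f x v *\<^sub>R \<Theta> x (Y x) + f x *\<^sub>R (vdir_deriv A (\<lambda>y. \<Theta> y (Y y)) x v + D (\<Theta> x v) (\<Theta> x (Y x)))) x"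
      by (simp add: nab_def coframe_scale[OF x vector_field_tangent[OF Y x]] bilinear_rmul[OF D] algebra_simps)
    then show ?thesis
      by (simp add: frame_add[OF x] frame_scale[OF x] nab_def frame_coframe[OF x vector_field_tangent[OF Y x]] plus_fun_def)
  qed
next
  fix Y X assume Y: "vector_field A Y" and X: "vector_field A X"
  show "vector_field A (\<lambda>x. if x \<in> points A then nab x (X x) Y else 0)"
  proof (rule vector_fieldI)
    fix c assume c: "c \<in> A"
    let ?y = "(\<lambda>x. \<Theta> x (Y x)) \<circ> chart_inv c" and ?x = "(\<lambda>x. \<Theta> x (X x)) \<circ> chart_inv c"
    \<comment> \<open>The components of the covariant derivative with respect to the frame, in the
      chart c; they are smooth since the components of X and Y are.\<close>
    let ?g = "\<lambda>u. frechet_derivative ?y (at u) (local_rep c X u) + D (?x u) (?y u)"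
    have "smooth_on (snd c ` fst c) ?g"
      by (intro smooth_on_add smooth_on_frechet coframe_field_smooth X Y c vector_field_smooth[OF X c]
          smooth_on_bilinear[OF bilinear_conv_bounded_bilinear[THEN iffD1, OF D]])
    from frame_combination_smooth[OF c this]
    show "smooth_on (snd c ` fst c) (local_rep c (\<lambda>x. if x \<in> points A then nab x (X x) Y else 0))"
    proof (rule smooth_on_cong)
      fix u assume u: "u \<in> snd c ` fst c"
      note at = chart_inv_charts_at[OF c u]
      note pt = charts_at_point[OF at]
      show "local_rep c (F (?g u)) u = local_rep c (\<lambda>x. if x \<in> points A then nab x (X x) Y else 0) u"
        by (simp add: local_rep_def pt nab_def coframe_field_vdir[OF Y at vector_field_tangent[OF X pt]] coord_chart_inv[OF u])
    qed
  qed (simp_all add: nab_def frame_tangent)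
qed

end

section \<open>A frame of the cotangent bundle adapted to the connection\<close>

context parallelized_connection
begin

abbreviation TA where "TA \<equiv> cotangent_atlas A"

interpretation T: smooth_atlas TA by (rule cotangent_atlas_smooth)

text \<open>The components of the covector with respect to the frame. On a Lie group with its
  left-invariant frame this is the fibre part of the left trivialization of the cotangent
  bundle.\<close>

definition momentum :: "'m \<times> ('m, 'e) covec \<Rightarrow> 'e" where
  "momentum z = (\<Sum>b\<in>Basis. snd z (F b (fst z)) *\<^sub>R b)"

definition momentum_at :: "('m, 'e) chart \<Rightarrow> 'e \<times> 'e \<Rightarrow> 'e" where
  "momentum_at c z = dual_map (frame_at c (fst z)) (snd z)"

abbreviation momentum_deriv where
  "momentum_deriv c z \<equiv> frechet_derivative (momentum_at c) (at z)"

text \<open>The tangent vector in the chart of the cotangent bundle over \<open>c\<close> that lies over \<open>v\<close> and along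
  which the momentum has derivative \<open>r\<close>.\<close>

definition lift_at :: "('m, 'e) chart \<Rightarrow> 'e \<times> 'e \<Rightarrow> 'e \<Rightarrow> 'e \<Rightarrow> 'e \<times> 'e" where
  "lift_at c z v r = (v, dual_map (coframe_at c (fst z)) (r - momentum_deriv c z (v, 0)))"

text \<open>Prescribed by its projection to the base and by the derivative of the momentum along it.
  The term with D makes the index \<open>(a, 0)\<close> a horizontal lift, and a constant derivative
  \<open>b\<close> over the zero vector makes \<open>(0, b)\<close> a vertical one.\<close>

definition cot_frame :: "'e \<times> 'e \<Rightarrow> 'm \<times> ('m, 'e) covec \<Rightarrow> ('m \<times> ('m, 'e) covec, 'e \<times> 'e) tvec" where
  "cot_frame s z = (if z \<in> points TA
     then let c = (SOME c. c \<in> charts_at A (fst z)); cc = cotangent_chart A c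
          in coord_vec TA cc z (lift_at c (snd cc z) (F (fst s) (fst z) c) (dual_map (D (fst s)) (momentum z) + snd s))
     else 0)"

definition cot_coframe :: "'m \<times> ('m, 'e) covec \<Rightarrow> ('m \<times> ('m, 'e) covec, 'e \<times> 'e) tvec \<Rightarrow> 'e \<times> 'e" where
  "cot_coframe z w = (let a = \<Theta> (fst z) (pushforward TA A fst z w)
     in (a, vdir_deriv TA momentum z w - dual_map (D a) (momentum z)))"

lemma D_linear: "linear (D a)"
  using D by (simp add: bilinear_def)

lemma D_linear_left: "linear (\<lambda>a. D a b)"
  using D by (simp add: bilinear_def)

lemma points_TA: "z \<in> points TA \<Longrightarrow> fst z \<in> points A" "z \<in> points TA \<Longrightarrow> snd z \<in> cotangent_space A (fst z)"
  using cotangent_points[of "fst z" "snd z"] by simp_all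

lemma frame_linear:
  assumes "\<xi> \<in> cotangent_space A x" "x \<in> points A"
  shows "linear (\<lambda>a. \<xi> (F a x))"
  by (rule linearI)
    (simp_all add: frame_add[OF assms(2)] frame_scale[OF assms(2)] cotangent_add[OF assms(1)]
      cotangent_scale[OF assms(1)] frame_tangent[OF assms(2)])

lemma momentum_inner: "z \<in> points TA \<Longrightarrow> momentum z \<bullet> a = snd z (F a (fst z))"
  unfolding momentum_def by (rule basis_sum_inner[OF frame_linear]) (simp_all add: points_TA)

context
  fixes c assumes c: "c \<in> A"
begin

lemma chart_TA: "cotangent_chart A c \<in> TA"
  using c by (simp add: cotangent_atlas_def)

lemma range_open: "open ((snd c ` fst c) \<times> (UNIV :: 'e set))"
  by (intro open_Times open_chart c open_UNIV)

lemma momentum_at_smooth: "smooth_on ((snd c ` fst c) \<times> UNIV) (momentum_at c)"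
proof -
  note id = smooth_on_id[OF range_open]
  have "smooth_on ((snd c ` fst c) \<times> UNIV) (\<lambda>z. dual_map (frame_at c (fst z)) (snd z))"
    by (intro smooth_on_tr smooth_on_snd id smooth_on_compose[OF frame_at_smooth[OF c] smooth_on_fst[OF id]]) auto
  then show ?thesis by (simp add: momentum_at_def[abs_def])
qed

lemma coframe_tr_smooth:
  assumes "smooth_on ((snd c ` fst c) \<times> (UNIV :: 'e set)) g"
  shows "smooth_on ((snd c ` fst c) \<times> (UNIV :: 'e set)) (\<lambda>z. dual_map (coframe_at c (fst z)) (g z))"
  by (intro smooth_on_tr assms smooth_on_compose[OF coframe_at_smooth[OF c] smooth_on_fst[OF smooth_on_id[OF range_open]]]) auto

lemma frame_fst_smooth: "smooth_on ((snd c ` fst c) \<times> (UNIV::'e set)) (\<lambda>z. frame_at c (fst z) a)"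
  by (rule smooth_on_compose[OF frame_at_smooth[OF c] smooth_on_fst[OF smooth_on_id[OF range_open]]]) auto

lemma momentum_chart:
  assumes z: "z \<in> (snd c ` fst c) \<times> UNIV"
  shows "(momentum \<circ> chart_inv (cotangent_chart A c)) z = momentum_at c z"
proof -
  obtain u p where up: "z = (u, p)" "u \<in> snd c ` fst c" using z by auto
  note at = chart_inv_charts_at[OF c up(2)]
  show ?thesis
    by (simp add: up(1) cotangent_chart_inv[OF c up(2)] momentum_def momentum_at_def dual_map_def coord_covec_def
        frame_tangent[OF charts_at_point[OF at]] frame_at_def local_rep_def)
qed

lemma momentum_deriv_linear: "z \<in> (snd c ` fst c) \<times> UNIV \<Longrightarrow> linear (momentum_deriv c z)"
  by (rule has_derivative_linear[OF smooth_on_has_derivative[OF momentum_at_smooth]])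

text \<open>On a fibre the momentum is linear, hence its own derivative.\<close>

lemma momentum_deriv_fibre:
  assumes z: "z \<in> (snd c ` fst c) \<times> UNIV"
  shows "momentum_deriv c z (0, p) = dual_map (frame_at c (fst z)) p"
proof -
  have 1: "((\<lambda>p. (fst z, p)) has_derivative (\<lambda>p. (0, p))) (at (snd z))"
    by (auto intro!: derivative_eq_intros)
  have 2: "(momentum_at c has_derivative momentum_deriv c z) (at (fst z, snd z))"
    using smooth_on_has_derivative[OF momentum_at_smooth z] by simp
  have 3: "((\<lambda>p. momentum_at c (fst z, p)) has_derivative (\<lambda>p. momentum_deriv c z (0, p))) (at (snd z))"
    by (rule has_derivative_compose[OF 1 2])
  have 4: "((\<lambda>p. momentum_at c (fst z, p)) has_derivative dual_map (frame_at c (fst z))) (at (snd z))"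
    unfolding momentum_at_def fst_conv snd_conv by (rule linear_imp_has_derivative[OF dual_map_linear])
  show ?thesis using has_derivative_unique[OF 3 4] by (rule fun_cong)
qed

lemma momentum_deriv_split:
  assumes z: "z \<in> (snd c ` fst c) \<times> UNIV"
  shows "momentum_deriv c z w = momentum_deriv c z (fst w, 0) + dual_map (frame_at c (fst z)) (snd w)"
  using linear_add[OF momentum_deriv_linear[OF z], of "(fst w, 0)" "(0, snd w)"] momentum_deriv_fibre[OF z]
  by simp

lemma dual_map_frame_coframe:
  assumes z: "z \<in> (snd c ` fst c) \<times> UNIV"
  shows "dual_map (frame_at c (fst z)) (dual_map (coframe_at c (fst z)) p) = p"
    "dual_map (coframe_at c (fst z)) (dual_map (frame_at c (fst z)) p) = p"
  by (rule dual_map_tr_inverse; use z c in \<open>auto simp: frame_at_linear coframe_at_linear frame_at_coframe_at\<close>)+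

text \<open>The momentum is a linear isomorphism on each fibre, so the base component together with
  the derivative of the momentum determines a tangent vector of the cotangent bundle.\<close>

lemma lift_at_unique:
  assumes z: "z \<in> (snd c ` fst c) \<times> UNIV"
  shows "w = lift_at c z (fst w) (momentum_deriv c z w)"
  unfolding lift_at_def momentum_deriv_split[OF z, of w] by (simp add: dual_map_frame_coframe(2)[OF z])

lemma momentum_deriv_lift:
  assumes z: "z \<in> (snd c ` fst c) \<times> UNIV"
  shows "momentum_deriv c z (lift_at c z v r) = r"
  unfolding momentum_deriv_split[OF z, of "lift_at c z v r"]
  by (simp add: lift_at_def dual_map_frame_coframe(1)[OF z])

lemma lift_at_smooth:
  assumes v: "smooth_on ((snd c ` fst c) \<times> UNIV) v" and r: "smooth_on ((snd c ` fst c) \<times> UNIV) r"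
  shows "smooth_on ((snd c ` fst c) \<times> UNIV) (\<lambda>z. lift_at c z (v z) (r z))"
proof -
  show ?thesis
    unfolding lift_at_def
    by (intro smooth_on_Pair v coframe_tr_smooth smooth_on_diff r smooth_on_frechet[OF momentum_at_smooth]
        smooth_on_const[OF range_open])
qed

end

lemma TA_chart:
  assumes "z \<in> points TA" "c \<in> charts_at A (fst z)"
  shows "cotangent_chart A c \<in> charts_at TA z" "snd (cotangent_chart A c) z \<in> (snd c ` fst c) \<times> UNIV"
    "fst (snd (cotangent_chart A c) z) = snd c (fst z)"
proof -
  show *: "cotangent_chart A c \<in> charts_at TA z" using assms by (simp add: cotangent_charts_at)
  show "snd (cotangent_chart A c) z \<in> (snd c ` fst c) \<times> UNIV"
    using cotangent_chart_range[OF charts_atD(1)[OF assms(2)]] T.charts_atD(2)[OF *] by blast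
  show "fst (snd (cotangent_chart A c) z) = snd c (fst z)"
    using cotangent_chart_map[of c "fst z" "snd z"] by simp
qed

lemma momentum_chart_derivative:
  assumes z: "z \<in> points TA" and c: "c \<in> charts_at A (fst z)"
  shows "((momentum \<circ> chart_inv (cotangent_chart A c)) has_derivative
    momentum_deriv c (snd (cotangent_chart A c) z)) (at (snd (cotangent_chart A c) z))"
proof -
  note cA = charts_atD(1)[OF c]
  show ?thesis
    by (rule has_derivative_transform_within_open[OF smooth_on_has_derivative[OF momentum_at_smooth[OF cA] TA_chart(2)[OF z c]]
          range_open[OF cA] TA_chart(2)[OF z c]])
      (rule momentum_chart[OF cA, symmetric])
qed

lemma momentum_vdir:
  assumes z: "z \<in> points TA" and c: "c \<in> charts_at A (fst z)" and w: "w \<in> tangent_space TA z"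
  shows "vdir_deriv TA momentum z w = momentum_deriv c (snd (cotangent_chart A c) z) (w (cotangent_chart A c))"
  by (rule T.vdir_deriv_coord[OF w TA_chart(1)[OF z c] momentum_chart_derivative[OF z c]])

lemma momentum_eq:
  assumes z: "z \<in> points TA" and c: "c \<in> charts_at A (fst z)"
  shows "momentum z = momentum_at c (snd (cotangent_chart A c) z)"
  using momentum_chart[OF charts_atD(1)[OF c] TA_chart(2)[OF z c]] T.chart_inv_at[OF TA_chart(1)[OF z c]] by simp

lemma fst_pushforward:
  assumes z: "z \<in> points TA" and c: "c \<in> charts_at A (fst z)" and w: "w \<in> tangent_space TA z"
  shows "pushforward TA A fst z w c = fst (w (cotangent_chart A c))"
proof -
  note cA = charts_atD(1)[OF c]
  have "((snd c \<circ> fst \<circ> chart_inv (cotangent_chart A c)) has_derivative fst) (at (snd (cotangent_chart A c) z))"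
  proof (rule has_derivative_transform_within_open[OF _ range_open[OF cA] TA_chart(2)[OF z c]])
    show "(fst has_derivative fst) (at (snd (cotangent_chart A c) z))"
      by (rule linear_imp_has_derivative) (simp add: linear_fst)
    fix y :: "'e \<times> 'e" assume "y \<in> (snd c ` fst c) \<times> UNIV"
    then have "fst y \<in> snd c ` fst c" by auto
    then show "fst y = (snd c \<circ> fst \<circ> chart_inv (cotangent_chart A c)) y"
      using cotangent_chart_inv[OF cA, of "fst y" "snd y"] by (simp add: coord_chart_inv)
  qed
  then show ?thesis
    unfolding T.pushforward_coord[OF cotangent_fst_smooth w TA_chart(1)[OF z c] c]
    using frechet_derivative_at by metis
qed

lemma fst_pushforward_tangent:
  "z \<in> points TA \<Longrightarrow> w \<in> tangent_space TA z \<Longrightarrow> pushforward TA A fst z w \<in> tangent_space A (fst z)"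
  by (rule pushforward_tangent[OF cotangent_atlas_smooth atlas cotangent_fst_smooth])

text \<open>The chart-free form of \<open>lift_at_unique\<close>. Linearity of the frame, inversion
  by the coframe and the formula for horizontal lifts are all checked on these two data.\<close>

lemma TA_tangent_eqI:
  assumes z: "z \<in> points TA" and w: "w \<in> tangent_space TA z" and w': "w' \<in> tangent_space TA z"
    and eq: "pushforward TA A fst z w = pushforward TA A fst z w'"
      "vdir_deriv TA momentum z w = vdir_deriv TA momentum z w'"
  shows "w = w'"
proof -
  obtain c where c: "c \<in> charts_at A (fst z)" using charts_at_nonempty[OF points_TA(1)[OF z]] by blast
  have "fst (w (cotangent_chart A c)) = fst (w' (cotangent_chart A c))"
    using fst_pushforward[OF z c w] fst_pushforward[OF z c w'] eq by simp
  moreover have "momentum_deriv c (snd (cotangent_chart A c) z) (w (cotangent_chart A c)) =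
     momentum_deriv c (snd (cotangent_chart A c) z) (w' (cotangent_chart A c))"
    using momentum_vdir[OF z c w] momentum_vdir[OF z c w'] eq by simp
  ultimately have "w (cotangent_chart A c) = w' (cotangent_chart A c)"
    using lift_at_unique[OF charts_atD(1)[OF c] TA_chart(2)[OF z c]] by metis
  then show ?thesis using T.tangent_eqI[OF w w' TA_chart(1)[OF z c]] by blast
qed

lemma cot_frame_props:
  assumes z: "z \<in> points TA"
  shows "cot_frame s z \<in> tangent_space TA z"
    "pushforward TA A fst z (cot_frame s z) = F (fst s) (fst z)"
    "vdir_deriv TA momentum z (cot_frame s z) = dual_map (D (fst s)) (momentum z) + snd s"
proof -
  define c where "c = (SOME c. c \<in> charts_at A (fst z))"
  note x = points_TA(1)[OF z]
  have c: "c \<in> charts_at A (fst z)" unfolding c_def by (rule some_chart[OF x])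
  let ?cc = "cotangent_chart A c"
  let ?r = "dual_map (D (fst s)) (momentum z) + snd s"
  have eq: "cot_frame s z = coord_vec TA ?cc z (lift_at c (snd ?cc z) (F (fst s) (fst z) c) ?r)"
    using z by (simp add: cot_frame_def c_def Let_def)
  show t: "cot_frame s z \<in> tangent_space TA z"
    unfolding eq by (rule T.coord_vec_tangent[OF TA_chart(1)[OF z c]])
  have at: "cot_frame s z ?cc = lift_at c (snd ?cc z) (F (fst s) (fst z) c) ?r"
    unfolding eq by (rule T.coord_vec_self[OF TA_chart(1)[OF z c]])
  show "pushforward TA A fst z (cot_frame s z) = F (fst s) (fst z)"
    by (rule tangent_eqI[OF fst_pushforward_tangent[OF z t] frame_tangent[OF x] c])
      (simp add: fst_pushforward[OF z c t] at lift_at_def)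
  show "vdir_deriv TA momentum z (cot_frame s z) = ?r"
    unfolding momentum_vdir[OF z c t] at by (rule momentum_deriv_lift[OF charts_atD(1)[OF c] TA_chart(2)[OF z c]])
qed

lemma cot_frame_coord:
  assumes z: "z \<in> points TA" and c: "c \<in> charts_at A (fst z)"
  shows "cot_frame s z (cotangent_chart A c) = lift_at c (snd (cotangent_chart A c) z)
    (frame_at c (snd c (fst z)) (fst s)) (dual_map (D (fst s)) (momentum_at c (snd (cotangent_chart A c) z)) + snd s)"
  using lift_at_unique[OF charts_atD(1)[OF c] TA_chart(2)[OF z c], of "cot_frame s z (cotangent_chart A c)"]
    fst_pushforward[OF z c cot_frame_props(1)[OF z]] momentum_vdir[OF z c cot_frame_props(1)[OF z]]
  by (simp add: cot_frame_props[OF z] frame_coord[OF c] momentum_eq[OF z c, symmetric])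

lemma cot_frame_local_rep:
  assumes c: "c \<in> A" and y: "y \<in> (snd c ` fst c) \<times> UNIV"
  shows "local_rep (cotangent_chart A c) (cot_frame s) y =
    lift_at c y (frame_at c (fst y) (fst s)) (dual_map (D (fst s)) (momentum_at c y) + snd s)"
proof -
  have y': "y \<in> snd (cotangent_chart A c) ` fst (cotangent_chart A c)" using y cotangent_chart_range[OF c] by simp
  let ?z = "chart_inv (cotangent_chart A c) y"
  have z: "?z \<in> points TA" by (rule pointsI[OF chart_TA[OF c] T.chart_inv_in[OF y']])
  have u: "fst y \<in> snd c ` fst c" using y by auto
  have fz: "fst ?z = chart_inv c (fst y)" using cotangent_chart_inv[OF c u, of "snd y"] by simp
  have at: "c \<in> charts_at A (fst ?z)" unfolding fz by (rule chart_inv_charts_at[OF c u])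
  show ?thesis
    unfolding local_rep_def cot_frame_coord[OF z at] T.coord_chart_inv[OF y'] fz coord_chart_inv[OF u] ..
qed

lemma vdir_linear:
  assumes z: "z \<in> points TA" and v: "v \<in> tangent_space TA z" and w: "w \<in> tangent_space TA z"
  shows "vdir_deriv TA momentum z (v + w) = vdir_deriv TA momentum z v + vdir_deriv TA momentum z w"
    "vdir_deriv TA momentum z (\<lambda>c. r *\<^sub>R v c) = r *\<^sub>R vdir_deriv TA momentum z v"
proof -
  obtain c where c: "c \<in> charts_at A (fst z)" using charts_at_nonempty[OF points_TA(1)[OF z]] by blast
  note lin = momentum_deriv_linear[OF charts_atD(1)[OF c] TA_chart(2)[OF z c]]
  show "vdir_deriv TA momentum z (v + w) = vdir_deriv TA momentum z v + vdir_deriv TA momentum z w"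
    by (simp add: momentum_vdir[OF z c] v w T.tangent_add linear_add[OF lin])
  show "vdir_deriv TA momentum z (\<lambda>c. r *\<^sub>R v c) = r *\<^sub>R vdir_deriv TA momentum z v"
    by (simp add: momentum_vdir[OF z c] v T.tangent_scale linear_cmul[OF lin])
qed

lemma dual_map_D_add: "dual_map (D (a + b)) p = dual_map (D a) p + dual_map (D b) p"
  by (simp add: dual_map_def linear_add[OF D_linear_left] inner_add_right scaleR_add_left sum.distrib)

lemma dual_map_D_scale: "dual_map (D (r *\<^sub>R a)) p = r *\<^sub>R dual_map (D a) p"
  by (simp add: dual_map_def linear_cmul[OF D_linear_left] scaleR_sum_right)

lemma cot_frame_linear:
  assumes z: "z \<in> points TA"
  shows "cot_frame (s + t) z = cot_frame s z + cot_frame t z"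
    "cot_frame (r *\<^sub>R s) z = (\<lambda>c. r *\<^sub>R cot_frame s z c)"
proof -
  note x = points_TA(1)[OF z]
  note p = cot_frame_props[OF z]
  note lin = pushforward_linear[OF cotangent_atlas_smooth atlas cotangent_fst_smooth z]
  show "cot_frame (s + t) z = cot_frame s z + cot_frame t z"
    by (rule TA_tangent_eqI[OF z])
      (simp_all add: p T.tangent_add lin vdir_linear[OF z] frame_add[OF x] dual_map_D_add)
  show "cot_frame (r *\<^sub>R s) z = (\<lambda>c. r *\<^sub>R cot_frame s z c)"
    by (rule TA_tangent_eqI[OF z])
      (simp_all add: p T.tangent_scale lin(2)[OF p(1) p(1)] vdir_linear(2)[OF z p(1) p(1)] frame_scale[OF x] dual_map_D_scale scaleR_add_right)
qed

lemma TA_E: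
  assumes "cc \<in> TA" obtains c where "c \<in> A" "cc = cotangent_chart A c"
  using assms unfolding cotangent_atlas_def by blast

lemma cot_frame_field: "vector_field TA (cot_frame s)"
proof (rule vector_fieldI)
  fix cc assume "cc \<in> TA"
  then obtain c where c: "c \<in> A" and cc: "cc = cotangent_chart A c" by (rule TA_E)
  have "smooth_on ((snd c ` fst c) \<times> UNIV)
    (\<lambda>y. lift_at c y (frame_at c (fst y) (fst s)) (dual_map (D (fst s)) (momentum_at c y) + snd s))"
    by (intro lift_at_smooth[OF c] frame_fst_smooth[OF c] smooth_on_add smooth_on_const[OF range_open[OF c]]
        smooth_on_linear[OF dual_map_linear momentum_at_smooth[OF c]])
  then show "smooth_on (snd cc ` fst cc) (local_rep cc (cot_frame s))"
    unfolding cc cotangent_chart_range[OF c]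
    by (rule smooth_on_cong) (rule cot_frame_local_rep[OF c, symmetric])
qed (simp_all add: cot_frame_props(1), simp add: cot_frame_def)

lemma cot_coframe_frame: "z \<in> points TA \<Longrightarrow> cot_coframe z (cot_frame s z) = s"
  by (simp add: cot_coframe_def Let_def cot_frame_props coframe_frame[OF points_TA(1)])

lemma cot_frame_coframe:
  assumes z: "z \<in> points TA" and w: "w \<in> tangent_space TA z"
  shows "cot_frame (cot_coframe z w) z = w"
  by (rule TA_tangent_eqI[OF z cot_frame_props(1)[OF z] w])
    (simp_all add: cot_frame_props[OF z] cot_coframe_def Let_def
      frame_coframe[OF points_TA(1)[OF z] fst_pushforward_tangent[OF z w]])

lemma cot_coframe_smooth:
  assumes "cc \<in> TA"
  shows "smooth_on (snd cc ` fst cc) (\<lambda>y. cot_coframe (chart_inv cc y) (coord_vec TA cc (chart_inv cc y) w))"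
proof -
  obtain c where c: "c \<in> A" and cc: "cc = cotangent_chart A c" using assms by (rule TA_E)
  let ?S = "(snd c ` fst c) \<times> (UNIV :: 'e set)"
  have bil: "bounded_bilinear (\<lambda>a p. dual_map (D a) p)"
    unfolding bilinear_conv_bounded_bilinear[symmetric] bilinear_def
    by (intro conjI allI linearI)
      (simp_all add: dual_map_D_add dual_map_D_scale linear_add[OF dual_map_linear] linear_cmul[OF dual_map_linear])
  have a: "smooth_on ?S (\<lambda>y. coframe_at c (fst y) (fst w))"
    by (rule smooth_on_compose[OF coframe_at_smooth[OF c] smooth_on_fst[OF smooth_on_id[OF range_open[OF c]]]]) auto
  have "smooth_on ?S (\<lambda>y. (coframe_at c (fst y) (fst w),
     momentum_deriv c y w - dual_map (D (coframe_at c (fst y) (fst w))) (momentum_at c y)))"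
    by (intro smooth_on_Pair a smooth_on_diff smooth_on_frechet_const[OF momentum_at_smooth[OF c]]
        smooth_on_bilinear[OF bil a momentum_at_smooth[OF c]])
  then show ?thesis
    unfolding cc cotangent_chart_range[OF c]
  proof (rule smooth_on_cong)
    fix y assume y: "y \<in> ?S"
    have y': "y \<in> snd (cotangent_chart A c) ` fst (cotangent_chart A c)" using y cotangent_chart_range[OF c] by simp
    let ?z = "chart_inv (cotangent_chart A c) y"
    have z: "?z \<in> points TA" by (rule pointsI[OF chart_TA[OF c] T.chart_inv_in[OF y']])
    have u: "fst y \<in> snd c ` fst c" using y by auto
    have fz: "fst ?z = chart_inv c (fst y)" using cotangent_chart_inv[OF c u, of "snd y"] by simp
    have at: "c \<in> charts_at A (fst ?z)" unfolding fz by (rule chart_inv_charts_at[OF c u])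
    let ?w = "coord_vec TA (cotangent_chart A c) ?z w"
    have w: "?w \<in> tangent_space TA ?z" by (rule T.coord_vec_tangent[OF TA_chart(1)[OF z at]])
    have wc: "?w (cotangent_chart A c) = w" by (rule T.coord_vec_self[OF TA_chart(1)[OF z at]])
    show "(coframe_at c (fst y) (fst w),
     momentum_deriv c y w - dual_map (D (coframe_at c (fst y) (fst w))) (momentum_at c y)) =
      cot_coframe ?z ?w"
      by (simp add: cot_coframe_def Let_def coframe_coord[OF at fst_pushforward_tangent[OF z w]] fst_pushforward[OF z at w]
          momentum_vdir[OF z at w] momentum_eq[OF z at] wc T.coord_chart_inv[OF y'])
        (simp add: fz coord_chart_inv[OF u])
  qed
qed

sublocale cot: framed_atlas TA cot_frame cot_coframe
proof (intro framed_atlas.intro cotangent_atlas_smooth framed_atlas_axioms.intro)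
qed (simp_all add: cot_frame_field cot_frame_linear cot_frame_coframe cot_coframe_frame cot_coframe_smooth)

text \<open>In position and momentum the frame fields consist of a frame field of the base and an
  affine field in the momentum. The parts linear in the momentum combine by flatness to the one
  belonging to \<beta>; the constant parts give the action on the dual.\<close>

lemma cot_frame_bracket:
  assumes br: "\<And>a b. vf_bracket A (F a) (F b) = F (\<beta> a b)"
    and flat: "\<And>a b w. D a (D b w) - D b (D a w) = D (\<beta> a b) w"
  shows "vf_bracket TA (cot_frame s) (cot_frame t) =
    cot_frame (\<beta> (fst s) (fst t), dual_map (D (fst t)) (snd s) - dual_map (D (fst s)) (snd t))"
proof
  fix z
  let ?s = "(\<beta> (fst s) (fst t), dual_map (D (fst t)) (snd s) - dual_map (D (fst s)) (snd t))"
  show "vf_bracket TA (cot_frame s) (cot_frame t) z = cot_frame ?s z"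
  proof (cases "z \<in> points TA")
    case True
    then obtain c where c: "c \<in> charts_at A (fst z)" using charts_at_nonempty[OF points_TA(1)] by blast
    let ?cc = "cotangent_chart A c"
    let ?y = "snd ?cc z"
    note cA = charts_atD(1)[OF c]
    note cc = TA_chart[OF True c]
    let ?S = "(snd c ` fst c) \<times> (UNIV :: 'e set)"
    \<comment> \<open>The change from canonical coordinates to position and momentum. It relates the
      frame fields to the affine fields \<open>?X'\<close>, whose derivatives are immediate.\<close>
    let ?f = "\<lambda>y. (fst y, momentum_at c y)"
    let ?X = "\<lambda>s. local_rep ?cc (cot_frame s)"
    let ?X' = "\<lambda>s y. (frame_at c (fst y) (fst s), dual_map (D (fst s)) (snd y) + snd s)"
    have f: "smooth_on ?S ?f"
      by (intro smooth_on_Pair smooth_on_fst smooth_on_id range_open[OF cA] momentum_at_smooth[OF cA])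
    have X: "smooth_on ?S (?X s)" for s
      using vector_field_smooth[OF cot_frame_field chart_TA[OF cA]] cotangent_chart_range[OF cA] by simp
    have X': "smooth_on ?S (?X' s)" for s
      by (intro smooth_on_Pair frame_fst_smooth[OF cA] smooth_on_add smooth_on_const[OF range_open[OF cA]]
          smooth_on_linear[OF dual_map_linear smooth_on_snd[OF smooth_on_id[OF range_open[OF cA]]]])
    have Df: "frechet_derivative ?f (at y) w = (fst w, momentum_deriv c y w)" if y: "y \<in> ?S" for y w
    proof -
      have "(?f has_derivative (\<lambda>w. (fst w, momentum_deriv c y w))) (at y)"
        by (intro has_derivative_Pair linear_imp_has_derivative linear_fst
            smooth_on_has_derivative[OF momentum_at_smooth[OF cA] y])
      from frechet_derivative_at[OF this] show ?thesis by metis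
    qed
    have rel: "frechet_derivative ?f (at y) (?X s y) = ?X' s (?f y)" if y: "y \<in> ?S" for y s
      unfolding Df[OF y] cot_frame_local_rep[OF cA y] momentum_deriv_lift[OF cA y]
      by (simp add: lift_at_def)
    have fS: "?f ` ?S \<subseteq> ?S" by auto
    note R = lie_bracket_related[OF f X X X' X' fS cc(2) rel rel, of t s]
    have DX': "frechet_derivative (?X' s) (at y) w =
        (frechet_derivative (local_rep c (F (fst s))) (at (fst y)) (fst w), dual_map (D (fst s)) (snd w))"
      if y: "y \<in> ?S" for y w s
    proof -
      have u: "fst y \<in> snd c ` fst c" using y by auto
      have 1: "((\<lambda>y. local_rep c (F (fst s)) (fst y)) has_derivative
         (\<lambda>w. frechet_derivative (local_rep c (F (fst s))) (at (fst y)) (fst w))) (at y)"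
        by (rule has_derivative_compose[OF has_derivative_fst[OF has_derivative_ident]
              smooth_on_has_derivative[OF vector_field_smooth[OF frame_field cA] u]])
      have "(?X' s has_derivative (\<lambda>w. (frechet_derivative (local_rep c (F (fst s))) (at (fst y)) (fst w),
          dual_map (D (fst s)) (snd w) + 0))) (at y)"
        unfolding frame_at_def
        by (intro has_derivative_Pair 1 has_derivative_add has_derivative_const
            bounded_linear.has_derivative[OF linear_conv_bounded_linear[THEN iffD1, OF dual_map_linear]]
            has_derivative_snd has_derivative_ident)
      note frechet_derivative_at[OF this, symmetric]
      then show ?thesis by (simp only: add_0_right)
    qed
    have fy: "?f ?y \<in> ?S" by (rule subsetD[OF fS imageI[OF cc(2)]])
    let ?B = "vf_bracket TA (cot_frame s) (cot_frame t) z ?cc"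
    have "?B = frechet_derivative (?X t) (at ?y) (?X s ?y) - frechet_derivative (?X s) (at ?y) (?X t ?y)"
      using cc(1) by (simp add: vf_bracket_def T.local_rep_at)
    then have "frechet_derivative ?f (at ?y) ?B =
        frechet_derivative (?X' t) (at (?f ?y)) (?X' s (?f ?y)) - frechet_derivative (?X' s) (at (?f ?y)) (?X' t (?f ?y))"
      using R by simp
    also have "\<dots> = (frechet_derivative (local_rep c (F (fst t))) (at (fst ?y)) (frame_at c (fst ?y) (fst s))
        - frechet_derivative (local_rep c (F (fst s))) (at (fst ?y)) (frame_at c (fst ?y) (fst t)),
        dual_map (D (fst t)) (dual_map (D (fst s)) (momentum_at c ?y) + snd s) - dual_map (D (fst s)) (dual_map (D (fst t)) (momentum_at c ?y) + snd t))"
      unfolding DX'[OF fy] by simp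
    also have "frechet_derivative (local_rep c (F (fst t))) (at (fst ?y)) (frame_at c (fst ?y) (fst s))
        - frechet_derivative (local_rep c (F (fst s))) (at (fst ?y)) (frame_at c (fst ?y) (fst t)) =
        vf_bracket A (F (fst s)) (F (fst t)) (fst z) c"
      using c by (simp add: vf_bracket_def cc(3) frame_coord[OF c])
    also have "\<dots> = frame_at c (fst ?y) (\<beta> (fst s) (fst t))" by (simp add: br frame_coord[OF c] cc(3))
    \<comment> \<open>Transposition reverses products, so tested against a vector the difference is
      the commutator in the order in which flatness states it.\<close>
    also have "dual_map (D (fst t)) (dual_map (D (fst s)) (momentum_at c ?y) + snd s) - dual_map (D (fst s)) (dual_map (D (fst t)) (momentum_at c ?y) + snd t)
        = dual_map (D (fst ?s)) (momentum_at c ?y) + snd ?s"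
      by (rule vector_eq_rdot[THEN iffD1])
        (simp add: inner_add_left inner_diff_left dual_map_inner[OF D_linear] inner_diff_right flat[symmetric])
    finally have *: "fst ?B = frame_at c (fst ?y) (\<beta> (fst s) (fst t))"
      "momentum_deriv c ?y ?B = dual_map (D (fst ?s)) (momentum_at c ?y) + snd ?s"
      unfolding Df[OF cc(2)] by simp_all
    have "?B = cot_frame ?s z ?cc"
      using lift_at_unique[OF cA cc(2), of ?B] unfolding * cot_frame_coord[OF True c] by (simp add: cc(3))
    then show ?thesis
      by (rule T.tangent_eqI[OF T.bracket_tangent[OF cot_frame_field cot_frame_field] cot_frame_props(1)[OF True] cc(1)])
  next
    case False
    then show ?thesis by (simp add: T.bracket_off cot_frame_def)
  qed
qed

end

section \<open>Horizontal and vertical lifts in terms of the adapted frame\<close>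

context parallelized_connection
begin

definition frame_covec :: "'m \<Rightarrow> 'e \<Rightarrow> ('m, 'e) covec" where
  "frame_covec x b = (\<lambda>v. if v \<in> tangent_space A x then b \<bullet> \<Theta> x v else 0)"

lemma frame_covec_cotangent: "x \<in> points A \<Longrightarrow> frame_covec x b \<in> cotangent_space A x"
  by (rule cotangent_spaceI)
    (simp_all add: frame_covec_def tangent_add tangent_scale coframe_add coframe_scale inner_add_right)

lemma frame_covec_momentum:
  assumes x: "x \<in> points A" and \<eta>: "\<eta> \<in> cotangent_space A x"
  shows "frame_covec x (momentum (x, \<eta>)) = \<eta>"
proof
  fix v
  have "(x, \<eta>) \<in> points TA" using assms by (simp add: cotangent_points)
  from momentum_inner[OF this] show "frame_covec x (momentum (x, \<eta>)) v = \<eta> v"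
    by (simp add: frame_covec_def cotangent_off[OF \<eta>] frame_coframe[OF x])
qed

lemma momentum_frame_covec: "x \<in> points A \<Longrightarrow> momentum (x, frame_covec x b) = b"
  by (simp add: momentum_def frame_covec_def frame_tangent coframe_frame euclidean_representation)

text \<open>The function is the inner product of the momentum with the components of Y, and the
  product rule splits its derivative. For a frame field the second summand vanishes, as the
  components are constant.\<close>

lemma fibre_linear_derivative:
  assumes z: "z \<in> points TA" and w: "w \<in> tangent_space TA z" and Y: "vector_field A Y"
  shows "dir_deriv TA (\<lambda>(y, \<eta>). \<eta> (Y y)) z w =
    vdir_deriv TA momentum z w \<bullet> \<Theta> (fst z) (Y (fst z))
    + momentum z \<bullet> vdir_deriv A (\<lambda>y. \<Theta> y (Y y)) (fst z) (pushforward TA A fst z w)"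
proof -
  obtain c where c: "c \<in> charts_at A (fst z)" using charts_at_nonempty[OF points_TA(1)[OF z]] by blast
  note cA = charts_atD(1)[OF c] and cc = TA_chart[OF z c]
  let ?cc = "cotangent_chart A c" and ?Y = "(\<lambda>x. \<Theta> x (Y x)) \<circ> chart_inv c"
  let ?y = "snd ?cc z"
  have u: "snd c (fst z) \<in> snd c ` fst c" using charts_atD(2)[OF c] by blast
  have 1: "((\<lambda>y. ?Y (fst y)) has_derivative (\<lambda>w. frechet_derivative ?Y (at (snd c (fst z))) (fst w))) (at ?y)"
    by (rule has_derivative_compose[OF has_derivative_fst[OF has_derivative_ident]])
      (simp add: cc(3) coframe_field_derivative[OF Y c] del: comp_apply)
  have 2: "(momentum_at c has_derivative momentum_deriv c ?y) (at ?y)"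
    by (rule smooth_on_has_derivative[OF momentum_at_smooth[OF cA] cc(2)])
  note 3 = has_derivative_inner[OF 2 1]
  have "(((\<lambda>(y, \<eta>). \<eta> (Y y)) \<circ> chart_inv ?cc) has_derivative
    (\<lambda>h. momentum_at c ?y \<bullet> frechet_derivative ?Y (at (snd c (fst z))) (fst h) + momentum_deriv c ?y h \<bullet> ?Y (fst ?y))) (at ?y)"
  proof (rule has_derivative_transform_within_open[OF 3 range_open[OF cA] cc(2)])
    fix y :: "'e \<times> 'e" assume y: "y \<in> (snd c ` fst c) \<times> UNIV"
    have uy: "fst y \<in> snd c ` fst c" using y by auto
    note at = chart_inv_charts_at[OF cA uy]
    note YT = vector_field_tangent[OF Y charts_at_point[OF at]]
    have "momentum_at c y \<bullet> ?Y (fst y) = snd y \<bullet> local_rep c Y (fst y)"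
      unfolding coframe_field_at[OF Y cA uy] momentum_at_def
      by (simp add: dual_map_inner[OF frame_at_linear[OF cA uy]] frame_at_coframe_at[OF cA uy])
    then show "momentum_at c y \<bullet> ?Y (fst y) = ((\<lambda>(y, \<eta>). \<eta> (Y y)) \<circ> chart_inv ?cc) y"
      using cotangent_chart_inv[OF cA uy, of "snd y"] YT by (simp add: coord_covec_def local_rep_def)
  qed
  from cot.dir_deriv_coord[OF w cc(1) this]
  show ?thesis
    by (simp add: momentum_vdir[OF z c w] momentum_eq[OF z c] coframe_field_vdir[OF Y c fst_pushforward_tangent[OF z w]]
        fst_pushforward[OF z c w] cc(3) chart_inv_at[OF c])
qed

text \<open>Uniqueness comes from testing on the frame fields: they recover the derivative of the
  momentum, which together with the projection fixes the vector.\<close>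

lemma horizontal_lift_eq:
  assumes z: "z \<in> points TA" and v: "v \<in> tangent_space A (fst z)"
  shows "horizontal_lift A nab z v = cot_frame (\<Theta> (fst z) v, 0) z"
  unfolding horizontal_lift_def
proof (rule the_equality)
  note x = points_TA(1)[OF z] and p = cot_frame_props[OF z, of "(\<Theta> (fst z) v, 0)"]
  have push: "pushforward TA A fst z (cot_frame (\<Theta> (fst z) v, 0) z) = v"
    by (simp add: p frame_coframe[OF x v])
  have lift: "dir_deriv TA (\<lambda>(y, \<eta>). \<eta> (Y y)) z (cot_frame (\<Theta> (fst z) v, 0) z) = snd z (nab (fst z) v Y)"
    if Y: "vector_field A Y" for Y
    by (simp add: fibre_linear_derivative[OF z p(1) Y] push p(3) dual_map_inner[OF D_linear] nab_def
        momentum_inner[OF z, symmetric] inner_add_right add.commute)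
  show "cot_frame (\<Theta> (fst z) v, 0) z \<in> tangent_space TA z \<and>
    pushforward TA A fst z (cot_frame (\<Theta> (fst z) v, 0) z) = v \<and>
    (\<forall>Y. vector_field A Y \<longrightarrow>
      dir_deriv TA (\<lambda>(y, \<eta>). \<eta> (Y y)) z (cot_frame (\<Theta> (fst z) v, 0) z) = snd z (nab (fst z) v Y))"
    using p(1) push lift by blast
  fix w assume w: "w \<in> tangent_space TA z \<and> pushforward TA A fst z w = v \<and>
    (\<forall>Y. vector_field A Y \<longrightarrow> dir_deriv TA (\<lambda>(y, \<eta>). \<eta> (Y y)) z w = snd z (nab (fst z) v Y))"
  show "w = cot_frame (\<Theta> (fst z) v, 0) z"
  proof (rule TA_tangent_eqI[OF z _ p(1)])
    show wt: "w \<in> tangent_space TA z" and wp: "pushforward TA A fst z w = pushforward TA A fst z (cot_frame (\<Theta> (fst z) v, 0) z)"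
      using w push by auto
    show "vdir_deriv TA momentum z w = vdir_deriv TA momentum z (cot_frame (\<Theta> (fst z) v, 0) z)"
    proof (rule vector_eq_rdot[THEN iffD1, rule_format])
      fix a
      have "dir_deriv TA (\<lambda>(y, \<eta>). \<eta> (F a y)) z w = dir_deriv TA (\<lambda>(y, \<eta>). \<eta> (F a y)) z (cot_frame (\<Theta> (fst z) v, 0) z)"
        using w lift frame_field by simp
      then show "vdir_deriv TA momentum z w \<bullet> a = vdir_deriv TA momentum z (cot_frame (\<Theta> (fst z) v, 0) z) \<bullet> a"
        by (simp add: fibre_linear_derivative[OF z wt frame_field] fibre_linear_derivative[OF z p(1) frame_field] wp coframe_frame[OF x])
    qed
  qed
qed

text \<open>In every cotangent chart the defining curve is a straight line in the fibre, so its
  velocity is the coordinate vector of \<eta>.\<close>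

lemma vertical_lift_eq:
  assumes z: "z \<in> points TA" and \<eta>: "\<eta> \<in> cotangent_space A (fst z)"
  shows "vertical_lift A z \<eta> = cot_frame (0, momentum (fst z, \<eta>)) z"
proof
  fix d
  have z0: "(fst z, \<lambda>v. snd z v + 0 * \<eta> v) = z" by simp
  show "vertical_lift A z \<eta> d = cot_frame (0, momentum (fst z, \<eta>)) z d"
  proof (cases "d \<in> charts_at TA z")
    case True
    then obtain c where c: "c \<in> charts_at A (fst z)" and d: "d = cotangent_chart A c"
      unfolding cotangent_charts_at[OF z] by blast
    note cA = charts_atD(1)[OF c] and cc = TA_chart[OF z c]
    have u: "snd c (fst z) \<in> snd c ` fst c" using charts_atD(2)[OF c] by blast
    have \<gamma>: "(snd d \<circ> (\<lambda>t. (fst z, \<lambda>v. snd z v + t * \<eta> v))) =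
        (\<lambda>t. (snd c (fst z), cot_coord A c (fst z) (snd z) + t *\<^sub>R cot_coord A c (fst z) \<eta>))"
      by (rule ext) (simp add: d cotangent_chart_map, simp add: cot_coord_def algebra_simps sum.distrib scaleR_sum_right)
    have "((\<lambda>t. (snd c (fst z), cot_coord A c (fst z) (snd z) + t *\<^sub>R cot_coord A c (fst z) \<eta>))
       has_vector_derivative (0, cot_coord A c (fst z) \<eta>)) (at 0)"
      unfolding has_vector_derivative_def by (auto intro!: derivative_eq_intros)
    then have "vertical_lift A z \<eta> d = (0, cot_coord A c (fst z) \<eta>)"
      using True vector_derivative_at by (simp add: vertical_lift_def velocity_def \<gamma>[unfolded comp_def] comp_def)
    moreover have "dual_map (coframe_at c (snd c (fst z))) (momentum (fst z, \<eta>)) = cot_coord A c (fst z) \<eta>"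
    proof (rule vector_eq_rdot[THEN iffD1, rule_format])
      fix w
      have p: "(fst z, \<eta>) \<in> points TA" using \<eta> points_TA(1)[OF z] by (simp add: cotangent_points)
      show "dual_map (coframe_at c (snd c (fst z))) (momentum (fst z, \<eta>)) \<bullet> w = cot_coord A c (fst z) \<eta> \<bullet> w"
        by (simp add: dual_map_inner[OF coframe_at_linear[OF cA u]] momentum_inner[OF p] cot_coord_inner[OF \<eta> c])
          (simp add: coframe_at_def chart_inv_at[OF c] frame_coframe[OF points_TA(1)[OF z]] coord_vec_tangent[OF c])
    qed
    ultimately show ?thesis
      using linear_0[OF momentum_deriv_linear[OF cA cc(2)]] linear_0[OF frame_at_linear[OF cA u]]
      by (simp add: d cot_frame_coord[OF z c] lift_at_def cc(3) zero_prod_def dual_map_def[of "D 0"] linear_0[OF D_linear_left])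
  next
    case False
    then show ?thesis
      using cot.tangent_off[OF cot_frame_props(1)[OF z] False] by (simp add: vertical_lift_def velocity_def)
  qed
qed

lemma splitting_iso_eq:
  assumes z: "z \<in> points TA" and v: "v \<in> tangent_space A (fst z)" and \<eta>: "\<eta> \<in> cotangent_space A (fst z)"
  shows "splitting_iso A nab z (v, \<eta>) = cot_frame (\<Theta> (fst z) v, momentum (fst z, \<eta>)) z"
  using cot_frame_linear(1)[OF z, of "(\<Theta> (fst z) v, 0)" "(0, momentum (fst z, \<eta>))"]
  by (simp add: splitting_iso_def horizontal_lift_eq[OF z v] vertical_lift_eq[OF z \<eta>])

lemma splitting_iso_inj:
  assumes z: "z \<in> points TA"
  shows "inj_on (splitting_iso A nab z) (tangent_space A (fst z) \<times> cotangent_space A (fst z))"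
proof (rule inj_onI)
  fix s t
  assume s: "s \<in> tangent_space A (fst z) \<times> cotangent_space A (fst z)"
    and t: "t \<in> tangent_space A (fst z) \<times> cotangent_space A (fst z)"
    and eq: "splitting_iso A nab z s = splitting_iso A nab z t"
  note x = points_TA(1)[OF z]
  obtain v \<eta> v' \<eta>' where st: "s = (v, \<eta>)" "t = (v', \<eta>')" by (metis prod.exhaust)
  have "cot_frame (\<Theta> (fst z) v, momentum (fst z, \<eta>)) z = cot_frame (\<Theta> (fst z) v', momentum (fst z, \<eta>')) z"
    using eq s t by (simp add: st splitting_iso_eq[OF z])
  then have "\<Theta> (fst z) v = \<Theta> (fst z) v'" "momentum (fst z, \<eta>) = momentum (fst z, \<eta>')"
    using cot_coframe_frame[OF z] by (metis prod.inject)+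
  moreover have "v \<in> tangent_space A (fst z)" "v' \<in> tangent_space A (fst z)"
    "\<eta> \<in> cotangent_space A (fst z)" "\<eta>' \<in> cotangent_space A (fst z)" using s t by (simp_all add: st)
  ultimately have "v = v'" "\<eta> = \<eta>'"
    using frame_coframe[OF x] frame_covec_momentum[OF x] by metis+
  then show "s = t" by (simp add: st)
qed

lemma splitting_iso_frame:
  assumes z: "z \<in> points TA"
  shows "splitting_iso A nab z (F a (fst z), frame_covec (fst z) b) = cot_frame (a, b) z"
  using points_TA(1)[OF z]
  by (simp add: splitting_iso_eq[OF z] frame_tangent frame_covec_cotangent coframe_frame momentum_frame_covec)

lemma cotangent_structure_frame:
  assumes z: "z \<in> points TA"
  shows "cotangent_structure A nab j z (cot_frame (a, b) z) =
    splitting_iso A nab z (j (fst z) (F a (fst z), frame_covec (fst z) b))"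
proof -
  have "(F a (fst z), frame_covec (fst z) b) \<in> tangent_space A (fst z) \<times> cotangent_space A (fst z)"
    using points_TA(1)[OF z] by (simp add: frame_tangent frame_covec_cotangent)
  from inv_into_f_f[OF splitting_iso_inj[OF z] this] show ?thesis
    by (simp add: cotangent_structure_def splitting_iso_frame[OF z])
qed

text \<open>The complex structure is integrable once it is so on the semidirect product of the Lie algebra
  of the frame with its dual, on which the Lie algebra acts through the flat connection.\<close>

lemma cotangent_complex_structure:
  assumes br: "\<And>a b. vf_bracket A (F a) (F b) = F (\<beta> a b)"
    and flat: "\<And>a b w. D a (D b w) - D b (D a w) = D (\<beta> a b) w"
    and K: "linear K" "\<And>s. K (K s) = - s"
    and j: "\<And>x a b. x \<in> points A \<Longrightarrow>
      j x (F a x, frame_covec x b) = (F (fst (K (a, b))) x, frame_covec x (snd (K (a, b))))"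
    and B: "\<And>s t. B s t = (\<beta> (fst s) (fst t), dual_map (D (fst t)) (snd s) - dual_map (D (fst s)) (snd t))"
    and integrable: "\<And>s t. B (K s) (K t) - K (B (K s) t) - K (B s (K t)) - B s t = 0"
  shows "complex_structure TA (cotangent_structure A nab j)"
proof (rule cot.frame_complex_structure[where K = K and \<beta> = B])
  show "vf_bracket TA (cot_frame s) (cot_frame t) = cot_frame (B s t)" for s t
    unfolding B by (rule cot_frame_bracket[OF br flat])
  show "cotangent_structure A nab j z (cot_frame s z) = cot_frame (K s) z" if z: "z \<in> points TA" for z s
    using cotangent_structure_frame[OF z, of j "fst s" "snd s"] j[OF points_TA(1)[OF z], of "fst s" "snd s"]
      splitting_iso_frame[OF z] by simp
qed (fact K integrable)+

end

section \<open>Right linearity of the bracket\<close>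

text \<open>The axioms of the class of complex Lie algebras demand linearity of the bracket in its first
  argument only, and together with \<open>[x, x] = 0\<close> and the Jacobi identity this does not entail
  linearity in the second argument. Here linearity in the second argument is deduced from antisymmetry
  on the real form (which left-invariant vector fields provide), the root decomposition and semisimplicity.\<close>

lemma lie_zero_left [simp]: "[0, x]\<^sub>L = 0"
  using lie_scaleC_left[of 0 0 x] by simp

lemma lie_minus_left: "[- x, y]\<^sub>L = - [x, y]\<^sub>L"
  using lie_scaleC_left[of "-1" x y] by simp

lemma double_eq_zero: "v + v = 0 \<Longrightarrow> v = (0::'g::complex_lie_algebra)"
  using scaleC_add_left[of 1 1 v] cvec.scale_eq_0_iff[of 2 v] by (simp add: scaleC_one)

lemma sum3_zero: "a + b + c = 0 \<Longrightarrow> c = - a - (b::'a::ab_group_add)"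
  using minus_unique[of "a + b" c] by simp

locale conjugated_algebra =
  fixes \<sigma> :: "'g::complex_lie_algebra \<Rightarrow> 'g"
  assumes conj: "conjugation \<sigma>"
begin

lemma sigma_add: "\<sigma> (x + y) = \<sigma> x + \<sigma> y"
  and sigma_scale: "\<sigma> (c *\<^sub>C x) = cnj c *\<^sub>C \<sigma> x"
  and sigma_bracket: "\<sigma> [x, y]\<^sub>L = [\<sigma> x, \<sigma> y]\<^sub>L"
  and sigma_sigma [simp]: "\<sigma> (\<sigma> x) = x"
  using conj by (simp_all add: conjugation_def)

lemma sigma_zero [simp]: "\<sigma> 0 = 0"
  using sigma_scale[of 0 0] by simp

lemma sigma_minus: "\<sigma> (- x) = - \<sigma> x"
  using sigma_scale[of "-1" x] by simp

lemma sigma_diff: "\<sigma> (x - y) = \<sigma> x - \<sigma> y"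
  using sigma_add[of x "- y"] by (simp add: sigma_minus)

definition re_part :: "'g \<Rightarrow> 'g" where "re_part x = (1/2) *\<^sub>C (x + \<sigma> x)"
definition im_part :: "'g \<Rightarrow> 'g" where "im_part x = re_part (- (\<i> *\<^sub>C x))"

abbreviation rf where "rf \<equiv> real_form \<sigma>"

lemma rf_iff: "x \<in> rf \<longleftrightarrow> \<sigma> x = x"
  by (simp add: real_form_def)

lemma re_part_rf [simp]: "re_part x \<in> rf"
  by (simp add: rf_iff re_part_def sigma_scale sigma_add add.commute)

lemma im_part_rf [simp]: "im_part x \<in> rf"
  by (simp add: im_part_def)

lemma re_im: "re_part x + \<i> *\<^sub>C im_part x = x"
proof -
  have "re_part x + \<i> *\<^sub>C im_part x = (1/2) *\<^sub>C x + (1/2) *\<^sub>C x"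
    by (simp add: re_part_def im_part_def sigma_minus sigma_scale scaleC_add_right scaleC_scaleC
        cvec.scale_right_diff_distrib cvec.scale_minus_right)
  also have "\<dots> = x" by (simp flip: scaleC_add_left add: scaleC_one)
  finally show ?thesis .
qed

lemma re_part_add: "re_part (x + y) = re_part x + re_part y"
  by (simp add: re_part_def sigma_add flip: scaleC_add_right)

lemma im_part_add: "im_part (x + y) = im_part x + im_part y"
  by (simp add: im_part_def scaleC_add_right flip: re_part_add)

lemma re_part_minus: "re_part (- x) = - re_part x"
  using re_part_add[of x "- x"] by (simp add: re_part_def eq_neg_iff_add_eq_0 add.commute)

lemma rf_add: "x \<in> rf \<Longrightarrow> y \<in> rf \<Longrightarrow> x + y \<in> rf"
  by (simp add: rf_iff sigma_add)

lemma rf_minus: "x \<in> rf \<Longrightarrow> - x \<in> rf"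
  by (simp add: rf_iff sigma_minus)

lemma rf_diff: "x \<in> rf \<Longrightarrow> y \<in> rf \<Longrightarrow> x - y \<in> rf"
  by (simp add: rf_iff sigma_diff)

lemma rf_zero [simp]: "0 \<in> rf"
  by (simp add: rf_iff)

lemma rf_scale: "x \<in> rf \<Longrightarrow> complex_of_real r *\<^sub>C x \<in> rf"
  by (simp add: rf_iff sigma_scale)

lemma rf_bracket: "x \<in> rf \<Longrightarrow> y \<in> rf \<Longrightarrow> [x, y]\<^sub>L \<in> rf"
  by (simp add: rf_iff sigma_bracket)

lemma re_im_rf: "x \<in> rf \<Longrightarrow> re_part x = x" "x \<in> rf \<Longrightarrow> im_part x = 0"
proof -
  assume "x \<in> rf"
  then have s: "\<sigma> x = x" by (simp add: rf_iff)
  show "re_part x = x"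
    using scaleC_add_left[of "1/2" "1/2" x] by (simp add: re_part_def s scaleC_add_right scaleC_one)
  show "im_part x = 0" by (simp add: im_part_def re_part_def sigma_minus sigma_scale s)
qed

lemma re_im_i: "re_part (\<i> *\<^sub>C x) = - im_part x" "im_part (\<i> *\<^sub>C x) = re_part x"
  by (simp_all add: im_part_def re_part_minus scaleC_scaleC scaleC_one)

lemma re_im_real: "re_part (complex_of_real r *\<^sub>C x) = complex_of_real r *\<^sub>C re_part x"
  "im_part (complex_of_real r *\<^sub>C x) = complex_of_real r *\<^sub>C im_part x"
  by (simp_all add: re_part_def im_part_def sigma_minus sigma_scale scaleC_scaleC scaleC_add_right mult.commute
      cvec.scale_right_diff_distrib cvec.scale_minus_right)

text \<open>The real form spans the algebra over the complex numbers. For the original bracket this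
  may be applied only to a left argument, where complex linearity is an axiom.\<close>

lemma linear_eq_on_rf:
  assumes add: "\<And>x y. f (x + y) = f x + f y" and sc: "\<And>c x. f (c *\<^sub>C x) = c *\<^sub>C f x"
    and z: "\<And>x. x \<in> rf \<Longrightarrow> f x = 0"
  shows "f x = (0::'g)"
  using add[of "re_part x" "\<i> *\<^sub>C im_part x"] by (simp add: re_im sc z)

end

locale real_antisymmetric = conjugated_algebra \<sigma> for \<sigma> :: "'g::complex_lie_algebra \<Rightarrow> 'g" +
  assumes anti: "\<And>x y. x \<in> rf \<Longrightarrow> y \<in> rf \<Longrightarrow> [x, y]\<^sub>L = - [y, x]\<^sub>L"
begin

lemma rf_add_right:
  assumes "y \<in> rf" "z \<in> rf"
  shows "[x, y + z]\<^sub>L = [x, y]\<^sub>L + [x, z]\<^sub>L"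
proof -
  have 1: "[x, y + z]\<^sub>L = [x, y]\<^sub>L + [x, z]\<^sub>L" if "x \<in> rf" for x
    using anti[OF that rf_add[OF assms]] anti[OF that assms(1)] anti[OF that assms(2)] by (simp add: lie_add_left)
  have "[x, y + z]\<^sub>L - ([x, y]\<^sub>L + [x, z]\<^sub>L) = 0"
    by (rule linear_eq_on_rf[of "\<lambda>x. [x, y + z]\<^sub>L - ([x, y]\<^sub>L + [x, z]\<^sub>L)"])
      (simp_all add: lie_add_left lie_scaleC_left 1 scaleC_add_right cvec.scale_right_diff_distrib)
  then show ?thesis by simp
qed

lemma rf_scale_right:
  assumes "y \<in> rf"
  shows "[x, complex_of_real r *\<^sub>C y]\<^sub>L = complex_of_real r *\<^sub>C [x, y]\<^sub>L"
proof -
  have 1: "[x, complex_of_real r *\<^sub>C y]\<^sub>L = complex_of_real r *\<^sub>C [x, y]\<^sub>L" if "x \<in> rf" for x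
    using anti[OF that rf_scale[OF assms]] anti[OF that assms] by (simp add: lie_scaleC_left)
  have "[x, complex_of_real r *\<^sub>C y]\<^sub>L - complex_of_real r *\<^sub>C [x, y]\<^sub>L = 0"
    by (rule linear_eq_on_rf[of "\<lambda>x. [x, complex_of_real r *\<^sub>C y]\<^sub>L - complex_of_real r *\<^sub>C [x, y]\<^sub>L"])
      (simp_all add: lie_add_left lie_scaleC_left 1 scaleC_add_right cvec.scale_right_diff_distrib scaleC_scaleC mult.commute)
  then show ?thesis by simp
qed

lemma lie_zero_right: "[x, 0]\<^sub>L = (0::'g)"
  using rf_add_right[of 0 0 x] by simp

lemma rf_minus_right: "y \<in> rf \<Longrightarrow> [x, - y]\<^sub>L = - [x, y]\<^sub>L"
  using rf_scale_right[of y x "-1"] by simp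

text \<open>The complex bilinear extension of the bracket on the real form. It agrees with the
  original bracket when the right argument is real; the aim is agreement everywhere.\<close>

definition ext_bracket :: "'g \<Rightarrow> 'g \<Rightarrow> 'g" where
  "ext_bracket x y = [x, re_part y]\<^sub>L + \<i> *\<^sub>C [x, im_part y]\<^sub>L"

notation ext_bracket (infixl "\<diamondop>" 72)

lemma ext_rf: "y \<in> rf \<Longrightarrow> x \<diamondop> y = [x, y]\<^sub>L"
  by (simp add: ext_bracket_def re_im_rf lie_zero_right)

lemma ext_add_left: "(x + y) \<diamondop> z = x \<diamondop> z + y \<diamondop> z"
  by (simp add: ext_bracket_def lie_add_left scaleC_add_right)

lemma ext_scale_left: "(c *\<^sub>C x) \<diamondop> z = c *\<^sub>C (x \<diamondop> z)"
  by (simp add: ext_bracket_def lie_scaleC_left scaleC_add_right scaleC_scaleC mult.commute)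

lemma ext_add_right: "x \<diamondop> (y + z) = x \<diamondop> y + x \<diamondop> z"
  by (simp add: ext_bracket_def re_part_add im_part_add rf_add_right scaleC_add_right)

lemma ext_i_right: "x \<diamondop> (\<i> *\<^sub>C y) = \<i> *\<^sub>C (x \<diamondop> y)"
  by (simp add: ext_bracket_def re_im_i rf_minus_right scaleC_add_right scaleC_scaleC)

lemma ext_real_right: "x \<diamondop> (complex_of_real r *\<^sub>C y) = complex_of_real r *\<^sub>C (x \<diamondop> y)"
  by (simp add: ext_bracket_def re_im_real rf_scale_right scaleC_add_right scaleC_scaleC mult.commute)

lemma ext_scale_right: "x \<diamondop> (c *\<^sub>C y) = c *\<^sub>C (x \<diamondop> y)"
proof -
  have c: "c *\<^sub>C v = complex_of_real (Re c) *\<^sub>C v + complex_of_real (Im c) *\<^sub>C (\<i> *\<^sub>C v)" for v :: 'g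
    using complex_eq[of c] by (simp add: scaleC_scaleC mult.commute flip: scaleC_add_left)
  show ?thesis
    unfolding c[of y] c[of "x \<diamondop> y"] ext_add_right ext_real_right ext_i_right ..
qed

lemma ext_minus_left: "(- x) \<diamondop> y = - (x \<diamondop> y)"
  using ext_scale_left[of "-1" x y] by simp

lemma ext_minus_right: "x \<diamondop> (- y) = - (x \<diamondop> y)"
  using ext_scale_right[of x "-1" y] by simp

lemma ext_diff_right: "x \<diamondop> (y - z) = x \<diamondop> y - x \<diamondop> z"
  using ext_add_right[of x y "- z"] by (simp add: ext_minus_right)

lemma ext_diff_left: "(x - y) \<diamondop> z = x \<diamondop> z - y \<diamondop> z"
  using ext_add_left[of x "- y" z] by (simp add: ext_minus_left)

lemma ext_zero [simp]: "x \<diamondop> 0 = 0" "0 \<diamondop> x = 0"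
  by (simp_all add: ext_rf lie_zero_right) (simp add: ext_bracket_def)

lemmas ext_linear = ext_add_left ext_scale_left ext_add_right ext_scale_right

lemma ext_anti: "x \<diamondop> y = - (y \<diamondop> x)"
proof -
  have 1: "x \<diamondop> y + y \<diamondop> x = 0" if x: "x \<in> rf" and y: "y \<in> rf" for x y
    using anti[OF x y] by (simp add: ext_rf x y)
  have 2: "x \<diamondop> y + y \<diamondop> x = 0" if y: "y \<in> rf" for x y
    by (rule linear_eq_on_rf[of "\<lambda>x. x \<diamondop> y + y \<diamondop> x"]) (simp_all add: ext_linear 1 y scaleC_add_right)
  have "x \<diamondop> y + y \<diamondop> x = 0"
    by (rule linear_eq_on_rf[of "\<lambda>y. x \<diamondop> y + y \<diamondop> x"]) (simp_all add: ext_linear 2 scaleC_add_right)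
  then show ?thesis by (simp add: eq_neg_iff_add_eq_0)
qed

lemma ext_self: "x \<diamondop> x = 0"
  by (rule double_eq_zero[OF iffD1[OF eq_neg_iff_add_eq_0 ext_anti]])

lemma ext_jacobi: "x \<diamondop> (y \<diamondop> z) + y \<diamondop> (z \<diamondop> x) + z \<diamondop> (x \<diamondop> y) = 0"
proof -
  let ?J = "\<lambda>x y z. x \<diamondop> (y \<diamondop> z) + y \<diamondop> (z \<diamondop> x) + z \<diamondop> (x \<diamondop> y)"
  have 1: "?J x y z = 0" if "x \<in> rf" "y \<in> rf" "z \<in> rf" for x y z
    using lie_jacobi[of x y z] that by (simp add: ext_rf rf_bracket)
  have 2: "?J x y z = 0" if "y \<in> rf" "z \<in> rf" for x y z
    by (rule linear_eq_on_rf[of "\<lambda>x. ?J x y z"]) (simp_all add: ext_linear 1 that scaleC_add_right)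
  have 3: "?J x y z = 0" if "z \<in> rf" for x y z
    by (rule linear_eq_on_rf[of "\<lambda>y. ?J x y z"]) (simp_all add: ext_linear 2 that scaleC_add_right)
  show ?thesis
    by (rule linear_eq_on_rf[of "\<lambda>z. ?J x y z"]) (simp_all add: ext_linear 3 scaleC_add_right)
qed

text \<open>The defect is shown to vanish first for \<open>y \<diamondop> z\<close> with \<open>z\<close> real in place of \<open>y\<close>.\<close>

definition defect :: "'g \<Rightarrow> 'g \<Rightarrow> 'g" where
  "defect y x = [x, y]\<^sub>L - x \<diamondop> y"

definition com_defect :: "'g \<Rightarrow> 'g \<Rightarrow> 'g \<Rightarrow> 'g" where
  "com_defect y z x = defect (y \<diamondop> z) x"

lemma defect_rf: "y \<in> rf \<Longrightarrow> defect y x = 0"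
  by (simp add: defect_def ext_rf)

lemma defect_linear: "defect y (u + v) = defect y u + defect y v" "defect y (c *\<^sub>C u) = c *\<^sub>C defect y u"
  by (simp_all add: defect_def lie_add_left lie_scaleC_left ext_linear cvec.scale_right_diff_distrib)

lemma jacobi_rf:
  assumes "x \<in> rf" "z \<in> rf"
  shows "[z, [x, y]\<^sub>L]\<^sub>L = - [x, y \<diamondop> z]\<^sub>L - y \<diamondop> [z, x]\<^sub>L"
  using sum3_zero[OF lie_jacobi[of x y z]] by (simp add: ext_rf assms rf_bracket)

text \<open>Subtracting the Jacobi identities of the two brackets moves z into left position only,
  and there both brackets are additive.\<close>

lemma com_defect_eq:
  assumes "x \<in> rf" "z \<in> rf"
  shows "com_defect y z x = z \<diamondop> (x \<diamondop> y) - [z, [x, y]\<^sub>L]\<^sub>L"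
proof -
  have "z \<diamondop> (x \<diamondop> y) = - (x \<diamondop> (y \<diamondop> z)) - y \<diamondop> [z, x]\<^sub>L"
    using sum3_zero[OF ext_jacobi[of x y z]] assms by (simp add: ext_rf[of x z])
  then show ?thesis by (simp add: com_defect_def defect_def jacobi_rf[OF assms])
qed

lemma com_defect_add:
  assumes "x \<in> rf" "z \<in> rf" "z' \<in> rf"
  shows "com_defect y (z + z') x = com_defect y z x + com_defect y z' x"
  by (simp add: com_defect_eq assms rf_add lie_add_left ext_add_left)

lemma com_defect_minus:
  assumes "x \<in> rf" "z \<in> rf"
  shows "com_defect y (- z) x = - com_defect y z x"
  by (simp add: com_defect_eq assms rf_minus lie_minus_left ext_minus_left)

lemma com_defect_linear: "com_defect y z (u + v) = com_defect y z u + com_defect y z v"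
  by (simp add: com_defect_def defect_linear)

text \<open>The elements y + \<kappa> z and y - \<kappa> z' differ by a multiple of z + z', so they
  have the same extended bracket with z + z'. Additivity in the second variable expands both
  sides.\<close>

lemma com_defect_shift:
  assumes x: "x \<in> rf" and z: "z \<in> rf" and z': "z' \<in> rf"
  shows "com_defect y z x + defect (y \<diamondop> z' + \<kappa> *\<^sub>C (z \<diamondop> z')) x =
    defect (y \<diamondop> z + \<kappa> *\<^sub>C (z \<diamondop> z')) x + com_defect y z' x"
proof -
  have "com_defect (y + \<kappa> *\<^sub>C z) (z + z') x = com_defect (y - \<kappa> *\<^sub>C z') (z + z') x"
    using ext_anti[of z' z]
    by (simp add: com_defect_def ext_linear ext_diff_left ext_self algebra_simps)
  then show ?thesis
    using ext_anti[of z' z] unfolding com_defect_add[OF x z z']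
    by (simp add: com_defect_def ext_linear ext_diff_left ext_self)
qed

text \<open>The shift with z' = q and \<kappa> = \<i>: in two of the four terms the imaginary parts
  cancel, which leaves brackets of real elements, and these have no defect.\<close>

lemma com_defect_swap_im:
  assumes "p \<in> rf" "q \<in> rf" "z \<in> rf" "x \<in> rf"
  shows "com_defect (p + \<i> *\<^sub>C q) z x = - com_defect (p + \<i> *\<^sub>C z) q x"
proof -
  have "defect ((p + \<i> *\<^sub>C q) \<diamondop> q + \<i> *\<^sub>C (z \<diamondop> q)) x = com_defect (p + \<i> *\<^sub>C z) q x"
    by (simp add: com_defect_def ext_linear ext_self)
  moreover have "defect ((p + \<i> *\<^sub>C q) \<diamondop> z + \<i> *\<^sub>C (z \<diamondop> q)) x = defect [p, z]\<^sub>L x"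
    using ext_anti[of z q] assms by (simp add: ext_linear ext_rf)
  moreover have "com_defect (p + \<i> *\<^sub>C q) q x = defect [p, q]\<^sub>L x"
    using assms by (simp add: com_defect_def ext_linear ext_self) (simp add: ext_rf)
  ultimately show ?thesis
    using com_defect_shift[OF assms(4,3,2), of "p + \<i> *\<^sub>C q" \<i>] assms
    by (simp add: defect_rf rf_bracket eq_neg_iff_add_eq_0)
qed

text \<open>The shift with z' = p and \<kappa> = 1, which acts on the real part of the left
  factor.\<close>

lemma com_defect_swap_re:
  assumes "p \<in> rf" "q \<in> rf" "z \<in> rf" "x \<in> rf"
  shows "com_defect (p + \<i> *\<^sub>C q) z x + com_defect (z + \<i> *\<^sub>C q) p x =
    com_defect (\<i> *\<^sub>C q) z x + com_defect (\<i> *\<^sub>C q) p x"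
proof -
  have "defect ((p + \<i> *\<^sub>C q) \<diamondop> p + 1 *\<^sub>C (z \<diamondop> p)) x = com_defect (z + \<i> *\<^sub>C q) p x"
    by (simp add: com_defect_def ext_linear ext_self scaleC_one add.commute)
  moreover have "defect ((p + \<i> *\<^sub>C q) \<diamondop> z + 1 *\<^sub>C (z \<diamondop> p)) x = com_defect (\<i> *\<^sub>C q) z x"
    using ext_anti[of z p] by (simp add: com_defect_def ext_linear scaleC_one)
  moreover have "com_defect (p + \<i> *\<^sub>C q) p x = com_defect (\<i> *\<^sub>C q) p x"
    by (simp add: com_defect_def ext_linear ext_self)
  ultimately show ?thesis
    using com_defect_shift[OF assms(4,3,1), of "p + \<i> *\<^sub>C q" 1] by simp
qed

text \<open>The two swaps make the defect of \<open>(p + \<i>q) \<diamondop> z\<close> additive in each of the three variables; as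
  doubling \<open>p\<close> and \<open>q\<close> has the same effect as doubling \<open>z\<close>, it does not depend on \<open>p\<close>.\<close>

lemma com_defect_im:
  assumes p: "p \<in> rf" and q: "q \<in> rf" and z: "z \<in> rf" and x: "x \<in> rf"
  shows "com_defect (p + \<i> *\<^sub>C q) z x = com_defect (\<i> *\<^sub>C q) z x"
proof -
  define h where "h = (1/2) *\<^sub>C q"
  have h: "h \<in> rf" using rf_scale[OF q, of "1/2"] by (simp add: h_def)
  have hh: "h + h = q" by (simp add: h_def scaleC_one flip: scaleC_add_left)
  have ih: "\<i> *\<^sub>C q = \<i> *\<^sub>C h + \<i> *\<^sub>C h" by (simp add: hh flip: scaleC_add_right)
  \<comment> \<open>The swap brings q into the second variable, where additivity is available; after
    halving it is swapped back.\<close>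
  have half: "com_defect (z + \<i> *\<^sub>C q) p x = com_defect (z + \<i> *\<^sub>C h) p x + com_defect (z + \<i> *\<^sub>C h) p x"
    using com_defect_swap_im[OF z q p x] com_defect_swap_im[OF z h p x]
      com_defect_add[OF x h h, of "z + \<i> *\<^sub>C p"] by (simp add: hh)
  have "com_defect ((z + z) + \<i> *\<^sub>C q) p x = com_defect (z + \<i> *\<^sub>C h) (p + p) x"
    by (simp add: com_defect_def ih ext_linear algebra_simps)
  then have dbl: "com_defect ((z + z) + \<i> *\<^sub>C q) p x = com_defect (z + \<i> *\<^sub>C q) p x"
    by (simp add: half com_defect_add[OF x p p])
  let ?M = "com_defect (p + \<i> *\<^sub>C q) z x" and ?N = "com_defect (z + \<i> *\<^sub>C q) p x"
    and ?T = "com_defect (\<i> *\<^sub>C q) z x" and ?U = "com_defect (\<i> *\<^sub>C q) p x"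
  have "?M + ?N = ?T + ?U" by (rule com_defect_swap_re[OF p q z x])
  moreover have "(?M + ?M) + ?N = (?T + ?T) + ?U"
    using com_defect_swap_re[OF p q rf_add[OF z z] x] by (simp only: dbl com_defect_add[OF x z z])
  moreover have "?M = ((?M + ?M) + ?N) - (?M + ?N)" "?T = ((?T + ?T) + ?U) - (?T + ?U)" by simp_all
  ultimately show ?thesis by metis
qed

text \<open>By \<open>com_defect_im\<close> it carries the whole of \<open>com_defect\<close>. On
  the real form it turns out to be additive and alternating in its three arguments.\<close>

definition alt :: "'g \<Rightarrow> 'g \<Rightarrow> 'g \<Rightarrow> 'g" where
  "alt y z x = com_defect (\<i> *\<^sub>C y) z x"

lemma com_defect_alt:
  assumes "z \<in> rf" "x \<in> rf"
  shows "com_defect y z x = alt (im_part y) z x"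
  using com_defect_im[of "re_part y" "im_part y" z x] assms by (simp add: re_im alt_def)

lemma alt_add:
  assumes "x \<in> rf" "z \<in> rf" "z' \<in> rf"
  shows "alt y (z + z') x = alt y z x + alt y z' x"
  by (simp add: alt_def com_defect_add[OF assms])

lemma alt_add_right: "alt y z (u + v) = alt y z u + alt y z v"
  by (simp add: alt_def com_defect_linear)

lemma alt_swap:
  assumes "y \<in> rf" "z \<in> rf" "x \<in> rf"
  shows "alt y z x = - alt z y x"
  using com_defect_swap_im[of 0 y z x] assms by (simp add: alt_def)

lemma alt_add_left:
  assumes "x \<in> rf" "y \<in> rf" "y' \<in> rf" "z \<in> rf"
  shows "alt (y + y') z x = alt y z x + alt y' z x"
  by (simp add: alt_swap[of "y + y'"] alt_swap[of y] alt_swap[of y'] assms rf_add alt_add)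

text \<open>When \<open>[x, y]\<close> has no defect, \<open>com_defect_eq\<close> reduces to the
  defect of x \<diamondop> y at z. Up to sign this is again a defect of the same kind with x and z
  exchanged.\<close>

lemma com_defect_symmetric:
  assumes x: "x \<in> rf" and z: "z \<in> rf" and eq: "[x, y]\<^sub>L = x \<diamondop> y"
  shows "com_defect y x z = com_defect y z x"
proof -
  have e: "y \<diamondop> (- x) = x \<diamondop> y" using ext_anti[of x y] by (simp add: ext_minus_right)
  have "defect (x \<diamondop> y) z = - com_defect y x z"
    using com_defect_minus[OF z x, of y] by (simp only: com_defect_def e)
  moreover have "com_defect y z x = - defect (x \<diamondop> y) z"
    by (simp add: com_defect_eq[OF x z] eq defect_def)
  ultimately show ?thesis by simp
qed

lemma alt_same:
  assumes x: "x \<in> rf" and z: "z \<in> rf"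
  shows "alt x z x = 0"
proof -
  \<comment> \<open>Pulling the left factor \<i> out of the bracket of \<i> x with itself shows that
    the original bracket of x and \<i> x vanishes.\<close>
  have "[x, \<i> *\<^sub>C x]\<^sub>L = x \<diamondop> (\<i> *\<^sub>C x)"
    using lie_self[of "\<i> *\<^sub>C x"] by (simp add: lie_scaleC_left ext_scale_right ext_self)
  from com_defect_symmetric[OF x z this] show ?thesis
    by (simp add: alt_def) (simp add: com_defect_def ext_scale_left ext_self defect_def lie_zero_right)
qed

lemma alt_swap_outer:
  assumes x: "x \<in> rf" and y: "y \<in> rf" and z: "z \<in> rf"
  shows "alt y z x = - alt x z y"
  using alt_same[OF rf_add[OF x y] z] alt_same[OF x z] alt_same[OF y z] assms
  by (simp add: alt_add_left alt_add_right rf_add eq_neg_iff_add_eq_0 add.commute)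

lemma alt_zero_middle:
  assumes "y \<in> rf" "x \<in> rf"
  shows "alt y x x = 0"
  using alt_swap[OF assms(1,2,2)] alt_same[OF assms(2,1)] by simp

text \<open>If \<open>[x, \<i>y]\<close> has no defect then \<open>alt y x\<close> is symmetric as well as antisymmetric.\<close>

lemma alt_bracket:
  assumes u: "u \<in> rf" and v: "v \<in> rf" and z: "z \<in> rf"
  shows "alt [u, v]\<^sub>L u z = 0"
proof -
  have uv: "[u, v]\<^sub>L \<in> rf" by (rule rf_bracket[OF u v])
  have "defect (\<i> *\<^sub>C [u, v]\<^sub>L) u = alt u v u"
    by (simp add: alt_def com_defect_def ext_scale_left ext_rf v)
  then have "[u, \<i> *\<^sub>C [u, v]\<^sub>L]\<^sub>L = u \<diamondop> (\<i> *\<^sub>C [u, v]\<^sub>L)"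
    using alt_same[OF u v] by (simp add: defect_def)
  from com_defect_symmetric[OF u z this] have "alt [u, v]\<^sub>L u z = alt [u, v]\<^sub>L z u" by (simp add: alt_def)
  also have "\<dots> = - alt u z [u, v]\<^sub>L" by (rule alt_swap_outer[OF u uv z])
  also have "\<dots> = alt z u [u, v]\<^sub>L" using alt_swap[OF u z uv] by simp
  also have "\<dots> = - alt [u, v]\<^sub>L u z" by (rule alt_swap_outer[OF uv z u])
  finally show ?thesis by (rule double_eq_zero[OF iffD1[OF eq_neg_iff_add_eq_0]])
qed

lemma alt_bracket_swap:
  assumes u: "u \<in> rf" and u': "u' \<in> rf" and v: "v \<in> rf" and z: "z \<in> rf"
  shows "alt [u, v]\<^sub>L u' z = - alt [u', v]\<^sub>L u z"
  using alt_bracket[OF rf_add[OF u u'] v z] alt_bracket[OF u v z] alt_bracket[OF u' v z] assms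
  by (simp add: lie_add_left alt_add_left alt_add rf_bracket rf_add eq_neg_iff_add_eq_0 add.commute)

end

section \<open>Vanishing of the defect by means of the root decomposition\<close>

locale compatible_real_form = inner_real_form h E N a \<sigma> + real_antisymmetric \<sigma>
  for h :: "'g::complex_lie_algebra set" and E N a and \<sigma> :: "'g \<Rightarrow> 'g"
begin

lemma h_subspace: "cvec.subspace h"
  using cartan by (simp add: cartan_subalgebra_def lie_subalgebra_def)

lemma h_add: "x \<in> h \<Longrightarrow> y \<in> h \<Longrightarrow> x + y \<in> h"
  and h_scale: "x \<in> h \<Longrightarrow> c *\<^sub>C x \<in> h"
  and h_zero: "0 \<in> h"
  and h_minus: "x \<in> h \<Longrightarrow> - x \<in> h"
  and h_diff: "x \<in> h \<Longrightarrow> y \<in> h \<Longrightarrow> x - y \<in> h"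
  using h_subspace by (simp_all add: cvec.subspace_add cvec.subspace_scale cvec.subspace_0 cvec.subspace_neg cvec.subspace_diff)

lemma h_abelian: "x \<in> h \<Longrightarrow> y \<in> h \<Longrightarrow> [x, y]\<^sub>L = 0"
  using cartan by (simp add: cartan_subalgebra_def)

lemma h_sigma: "x \<in> h \<Longrightarrow> \<sigma> x \<in> h"
  using sigma_cartan by blast

lemma h_parts: "x \<in> h \<Longrightarrow> re_part x \<in> h" "x \<in> h \<Longrightarrow> im_part x \<in> h"
proof -
  show re: "re_part x \<in> h" if "x \<in> h" for x using that by (simp add: re_part_def h_add h_scale h_sigma)
  show "im_part x \<in> h" if "x \<in> h" using that by (simp add: im_part_def re h_scale h_minus)
qed

lemma root_linear:
  assumes "\<alpha> \<in> roots h"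
  shows "x \<in> h \<Longrightarrow> y \<in> h \<Longrightarrow> \<alpha> (x + y) = \<alpha> x + \<alpha> y" "x \<in> h \<Longrightarrow> \<alpha> (c *\<^sub>C x) = c * \<alpha> x"
    "x \<notin> h \<Longrightarrow> \<alpha> x = 0" "\<alpha> \<noteq> 0"
  using assms by (simp_all add: roots_def)

lemma root_space_E: "\<alpha> \<in> roots h \<Longrightarrow> root_space h \<alpha> = range (\<lambda>c. c *\<^sub>C E \<alpha>)"
  using weyl_basis by (simp add: weyl_basis_def cvec.span_singleton)

lemma bracket_h_E: "\<alpha> \<in> roots h \<Longrightarrow> H \<in> h \<Longrightarrow> [H, c *\<^sub>C E \<alpha>]\<^sub>L = (\<alpha> H * c) *\<^sub>C E \<alpha>"
proof -
  assume "\<alpha> \<in> roots h" "H \<in> h"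
  then have "c *\<^sub>C E \<alpha> \<in> root_space h \<alpha>" by (auto simp: root_space_E)
  then show ?thesis using \<open>H \<in> h\<close> by (simp add: root_space_def scaleC_scaleC)
qed

lemma E_nonzero: "\<alpha> \<in> roots h \<Longrightarrow> E \<alpha> \<noteq> 0"
  using root_space_E[of \<alpha>] by (auto simp: roots_def)

lemma root_nonzero_real:
  assumes \<alpha>: "\<alpha> \<in> roots h"
  obtains H where "H \<in> h" "H \<in> rf" "\<alpha> H \<noteq> 0"
proof -
  obtain x where x: "\<alpha> x \<noteq> 0" using root_linear(4)[OF \<alpha>] by (auto simp: fun_eq_iff)
  then have xh: "x \<in> h" using root_linear(3)[OF \<alpha>] by blast
  have "\<alpha> x = \<alpha> (re_part x) + \<i> * \<alpha> (im_part x)"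
    using root_linear(1)[OF \<alpha> h_parts(1)[OF xh] h_scale[OF h_parts(2)[OF xh]], of \<i>]
    by (simp add: re_im root_linear(2)[OF \<alpha> h_parts(2)[OF xh]])
  then show thesis using that[of "re_part x"] that[of "im_part x"] x h_parts[OF xh] by fastforce
qed

lemma root_induct:
  assumes sub: "cvec.subspace S" and h: "\<And>H. H \<in> h \<Longrightarrow> H \<in> S"
    and E: "\<And>\<alpha>. \<alpha> \<in> roots h \<Longrightarrow> E \<alpha> \<in> S"
  shows "x \<in> S"
proof -
  have "h \<union> (\<Union>\<alpha>\<in>roots h. root_space h \<alpha>) \<subseteq> S"
    using h E cvec.subspace_scale[OF sub] by (auto simp: root_space_E)
  then show ?thesis using cvec.span_minimal[OF _ sub] root_decomposition by blast
qed

lemma ext_im_part: "x \<in> rf \<Longrightarrow> im_part (x \<diamondop> y) = [x, im_part y]\<^sub>L"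
  by (simp add: ext_bracket_def im_part_add re_im_i re_im_rf rf_bracket)

text \<open>Root vectors are defined through the original bracket, so the extended one has to be
  computed on them. The two agree on H and y \<diamondop> H because \<open>alt\<close> vanishes when
  H is repeated, and \<open>E \<alpha>\<close> has the form y \<diamondop> H.\<close>

lemma ext_h_E_aux:
  assumes \<alpha>: "\<alpha> \<in> roots h" and H: "H \<in> h" "H \<in> rf" and nz: "\<alpha> H \<noteq> 0"
  shows "H \<diamondop> E \<alpha> = \<alpha> H *\<^sub>C E \<alpha>"
proof -
  have com: "com_defect y H H = 0" for y
    by (simp add: com_defect_alt H alt_zero_middle)
  have br: "[H, y \<diamondop> H]\<^sub>L = H \<diamondop> (y \<diamondop> H)" for y
    using com[of y] by (simp add: com_defect_def defect_def)
  have "[H, [H, E \<alpha>]\<^sub>L]\<^sub>L = (\<alpha> H * \<alpha> H) *\<^sub>C E \<alpha>"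
    using bracket_h_E[OF \<alpha> H(1), of 1] bracket_h_E[OF \<alpha> H(1), of "\<alpha> H"] by (simp add: scaleC_one)
  moreover have "[H, [H, E \<alpha>]\<^sub>L]\<^sub>L = H \<diamondop> (H \<diamondop> E \<alpha>)"
  proof -
    have "[H, [H, E \<alpha>]\<^sub>L]\<^sub>L = - (H \<diamondop> (E \<alpha> \<diamondop> H))"
      using jacobi_rf[OF H(2) H(2), of "E \<alpha>"] by (simp add: br lie_self)
    then show ?thesis using ext_anti[of "E \<alpha>" H] by (simp add: ext_minus_right)
  qed
  ultimately have sq: "H \<diamondop> (H \<diamondop> E \<alpha>) = (\<alpha> H * \<alpha> H) *\<^sub>C E \<alpha>" by simp
  \<comment> \<open>Bracketing twice with H multiplies \<open>E \<alpha>\<close> by the square of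
    \<alpha> H; dividing by it gives y \<diamondop> H = \<open>E \<alpha>\<close>, the sign coming
    from antisymmetry.\<close>
  define y where "y = (- inverse (\<alpha> H * \<alpha> H)) *\<^sub>C (H \<diamondop> E \<alpha>)"
  have "y \<diamondop> H = - ((- inverse (\<alpha> H * \<alpha> H)) *\<^sub>C (H \<diamondop> (H \<diamondop> E \<alpha>)))"
    using ext_anti[of "H \<diamondop> E \<alpha>" H] by (simp add: y_def ext_scale_left ext_minus_left cvec.scale_minus_right)
  also have "\<dots> = (inverse (\<alpha> H * \<alpha> H) * (\<alpha> H * \<alpha> H)) *\<^sub>C E \<alpha>" by (simp only: sq scaleC_scaleC cvec.scale_minus_left minus_minus mult_minus_left)
  also have "\<dots> = E \<alpha>" using nz by (subst left_inverse) (simp_all add: scaleC_one)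
  finally have "[H, E \<alpha>]\<^sub>L = H \<diamondop> E \<alpha>" using br[of y] by simp
  then show ?thesis using bracket_h_E[OF \<alpha> H(1), of 1] by (simp add: scaleC_one)
qed

text \<open>As \<alpha> H is not zero, the imaginary part of a multiple of \<open>E \<alpha>\<close>
  is the bracket of H with a real element. \<open>alt_bracket_swap\<close> exchanges H with u and so
  leaves a Cartan element in the middle.\<close>

lemma alt_E_h_aux:
  assumes \<alpha>: "\<alpha> \<in> roots h" and H: "H \<in> h" "H \<in> rf" and nz: "\<alpha> H \<noteq> 0" and z: "z \<in> rf" and u: "u \<in> rf"
  shows "alt (im_part (c *\<^sub>C E \<alpha>)) u z = - alt [u, im_part ((c / \<alpha> H) *\<^sub>C E \<alpha>)]\<^sub>L H z"
proof -
  let ?v = "im_part ((c / \<alpha> H) *\<^sub>C E \<alpha>)"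
  have "[H, ?v]\<^sub>L = im_part (c *\<^sub>C E \<alpha>)"
    using nz by (simp add: ext_im_part[OF H(2), symmetric] ext_scale_right ext_h_E_aux[OF \<alpha> H nz] scaleC_scaleC)
  then show ?thesis using alt_bracket_swap[OF H(2) u im_part_rf z, of "(c / \<alpha> H) *\<^sub>C E \<alpha>"] by simp
qed

lemma alt_E_h:
  assumes \<alpha>: "\<alpha> \<in> roots h" and H: "H \<in> h" "H \<in> rf" and z: "z \<in> rf"
  shows "alt (im_part (c *\<^sub>C E \<alpha>)) H z = 0"
proof -
  have nz: "alt (im_part (c *\<^sub>C E \<alpha>)) H z = 0" if H: "H \<in> h" "H \<in> rf" "\<alpha> H \<noteq> 0" for H
    using alt_E_h_aux[OF \<alpha> H z H(2), of c] alt_bracket[OF H(2) im_part_rf z] by simp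
  obtain H' where H': "H' \<in> h" "H' \<in> rf" "\<alpha> H' \<noteq> 0" using \<alpha> by (rule root_nonzero_real)
  show ?thesis
  proof (cases "\<alpha> H = 0")
    \<comment> \<open>A root that vanishes on H does not vanish on H + H', so additivity settles
      this case.\<close>
    case True
    then have "alt (im_part (c *\<^sub>C E \<alpha>)) (H + H') z = 0"
      by (intro nz h_add rf_add H H') (simp add: root_linear[OF \<alpha>] H H')
    then show ?thesis using nz[OF H'] by (simp add: alt_add z H H')
  qed (use nz H in blast)
qed

text \<open>Reduction to the root decomposition of the first argument: root vectors are covered by
  \<open>alt_E_h\<close>, and on the Cartan subalgebra the bracket with H vanishes
  altogether.\<close>

lemma alt_h:
  assumes H: "H \<in> h" "H \<in> rf" and y: "y \<in> rf" and z: "z \<in> rf"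
  shows "alt y H z = 0"
proof -
  let ?S = "{x. \<forall>c. alt (im_part (c *\<^sub>C x)) H z = 0}"
  have "cvec.subspace ?S"
    by (rule cvec.subspaceI)
      (simp_all add: scaleC_add_right im_part_add alt_add_left z H scaleC_scaleC,
        simp add: alt_def im_part_def re_part_def com_defect_def defect_def lie_zero_right)
  moreover have "x \<in> ?S" if "x \<in> h" for x
  proof (intro CollectI allI)
    fix c
    have "[im_part (c *\<^sub>C x), H]\<^sub>L = 0" by (intro h_abelian h_parts h_scale that H)
    then show "alt (im_part (c *\<^sub>C x)) H z = 0"
      by (simp add: alt_def com_defect_def ext_scale_left ext_rf H defect_def lie_zero_right)
  qed
  moreover have "E \<alpha> \<in> ?S" if "\<alpha> \<in> roots h" for \<alpha>
    using alt_E_h[OF that H z] by blast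
  \<comment> \<open>Since y is real, it is the imaginary part of \<i> y.\<close>
  ultimately have "\<i> *\<^sub>C y \<in> ?S" by (rule root_induct[of ?S])
  then have "alt (im_part (1 *\<^sub>C (\<i> *\<^sub>C y))) H z = 0" by blast
  then show ?thesis by (simp add: scaleC_one re_im_i re_im_rf y)
qed

text \<open>\<open>alt\<close> already vanishes when a Cartan element stands in the middle. The
  alternating property treats a Cartan element in the first place, and \<open>alt_E_h_aux\<close>
  reduces root vectors to the same situation.\<close>

lemma alt_zero:
  assumes u: "u \<in> rf" and y: "y \<in> rf" and z: "z \<in> rf"
  shows "alt y u z = 0"
proof -
  let ?S = "{x. \<forall>c. alt (im_part (c *\<^sub>C x)) u z = 0}"
  have "cvec.subspace ?S"
    by (rule cvec.subspaceI)
      (simp_all add: scaleC_add_right im_part_add alt_add_left z u scaleC_scaleC,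
        simp add: alt_def im_part_def re_part_def com_defect_def defect_def lie_zero_right)
  moreover have "x \<in> ?S" if "x \<in> h" for x
    using alt_swap[OF im_part_rf u z] alt_h[OF h_parts(2)[OF h_scale[OF that]] im_part_rf u z] by simp
  moreover have "E \<alpha> \<in> ?S" if \<alpha>: "\<alpha> \<in> roots h" for \<alpha>
  proof (intro CollectI allI)
    fix c
    obtain H where H: "H \<in> h" "H \<in> rf" "\<alpha> H \<noteq> 0" using \<alpha> by (rule root_nonzero_real)
    show "alt (im_part (c *\<^sub>C E \<alpha>)) u z = 0"
      using alt_E_h_aux[OF \<alpha> H z u, of c] alt_h[OF H(1,2) rf_bracket[OF u im_part_rf] z] by simp
  qed
  ultimately have "\<i> *\<^sub>C y \<in> ?S" by (rule root_induct[of ?S])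
  then have "alt (im_part (1 *\<^sub>C (\<i> *\<^sub>C y))) u z = 0" by blast
  then show ?thesis by (simp add: scaleC_one re_im_i re_im_rf y)
qed

lemma bracket_ext_rf:
  assumes z: "z \<in> rf"
  shows "[x, y \<diamondop> z]\<^sub>L = x \<diamondop> (y \<diamondop> z)"
proof -
  have "defect (y \<diamondop> z) x = 0"
  proof (rule linear_eq_on_rf[of "\<lambda>x. defect (y \<diamondop> z) x"])
    show "defect (y \<diamondop> z) x = 0" if "x \<in> rf" for x
      using com_defect_alt[OF z that, of y] alt_zero[OF z im_part_rf that] by (simp add: com_defect_def)
  qed (simp_all add: defect_linear)
  then show ?thesis by (simp add: defect_def)
qed

text \<open>For real x two of the three cyclic terms agree between the two brackets, and the Jacobi
  identities force the third. Complex linearity in the leftmost argument removes the restriction on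
  x.\<close>

lemma bracket_bracket: "[x, [y, z]\<^sub>L]\<^sub>L = x \<diamondop> (y \<diamondop> z)"
proof -
  have rf: "[x, [y, z]\<^sub>L]\<^sub>L = x \<diamondop> (y \<diamondop> z)" if x: "x \<in> rf" for x
  proof -
    have 1: "[z, [x, y]\<^sub>L]\<^sub>L = z \<diamondop> (x \<diamondop> y)" for z
    proof -
      have "[z, [x, y]\<^sub>L]\<^sub>L - z \<diamondop> (x \<diamondop> y) = 0"
      proof (rule linear_eq_on_rf[of "\<lambda>z. [z, [x, y]\<^sub>L]\<^sub>L - z \<diamondop> (x \<diamondop> y)"])
        show "[z, [x, y]\<^sub>L]\<^sub>L - z \<diamondop> (x \<diamondop> y) = 0" if "z \<in> rf" for z
          using com_defect_eq[OF x that, of y] com_defect_alt[OF that x, of y] alt_zero[OF that im_part_rf x] by simp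
      qed (simp_all add: lie_add_left lie_scaleC_left ext_linear cvec.scale_right_diff_distrib)
      then show ?thesis by simp
    qed
    have 2: "[y, [z, x]\<^sub>L]\<^sub>L = y \<diamondop> (z \<diamondop> x)" using bracket_ext_rf[OF x, of y z] by (simp add: ext_rf x)
    show ?thesis
      using sum3_zero[of "[y, [z, x]\<^sub>L]\<^sub>L" "[z, [x, y]\<^sub>L]\<^sub>L" "[x, [y, z]\<^sub>L]\<^sub>L"] lie_jacobi[of x y z]
        sum3_zero[of "y \<diamondop> (z \<diamondop> x)" "z \<diamondop> (x \<diamondop> y)" "x \<diamondop> (y \<diamondop> z)"] ext_jacobi[of x y z] 1 2
      by (simp add: ac_simps)
  qed
  have "[x, [y, z]\<^sub>L]\<^sub>L - x \<diamondop> (y \<diamondop> z) = 0"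
    by (rule linear_eq_on_rf[of "\<lambda>x. [x, [y, z]\<^sub>L]\<^sub>L - x \<diamondop> (y \<diamondop> z)"])
      (simp_all add: rf lie_add_left lie_scaleC_left ext_linear cvec.scale_right_diff_distrib)
  then show ?thesis by simp
qed

text \<open>Such a subspace is an ideal with derived algebra zero, so semisimplicity applies. It is
  phrased for the original bracket, the one in which semisimplicity is stated.\<close>

lemma abelian_ideal_zero:
  fixes I :: "'g set"
  assumes sub: "cvec.subspace I" and zero: "\<And>x y. y \<in> I \<Longrightarrow> [x, y]\<^sub>L = 0" and x: "x \<in> I"
  shows "x = 0"
proof -
  have "lie_ideal I" by (simp add: lie_ideal_def sub zero cvec.subspace_0)
  moreover have "{[x, y]\<^sub>L |x y. x \<in> I \<and> y \<in> I} = {0}"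
  proof (intro equalityI subsetI)
    fix v assume "v \<in> {0 :: 'g}"
    then have "v = [x, x]\<^sub>L" by (simp add: lie_self)
    then show "v \<in> {[x, y]\<^sub>L |x y. x \<in> I \<and> y \<in> I}" using x by blast
  qed (use zero in auto)
  then have "(derived_algebra ^^ 1) I = {0}" by (simp add: derived_algebra_def)
  then have "solvable I" unfolding solvable_def by blast
  ultimately show ?thesis using semisimple x unfolding semisimple_def by blast
qed

text \<open>Semisimplicity is used twice. For k in the centre of the extended bracket, the elements
  \<open>[x, k]\<close> form an ideal killed by the original bracket, so they vanish; hence the
  extended centre is itself such an ideal.\<close>

lemma ext_center_zero:
  assumes m: "\<And>v. v \<in> rf \<Longrightarrow> v \<diamondop> m = 0"
  shows "m = 0"
proof -
  let ?Z = "{m. \<forall>v. v \<diamondop> m = 0}"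
  have all: "v \<diamondop> m = 0" for v
    by (rule linear_eq_on_rf[of "\<lambda>v. v \<diamondop> m"]) (simp_all add: ext_linear m)
  have br: "[x, k]\<^sub>L = 0" if k: "k \<in> ?Z" for x k
  proof (rule abelian_ideal_zero)
    show "cvec.subspace (range (\<lambda>x. [x, k]\<^sub>L))"
      by (rule cvec.subspaceI) (force simp: image_iff lie_add_left[symmetric] lie_scaleC_left[symmetric] intro: exI[of _ 0])+
    show "[u, y]\<^sub>L = 0" if "y \<in> range (\<lambda>x. [x, k]\<^sub>L)" for u y
      using that k by (auto simp: bracket_bracket)
  qed auto
  show ?thesis
  proof (rule abelian_ideal_zero)
    show "cvec.subspace ?Z" by (rule cvec.subspaceI) (simp_all add: ext_linear)
    show "m \<in> ?Z" using all by simp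
  qed (rule br)
qed

text \<open>Two successive extended brackets with real elements annihilate the difference, so
  triviality of the extended centre applies twice.\<close>

theorem bracket_eq_ext: "[y, z]\<^sub>L = y \<diamondop> z"
proof -
  have "v \<diamondop> ([y, z]\<^sub>L - y \<diamondop> z) = 0" if v: "v \<in> rf" for v
  proof (rule ext_center_zero)
    fix x assume x: "x \<in> rf"
    have "x \<diamondop> (v \<diamondop> [y, z]\<^sub>L) = [x, [v, [y, z]\<^sub>L]\<^sub>L]\<^sub>L" by (rule bracket_bracket[symmetric])
    \<comment> \<open>Antisymmetry is used to put v on the right, because
      \<open>bracket_ext_rf\<close> asks for a real right factor.\<close>
    also have "[v, [y, z]\<^sub>L]\<^sub>L = - ((y \<diamondop> z) \<diamondop> v)" using ext_anti[of v "y \<diamondop> z"] by (simp add: bracket_bracket)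
    also have "\<dots> = (- (y \<diamondop> z)) \<diamondop> v" by (simp add: ext_minus_left)
    also have "[x, (- (y \<diamondop> z)) \<diamondop> v]\<^sub>L = x \<diamondop> ((- (y \<diamondop> z)) \<diamondop> v)" by (rule bracket_ext_rf[OF v])
    also have "(- (y \<diamondop> z)) \<diamondop> v = v \<diamondop> (y \<diamondop> z)" using ext_anti[of v "y \<diamondop> z"] by (simp add: ext_minus_left)
    finally show "x \<diamondop> (v \<diamondop> ([y, z]\<^sub>L - y \<diamondop> z)) = 0" by (simp add: ext_diff_right)
  qed
  then have "[y, z]\<^sub>L - y \<diamondop> z = 0" by (rule ext_center_zero)
  then show ?thesis by simp
qed

lemma lie_add_right: "[x :: 'g, y + z]\<^sub>L = [x, y]\<^sub>L + [x, z]\<^sub>L"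
  and lie_scale_right: "[x :: 'g, c *\<^sub>C y]\<^sub>L = c *\<^sub>C [x, y]\<^sub>L"
  and lie_anti: "[x :: 'g, y]\<^sub>L = - [y, x]\<^sub>L"
  by (simp_all add: bracket_eq_ext ext_linear) (rule ext_anti)

end

section \<open>Root data\<close>

lemma clinear_mapI:
  "(\<And>x y. f (x + y) = f x + f y) \<Longrightarrow> (\<And>c x. f (c *\<^sub>C x) = c *\<^sub>C f x) \<Longrightarrow> clinear_map f"
  by (simp add: Vector_Spaces.linear_iff cvec.vector_space_axioms)

lemma clinear_mapD:
  "clinear_map f \<Longrightarrow> f (x + y) = f x + f y" "clinear_map f \<Longrightarrow> f (c *\<^sub>C x) = c *\<^sub>C f x"
  by (simp_all add: Vector_Spaces.linear_iff)

lemma complex_vector_space: "vector_space ((*) :: complex \<Rightarrow> complex \<Rightarrow> complex)"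
  by unfold_locales (simp_all add: algebra_simps)

lemma cfunctionalI:
  "(\<And>x y. f (x + y) = f x + f y) \<Longrightarrow> (\<And>c x. f (c *\<^sub>C x) = c * f x) \<Longrightarrow> cfunctional f"
  by (simp add: Vector_Spaces.linear_iff cvec.vector_space_axioms complex_vector_space)

lemma cfunctionalD:
  "cfunctional f \<Longrightarrow> f (x + y) = f x + f y" "cfunctional f \<Longrightarrow> f (c *\<^sub>C x) = c * f x"
  by (simp_all add: Vector_Spaces.linear_iff)

context compatible_real_form
begin

lemmas lie_linear = lie_add_left lie_scaleC_left lie_add_right lie_scale_right

lemma lie_minus_right: "[x, - y]\<^sub>L = - [x, y :: 'g]\<^sub>L"
  using lie_scale_right[of x "-1" y] by simp

lemma lie_sum_right: "[x, \<Sum>i\<in>I. f i]\<^sub>L = (\<Sum>i\<in>I. [x, f i :: 'g]\<^sub>L)"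
  by (induction I rule: infinite_finite_induct) (simp_all add: lie_zero_right lie_add_right)

lemma lie_derivation: "[x, [y, z]\<^sub>L]\<^sub>L = [[x, y]\<^sub>L, z]\<^sub>L + [y, [x, z :: 'g]\<^sub>L]\<^sub>L"
proof -
  have "[x, [y, z]\<^sub>L]\<^sub>L + ([y, [z, x]\<^sub>L]\<^sub>L + [z, [x, y]\<^sub>L]\<^sub>L) = 0" using lie_jacobi[of x y z] by (simp add: add.assoc)
  moreover have "[y, [z, x]\<^sub>L]\<^sub>L = - [y, [x, z]\<^sub>L]\<^sub>L" "[z, [x, y]\<^sub>L]\<^sub>L = - [[x, y]\<^sub>L, z]\<^sub>L"
    using lie_anti[of z x] lie_anti[of z "[x, y]\<^sub>L"] by (simp_all add: lie_minus_right)
  ultimately have "[x, [y, z]\<^sub>L]\<^sub>L + (- [y, [x, z]\<^sub>L]\<^sub>L - [[x, y]\<^sub>L, z]\<^sub>L) = 0" by simp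
  then show ?thesis by (simp add: algebra_simps)
qed

lemma bracket_H_E: "\<alpha> \<in> roots h \<Longrightarrow> H \<in> h \<Longrightarrow> [H, E \<alpha>]\<^sub>L = \<alpha> H *\<^sub>C E \<alpha>"
  using bracket_h_E[of \<alpha> H 1] by (simp add: scaleC_one)

lemma bracket_E_H: "\<alpha> \<in> roots h \<Longrightarrow> H \<in> h \<Longrightarrow> [E \<alpha>, H]\<^sub>L = - (\<alpha> H *\<^sub>C E \<alpha>)"
  using lie_anti[of "E \<alpha>" H] by (simp add: bracket_H_E)

lemma conj_neg: "\<alpha> \<in> roots h \<Longrightarrow> cnj (\<alpha> (\<sigma> H)) = - \<alpha> H"
  using inner_type[of \<alpha>] by (simp add: conj_root_def fun_eq_iff)

lemma root_sigma: "\<alpha> \<in> roots h \<Longrightarrow> \<alpha> (\<sigma> H) = - cnj (\<alpha> H)"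
  using arg_cong[OF conj_neg[of \<alpha> H], of cnj] by simp

lemma sigma_E_neg: "\<alpha> \<in> roots h \<Longrightarrow> \<sigma> (E \<alpha>) = - (complex_of_real (a \<alpha>) *\<^sub>C E (- \<alpha>))"
  using sigma_E[of \<alpha>] inner_type[of \<alpha>] by simp

text \<open>Conjugation carries the root space of \<alpha> to that of its conjugate, which is -
  \<alpha> for inner type.\<close>

lemma roots_neg [simp]: "\<alpha> \<in> roots h \<Longrightarrow> - \<alpha> \<in> roots h"
proof -
  assume \<alpha>: "\<alpha> \<in> roots h"
  have "\<sigma> (E \<alpha>) \<noteq> 0" by (metis E_nonzero[OF \<alpha>] sigma_sigma sigma_zero)
  moreover have "\<sigma> (E \<alpha>) \<in> root_space h (- \<alpha>)"
    unfolding root_space_def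
  proof (intro CollectI ballI)
    fix H assume H: "H \<in> h"
    have "[H, \<sigma> (E \<alpha>)]\<^sub>L = \<sigma> [\<sigma> H, E \<alpha>]\<^sub>L" by (simp add: sigma_bracket)
    then show "[H, \<sigma> (E \<alpha>)]\<^sub>L = (- \<alpha>) H *\<^sub>C \<sigma> (E \<alpha>)"
      by (simp add: bracket_H_E \<alpha> h_sigma H sigma_scale conj_neg)
  qed
  ultimately show ?thesis
    using \<alpha> root_linear[OF \<alpha>] by (auto simp: roots_def)
qed

lemma a_square: "\<alpha> \<in> roots h \<Longrightarrow> complex_of_real (a \<alpha>) * complex_of_real (a \<alpha>) = 1"
  and a_neg: "\<alpha> \<in> roots h \<Longrightarrow> a (- \<alpha>) = a \<alpha>"
  and a_cases: "\<alpha> \<in> roots h \<Longrightarrow> a \<alpha> = 1 \<or> a \<alpha> = - 1"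
  using a_sign[of \<alpha>] by auto

lemma root_neg_neq: "\<alpha> \<in> roots h \<Longrightarrow> \<alpha> \<noteq> - \<alpha>"
proof
  assume \<alpha>: "\<alpha> \<in> roots h" and eq: "\<alpha> = - \<alpha>"
  have "\<alpha> x = 0" for x using fun_cong[OF eq, of x] by simp
  then show False using root_linear(4)[OF \<alpha>] by (auto simp: fun_eq_iff)
qed

lemma roots_separate:
  assumes "\<alpha> \<in> roots h" "\<beta> \<in> roots h" "\<alpha> \<noteq> \<beta>"
  obtains H where "H \<in> h" "\<alpha> H \<noteq> \<beta> H"
  using assms(3) root_linear(3)[OF assms(1)] root_linear(3)[OF assms(2)] by (metis ext)

lemma root_nonzero:
  assumes "\<alpha> \<in> roots h"
  obtains H where "H \<in> h" "\<alpha> H \<noteq> 0"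
  using root_nonzero_real[OF assms] by blast

text \<open>Subtracting \<beta> H times the element from its bracket with H removes the component at
  \<beta>. Suitable H keep the other components alive, since they separate \<beta> from zero and
  from every other root.\<close>

lemma weight_components:
  assumes sub: "cvec.subspace k" and inv: "\<And>H x. H \<in> h \<Longrightarrow> x \<in> k \<Longrightarrow> [H, x]\<^sub>L \<in> k"
    and T: "finite T" "T \<subseteq> roots h"
    and x: "H0 \<in> h" "H0 + (\<Sum>\<alpha>\<in>T. c \<alpha> *\<^sub>C E \<alpha>) \<in> k"
  shows "H0 \<in> k \<and> (\<forall>\<alpha>\<in>T. c \<alpha> *\<^sub>C E \<alpha> \<in> k)"
  using T x
proof (induction T arbitrary: H0 c rule: finite_induct)
  case (insert \<beta> T)
  let ?x = "H0 + (\<Sum>\<alpha>\<in>insert \<beta> T. c \<alpha> *\<^sub>C E \<alpha>)"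
  have \<beta>: "\<beta> \<in> roots h" and T: "T \<subseteq> roots h" using insert.prems by auto
  have scale: "d *\<^sub>C y \<in> k \<Longrightarrow> d \<noteq> 0 \<Longrightarrow> y \<in> k" for d y
    using cvec.subspace_scale[OF sub, of "d *\<^sub>C y" "inverse d"] by (simp add: scaleC_scaleC scaleC_one)
  have step: "(- \<beta> H) *\<^sub>C H0 \<in> k \<and> (\<forall>\<alpha>\<in>T. ((\<alpha> H - \<beta> H) * c \<alpha>) *\<^sub>C E \<alpha> \<in> k)" if H: "H \<in> h" for H
  proof (rule insert.IH[OF T])
    show "(- \<beta> H) *\<^sub>C H0 \<in> h" by (rule h_scale[OF insert.prems(2)])
    have "[H, ?x]\<^sub>L = (\<Sum>\<alpha>\<in>insert \<beta> T. (\<alpha> H * c \<alpha>) *\<^sub>C E \<alpha>)"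
      using \<beta> T by (simp add: lie_add_right h_abelian[OF H insert.prems(2)] lie_sum_right lie_scale_right
          bracket_H_E[OF _ H] scaleC_scaleC mult.commute subset_iff insert.hyps cong: sum.cong)
    then have "[H, ?x]\<^sub>L - \<beta> H *\<^sub>C ?x = (- \<beta> H) *\<^sub>C H0 + (\<Sum>\<alpha>\<in>T. ((\<alpha> H - \<beta> H) * c \<alpha>) *\<^sub>C E \<alpha>)"
      by (simp add: insert.hyps scaleC_add_right scaleC_scaleC cvec.scale_sum_right left_diff_distrib
          cvec.scale_left_diff_distrib sum_subtractf)
    moreover have "[H, ?x]\<^sub>L - \<beta> H *\<^sub>C ?x \<in> k"
      by (intro cvec.subspace_diff[OF sub] inv[OF H] cvec.subspace_scale[OF sub] insert.prems(3))
    ultimately show "(- \<beta> H) *\<^sub>C H0 + (\<Sum>\<alpha>\<in>T. ((\<alpha> H - \<beta> H) * c \<alpha>) *\<^sub>C E \<alpha>) \<in> k" by simp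
  qed
  obtain H where "H \<in> h" "\<beta> H \<noteq> 0" using \<beta> by (rule root_nonzero)
  then have H0: "H0 \<in> k" using step[of H] scale[of "- \<beta> H" H0] by simp
  have cT: "c \<alpha> *\<^sub>C E \<alpha> \<in> k" if \<alpha>: "\<alpha> \<in> T" for \<alpha>
  proof -
    have "\<alpha> \<in> roots h" "\<alpha> \<noteq> \<beta>" using \<alpha> T insert.hyps by auto
    then obtain H where H: "H \<in> h" "\<alpha> H \<noteq> \<beta> H" using \<beta> by (metis roots_separate)
    then show ?thesis using step[OF H(1)] \<alpha> scale[of "\<alpha> H - \<beta> H" "c \<alpha> *\<^sub>C E \<alpha>"] by (simp add: scaleC_scaleC)
  qed
  have "c \<beta> *\<^sub>C E \<beta> = ?x - H0 - (\<Sum>\<alpha>\<in>T. c \<alpha> *\<^sub>C E \<alpha>)" by (simp add: insert.hyps)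
  also have "\<dots> \<in> k" by (intro cvec.subspace_diff[OF sub] insert.prems(3) H0 cvec.subspace_sum[OF sub] cT)
  finally show ?case using H0 cT by simp
qed simp

lemma weight_independent:
  assumes "finite T" "T \<subseteq> roots h" "H0 \<in> h" "H0 + (\<Sum>\<alpha>\<in>T. c \<alpha> *\<^sub>C E \<alpha>) = 0"
  shows "H0 = 0" "\<alpha> \<in> T \<Longrightarrow> c \<alpha> = 0"
proof -
  have "H0 \<in> {0} \<and> (\<forall>\<alpha>\<in>T. c \<alpha> *\<^sub>C E \<alpha> \<in> {0})"
    by (rule weight_components[OF _ _ assms(1-3)]) (simp_all add: assms(4) cvec.subspace_def lie_zero_right)
  then show "H0 = 0" "\<alpha> \<in> T \<Longrightarrow> c \<alpha> = 0" using E_nonzero assms(2) by auto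
qed

lemma E_inj: "inj_on E (roots h)"
proof (rule inj_onI, rule ccontr)
  fix \<alpha> \<beta> assume ab: "\<alpha> \<in> roots h" "\<beta> \<in> roots h" "E \<alpha> = E \<beta>" "\<alpha> \<noteq> \<beta>"
  obtain H where H: "H \<in> h" "\<alpha> H \<noteq> \<beta> H" using roots_separate[OF ab(1,2,4)] .
  have "\<alpha> H *\<^sub>C E \<alpha> = \<beta> H *\<^sub>C E \<alpha>"
    using bracket_H_E[OF ab(1) H(1)] bracket_H_E[OF ab(2) H(1)] by (simp only: ab(3))
  then show False using H(2) E_nonzero[OF ab(1)] cvec.scale_right_imp_eq by blast
qed

lemma finite_roots: "finite (roots h)"
proof -
  obtain B :: "'g set" where B: "finite B" "cvec.span B = UNIV" using semisimple unfolding semisimple_def by blast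
  have "cvec.independent (E ` roots h)"
    unfolding cvec.dependent_explicit
  proof (rule notI, elim exE conjE bexE)
    fix t u v assume t: "finite t" "t \<subseteq> E ` roots h" "(\<Sum>v\<in>t. u v *\<^sub>C v) = 0" "v \<in> t" "u v \<noteq> 0"
    obtain T where T: "T \<subseteq> roots h" "t = E ` T" using t(2) by (auto simp: subset_image_iff)
    have inj: "inj_on E T" using E_inj T(1) inj_on_subset by blast
    have fT: "finite T" using t(1) T(2) finite_image_iff[OF inj] by simp
    have "0 + (\<Sum>\<alpha>\<in>T. u (E \<alpha>) *\<^sub>C E \<alpha>) = 0" using t(3) by (simp add: T(2) sum.reindex[OF inj])
    then have "u (E \<alpha>) = 0" if "\<alpha> \<in> T" for \<alpha> using weight_independent(2)[OF fT T(1) h_zero, of "\<lambda>\<alpha>. u (E \<alpha>)"] that by simp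
    then show False using t(4,5) T(2) by blast
  qed
  then have "finite (E ` roots h)" using cvec.independent_span_bound[OF B(1)] B(2) by auto
  then show ?thesis using finite_image_iff[OF E_inj] by blast
qed

lemma decomposition_exists: "\<exists>H c. H \<in> h \<and> x = H + (\<Sum>\<alpha>\<in>roots h. c \<alpha> *\<^sub>C E \<alpha>)"
proof -
  let ?S = "{x. \<exists>H c. H \<in> h \<and> x = H + (\<Sum>\<alpha>\<in>roots h. c \<alpha> *\<^sub>C E \<alpha>)}"
  have "x \<in> ?S"
  proof (rule root_induct)
    show "cvec.subspace ?S"
    proof (rule cvec.subspaceI)
      show "0 \<in> ?S" using h_zero by (intro CollectI exI[of _ 0] exI[of _ "\<lambda>_. 0"]) simp
      fix x y assume "x \<in> ?S" "y \<in> ?S"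
      then obtain H c H' c' where "H \<in> h" "x = H + (\<Sum>\<alpha>\<in>roots h. c \<alpha> *\<^sub>C E \<alpha>)"
        "H' \<in> h" "y = H' + (\<Sum>\<alpha>\<in>roots h. c' \<alpha> *\<^sub>C E \<alpha>)" by blast
      then show "x + y \<in> ?S"
        by (intro CollectI exI[of _ "H + H'"] exI[of _ "\<lambda>\<alpha>. c \<alpha> + c' \<alpha>"])
          (simp add: h_add scaleC_add_left sum.distrib)
    next
      fix d x assume "x \<in> ?S"
      then obtain H c where "H \<in> h" "x = H + (\<Sum>\<alpha>\<in>roots h. c \<alpha> *\<^sub>C E \<alpha>)" by blast
      then show "d *\<^sub>C x \<in> ?S"
        by (intro CollectI exI[of _ "d *\<^sub>C H"] exI[of _ "\<lambda>\<alpha>. d * c \<alpha>"])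
          (simp add: h_scale scaleC_add_right cvec.scale_sum_right scaleC_scaleC)
    qed
    show "H \<in> ?S" if "H \<in> h" for H
      using that by (intro CollectI exI[of _ H] exI[of _ "\<lambda>_. 0"]) simp
    show "E \<alpha> \<in> ?S" if "\<alpha> \<in> roots h" for \<alpha>
      using that h_zero finite_roots
      by (intro CollectI exI[of _ 0] exI[of _ "\<lambda>\<beta>. if \<beta> = \<alpha> then 1 else 0"])
        (simp add: if_distrib[of "\<lambda>c. c *\<^sub>C _"] scaleC_one cong: if_cong)
  qed
  then show ?thesis by blast
qed

lemma decomposition_unique:
  assumes "H \<in> h" "H' \<in> h"
    "H + (\<Sum>\<alpha>\<in>roots h. c \<alpha> *\<^sub>C E \<alpha>) = H' + (\<Sum>\<alpha>\<in>roots h. c' \<alpha> *\<^sub>C E \<alpha>)"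
  shows "H = H'" "\<alpha> \<in> roots h \<Longrightarrow> c \<alpha> = c' \<alpha>"
proof -
  have "(H - H') + (\<Sum>\<alpha>\<in>roots h. (c \<alpha> - c' \<alpha>) *\<^sub>C E \<alpha>) = 0"
    using assms(3) by (simp add: cvec.scale_left_diff_distrib sum_subtractf algebra_simps)
  from weight_independent[OF finite_roots order_refl h_diff[OF assms(1,2)] this]
  show "H = H'" "\<alpha> \<in> roots h \<Longrightarrow> c \<alpha> = c' \<alpha>" by auto
qed

lemma components_exist:
  "\<exists>p w. clinear_map p \<and> (\<forall>\<alpha>\<in>roots h. cfunctional (w \<alpha>)) \<and>
     (\<forall>x. p x \<in> h \<and> x = p x + (\<Sum>\<alpha>\<in>roots h. w \<alpha> x *\<^sub>C E \<alpha>))"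
proof -
  obtain p c where pc: "\<And>x. p x \<in> h" "\<And>x. x = p x + (\<Sum>\<alpha>\<in>roots h. c x \<alpha> *\<^sub>C E \<alpha>)"
    using decomposition_exists by metis
  have "p x + p y + (\<Sum>\<alpha>\<in>roots h. (c x \<alpha> + c y \<alpha>) *\<^sub>C E \<alpha>) =
      (p x + (\<Sum>\<alpha>\<in>roots h. c x \<alpha> *\<^sub>C E \<alpha>)) + (p y + (\<Sum>\<alpha>\<in>roots h. c y \<alpha> *\<^sub>C E \<alpha>))" for x y
    by (simp add: scaleC_add_left sum.distrib)
  then have "p x + p y + (\<Sum>\<alpha>\<in>roots h. (c x \<alpha> + c y \<alpha>) *\<^sub>C E \<alpha>) = x + y" for x y
    by (simp only: pc(2)[symmetric])
  then have "p x + p y + (\<Sum>\<alpha>\<in>roots h. (c x \<alpha> + c y \<alpha>) *\<^sub>C E \<alpha>) =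
      p (x + y) + (\<Sum>\<alpha>\<in>roots h. c (x + y) \<alpha> *\<^sub>C E \<alpha>)" for x y using pc(2)[of "x + y"] by metis
  note add = decomposition_unique[OF h_add[OF pc(1) pc(1)] pc(1) this]
  have "d *\<^sub>C p x + (\<Sum>\<alpha>\<in>roots h. (d * c x \<alpha>) *\<^sub>C E \<alpha>) =
      d *\<^sub>C (p x + (\<Sum>\<alpha>\<in>roots h. c x \<alpha> *\<^sub>C E \<alpha>))" for x d
    by (simp add: scaleC_add_right cvec.scale_sum_right scaleC_scaleC)
  then have "d *\<^sub>C p x + (\<Sum>\<alpha>\<in>roots h. (d * c x \<alpha>) *\<^sub>C E \<alpha>) = d *\<^sub>C x" for x d
    by (simp only: pc(2)[symmetric])
  then have "d *\<^sub>C p x + (\<Sum>\<alpha>\<in>roots h. (d * c x \<alpha>) *\<^sub>C E \<alpha>) =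
      p (d *\<^sub>C x) + (\<Sum>\<alpha>\<in>roots h. c (d *\<^sub>C x) \<alpha> *\<^sub>C E \<alpha>)" for x d using pc(2)[of "d *\<^sub>C x"] by metis
  note scale = decomposition_unique[OF h_scale[OF pc(1)] pc(1) this]
  have "clinear_map p" using add(1) scale(1) by (intro clinear_mapI) metis+
  moreover have "cfunctional (\<lambda>x. c x \<alpha>)" if "\<alpha> \<in> roots h" for \<alpha>
    using add(2)[OF that] scale(2)[OF that] by (intro cfunctionalI) metis+
  ultimately show ?thesis using pc by (intro exI[of _ p] exI[of _ "\<lambda>\<alpha> x. c x \<alpha>"]) blast
qed

lemma clinear_root_eqI:
  assumes "clinear_map f" "clinear_map g" "\<And>H. H \<in> h \<Longrightarrow> f H = g H" "\<And>\<alpha>. \<alpha> \<in> roots h \<Longrightarrow> f (E \<alpha>) = g (E \<alpha>)"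
  shows "f = g"
proof
  fix x
  have "x \<in> {x. f x = g x}"
    by (rule root_induct)
      (auto intro!: cvec.subspaceI simp: clinear_mapD[OF assms(1)] clinear_mapD[OF assms(2)] assms(3,4) h_zero)
  then show "f x = g x" by simp
qed

lemma cfunctional_root_eqI:
  assumes "cfunctional f" "cfunctional g" "\<And>H. H \<in> h \<Longrightarrow> f H = g H" "\<And>\<alpha>. \<alpha> \<in> roots h \<Longrightarrow> f (E \<alpha>) = g (E \<alpha>)"
  shows "f = g"
proof
  fix x
  have "x \<in> {x. f x = g x}"
    by (rule root_induct)
      (auto intro!: cvec.subspaceI simp: cfunctionalD[OF assms(1)] cfunctionalD[OF assms(2)] assms(3,4) h_zero)
  then show "f x = g x" by simp
qed

abbreviation pr where "pr \<equiv> cartan_proj h E"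
abbreviation om where "om \<equiv> omega h E"

text \<open>Turns the definite descriptions into usable facts: the root decomposition gives
  existence, and a linear map is determined on h and the root vectors.\<close>

lemma components:
  shows "clinear_map pr" "\<alpha> \<in> roots h \<Longrightarrow> cfunctional (om \<alpha>)" "pr x \<in> h"
    "H \<in> h \<Longrightarrow> pr H = H" "\<beta> \<in> roots h \<Longrightarrow> pr (E \<beta>) = 0"
    "\<alpha> \<in> roots h \<Longrightarrow> H \<in> h \<Longrightarrow> om \<alpha> H = 0"
    "\<alpha> \<in> roots h \<Longrightarrow> \<beta> \<in> roots h \<Longrightarrow> om \<alpha> (E \<beta>) = (if \<beta> = \<alpha> then 1 else 0)"
    "\<alpha> \<in> roots h \<Longrightarrow> root_ext h E \<alpha> x = \<alpha> (pr x)"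
    "x = pr x + (\<Sum>\<alpha>\<in>roots h. om \<alpha> x *\<^sub>C E \<alpha>)"
proof -
  obtain p w where p: "clinear_map p" and w: "\<And>\<alpha>. \<alpha> \<in> roots h \<Longrightarrow> cfunctional (w \<alpha>)"
    and dec: "\<And>x. p x \<in> h" "\<And>x. x = p x + (\<Sum>\<alpha>\<in>roots h. w \<alpha> x *\<^sub>C E \<alpha>)"
    using components_exist by blast
  have H: "p H = H" "\<And>\<alpha>. \<alpha> \<in> roots h \<Longrightarrow> w \<alpha> H = 0" if "H \<in> h" for H
  proof -
    have "H + (\<Sum>\<alpha>\<in>roots h. 0 *\<^sub>C E \<alpha>) = p H + (\<Sum>\<alpha>\<in>roots h. w \<alpha> H *\<^sub>C E \<alpha>)" using dec(2)[of H] by simp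
    from decomposition_unique[OF that dec(1) this] show "p H = H" "\<And>\<alpha>. \<alpha> \<in> roots h \<Longrightarrow> w \<alpha> H = 0" by auto
  qed
  have Eb: "p (E \<beta>) = 0" "\<And>\<alpha>. \<alpha> \<in> roots h \<Longrightarrow> w \<alpha> (E \<beta>) = (if \<beta> = \<alpha> then 1 else 0)" if \<beta>: "\<beta> \<in> roots h" for \<beta>
  proof -
    have "0 + (\<Sum>\<alpha>\<in>roots h. (if \<beta> = \<alpha> then 1 else 0) *\<^sub>C E \<alpha>) = E \<beta>"
      using finite_roots \<beta> by (simp add: if_distrib[of "\<lambda>c. c *\<^sub>C _"] scaleC_one cong: if_cong)
    also have "\<dots> = p (E \<beta>) + (\<Sum>\<alpha>\<in>roots h. w \<alpha> (E \<beta>) *\<^sub>C E \<alpha>)" by (rule dec(2))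
    finally have "0 + (\<Sum>\<alpha>\<in>roots h. (if \<beta> = \<alpha> then 1 else 0) *\<^sub>C E \<alpha>) = p (E \<beta>) + (\<Sum>\<alpha>\<in>roots h. w \<alpha> (E \<beta>) *\<^sub>C E \<alpha>)" .
    from decomposition_unique[OF h_zero dec(1) this]
    show "p (E \<beta>) = 0" "\<And>\<alpha>. \<alpha> \<in> roots h \<Longrightarrow> w \<alpha> (E \<beta>) = (if \<beta> = \<alpha> then 1 else 0)" by auto
  qed
  have pr: "pr = p"
    unfolding cartan_proj_def
  proof (rule the_equality)
    fix f assume f: "clinear_map f \<and> (\<forall>H\<in>h. f H = H) \<and> (\<forall>\<beta>\<in>roots h. f (E \<beta>) = 0)"
    show "f = p" by (rule clinear_root_eqI) (use f p H Eb in auto)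
  qed (use p H Eb in auto)
  have om: "om \<alpha> = w \<alpha>" if \<alpha>: "\<alpha> \<in> roots h" for \<alpha>
    unfolding omega_def
  proof (rule the_equality)
    fix f assume f: "cfunctional f \<and> (\<forall>H\<in>h. f H = 0) \<and> (\<forall>\<beta>\<in>roots h. f (E \<beta>) = (if \<beta> = \<alpha> then 1 else 0))"
    show "f = w \<alpha>" by (rule cfunctional_root_eqI) (use f w[OF \<alpha>] H(2)[OF _ \<alpha>] Eb(2)[OF _ \<alpha>] in auto)
  qed (use w[OF \<alpha>] H(2)[OF _ \<alpha>] Eb(2)[OF _ \<alpha>] in auto)
  have ext: "root_ext h E \<alpha> = (\<lambda>x. \<alpha> (p x))" if \<alpha>: "\<alpha> \<in> roots h" for \<alpha>
  proof -
    have lin: "cfunctional (\<lambda>x. \<alpha> (p x))"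
      by (rule cfunctionalI) (simp_all add: clinear_mapD[OF p] root_linear[OF \<alpha>] dec(1))
    have \<alpha>0: "\<alpha> 0 = 0" using root_linear(2)[OF \<alpha> h_zero, of 0] by simp
    show ?thesis
      unfolding root_ext_def
    proof (rule the_equality)
      fix f assume f: "cfunctional f \<and> (\<forall>H\<in>h. f H = \<alpha> H) \<and> (\<forall>\<beta>\<in>roots h. f (E \<beta>) = 0)"
      show "f = (\<lambda>x. \<alpha> (p x))" by (rule cfunctional_root_eqI) (use f lin H Eb \<alpha>0 in auto)
    qed (use lin H Eb \<alpha>0 in auto)
  qed
  show "clinear_map pr" "\<alpha> \<in> roots h \<Longrightarrow> cfunctional (om \<alpha>)" "pr x \<in> h"
    "H \<in> h \<Longrightarrow> pr H = H" "\<beta> \<in> roots h \<Longrightarrow> pr (E \<beta>) = 0"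
    "\<alpha> \<in> roots h \<Longrightarrow> H \<in> h \<Longrightarrow> om \<alpha> H = 0"
    "\<alpha> \<in> roots h \<Longrightarrow> \<beta> \<in> roots h \<Longrightarrow> om \<alpha> (E \<beta>) = (if \<beta> = \<alpha> then 1 else 0)"
    "\<alpha> \<in> roots h \<Longrightarrow> root_ext h E \<alpha> x = \<alpha> (pr x)"
    using p w dec(1) H Eb by (auto simp: pr om ext)
  show "x = pr x + (\<Sum>\<alpha>\<in>roots h. om \<alpha> x *\<^sub>C E \<alpha>)"
    using dec(2)[of x] by (simp add: pr om cong: sum.cong)
qed

lemmas pr_linear = clinear_mapD[OF components(1)]
lemmas om_linear = cfunctionalD[OF components(2)]


section \<open>Brackets of root vectors and the automorphism \<open>tau\<close>\<close>

abbreviation Hv where "Hv \<alpha> \<equiv> [E \<alpha>, E (- \<alpha>)]\<^sub>L"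

lemma E_bracket_weight:
  assumes "\<alpha> \<in> roots h" "\<beta> \<in> roots h" "H \<in> h"
  shows "[H, [E \<alpha>, E \<beta>]\<^sub>L]\<^sub>L = (\<alpha> H + \<beta> H) *\<^sub>C [E \<alpha>, E \<beta>]\<^sub>L"
  unfolding lie_derivation[of H] bracket_H_E[OF assms(1,3)] bracket_H_E[OF assms(2,3)]
  by (simp add: lie_linear lie_scaleC_left scaleC_add_left)

text \<open>The bracket has weight zero, so it centralizes h, and h is its own centralizer.\<close>

lemma Hv_h: "\<alpha> \<in> roots h \<Longrightarrow> Hv \<alpha> \<in> h"
proof -
  assume \<alpha>: "\<alpha> \<in> roots h"
  have "[Hv \<alpha>, H]\<^sub>L = 0" if "H \<in> h" for H
    using lie_anti[of "Hv \<alpha>" H] E_bracket_weight[OF \<alpha> roots_neg[OF \<alpha>] that] by simp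
  then show ?thesis using cartan by (simp add: cartan_subalgebra_def)
qed

lemma bracket_E_root:
  assumes "\<alpha> \<in> roots h" "\<beta> \<in> roots h" "\<alpha> + \<beta> \<in> roots h"
  shows "[E \<alpha>, E \<beta>]\<^sub>L = complex_of_real (N \<alpha> \<beta>) *\<^sub>C E (\<alpha> + \<beta>)" "N (- \<alpha>) (- \<beta>) = - N \<alpha> \<beta>"
  using weyl_basis assms by (auto simp: weyl_basis_def)

lemma bracket_E_zero:
  assumes "\<alpha> \<in> roots h" "\<beta> \<in> roots h" "\<alpha> + \<beta> \<notin> roots h" "\<beta> \<noteq> - \<alpha>"
  shows "[E \<alpha>, E \<beta>]\<^sub>L = 0"
proof -
  have "\<alpha> + \<beta> \<noteq> 0" using assms(4) by (simp add: add_eq_0_iff)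
  then have "root_space h (\<alpha> + \<beta>) = {0}"
    using assms(3) root_linear[OF assms(1)] root_linear[OF assms(2)] by (auto simp: roots_def algebra_simps)
  moreover have "[E \<alpha>, E \<beta>]\<^sub>L \<in> root_space h (\<alpha> + \<beta>)"
    using E_bracket_weight[OF assms(1,2)] by (simp add: root_space_def)
  ultimately show ?thesis by blast
qed

text \<open>The formula for the sign of \<alpha> + \<beta> contains the factor
  \<open>inverse (N \<alpha> \<beta>)\<close>, which would be 0 if N vanished, while the sign is 1
  or -1. Then N cancels against its value at the negative roots.\<close>

lemma a_sum:
  assumes "\<alpha> \<in> roots h" "\<beta> \<in> roots h" "\<alpha> + \<beta> \<in> roots h"
  shows "N \<alpha> \<beta> \<noteq> 0" "a (\<alpha> + \<beta>) = a \<alpha> * a \<beta>"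
proof -
  have *: "a (\<alpha> + \<beta>) = a \<alpha> * a \<beta> * inverse (N \<alpha> \<beta>) * N \<alpha> \<beta>"
    using a_add[OF assms] bracket_E_root(2)[OF assms] by (simp add: inner_type assms)
  then show nz: "N \<alpha> \<beta> \<noteq> 0" using a_sign[OF assms(3)] by auto
  show "a (\<alpha> + \<beta>) = a \<alpha> * a \<beta>" using * nz by simp
qed

lemma E_bracket_cases:
  assumes "\<alpha> \<in> roots h" "\<beta> \<in> roots h"
  obtains (dual) "\<beta> = - \<alpha>" | (sum) "\<alpha> + \<beta> \<in> roots h" | (zero) "\<alpha> + \<beta> \<notin> roots h" "\<beta> \<noteq> - \<alpha>"
  by blast

text \<open>The map below is the linear automorphism through which \<open>D_zero\<close> is an adjoint action.\<close>

definition tau :: "'g \<Rightarrow> 'g" where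
  "tau x = - pr x - (\<Sum>\<alpha>\<in>roots h. (complex_of_real (a \<alpha>) * om \<alpha> x) *\<^sub>C E (- \<alpha>))"

lemma tau_linear: "tau (x + y) = tau x + tau y" "tau (c *\<^sub>C x) = c *\<^sub>C tau x"
  by (simp_all add: tau_def pr_linear om_linear distrib_left scaleC_add_left sum.distrib algebra_simps
      cvec.scale_right_diff_distrib cvec.scale_minus_right cvec.scale_sum_right scaleC_scaleC cong: sum.cong)

lemma tau_zero: "tau 0 = 0"
  using tau_linear(2)[of 0 0] by simp

lemma tau_minus: "tau (- x) = - tau x"
  using tau_linear(2)[of "-1" x] by simp

lemma tau_h: "H \<in> h \<Longrightarrow> tau H = - H"
  by (simp add: tau_def components cong: sum.cong)

lemma tau_E: "\<alpha> \<in> roots h \<Longrightarrow> tau (E \<alpha>) = - (complex_of_real (a \<alpha>) *\<^sub>C E (- \<alpha>))"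
  using finite_roots
  by (simp add: tau_def components if_distrib[of "\<lambda>c. _ * c"] if_distrib[of "\<lambda>c. c *\<^sub>C _"] cong: sum.cong if_cong)

lemma lie_minus_minus: "[- x, - y]\<^sub>L = [x, y :: 'g]\<^sub>L"
  by (simp add: lie_minus_left lie_minus_right)

text \<open>If \<alpha> + \<beta> is a root, the sign change of N under negation meets the sign in
  \<open>tau_E\<close>, and the factors a are multiplicative. For opposite roots the factors
  multiply to 1 and exchanging the vectors gives the sign on h.\<close>

lemma tau_bracket_E:
  assumes \<alpha>: "\<alpha> \<in> roots h" and \<beta>: "\<beta> \<in> roots h"
  shows "tau [E \<alpha>, E \<beta>]\<^sub>L = [tau (E \<alpha>), tau (E \<beta>)]\<^sub>L"
proof -
  have r: "[tau (E \<alpha>), tau (E \<beta>)]\<^sub>L =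
      (complex_of_real (a \<alpha>) * complex_of_real (a \<beta>)) *\<^sub>C [E (- \<alpha>), E (- \<beta>)]\<^sub>L"
    by (simp add: tau_E \<alpha> \<beta> lie_minus_minus lie_linear lie_scaleC_left scaleC_scaleC)
  have s: "- \<alpha> + - \<beta> = - (\<alpha> + \<beta>)" by (simp add: fun_eq_iff)
  show ?thesis
    using \<alpha> \<beta>
  proof (cases rule: E_bracket_cases)
    case dual
    have "[tau (E \<alpha>), tau (E \<beta>)]\<^sub>L = [E (- \<alpha>), E \<alpha>]\<^sub>L"
      using \<alpha> unfolding r unfolding dual by (simp add: a_neg a_square scaleC_one)
    then show ?thesis using tau_h[OF Hv_h[OF \<alpha>]] lie_anti[of "E \<alpha>" "E (- \<alpha>)"] by (simp add: dual)
  next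
    case sum
    have "[E (- \<alpha>), E (- \<beta>)]\<^sub>L = - (complex_of_real (N \<alpha> \<beta>) *\<^sub>C E (- (\<alpha> + \<beta>)))"
      using bracket_E_root(1)[OF roots_neg[OF \<alpha>] roots_neg[OF \<beta>]] roots_neg[OF sum]
        bracket_E_root(2)[OF \<alpha> \<beta> sum] unfolding s by simp
    then show ?thesis
      by (simp add: r bracket_E_root(1)[OF \<alpha> \<beta> sum] tau_linear tau_E[OF sum] a_sum[OF \<alpha> \<beta> sum] scaleC_scaleC
          cvec.scale_minus_right mult.commute mult.left_commute)
  next
    case zero
    have "- \<alpha> + - \<beta> \<notin> roots h" using zero(1) roots_neg[of "- (\<alpha> + \<beta>)"] unfolding s minus_minus by blast
    moreover have "- \<beta> \<noteq> - (- \<alpha>)" using zero(2) by auto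
    ultimately show ?thesis
      using bracket_E_zero[OF \<alpha> \<beta> zero] bracket_E_zero[of "- \<alpha>" "- \<beta>"] \<alpha> \<beta> by (simp add: r tau_zero)
  qed
qed

lemma tau_bracket: "tau [x, y]\<^sub>L = [tau x, tau y]\<^sub>L"
proof -
  let ?f = "\<lambda>x y. tau [x, y]\<^sub>L" and ?g = "\<lambda>x y. [tau x, tau y]\<^sub>L"
  have lin: "clinear_map (?f x)" "clinear_map (?g x)" "clinear_map (\<lambda>x. ?f x y)" "clinear_map (\<lambda>x. ?g x y)" for x y
    by (rule clinear_mapI; simp add: tau_linear lie_linear)+
  have HE: "?f H (E \<beta>) = ?g H (E \<beta>)" if "H \<in> h" "\<beta> \<in> roots h" for H \<beta>
    by (simp add: bracket_H_E that tau_linear tau_E tau_h lie_minus_minus lie_linear scaleC_scaleC mult.commute cvec.scale_minus_right)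
  have EH: "?f (E \<beta>) H = ?g (E \<beta>) H" if "H \<in> h" "\<beta> \<in> roots h" for H \<beta>
    using HE[OF that] lie_anti[of "E \<beta>" H] lie_anti[of "tau (E \<beta>)" "tau H"] by (simp add: tau_minus)
  have HH: "?f H H' = ?g H H'" if "H \<in> h" "H' \<in> h" for H H'
    by (simp add: h_abelian that tau_zero tau_h lie_minus_minus)
  have E: "?f (E \<alpha>) = ?g (E \<alpha>)" if "\<alpha> \<in> roots h" for \<alpha>
    by (rule clinear_root_eqI[OF lin(1,2)]) (use that EH tau_bracket_E in auto)
  have H: "?f H = ?g H" if "H \<in> h" for H
    by (rule clinear_root_eqI[OF lin(1,2)]) (use that HE HH in auto)
  have "(\<lambda>x. ?f x y) = (\<lambda>x. ?g x y)"
    by (rule clinear_root_eqI[OF lin(3,4)]) (use fun_cong[OF E] fun_cong[OF H] in auto)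
  then show ?thesis by (rule fun_cong)
qed

lemma tau_sigma: "\<sigma> (tau x) = tau (\<sigma> x)"
proof -
  have "(\<lambda>x. \<sigma> (tau (\<sigma> x))) = tau"
    by (rule clinear_root_eqI)
      (auto intro!: clinear_mapI simp: tau_linear sigma_add sigma_scale tau_h h_sigma sigma_minus sigma_E_neg tau_minus
        tau_E a_neg scaleC_scaleC a_square scaleC_one)
  from fun_cong[OF this, of "\<sigma> x"] show ?thesis by simp
qed

text \<open>On generators the prescribed values are brackets with \<open>tau\<close> of the first
  argument, and bilinearity leaves no other solution of the description.\<close>

lemma D_zero_eq: "D_zero h E a \<sigma> = (\<lambda>X Y. [tau X, Y]\<^sub>L)"
  unfolding D_zero_def
proof (rule the_equality)
  let ?D = "\<lambda>X Y. [tau X, Y]\<^sub>L"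
  have bil: "cbilinear_map ?D"
    by (auto simp: cbilinear_map_def tau_linear lie_linear intro!: clinear_mapI)
  have gen: "?D (E \<alpha>) (E \<beta>) = - (complex_of_real (a \<alpha>) *\<^sub>C [E (conj_root \<sigma> \<alpha>), E \<beta>]\<^sub>L)"
    "H \<in> h \<Longrightarrow> ?D H (E \<beta>) = conj_root \<sigma> \<beta> H *\<^sub>C E \<beta>"
    "H \<in> h \<Longrightarrow> ?D (E \<beta>) H = (conj_root \<sigma> \<beta> H * complex_of_real (a \<beta>)) *\<^sub>C E (conj_root \<sigma> \<beta>)"
    if "\<alpha> \<in> roots h" "\<beta> \<in> roots h" for \<alpha> \<beta> H
    using that by (simp_all add: tau_E tau_h inner_type lie_minus_left lie_scaleC_left bracket_H_E bracket_E_H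
        scaleC_scaleC mult.commute cvec.scale_minus_right)
  have HH: "?D H H' = 0" if "H \<in> h" "H' \<in> h" for H H'
    by (simp add: tau_h that lie_minus_left h_abelian)
  show "cbilinear_map ?D \<and>
     (\<forall>\<alpha>\<in>roots h. \<forall>\<beta>\<in>roots h.
        ?D (E \<alpha>) (E \<beta>) = - (complex_of_real (a \<alpha>) *\<^sub>C [E (conj_root \<sigma> \<alpha>), E \<beta>]\<^sub>L)) \<and>
     (\<forall>H\<in>h. \<forall>\<beta>\<in>roots h. ?D H (E \<beta>) = conj_root \<sigma> \<beta> H *\<^sub>C E \<beta>) \<and>
     (\<forall>H\<in>h. \<forall>\<beta>\<in>roots h.
        ?D (E \<beta>) H = (conj_root \<sigma> \<beta> H * complex_of_real (a \<beta>)) *\<^sub>C E (conj_root \<sigma> \<beta>)) \<and>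
     (\<forall>H\<in>h. \<forall>H'\<in>h. ?D H H' = 0)"
    using bil gen HH by blast
  fix D
  assume D: "cbilinear_map D \<and>
     (\<forall>\<alpha>\<in>roots h. \<forall>\<beta>\<in>roots h.
        D (E \<alpha>) (E \<beta>) = - (complex_of_real (a \<alpha>) *\<^sub>C [E (conj_root \<sigma> \<alpha>), E \<beta>]\<^sub>L)) \<and>
     (\<forall>H\<in>h. \<forall>\<beta>\<in>roots h. D H (E \<beta>) = conj_root \<sigma> \<beta> H *\<^sub>C E \<beta>) \<and>
     (\<forall>H\<in>h. \<forall>\<beta>\<in>roots h.
        D (E \<beta>) H = (conj_root \<sigma> \<beta> H * complex_of_real (a \<beta>)) *\<^sub>C E (conj_root \<sigma> \<beta>)) \<and>
     (\<forall>H\<in>h. \<forall>H'\<in>h. D H H' = 0)"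
  have lin: "clinear_map (D x)" "clinear_map (?D x)" "clinear_map (\<lambda>x. D x y)" "clinear_map (\<lambda>x. ?D x y)" for x y
    using D bil by (simp_all add: cbilinear_map_def)
  have E: "D (E \<alpha>) = ?D (E \<alpha>)" if "\<alpha> \<in> roots h" for \<alpha>
    by (rule clinear_root_eqI[OF lin(1,2)]) (use that D gen in \<open>simp_all\<close>)
  have H: "D H = ?D H" if "H \<in> h" for H
    by (rule clinear_root_eqI[OF lin(1,2)]) (use that D gen HH in \<open>simp_all\<close>)
  show "D = ?D"
  proof
    fix x
    have "(\<lambda>x. D x y) = (\<lambda>x. ?D x y)" for y
      by (rule clinear_root_eqI[OF lin(3,4)]) (use fun_cong[OF E] fun_cong[OF H] in simp_all)
    then show "D x = ?D x" by (auto simp: fun_eq_iff)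
  qed
qed

text \<open>As \<open>tau\<close> is an automorphism, its composition with the adjoint action is a
  representation.\<close>

lemma tau_flat: "- [tau X, [tau Y, Z]\<^sub>L]\<^sub>L + [tau Y, [tau X, Z]\<^sub>L]\<^sub>L + [tau [X, Y]\<^sub>L, Z]\<^sub>L = 0"
  by (simp add: lie_derivation[of "tau X" "tau Y" Z] tau_bracket)

end

text \<open>Gaussian elimination by induction on the equations. Stated over any field: it serves
  complex scalars when functionals are represented and real scalars in the count that excludes
  opposite roots.\<close>

lemma underdetermined_system:
  fixes m :: "'j \<Rightarrow> 'i \<Rightarrow> 'f::field"
  assumes "finite J" "finite I" "card J < card I"
  obtains x where "\<And>j. j \<in> J \<Longrightarrow> (\<Sum>i\<in>I. m j i * x i) = 0" "\<exists>i\<in>I. x i \<noteq> 0"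
proof -
  have "\<exists>x. (\<forall>j\<in>J. (\<Sum>i\<in>I. m j i * x i) = 0) \<and> (\<exists>i\<in>I. x i \<noteq> 0)"
    using assms
  proof (induction J arbitrary: I m rule: finite_induct)
    case empty
    then have "I \<noteq> {}" by auto
    then show ?case by (intro exI[of _ "\<lambda>_. 1"]) auto
  next
    case (insert j J)
    show ?case
    proof (cases "\<forall>i\<in>I. m j i = 0")
      case True
      obtain x where "\<forall>j\<in>J. (\<Sum>i\<in>I. m j i * x i) = 0" "\<exists>i\<in>I. x i \<noteq> 0"
        using insert.IH[of I m] insert.prems insert.hyps by auto
      then show ?thesis using True by (intro exI[of _ x]) auto
    next
      case False
      then obtain p where p: "p \<in> I" "m j p \<noteq> 0" by blast
      have "card J < card (I - {p})" using insert.prems insert.hyps p by simp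
      then obtain x where x: "\<forall>j'\<in>J. (\<Sum>i\<in>I-{p}. (m j' i - m j' p * m j i / m j p) * x i) = 0"
          "\<exists>i\<in>I-{p}. x i \<noteq> 0"
        using insert.IH[of "I - {p}" "\<lambda>j' i. m j' i - m j' p * m j i / m j p"] insert.prems by auto
      \<comment> \<open>The value at the pivot p is the one that solves equation j.\<close>
      define y where "y = x(p := - (\<Sum>i\<in>I-{p}. m j i * x i) / m j p)"
      have s: "(\<Sum>i\<in>I. c i * y i) = (\<Sum>i\<in>I-{p}. c i * x i) - c p * (\<Sum>i\<in>I-{p}. m j i * x i) / m j p" for c
        using insert.prems(1) p(1) by (simp add: sum.remove[of I p] y_def)
      have "(\<Sum>i\<in>I. m j' i * y i) = 0" if "j' \<in> J" for j'
      proof -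
        have "(\<Sum>i\<in>I-{p}. (m j' i - m j' p * m j i / m j p) * x i) =
            (\<Sum>i\<in>I-{p}. m j' i * x i) - m j' p / m j p * (\<Sum>i\<in>I-{p}. m j i * x i)"
          unfolding sum_distrib_left
          by (simp add: left_diff_distrib sum_subtractf mult.assoc)
        then show ?thesis using x(1) that by (simp add: s)
      qed
      moreover have "(\<Sum>i\<in>I. m j i * y i) = 0" using p(2) by (simp add: s)
      moreover have "\<exists>i\<in>I. y i \<noteq> 0" using x(2) by (auto simp: y_def)
      ultimately show ?thesis by (intro exI[of _ y]) auto
    qed
  qed
  then show thesis using that by blast
qed

lemma subspace_basis:
  fixes W :: "'g::complex_lie_algebra set"
  assumes "semisimple TYPE('g)" "cvec.subspace W"
  obtains B where "finite B" "cvec.independent B" "cvec.span B = W"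
proof -
  obtain C :: "'g set" where C: "finite C" "cvec.span C = UNIV"
    using assms(1) unfolding semisimple_def by blast
  obtain B where B: "B \<subseteq> W" "cvec.independent B" "W \<subseteq> cvec.span B"
    using cvec.basis_exists[of W] by metis
  have "finite B" using cvec.independent_span_bound[OF C(1) B(2)] C(2) by auto
  moreover have "cvec.span B = W" using B assms(2) cvec.span_minimal by blast
  ultimately show thesis using that B by blast
qed

text \<open>The unknowns are the coordinates of x and a factor in front of f, one more than there
  are equations. Nondegeneracy shows that the factor of a nontrivial solution is not zero, and one
  divides by it.\<close>

lemma nondegenerate_represents:
  fixes W :: "'g::complex_lie_algebra set" and b :: "'g \<Rightarrow> 'g \<Rightarrow> complex"
  assumes ss: "semisimple TYPE('g)" and W: "cvec.subspace W"
    and bil: "cbilinear_form_on W W b"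
    and nd: "\<And>x. x \<in> W \<Longrightarrow> \<forall>y\<in>W. b x y = 0 \<Longrightarrow> x = 0"
    and f: "\<And>x y. x \<in> W \<Longrightarrow> y \<in> W \<Longrightarrow> f (x + y) = f x + f y" "\<And>c x. x \<in> W \<Longrightarrow> f (c *\<^sub>C x) = c * f x"
  obtains x where "x \<in> W" "\<And>y. y \<in> W \<Longrightarrow> b x y = f y"
proof -
  obtain B where B: "finite B" "cvec.independent B" "cvec.span B = W" using subspace_basis[OF ss W] .
  have BW: "B \<subseteq> W" using B(3) cvec.span_superset by blast
  have b: "x \<in> W \<Longrightarrow> x' \<in> W \<Longrightarrow> y \<in> W \<Longrightarrow> b (x + x') y = b x y + b x' y"
    "x \<in> W \<Longrightarrow> y \<in> W \<Longrightarrow> b (c *\<^sub>C x) y = c * b x y"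
    "x \<in> W \<Longrightarrow> y \<in> W \<Longrightarrow> y' \<in> W \<Longrightarrow> b x (y + y') = b x y + b x y'"
    "x \<in> W \<Longrightarrow> y \<in> W \<Longrightarrow> b x (c *\<^sub>C y) = c * b x y" for x x' y y' c
    using bil by (simp_all add: cbilinear_form_on_def)
  have ext: "F y = 0" if "\<And>y. y \<in> B \<Longrightarrow> F y = 0" "y \<in> W"
    "\<And>x y. x \<in> W \<Longrightarrow> y \<in> W \<Longrightarrow> F (x + y) = F x + F y" "\<And>c x. x \<in> W \<Longrightarrow> F (c *\<^sub>C x) = c * F x"
    for F :: "'g \<Rightarrow> complex" and y
  proof -
    have "cvec.subspace {y \<in> W. F y = 0}"
      using that(3,4) W that(4)[of 0 0] by (intro cvec.subspaceI) (auto simp: cvec.subspace_add cvec.subspace_scale cvec.subspace_0)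
    then have "cvec.span B \<subseteq> {y \<in> W. F y = 0}" using that(1) BW by (intro cvec.span_minimal) auto
    then show ?thesis using B(3) that(2) by blast
  qed
  \<comment> \<open>\<open>None\<close> indexes the extra unknown, the factor of f;
    \<open>Some x\<close> indexes the coordinate along the basis vector x.\<close>
  define m where "m y i = (case i of None \<Rightarrow> - f y | Some x \<Rightarrow> b x y)" for y i
  obtain x where x: "\<And>y. y \<in> B \<Longrightarrow> (\<Sum>i\<in>insert None (Some ` B). m y i * x i) = 0"
      and nz: "\<exists>i\<in>insert None (Some ` B). x i \<noteq> 0"
    by (rule underdetermined_system[of B "insert None (Some ` B)" m])
      (use B(1) in \<open>auto simp: card_image card_insert_if\<close>)
  have split: "(\<Sum>i\<in>insert None (Some ` B). g i) = g None + (\<Sum>v\<in>B. g (Some v))" for g :: "'g option \<Rightarrow> complex"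
    using B(1) by (subst sum.insert) (auto simp: sum.reindex)
  define v where "v = (\<Sum>u\<in>B. x (Some u) *\<^sub>C u)"
  have sumW: "(\<Sum>u\<in>C. c u *\<^sub>C u) \<in> W" if "C \<subseteq> B" for C c
    using that BW by (intro cvec.subspace_sum[OF W] cvec.subspace_scale[OF W]) auto
  have vW: "v \<in> W" unfolding v_def by (rule sumW) simp
  have b0: "b 0 y = 0" if "y \<in> W" for y
    using b(2)[of 0 y 0] that cvec.subspace_0[OF W] by simp
  have bv: "b v y = (\<Sum>u\<in>B. x (Some u) * b u y)" if y: "y \<in> W" for y
  proof -
    have "b (\<Sum>u\<in>C. x (Some u) *\<^sub>C u) y = (\<Sum>u\<in>C. x (Some u) * b u y)" if "C \<subseteq> B" for C
      using finite_subset[OF that B(1)] that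
    proof (induction C rule: finite_induct)
      case (insert u C)
      have u: "u \<in> W" "(\<Sum>u\<in>C. x (Some u) *\<^sub>C u) \<in> W" using insert.prems BW sumW by auto
      show ?case
        using insert b(1)[OF cvec.subspace_scale[OF W u(1)] u(2) y] b(2)[OF u(1) y] by simp
    qed (simp add: b0 y)
    then show ?thesis by (simp add: v_def)
  qed
  have eq: "b v y = x None * f y" if "y \<in> W" for y
  proof -
    have "b v y - x None * f y = 0"
    proof (rule ext[where F = "\<lambda>y. b v y - x None * f y"])
      show "b v y - x None * f y = 0" if "y \<in> B" for y
        using x[OF that] bv[of y] that BW by (auto simp: split m_def mult.commute)
    qed (simp_all add: that b(3,4) vW f algebra_simps)
    then show ?thesis by simp
  qed
  have "x None \<noteq> 0"
  proof
    assume n: "x None = 0"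
    then have "v = 0" using nd[OF vW] eq by simp
    then have "x (Some u) = 0" if "u \<in> B" for u
      using that B(1) cvec.independentD[OF B(2,1) subset_refl, of "\<lambda>u. x (Some u)"] by (simp add: v_def)
    then show False using nz n by auto
  qed
  then show thesis
    using that[of "inverse (x None) *\<^sub>C v"] b vW eq by (simp add: cvec.subspace_scale[OF W])
qed

section \<open>The Killing form and the real part of the Cartan subalgebra\<close>

context compatible_real_form
begin

lemma basis_exists: "\<exists>B :: 'g set. finite B \<and> cvec.independent B \<and> cvec.span B = UNIV"
  by (rule subspace_basis[OF semisimple cvec.subspace_UNIV]) blast

lemma trace_commute:
  assumes f: "clinear_map f" and g: "clinear_map (g :: 'g \<Rightarrow> 'g)"
  shows "ctrace (\<lambda>x. f (g x)) = ctrace (\<lambda>x. g (f x))"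
proof -
  define B :: "'g set" where "B = (SOME B. finite B \<and> cvec.independent B \<and> cvec.span B = UNIV)"
  have "finite B \<and> cvec.independent B \<and> cvec.span B = UNIV"
    unfolding B_def by (rule someI_ex) (rule basis_exists)
  then have B: "finite B" "cvec.independent B" "cvec.span B = UNIV" by auto
  let ?r = "cvec.representation B"
  have exp: "(\<Sum>c\<in>B. ?r x c *\<^sub>C c) = x" for x
    using cvec.sum_representation_eq[OF B(2) _ B(1) subset_refl] B(3) by blast
  have comp: "?r (f (g x)) b = (\<Sum>c\<in>B. ?r (g x) c * ?r (f c) b)" if f: "clinear_map f" for f g :: "'g \<Rightarrow> 'g" and x b
  proof -
    have "f (\<Sum>c\<in>C. ?r (g x) c *\<^sub>C c) = (\<Sum>c\<in>C. ?r (g x) c *\<^sub>C f c)" if "finite C" for C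
      using that clinear_mapD(2)[OF f, of 0 0] by (induction C rule: finite_induct) (simp_all add: clinear_mapD[OF f])
    from this[OF B(1)] have "f (g x) = (\<Sum>c\<in>B. ?r (g x) c *\<^sub>C f c)" by (simp add: exp)
    then show ?thesis
      by (simp add: cvec.representation_sum[OF B(2)] cvec.representation_scale[OF B(2)] B(3))
  qed
  have "ctrace (\<lambda>x. f (g x)) = (\<Sum>b\<in>B. \<Sum>c\<in>B. ?r (g b) c * ?r (f c) b)"
    unfolding ctrace_def Let_def B_def[symmetric] by (simp add: comp[OF f])
  also have "\<dots> = (\<Sum>b\<in>B. \<Sum>c\<in>B. ?r (f b) c * ?r (g c) b)"
    by (subst sum.swap) (simp add: mult.commute)
  also have "\<dots> = ctrace (\<lambda>x. g (f x))"
    unfolding ctrace_def Let_def B_def[symmetric] by (simp add: comp[OF g])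
  finally show ?thesis .
qed

lemma trace_linear:
  "ctrace (\<lambda>x. f x + g x) = ctrace f + ctrace (g :: 'g \<Rightarrow> 'g)" "ctrace (\<lambda>x. c *\<^sub>C f x) = c * ctrace f"
proof -
  define B :: "'g set" where "B = (SOME B. finite B \<and> cvec.independent B \<and> cvec.span B = UNIV)"
  have "finite B \<and> cvec.independent B \<and> cvec.span B = UNIV"
    unfolding B_def by (rule someI_ex) (rule basis_exists)
  then have B: "finite B" "cvec.independent B" "cvec.span B = UNIV" by auto
  show "ctrace (\<lambda>x. f x + g x) = ctrace f + ctrace g" "ctrace (\<lambda>x. c *\<^sub>C f x) = c * ctrace f"
    unfolding ctrace_def Let_def B_def[symmetric]
    by (simp_all add: cvec.representation_add[OF B(2)] cvec.representation_scale[OF B(2)] B(3) sum.distrib sum_distrib_left)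
qed

lemma ad_linear: "clinear_map (\<lambda>x. [y, x :: 'g]\<^sub>L)"
  by (rule clinear_mapI) (simp_all add: lie_linear)

lemma ad_ad_linear: "clinear_map (\<lambda>x. [y, [z, x :: 'g]\<^sub>L]\<^sub>L)"
  by (rule clinear_mapI) (simp_all add: lie_linear)

lemma killing_linear:
  "killing_form (x + y) z = killing_form x z + killing_form y (z :: 'g)"
  "killing_form (c *\<^sub>C x) z = c * killing_form x z"
  "killing_form x (c *\<^sub>C z) = c * killing_form x z"
  by (simp_all add: killing_form_def lie_linear trace_linear)

lemma killing_commute: "killing_form x y = killing_form y (x :: 'g)"
  unfolding killing_form_def by (rule trace_commute) (rule ad_linear)+

text \<open>Expanding both sides by the derivation rule leaves two triple products that are cyclic
  rotations of one another and so have the same trace.\<close>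

lemma killing_invariant: "killing_form [x, y]\<^sub>L z = killing_form x [y, z :: 'g]\<^sub>L"
proof -
  have t: "ctrace (\<lambda>v. [x, [y, [z, v]\<^sub>L]\<^sub>L]\<^sub>L) = ctrace (\<lambda>v. [[x, y]\<^sub>L, [z, v]\<^sub>L]\<^sub>L) + ctrace (\<lambda>v. [y, [x, [z, v]\<^sub>L]\<^sub>L]\<^sub>L)"
    unfolding trace_linear[symmetric] by (simp only: lie_derivation[of x y])
  have u: "ctrace (\<lambda>v. [x, [y, [z, v]\<^sub>L]\<^sub>L]\<^sub>L) = ctrace (\<lambda>v. [x, [[y, z]\<^sub>L, v]\<^sub>L]\<^sub>L) + ctrace (\<lambda>v. [x, [z, [y, v]\<^sub>L]\<^sub>L]\<^sub>L)"
    unfolding trace_linear[symmetric] by (simp only: lie_derivation[of y z] lie_add_right)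
  have "ctrace (\<lambda>v. [y, [x, [z, v]\<^sub>L]\<^sub>L]\<^sub>L) = ctrace (\<lambda>v. [x, [z, [y, v]\<^sub>L]\<^sub>L]\<^sub>L)"
    by (rule trace_commute[OF ad_linear ad_ad_linear])
  then show ?thesis using t u by (simp add: killing_form_def)
qed

lemma killing_Hv:
  assumes "\<alpha> \<in> roots h" "H \<in> h"
  shows "killing_form (Hv \<alpha>) H = \<alpha> H"
proof -
  have "killing_form (E \<alpha>) (E (- \<alpha>)) = 1" using weyl_basis assms by (simp add: weyl_basis_def)
  moreover have "[E (- \<alpha>), H]\<^sub>L = \<alpha> H *\<^sub>C E (- \<alpha>)" using assms by (simp add: bracket_E_H)
  ultimately show ?thesis by (simp add: killing_invariant killing_linear)
qed

lemma root_dual_eq: "\<alpha> \<in> roots h \<Longrightarrow> root_dual h \<alpha> = Hv \<alpha>"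
  using weyl_basis by (simp add: weyl_basis_def)

lemma Hv_nonzero: "\<alpha> \<in> roots h \<Longrightarrow> Hv \<alpha> \<noteq> 0"
proof
  assume \<alpha>: "\<alpha> \<in> roots h" and z: "Hv \<alpha> = 0"
  obtain H where "H \<in> h" "\<alpha> H \<noteq> 0" using \<alpha> by (rule root_nonzero)
  then show False using killing_Hv[OF \<alpha>, of H] killing_linear(2)[of 0 0 H] z by simp
qed

text \<open>An element of h killed by all roots commutes with every root vector, so these elements
  form a central ideal.\<close>

lemma roots_zero_imp_zero:
  assumes H: "H \<in> h" and z: "\<And>\<alpha>. \<alpha> \<in> roots h \<Longrightarrow> \<alpha> H = 0"
  shows "H = 0"
proof (rule abelian_ideal_zero)
  let ?Z = "{H \<in> h. \<forall>\<alpha>\<in>roots h. \<alpha> H = 0}"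
  show "cvec.subspace ?Z"
  proof (rule cvec.subspaceI)
    show "0 \<in> ?Z" using root_linear(2)[OF _ h_zero, of _ 0] h_zero by auto
  qed (auto simp: h_add h_scale root_linear)
  show "[x, y]\<^sub>L = 0" if "y \<in> ?Z" for x y
  proof -
    have "x \<in> {x. [x, y]\<^sub>L = 0}"
      by (rule root_induct) (use that in \<open>auto intro!: cvec.subspaceI simp: lie_linear h_abelian bracket_E_H\<close>)
    then show ?thesis by simp
  qed
  show "H \<in> ?Z" using assms by blast
qed

text \<open>The Killing form is nondegenerate on the span of the \<open>Hv \<alpha>\<close>, so some
  element of the span has the same Killing products with it as H. All roots vanish on the
  difference.\<close>

lemma span_Hv:
  assumes H: "H \<in> h"
  obtains z where "H = (\<Sum>\<alpha>\<in>roots h. z \<alpha> *\<^sub>C Hv \<alpha>)"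
proof -
  let ?S = "cvec.span (Hv ` roots h)"
  have Sh: "?S \<subseteq> h" using Hv_h h_subspace by (intro cvec.span_minimal) auto
  have nd: "x = 0" if "x \<in> h" "\<forall>y\<in>?S. killing_form x y = 0" for x
  proof (rule roots_zero_imp_zero[OF that(1)])
    fix \<alpha> assume \<alpha>: "\<alpha> \<in> roots h"
    then have "Hv \<alpha> \<in> ?S" by (intro cvec.span_base) simp
    then show "\<alpha> x = 0" using that(2) killing_Hv[OF \<alpha> that(1)] killing_commute[of x "Hv \<alpha>"] by simp
  qed
  have add_right: "killing_form x (y + z) = killing_form x y + killing_form x z" for x y z :: 'g
    by (simp add: killing_commute[of x] killing_linear)
  have "cbilinear_form_on ?S ?S killing_form"
    by (simp add: cbilinear_form_on_def killing_linear add_right)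
  then obtain x where x: "x \<in> ?S" "\<And>y. y \<in> ?S \<Longrightarrow> killing_form x y = killing_form H y"
    by (rule nondegenerate_represents[OF semisimple cvec.subspace_span _ , where f = "killing_form H"])
      (use nd Sh in \<open>auto simp: killing_linear add_right\<close>)
  have "H - x = 0"
  proof (rule nd)
    show "H - x \<in> h" using x(1) Sh H by (blast intro: h_diff)
    show "\<forall>y\<in>?S. killing_form (H - x) y = 0"
      using x(2) killing_linear(1)[of "H - x" x] by simp
  qed
  then have "H \<in> ?S" using x(1) by simp
  also have "?S = range (\<lambda>u. \<Sum>v\<in>Hv ` roots h. u v *\<^sub>C v)"
    by (rule cvec.span_finite) (simp add: finite_roots)
  finally obtain u where u: "H = (\<Sum>v\<in>Hv ` roots h. u v *\<^sub>C v)" by blast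
  \<comment> \<open>Passes from a sum over vectors to a sum over roots: the coefficient of v is
    shared equally among all roots with \<open>Hv \<alpha> = v\<close>, whether or not there are
    several.\<close>
  define c where "c v = complex_of_real (real (card {\<alpha> \<in> roots h. Hv \<alpha> = v}))" for v
  have "(\<Sum>\<alpha>\<in>roots h. (u (Hv \<alpha>) / c (Hv \<alpha>)) *\<^sub>C Hv \<alpha>) =
      (\<Sum>v\<in>Hv ` roots h. \<Sum>\<alpha> | \<alpha> \<in> roots h \<and> Hv \<alpha> = v. (u (Hv \<alpha>) / c (Hv \<alpha>)) *\<^sub>C Hv \<alpha>)"
    by (rule sum.image_gen[OF finite_roots])
  also have "\<dots> = (\<Sum>v\<in>Hv ` roots h. u v *\<^sub>C v)"
  proof (rule sum.cong[OF refl])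
    fix v assume "v \<in> Hv ` roots h"
    then have "card {\<alpha> \<in> roots h. Hv \<alpha> = v} \<noteq> 0" using finite_roots by auto
    then have nz: "c v \<noteq> 0" by (simp add: c_def)
    have "(\<Sum>\<alpha> | \<alpha> \<in> roots h \<and> Hv \<alpha> = v. (u (Hv \<alpha>) / c (Hv \<alpha>)) *\<^sub>C Hv \<alpha>) =
        (\<Sum>\<alpha> | \<alpha> \<in> roots h \<and> Hv \<alpha> = v. (u v / c v) *\<^sub>C v)"
      by (rule sum.cong) auto
    also have "\<dots> = (c v * (u v / c v)) *\<^sub>C v"
      by (simp add: cvec.sum_constant_scale c_def scaleC_scaleC)
    finally show "(\<Sum>\<alpha> | \<alpha> \<in> roots h \<and> Hv \<alpha> = v. (u (Hv \<alpha>) / c (Hv \<alpha>)) *\<^sub>C Hv \<alpha>) = u v *\<^sub>C v" using nz by simp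
  qed
  finally have "H = (\<Sum>\<alpha>\<in>roots h. (u (Hv \<alpha>) / c (Hv \<alpha>)) *\<^sub>C Hv \<alpha>)" by (simp only: u)
  then show thesis by (rule that)
qed

lemma sigma_Hv: "\<alpha> \<in> roots h \<Longrightarrow> \<sigma> (Hv \<alpha>) = - Hv \<alpha>"
  using lie_anti[of "E (- \<alpha>)" "E \<alpha>"]
  by (simp add: sigma_bracket sigma_E_neg lie_minus_minus lie_linear scaleC_scaleC a_neg a_square scaleC_one)

lemma sigma_sum: "\<sigma> (\<Sum>i\<in>I. f i) = (\<Sum>i\<in>I. \<sigma> (f i))"
  by (induction I rule: infinite_finite_induct) (simp_all add: sigma_add)

text \<open>Conjugation negates every \<open>Hv \<alpha>\<close>, so averaging a combination of them
  over \<sigma> leaves \<i> times the imaginary parts of the coefficients.\<close>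

lemma cartan_real_form: "h \<inter> rf = {\<i> *\<^sub>C H | H. H \<in> real_cartan h}"
proof (intro equalityI subsetI)
  fix H assume H: "H \<in> h \<inter> rf"
  then obtain z where z: "H = (\<Sum>\<alpha>\<in>roots h. z \<alpha> *\<^sub>C Hv \<alpha>)" using span_Hv by blast
  have i: "\<i> * complex_of_real (Im w) = w / 2 - cnj w / 2" for w by (simp add: complex_eq_iff)
  have "\<sigma> H = (\<Sum>\<alpha>\<in>roots h. (- cnj (z \<alpha>)) *\<^sub>C Hv \<alpha>)"
    unfolding z by (simp add: sigma_sum sigma_scale sigma_Hv cvec.scale_minus_right cong: sum.cong)
  then have "\<i> *\<^sub>C (\<Sum>\<alpha>\<in>roots h. complex_of_real (Im (z \<alpha>)) *\<^sub>C root_dual h \<alpha>) = (1/2) *\<^sub>C H + (1/2) *\<^sub>C \<sigma> H"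
    by (simp add: z cvec.scale_sum_right scaleC_scaleC root_dual_eq sum_subtractf[symmetric]
        cvec.scale_left_diff_distrib i sum_negf cong: sum.cong)
  also have "\<dots> = H" using H by (simp add: rf_iff scaleC_add_left[symmetric] scaleC_one)
  finally show "H \<in> {\<i> *\<^sub>C H | H. H \<in> real_cartan h}"
    unfolding real_cartan_def by (intro CollectI exI[of _ "\<Sum>\<alpha>\<in>roots h. complex_of_real (Im (z \<alpha>)) *\<^sub>C root_dual h \<alpha>"]
      exI[of _ "\<lambda>\<alpha>. Im (z \<alpha>)"] conjI refl TrueI) (rule sym)
next
  fix H assume "H \<in> {\<i> *\<^sub>C H | H. H \<in> real_cartan h}"
  then obtain c where c: "H = \<i> *\<^sub>C (\<Sum>\<alpha>\<in>roots h. complex_of_real (c \<alpha>) *\<^sub>C Hv \<alpha>)"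
    by (auto simp: real_cartan_def root_dual_eq cong: sum.cong)
  have "\<sigma> H = H" unfolding c
    by (simp add: sigma_sum sigma_scale sigma_Hv cvec.scale_minus_right cvec.scale_sum_right sum_negf cong: sum.cong)
  moreover have "H \<in> h" unfolding c by (intro h_scale cvec.subspace_sum[OF h_subspace] Hv_h)
  ultimately show "H \<in> h \<inter> rf" by (simp add: rf_iff)
qed

end

lemma cbilinear_form_on_sum:
  "(\<And>i. i \<in> I \<Longrightarrow> cbilinear_form_on V W (f i)) \<Longrightarrow> cbilinear_form_on V W (\<lambda>X Y. \<Sum>i\<in>I. f i X Y)"
  by (simp add: cbilinear_form_on_def sum.distrib sum_distrib_left cong: sum.cong)

lemma cbilinear_form_on_add:
  "cbilinear_form_on V W f \<Longrightarrow> cbilinear_form_on V W g \<Longrightarrow> cbilinear_form_on V W (\<lambda>X Y. f X Y + g X Y)"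
  by (simp add: cbilinear_form_on_def algebra_simps)

section \<open>Regular subalgebras\<close>

locale regular_pair = compatible_real_form h E N a \<sigma>
  for h :: "'g::complex_lie_algebra set" and E N a \<sigma> +
  fixes k :: "'g set" and \<epsilon> :: "'g \<Rightarrow> 'g \<Rightarrow> complex"
  assumes regular: "regular_subalgebra h \<sigma> k" and skew: "skew_hermitian_on \<sigma> k \<epsilon>"
begin

abbreviation R0 where "R0 \<equiv> roots_of h k"

lemma k_subspace: "cvec.subspace k"
  and k_bracket: "x \<in> k \<Longrightarrow> y \<in> k \<Longrightarrow> [x, y]\<^sub>L \<in> k"
  using regular by (simp_all add: regular_subalgebra_def lie_subalgebra_def)

lemma k_add: "x \<in> k \<Longrightarrow> y \<in> k \<Longrightarrow> x + y \<in> k"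
  and k_scale: "x \<in> k \<Longrightarrow> c *\<^sub>C x \<in> k"
  and k_zero: "0 \<in> k"
  using k_subspace by (simp_all add: cvec.subspace_add cvec.subspace_scale cvec.subspace_0)

lemma k_normal: "H \<in> h \<Longrightarrow> x \<in> k \<Longrightarrow> [H, x]\<^sub>L \<in> k"
proof -
  assume H: "H \<in> h" and x: "x \<in> k"
  have "[re_part H, x]\<^sub>L \<in> k" "[im_part H, x]\<^sub>L \<in> k"
    using regular h_parts[OF H] x by (simp_all add: regular_subalgebra_def)
  then have "[re_part H + \<i> *\<^sub>C im_part H, x]\<^sub>L \<in> k" by (simp add: lie_linear k_add k_scale)
  then show ?thesis by (simp add: re_im)
qed

lemma R0_iff: "\<alpha> \<in> R0 \<longleftrightarrow> \<alpha> \<in> roots h \<and> E \<alpha> \<in> k"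
proof (cases "\<alpha> \<in> roots h")
  case True
  have "E \<alpha> \<in> range (\<lambda>c. c *\<^sub>C E \<alpha>)" by (rule range_eqI[of _ _ 1]) (simp add: scaleC_one)
  then show ?thesis using True k_scale[of "E \<alpha>"] by (auto simp: roots_of_def root_space_E)
qed (simp add: roots_of_def)

lemma R0_roots: "\<alpha> \<in> R0 \<Longrightarrow> \<alpha> \<in> roots h"
  and R0_E: "\<alpha> \<in> R0 \<Longrightarrow> E \<alpha> \<in> k"
  by (simp_all add: R0_iff)

lemma finite_R0: "finite R0"
  using finite_subset[OF _ finite_roots] R0_roots by blast

definition kbar where "kbar = \<sigma> ` k"

lemma kbar_iff: "x \<in> kbar \<longleftrightarrow> \<sigma> x \<in> k"
  unfolding kbar_def by (metis image_iff sigma_sigma)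

lemma expand: "pr x + (\<Sum>\<alpha>\<in>roots h. om \<alpha> x *\<^sub>C E \<alpha>) = x"
  using components(9)[of x] by (rule sym)

lemma kbar_subspace: "cvec.subspace (kbar)"
  by (rule cvec.subspaceI) (simp_all add: kbar_iff sigma_add sigma_scale k_add k_scale k_zero)

lemma kbar_E: "\<alpha> \<in> roots h \<Longrightarrow> E (- \<alpha>) \<in> kbar \<longleftrightarrow> \<alpha> \<in> R0"
proof -
  assume \<alpha>: "\<alpha> \<in> roots h"
  have "\<sigma> (E (- \<alpha>)) = (- complex_of_real (a \<alpha>)) *\<^sub>C E \<alpha>" using \<alpha> by (simp add: sigma_E_neg a_neg)
  moreover have "(- complex_of_real (a \<alpha>)) *\<^sub>C E \<alpha> \<in> k \<longleftrightarrow> E \<alpha> \<in> k"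
  proof
    show "E \<alpha> \<in> k" if "(- complex_of_real (a \<alpha>)) *\<^sub>C E \<alpha> \<in> k"
      using k_scale[OF that, of "- complex_of_real (a \<alpha>)"] \<alpha> by (simp add: scaleC_scaleC a_square scaleC_one)
  qed (rule k_scale)
  ultimately show ?thesis using \<alpha> by (simp add: kbar_iff R0_iff)
qed

lemma kbar_normal: "H \<in> h \<Longrightarrow> x \<in> kbar \<Longrightarrow> [H, x]\<^sub>L \<in> kbar"
  by (simp add: kbar_iff sigma_bracket k_normal h_sigma)

lemma sigma_kh_iff: "x \<in> \<sigma> ` (k \<inter> h) \<longleftrightarrow> x \<in> kbar \<and> x \<in> h"
  proof
  show "x \<in> \<sigma> ` (k \<inter> h)" if "x \<in> kbar \<and> x \<in> h"
    using that h_sigma sigma_sigma[of x] unfolding kbar_iff by (metis IntI image_eqI)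
qed (auto simp: kbar_iff h_sigma)

lemma k_components:
  assumes "x \<in> k"
  shows "pr x \<in> k" "\<alpha> \<in> roots h \<Longrightarrow> om \<alpha> x \<noteq> 0 \<Longrightarrow> \<alpha> \<in> R0"
proof -
  have c: "pr x \<in> k \<and> (\<forall>\<alpha>\<in>roots h. om \<alpha> x *\<^sub>C E \<alpha> \<in> k)"
  proof (rule weight_components[OF k_subspace k_normal finite_roots order_refl components(3)])
    show "pr x + (\<Sum>\<alpha>\<in>roots h. om \<alpha> x *\<^sub>C E \<alpha>) \<in> k" unfolding expand by (rule assms)
  qed
  then show "pr x \<in> k" by blast
  assume \<alpha>: "\<alpha> \<in> roots h" "om \<alpha> x \<noteq> 0"
  then show "\<alpha> \<in> R0"
    using c k_scale[of "om \<alpha> x *\<^sub>C E \<alpha>" "inverse (om \<alpha> x)"] by (simp add: R0_iff scaleC_scaleC scaleC_one)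
qed

lemma kbar_components:
  assumes "x \<in> kbar"
  shows "pr x \<in> kbar" "\<alpha> \<in> roots h \<Longrightarrow> om \<alpha> x \<noteq> 0 \<Longrightarrow> - \<alpha> \<in> R0"
proof -
  have c: "pr x \<in> kbar \<and> (\<forall>\<alpha>\<in>roots h. om \<alpha> x *\<^sub>C E \<alpha> \<in> kbar)"
  proof (rule weight_components[OF kbar_subspace kbar_normal finite_roots order_refl components(3)])
    show "pr x + (\<Sum>\<alpha>\<in>roots h. om \<alpha> x *\<^sub>C E \<alpha>) \<in> kbar" unfolding expand by (rule assms)
  qed
  then show "pr x \<in> kbar" by blast
  assume \<alpha>: "\<alpha> \<in> roots h" "om \<alpha> x \<noteq> 0"
  then have "E (- (- \<alpha>)) \<in> kbar"
    using c cvec.subspace_scale[OF kbar_subspace, of "om \<alpha> x *\<^sub>C E \<alpha>" "inverse (om \<alpha> x)"]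
    by (simp add: scaleC_scaleC scaleC_one)
  then show "- \<alpha> \<in> R0" using kbar_E[OF roots_neg[OF \<alpha>(1)]] by simp
qed

lemma k_induct:
  assumes "cvec.subspace S" "\<And>H. H \<in> k \<Longrightarrow> H \<in> h \<Longrightarrow> H \<in> S" "\<And>\<alpha>. \<alpha> \<in> R0 \<Longrightarrow> E \<alpha> \<in> S" "x \<in> k"
  shows "x \<in> S"
proof -
  have "om \<alpha> x *\<^sub>C E \<alpha> \<in> S" if "\<alpha> \<in> roots h" for \<alpha>
    using k_components(2)[OF assms(4) that] cvec.subspace_scale[OF assms(1) assms(3)]
      cvec.subspace_0[OF assms(1)] by (cases "om \<alpha> x = 0") auto
  then have "pr x + (\<Sum>\<alpha>\<in>roots h. om \<alpha> x *\<^sub>C E \<alpha>) \<in> S"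
    using assms(2)[OF k_components(1)[OF assms(4)] components(3)]
    by (intro cvec.subspace_add[OF assms(1)] cvec.subspace_sum[OF assms(1)])
  then show ?thesis by (simp only: expand)
qed

lemma kbar_induct:
  assumes "cvec.subspace S" "\<And>H. H \<in> kbar \<Longrightarrow> H \<in> h \<Longrightarrow> H \<in> S" "\<And>\<alpha>. \<alpha> \<in> R0 \<Longrightarrow> E (- \<alpha>) \<in> S" "x \<in> kbar"
  shows "x \<in> S"
proof -
  have "om \<alpha> x *\<^sub>C E \<alpha> \<in> S" if "\<alpha> \<in> roots h" for \<alpha>
    using kbar_components(2)[OF assms(4) that] cvec.subspace_scale[OF assms(1) assms(3)[of "- \<alpha>"]]
      cvec.subspace_0[OF assms(1)] by (cases "om \<alpha> x = 0") auto
  then have "pr x + (\<Sum>\<alpha>\<in>roots h. om \<alpha> x *\<^sub>C E \<alpha>) \<in> S"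
    using assms(2)[OF kbar_components(1)[OF assms(4)] components(3)]
    by (intro cvec.subspace_add[OF assms(1)] cvec.subspace_sum[OF assms(1)])
  then show ?thesis by (simp only: expand)
qed

lemma tau_kbar: "X \<in> k \<Longrightarrow> Y \<in> kbar \<Longrightarrow> [tau X, Y]\<^sub>L \<in> kbar"
proof -
  assume X: "X \<in> k" and Y: "Y \<in> kbar"
  have br: "[x, y]\<^sub>L \<in> kbar" if "x \<in> kbar" "y \<in> kbar" for x y
    using that by (simp add: kbar_iff sigma_bracket k_bracket)
  note sub = kbar_subspace
  have "X \<in> {X. [tau X, Y]\<^sub>L \<in> kbar}"
  proof (rule k_induct[OF _ _ _ X])
    show "cvec.subspace {X. [tau X, Y]\<^sub>L \<in> kbar}"
      by (rule cvec.subspaceI)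
        (simp_all add: tau_linear tau_zero lie_linear cvec.subspace_add[OF sub] cvec.subspace_scale[OF sub] cvec.subspace_0[OF sub])
    show "H \<in> {X. [tau X, Y]\<^sub>L \<in> kbar}" if "H \<in> k" "H \<in> h" for H
      using kbar_normal[OF that(2) Y] by (simp add: tau_h that lie_minus_left cvec.subspace_neg[OF sub])
    show "E \<alpha> \<in> {X. [tau X, Y]\<^sub>L \<in> kbar}" if \<alpha>: "\<alpha> \<in> R0" for \<alpha>
      using br[OF _ Y, of "E (- \<alpha>)"] kbar_E[OF R0_roots[OF \<alpha>]] \<alpha>
      by (simp add: tau_E R0_roots lie_minus_left lie_linear cvec.subspace_neg[OF sub] cvec.subspace_scale[OF sub])
  qed
  then show ?thesis by simp
qed

definition cartan_spans :: bool where
  "cartan_spans \<longleftrightarrow> {X + Y | X Y. X \<in> k \<inter> h \<and> Y \<in> \<sigma> ` (k \<inter> h)} = h"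

text \<open>Both subspaces contain the weight components of their elements, and \<open>kbar\<close>
  has the negatives of R0 as roots. So the sum can be tested on the Cartan subalgebra and on each
  root space separately.\<close>

lemma sum_iff:
  "{X + Y | X Y. X \<in> k \<and> Y \<in> kbar} = UNIV \<longleftrightarrow> cartan_spans \<and> R0 \<union> uminus ` R0 = roots h"
proof
  assume sum: "{X + Y | X Y. X \<in> k \<and> Y \<in> kbar} = UNIV"
  have "H \<in> {X + Y | X Y. X \<in> k \<inter> h \<and> Y \<in> \<sigma> ` (k \<inter> h)}" if H: "H \<in> h" for H
  proof -
    have "H \<in> {X + Y | X Y. X \<in> k \<and> Y \<in> kbar}" unfolding sum by (rule UNIV_I)
    then obtain X Y where XY: "X \<in> k" "Y \<in> kbar" "H = X + Y" by blast
    then have "H = pr X + pr Y" using components(4)[OF H] pr_linear(1)[of X Y] by simp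
    moreover have "pr X \<in> k \<inter> h" "pr Y \<in> \<sigma> ` (k \<inter> h)"
      by (simp_all add: sigma_kh_iff k_components kbar_components XY components(3))
    ultimately show ?thesis by blast
  qed
  moreover have "X + Y \<in> h" if "X \<in> k \<inter> h" "Y \<in> \<sigma> ` (k \<inter> h)" for X Y
    using that by (auto simp: sigma_kh_iff h_add)
  ultimately have "cartan_spans" unfolding cartan_spans_def by blast
  moreover have "\<alpha> \<in> R0 \<or> - \<alpha> \<in> R0" if \<alpha>: "\<alpha> \<in> roots h" for \<alpha>
  proof -
    have "E \<alpha> \<in> {X + Y | X Y. X \<in> k \<and> Y \<in> kbar}" unfolding sum by (rule UNIV_I)
    then obtain X Y where XY: "X \<in> k" "Y \<in> kbar" "E \<alpha> = X + Y" by blast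
    then have "om \<alpha> X + om \<alpha> Y = 1" using components(7)[OF \<alpha> \<alpha>] om_linear(1)[OF \<alpha>, of X Y] by simp
    then have "om \<alpha> X \<noteq> 0 \<or> om \<alpha> Y \<noteq> 0" by auto
    then show ?thesis using k_components(2)[OF XY(1) \<alpha>] kbar_components(2)[OF XY(2) \<alpha>] by blast
  qed
  ultimately show "cartan_spans \<and> R0 \<union> uminus ` R0 = roots h"
    using R0_roots roots_neg by (fastforce simp: image_iff intro: rev_bexI[of "- _"])
next
  assume r: "cartan_spans \<and> R0 \<union> uminus ` R0 = roots h"
  let ?S = "{X + Y | X Y. X \<in> k \<and> Y \<in> kbar}"
  have "x \<in> ?S" for x
  proof (rule root_induct)
    show "cvec.subspace ?S" by (rule cvec.subspace_sums[OF k_subspace kbar_subspace])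
    show "H \<in> ?S" if "H \<in> h" for H
      using that r unfolding cartan_spans_def sigma_kh_iff by blast
    show "E \<alpha> \<in> ?S" if \<alpha>: "\<alpha> \<in> roots h" for \<alpha>
    proof -
      consider "\<alpha> \<in> R0" | "- \<alpha> \<in> R0" using r \<alpha> by fastforce
      then show ?thesis
      proof cases
        case 1
        then have "E \<alpha> + 0 \<in> ?S" using R0_E cvec.subspace_0[OF kbar_subspace] by blast
        then show ?thesis by simp
      next
        case 2
        then have "E \<alpha> \<in> kbar" using kbar_E[OF roots_neg[OF \<alpha>]] by simp
        then have "0 + E \<alpha> \<in> ?S" using k_zero by blast
        then show ?thesis by simp
      qed
    qed
  qed
  then show "?S = UNIV" by blast
qed

lemma R0_closed: "\<alpha> \<in> R0 \<Longrightarrow> \<beta> \<in> R0 \<Longrightarrow> \<alpha> + \<beta> \<in> roots h \<Longrightarrow> \<alpha> + \<beta> \<in> R0"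
proof -
  assume \<alpha>: "\<alpha> \<in> R0" and \<beta>: "\<beta> \<in> R0" and s: "\<alpha> + \<beta> \<in> roots h"
  have "complex_of_real (N \<alpha> \<beta>) *\<^sub>C E (\<alpha> + \<beta>) \<in> k"
    using k_bracket[OF R0_E[OF \<alpha>] R0_E[OF \<beta>]] bracket_E_root(1)[OF R0_roots[OF \<alpha>] R0_roots[OF \<beta>] s] by simp
  from k_scale[OF this, of "inverse (complex_of_real (N \<alpha> \<beta>))"]
  show ?thesis using s a_sum(1)[OF R0_roots[OF \<alpha>] R0_roots[OF \<beta>] s] by (simp add: R0_iff scaleC_scaleC scaleC_one)
qed

lemma positive_iff:
  "positive_root_system (roots h) R0 \<longleftrightarrow> R0 \<union> uminus ` R0 = roots h \<and> R0 \<inter> uminus ` R0 = {}"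
  using R0_closed by (auto simp: positive_root_system_def)

lemma eps_bilinear:
  "X \<in> k \<Longrightarrow> X' \<in> k \<Longrightarrow> Y \<in> kbar \<Longrightarrow> \<epsilon> (X + X') Y = \<epsilon> X Y + \<epsilon> X' Y"
  "X \<in> k \<Longrightarrow> Y \<in> kbar \<Longrightarrow> \<epsilon> (c *\<^sub>C X) Y = c * \<epsilon> X Y"
  "X \<in> k \<Longrightarrow> Y \<in> kbar \<Longrightarrow> Y' \<in> kbar \<Longrightarrow> \<epsilon> X (Y + Y') = \<epsilon> X Y + \<epsilon> X Y'"
  "X \<in> k \<Longrightarrow> Y \<in> kbar \<Longrightarrow> \<epsilon> X (c *\<^sub>C Y) = c * \<epsilon> X Y"
  using skew by (simp_all add: skew_hermitian_on_def cbilinear_form_on_def flip: kbar_def)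

lemma eps_skew: "X \<in> k \<Longrightarrow> Y \<in> kbar \<Longrightarrow> \<epsilon> X Y = - cnj (\<epsilon> (\<sigma> Y) (\<sigma> X))"
proof -
  assume "X \<in> k" "Y \<in> kbar"
  then have "\<epsilon> X (\<sigma> (\<sigma> Y)) + cnj (\<epsilon> (\<sigma> Y) (\<sigma> X)) = 0"
    using skew unfolding skew_hermitian_on_def kbar_iff by blast
  then show ?thesis by (simp add: eq_neg_iff_add_eq_0)
qed

lemma eps_zero: "Y \<in> kbar \<Longrightarrow> \<epsilon> 0 Y = 0" "X \<in> k \<Longrightarrow> \<epsilon> X 0 = 0"
  using eps_bilinear(2)[of 0 Y 0] eps_bilinear(4)[of X 0 0] k_zero cvec.subspace_0[OF kbar_subspace] by simp_all

lemma eps_minus: "X \<in> k \<Longrightarrow> Y \<in> kbar \<Longrightarrow> \<epsilon> X (- Y) = - \<epsilon> X Y"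
  using eps_bilinear(4)[of X Y "-1"] by simp

lemma form_eqI:
  assumes G: "cbilinear_form_on k kbar G" and F: "cbilinear_form_on k (kbar) F"
    and "\<And>H H'. H \<in> k \<inter> h \<Longrightarrow> H' \<in> kbar \<inter> h \<Longrightarrow> G H H' = F H H'"
    and "\<And>H \<beta>. H \<in> k \<inter> h \<Longrightarrow> \<beta> \<in> R0 \<Longrightarrow> G H (E (- \<beta>)) = F H (E (- \<beta>))"
    and "\<And>H \<alpha>. H \<in> kbar \<inter> h \<Longrightarrow> \<alpha> \<in> R0 \<Longrightarrow> G (E \<alpha>) H = F (E \<alpha>) H"
    and "\<And>\<alpha> \<beta>. \<alpha> \<in> R0 \<Longrightarrow> \<beta> \<in> R0 \<Longrightarrow> G (E \<alpha>) (E (- \<beta>)) = F (E \<alpha>) (E (- \<beta>))"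
    and X: "X \<in> k" and Y: "Y \<in> kbar"
  shows "G X Y = F X Y"
proof -
  have lin: "X \<in> k \<Longrightarrow> X' \<in> k \<Longrightarrow> Y \<in> kbar \<Longrightarrow> F (X + X') Y = F X Y + F X' Y"
    "X \<in> k \<Longrightarrow> Y \<in> kbar \<Longrightarrow> F (c *\<^sub>C X) Y = c * F X Y"
    "X \<in> k \<Longrightarrow> Y \<in> kbar \<Longrightarrow> Y' \<in> kbar \<Longrightarrow> F X (Y + Y') = F X Y + F X Y'"
    "X \<in> k \<Longrightarrow> Y \<in> kbar \<Longrightarrow> F X (c *\<^sub>C Y) = c * F X Y" for X X' Y Y' c
    using F by (simp_all add: cbilinear_form_on_def)
  have linG: "X \<in> k \<Longrightarrow> X' \<in> k \<Longrightarrow> Y \<in> kbar \<Longrightarrow> G (X + X') Y = G X Y + G X' Y"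
    "X \<in> k \<Longrightarrow> Y \<in> kbar \<Longrightarrow> G (c *\<^sub>C X) Y = c * G X Y"
    "X \<in> k \<Longrightarrow> Y \<in> kbar \<Longrightarrow> Y' \<in> kbar \<Longrightarrow> G X (Y + Y') = G X Y + G X Y'"
    "X \<in> k \<Longrightarrow> Y \<in> kbar \<Longrightarrow> G X (c *\<^sub>C Y) = c * G X Y" for X X' Y Y' c
    using G by (simp_all add: cbilinear_form_on_def)
  note kbar_closed = cvec.subspace_add[OF kbar_subspace] cvec.subspace_scale[OF kbar_subspace] cvec.subspace_0[OF kbar_subspace]
  have F0: "F 0 Y = G 0 Y" if "Y \<in> kbar" for Y using lin(2)[OF k_zero that, of 0] linG(2)[OF k_zero that, of 0] by simp
  have F1: "F X 0 = G X 0" if "X \<in> k" for X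
    using lin(4)[OF that kbar_closed(3), of 0] linG(4)[OF that kbar_closed(3), of 0] by simp
  have sub2: "cvec.subspace {Y \<in> kbar. G X Y = F X Y}" if X: "X \<in> k" for X
    by (rule cvec.subspaceI) (simp_all add: lin linG F1 kbar_closed X)
  have "X \<in> {X \<in> k. \<forall>Y\<in>kbar. G X Y = F X Y}"
  proof (rule k_induct[OF _ _ _ X])
    show "cvec.subspace {X \<in> k. \<forall>Y\<in>kbar. G X Y = F X Y}"
      by (rule cvec.subspaceI) (simp_all add: lin linG F0 k_add k_scale k_zero)
    show "H \<in> {X \<in> k. \<forall>Y\<in>kbar. G X Y = F X Y}" if H: "H \<in> k" "H \<in> h" for H
    proof (intro CollectI conjI ballI H(1))
      fix Y assume Y: "Y \<in> kbar"
      have "Y \<in> {Y \<in> kbar. G H Y = F H Y}"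
        by (rule kbar_induct[OF sub2[OF H(1)] _ _ Y]) (use assms(3,4) H R0_roots kbar_E in auto)
      then show "G H Y = F H Y" by blast
    qed
    show "E \<alpha> \<in> {X \<in> k. \<forall>Y\<in>kbar. G X Y = F X Y}" if \<alpha>: "\<alpha> \<in> R0" for \<alpha>
    proof (intro CollectI conjI ballI R0_E[OF \<alpha>])
      fix Y assume Y: "Y \<in> kbar"
      have "Y \<in> {Y \<in> kbar. G (E \<alpha>) Y = F (E \<alpha>) Y}"
        by (rule kbar_induct[OF sub2[OF R0_E[OF \<alpha>]] _ _ Y]) (use assms(5,6) \<alpha> R0_roots kbar_E in auto)
      then show "G (E \<alpha>) Y = F (E \<alpha>) Y" by blast
    qed
  qed
  then show ?thesis using Y by blast
qed

text \<open>The sum over the roots in the asserted form of \<open>\<epsilon>\<close> is the coboundary of the functional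
  below: it equals \<open>coboundary \<mu> [tau X, Y]\<close>.\<close>

definition coboundary :: "(('g \<Rightarrow> complex) \<Rightarrow> real) \<Rightarrow> 'g \<Rightarrow> complex" where
  "coboundary \<mu> x = (\<Sum>\<beta>\<in>R0. complex_of_real (\<mu> \<beta>) * om (- \<beta>) x)"

lemma coboundary_linear:
  "coboundary \<mu> (x + y) = coboundary \<mu> x + coboundary \<mu> y" "coboundary \<mu> (c *\<^sub>C x) = c * coboundary \<mu> x"
  by (simp_all add: coboundary_def om_linear R0_roots algebra_simps sum.distrib sum_distrib_left cong: sum.cong)

lemma coboundary_minus: "coboundary \<mu> (- x) = - coboundary \<mu> x"
  using coboundary_linear(2)[of \<mu> "-1" x] by simp

lemma coboundary_h: "H \<in> h \<Longrightarrow> coboundary \<mu> H = 0"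
  by (simp add: coboundary_def components R0_roots cong: sum.cong)

lemma coboundary_E: "\<beta> \<in> roots h \<Longrightarrow> coboundary \<mu> (E (- \<beta>)) = (if \<beta> \<in> R0 then complex_of_real (\<mu> \<beta>) else 0)"
  using finite_R0
  by (simp add: coboundary_def components R0_roots if_distrib[of "\<lambda>c. _ * c"] cong: sum.cong if_cong)

definition standard_form :: "(('g \<Rightarrow> complex) \<Rightarrow> real) \<Rightarrow> 'g \<Rightarrow> 'g \<Rightarrow> complex" where
  "standard_form \<mu> X Y =
    (\<Sum>\<alpha>\<in>R0. complex_of_real (\<mu> \<alpha>) *
       (root_ext h E \<alpha> X * om (- \<alpha>) Y - complex_of_real (a \<alpha>) * om \<alpha> X * root_ext h E \<alpha> Y))
    + (\<Sum>(\<alpha>, \<beta>) \<in> {(\<alpha>, \<beta>). \<alpha> \<in> R0 \<and> \<beta> \<in> R0 \<and> \<alpha> + \<beta> \<in> R0}.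
         complex_of_real (a \<alpha> * \<mu> (\<alpha> + \<beta>) * N \<alpha> \<beta>) * (om \<alpha> X * om (- \<beta>) Y))"

lemma standard_form_bilinear: "cbilinear_form_on k (kbar) (standard_form \<mu>)"
proof -
  have e: "root_ext h E \<alpha> (x + y) = root_ext h E \<alpha> x + root_ext h E \<alpha> y"
    "root_ext h E \<alpha> (c *\<^sub>C x) = c * root_ext h E \<alpha> x" if "\<alpha> \<in> R0" for \<alpha> x y c
    using R0_roots[OF that] by (simp_all add: components pr_linear root_linear)
  show ?thesis
    unfolding standard_form_def
    by (intro cbilinear_form_on_add cbilinear_form_on_sum)
      (auto simp: cbilinear_form_on_def e om_linear R0_roots algebra_simps)
qed

end

section \<open>Sufficiency: forms of the standard shape satisfy the cocycle condition\<close>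

context regular_pair
begin

lemma eps_form: "cbilinear_form_on k kbar \<epsilon>"
  using skew by (simp add: skew_hermitian_on_def kbar_def)

lemma pr_E_root: "\<alpha> \<in> roots h \<Longrightarrow> \<beta> \<in> roots h \<Longrightarrow> root_ext h E \<alpha> (E \<beta>) = 0"
  using root_linear(2)[OF _ h_zero, of \<alpha> 0] by (simp add: components)

lemma standard_form_values:
  "H \<in> h \<Longrightarrow> H' \<in> h \<Longrightarrow> standard_form \<mu> H H' = 0"
  "H \<in> h \<Longrightarrow> \<beta> \<in> R0 \<Longrightarrow> standard_form \<mu> H (E (- \<beta>)) = complex_of_real (\<mu> \<beta>) * \<beta> H"
  "H \<in> h \<Longrightarrow> \<alpha> \<in> R0 \<Longrightarrow> standard_form \<mu> (E \<alpha>) H = - complex_of_real (a \<alpha> * \<mu> \<alpha>) * \<alpha> H"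
  "\<alpha> \<in> R0 \<Longrightarrow> \<beta> \<in> R0 \<Longrightarrow> standard_form \<mu> (E \<alpha>) (E (- \<beta>)) =
     (if \<alpha> + \<beta> \<in> R0 then complex_of_real (a \<alpha> * \<mu> (\<alpha> + \<beta>) * N \<alpha> \<beta>) else 0)"
proof -
  let ?P = "{(\<alpha>, \<beta>). \<alpha> \<in> R0 \<and> \<beta> \<in> R0 \<and> \<alpha> + \<beta> \<in> R0}"
  have fin: "finite ?P"
    by (rule finite_subset[of _ "R0 \<times> R0"]) (use finite_R0 in auto)
  have z: "(\<Sum>(\<alpha>, \<beta>)\<in>?P. c \<alpha> \<beta> * (om \<alpha> X * om (- \<beta>) Y)) = 0" if "X \<in> h \<or> Y \<in> h" for c X Y
    by (rule sum.neutral) (use that in \<open>auto simp: components R0_roots\<close>)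
  show "standard_form \<mu> H H' = 0" if "H \<in> h" "H' \<in> h"
    using that by (simp add: standard_form_def z components R0_roots cong: sum.cong)
  show "standard_form \<mu> H (E (- \<beta>)) = complex_of_real (\<mu> \<beta>) * \<beta> H" if "H \<in> h" "\<beta> \<in> R0"
    using that finite_R0
    by (simp add: standard_form_def z pr_E_root components R0_roots if_distrib[of "\<lambda>c. _ * c"] cong: sum.cong if_cong)
  show "standard_form \<mu> (E \<alpha>) H = - complex_of_real (a \<alpha> * \<mu> \<alpha>) * \<alpha> H" if "H \<in> h" "\<alpha> \<in> R0"
  proof -
    have "standard_form \<mu> (E \<alpha>) H = (\<Sum>\<beta>\<in>R0. if \<beta> = \<alpha> then - complex_of_real (a \<alpha> * \<mu> \<alpha>) * \<alpha> H else 0)"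
      unfolding standard_form_def using that
      by (simp add: z) (rule sum.cong, auto simp: pr_E_root components R0_roots)
    then show ?thesis using that(2) finite_R0 by simp
  qed
  show "standard_form \<mu> (E \<alpha>) (E (- \<beta>)) =
     (if \<alpha> + \<beta> \<in> R0 then complex_of_real (a \<alpha> * \<mu> (\<alpha> + \<beta>) * N \<alpha> \<beta>) else 0)" if ab: "\<alpha> \<in> R0" "\<beta> \<in> R0"
  proof -
    have "standard_form \<mu> (E \<alpha>) (E (- \<beta>)) =
        (\<Sum>p\<in>?P. if p = (\<alpha>, \<beta>) then complex_of_real (a \<alpha> * \<mu> (\<alpha> + \<beta>) * N \<alpha> \<beta>) else 0)"
      unfolding standard_form_def using ab
      by (simp add: pr_E_root R0_roots cong: sum.cong) (rule sum.cong, auto simp: components R0_roots split: if_splits)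
    also have "\<dots> = (if (\<alpha>, \<beta>) \<in> ?P then complex_of_real (a \<alpha> * \<mu> (\<alpha> + \<beta>) * N \<alpha> \<beta>) else 0)"
      by (rule sum.delta[OF fin])
    finally show ?thesis using ab by simp
  qed
qed

text \<open>Both sides are bilinear, so weight vectors suffice. The double sum in the standard form
  arises from brackets of root vectors, the simple sum from brackets with the Cartan
  subalgebra.\<close>

lemma coboundary_standard:
  assumes X: "X \<in> k" and Y: "Y \<in> kbar"
  shows "coboundary \<mu> [tau X, Y]\<^sub>L = standard_form \<mu> X Y"
proof (rule form_eqI[OF _ standard_form_bilinear _ _ _ _ X Y])
  show "cbilinear_form_on k kbar (\<lambda>X Y. coboundary \<mu> [tau X, Y]\<^sub>L)"
    by (simp add: cbilinear_form_on_def tau_linear lie_linear coboundary_linear)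
  show "coboundary \<mu> [tau H, H']\<^sub>L = standard_form \<mu> H H'" if "H \<in> k \<inter> h" "H' \<in> kbar \<inter> h" for H H'
    using that by (simp add: standard_form_values tau_h lie_minus_left h_abelian coboundary_h h_zero)
  show "coboundary \<mu> [tau H, E (- \<beta>)]\<^sub>L = standard_form \<mu> H (E (- \<beta>))" if "H \<in> k \<inter> h" "\<beta> \<in> R0" for H \<beta>
    using that by (simp add: standard_form_values tau_h lie_minus_left bracket_H_E R0_roots coboundary_linear coboundary_E)
  show "coboundary \<mu> [tau (E \<alpha>), H]\<^sub>L = standard_form \<mu> (E \<alpha>) H" if "H \<in> kbar \<inter> h" "\<alpha> \<in> R0" for H \<alpha>
    using that by (simp add: standard_form_values tau_E lie_minus_left lie_linear bracket_E_H R0_roots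
      coboundary_linear coboundary_minus coboundary_E)
  show "coboundary \<mu> [tau (E \<alpha>), E (- \<beta>)]\<^sub>L = standard_form \<mu> (E \<alpha>) (E (- \<beta>))" if \<alpha>: "\<alpha> \<in> R0" and \<beta>: "\<beta> \<in> R0" for \<alpha> \<beta>
  proof -
    have s: "- \<alpha> + - \<beta> = - (\<alpha> + \<beta>)" by (simp add: fun_eq_iff)
    note ra = R0_roots[OF \<alpha>] and rb = R0_roots[OF \<beta>]
    have l: "coboundary \<mu> [tau (E \<alpha>), E (- \<beta>)]\<^sub>L = - (complex_of_real (a \<alpha>) * coboundary \<mu> [E (- \<alpha>), E (- \<beta>)]\<^sub>L)"
      by (simp add: tau_E ra lie_minus_left lie_linear coboundary_linear coboundary_minus)
    show ?thesis
      using ra rb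
    proof (cases rule: E_bracket_cases)
      \<comment> \<open>The bracket lies in h, where the functional vanishes, and the zero
        functional is not a root, so the other side has no summand either.\<close>
      case dual
      then have "\<alpha> + \<beta> \<notin> R0" using root_linear(4)[OF R0_roots, of "\<alpha> + \<beta>"] by auto
      moreover have "[E (- \<alpha>), E (- \<beta>)]\<^sub>L \<in> h" using Hv_h[OF rb] by (simp add: dual)
      ultimately show ?thesis unfolding l by (simp add: standard_form_values \<alpha> \<beta> coboundary_h)
    next
      case sum
      have "[E (- \<alpha>), E (- \<beta>)]\<^sub>L = - (complex_of_real (N \<alpha> \<beta>) *\<^sub>C E (- (\<alpha> + \<beta>)))"
        using bracket_E_root(1)[OF roots_neg[OF ra] roots_neg[OF rb]] roots_neg[OF sum]
          bracket_E_root(2)[OF ra rb sum] unfolding s by simp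
      then show ?thesis
        unfolding l standard_form_values(4)[OF \<alpha> \<beta>]
        by (simp only: coboundary_minus coboundary_linear coboundary_E[OF sum]) (simp add: R0_closed[OF \<alpha> \<beta> sum] del: minus_add_distrib)
    next
      case zero
      have "- \<alpha> + - \<beta> \<notin> roots h" using zero(1) roots_neg[of "- (\<alpha> + \<beta>)"] unfolding s minus_minus by blast
      moreover have "- \<beta> \<noteq> - (- \<alpha>)" using zero(2) by auto
      ultimately have "[E (- \<alpha>), E (- \<beta>)]\<^sub>L = 0"
        using bracket_E_zero[of "- \<alpha>" "- \<beta>"] ra rb by simp
      moreover have "\<alpha> + \<beta> \<notin> R0" using zero(1) R0_roots by blast
      ultimately show ?thesis unfolding l by (simp add: standard_form_values \<alpha> \<beta> coboundary_h h_zero)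
    qed
  qed
qed

lemma R0_no_opposite: "R0 \<inter> uminus ` R0 = {} \<Longrightarrow> \<alpha> \<in> R0 \<Longrightarrow> - \<alpha> \<notin> R0"
  by force

lemma real_part_cartan:
  assumes disj: "R0 \<inter> uminus ` R0 = {}" and y: "y \<in> k \<inter> rf"
  shows "y \<in> h"
proof -
  have "om \<alpha> y = 0" if \<alpha>: "\<alpha> \<in> roots h" for \<alpha>
    using k_components(2)[of y, OF _ \<alpha>] kbar_components(2)[of y, OF _ \<alpha>] R0_no_opposite[OF disj] y
    by (auto simp: kbar_iff rf_iff)
  then have "(\<Sum>\<alpha>\<in>roots h. om \<alpha> y *\<^sub>C E \<alpha>) = 0" by simp
  then show ?thesis using expand[of y] components(3)[of y] by simp
qed

text \<open>A real element of k has root components only at roots whose negatives also belong to R0.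
  Without opposite pairs it lies in h, and \<open>cartan_real_form\<close> does the rest.\<close>

lemma nondegenerate_iff:
  assumes disj: "R0 \<inter> uminus ` R0 = {}"
  shows "k \<inter> h \<inter> {\<i> *\<^sub>C H | H. H \<in> real_cartan h} = k \<inter> rf"
  unfolding cartan_real_form[symmetric] using real_part_cartan[OF disj] by blast

text \<open>The standard form is the coboundary of a functional, and the
  component on the Cartan subalgebra kills all brackets that enter the cocycle condition.\<close>

lemma admissible_standard:
  assumes spans: "cartan_spans" and pos: "positive_root_system (roots h) R0"
    and e0: "skew_hermitian_on \<sigma> (k \<inter> h) \<epsilon>\<^sub>0"
    and eps: "\<And>X Y. X \<in> k \<Longrightarrow> Y \<in> kbar \<Longrightarrow> \<epsilon> X Y = \<epsilon>\<^sub>0 (pr X) (pr Y) + standard_form \<mu> X Y"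
    and X: "X \<in> k" and Y: "Y \<in> k" and W: "W \<in> kbar"
  shows "\<epsilon> X [tau Y, W]\<^sub>L - \<epsilon> Y [tau X, W]\<^sub>L = \<epsilon> [X, Y]\<^sub>L W"
proof -
  have disj: "R0 \<inter> uminus ` R0 = {}" using pos positive_iff by blast
  have pr_EE: "pr [E \<alpha>, E \<beta>]\<^sub>L = 0" if "\<alpha> \<in> roots h" "\<beta> \<in> roots h" "\<beta> \<noteq> - \<alpha>" for \<alpha> \<beta>
    using that(1,2)
  proof (cases rule: E_bracket_cases)
    case sum
    then show ?thesis by (simp add: bracket_E_root(1) that components pr_linear)
  next
    case zero
    then show ?thesis using bracket_E_zero[OF that(1,2)] components(4)[OF h_zero] by simp
  qed (use that in simp)
  have pr0: "pr 0 = 0" by (rule components(4)[OF h_zero])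
  have pr_HE: "pr [H, E \<alpha>]\<^sub>L = 0" "pr [E \<alpha>, H]\<^sub>L = 0" if "H \<in> h" "\<alpha> \<in> roots h" for H \<alpha>
    using that pr_linear(2)[of "- \<alpha> H" "E \<alpha>"] by (simp_all add: bracket_H_E bracket_E_H pr_linear components)
  \<comment> \<open>A bracket of two elements of k gets a Cartan component only from opposite roots,
    of which there are none.\<close>
  have prk: "pr [X, Y]\<^sub>L = 0" if X: "X \<in> k" and Y: "Y \<in> k" for X Y
  proof -
    have gen: "pr [Z, Y]\<^sub>L = 0" if Z: "Z \<in> h \<or> Z \<in> E ` R0" for Z
    proof -
      have "Y \<in> {Y. pr [Z, Y]\<^sub>L = 0}"
      proof (rule k_induct[OF _ _ _ Y])
        show "cvec.subspace {Y. pr [Z, Y]\<^sub>L = 0}"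
          by (rule cvec.subspaceI) (simp_all add: lie_linear lie_zero_right pr_linear pr0)
        show "H \<in> {Y. pr [Z, Y]\<^sub>L = 0}" if "H \<in> h" for H
          using Z that by (auto simp: h_abelian pr0 pr_HE R0_roots)
        show "E \<beta> \<in> {Y. pr [Z, Y]\<^sub>L = 0}" if \<beta>: "\<beta> \<in> R0" for \<beta>
        proof -
          have "pr [E \<alpha>, E \<beta>]\<^sub>L = 0" if "\<alpha> \<in> R0" for \<alpha>
            using pr_EE[OF R0_roots[OF that] R0_roots[OF \<beta>]] R0_no_opposite[OF disj that] \<beta> by auto
          then show ?thesis using Z pr_HE(1)[OF _ R0_roots[OF \<beta>]] by auto
        qed
      qed
      then show ?thesis by blast
    qed
    have "X \<in> {X. pr [X, Y]\<^sub>L = 0}"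
      by (rule k_induct[OF _ _ _ X]) (auto intro!: cvec.subspaceI simp: gen lie_linear pr_linear pr0)
    then show ?thesis by blast
  qed
  \<comment> \<open>The same for \<open>kbar\<close>: \<open>tau\<close> turns the root vectors of k
    into multiples of those for negative roots, and again no opposite pairs meet.\<close>
  have prt: "pr [tau X, W]\<^sub>L = 0" if X: "X \<in> k" and W: "W \<in> kbar" for X W
  proof -
    have gen: "pr [Z, W]\<^sub>L = 0" if Z: "Z \<in> h \<or> (\<exists>\<alpha>\<in>R0. Z = E (- \<alpha>))" for Z
    proof -
      have "W \<in> {W. pr [Z, W]\<^sub>L = 0}"
      proof (rule kbar_induct[OF _ _ _ W])
        show "cvec.subspace {W. pr [Z, W]\<^sub>L = 0}"
          by (rule cvec.subspaceI) (simp_all add: lie_linear lie_zero_right pr_linear pr0)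
        show "H \<in> {W. pr [Z, W]\<^sub>L = 0}" if "H \<in> h" for H
          using Z that by (auto simp: h_abelian pr0 pr_HE R0_roots)
        show "E (- \<beta>) \<in> {W. pr [Z, W]\<^sub>L = 0}" if \<beta>: "\<beta> \<in> R0" for \<beta>
          using Z pr_HE(1)[OF _ roots_neg[OF R0_roots[OF \<beta>]]]
            pr_EE[OF roots_neg[OF R0_roots] roots_neg[OF R0_roots[OF \<beta>]]] R0_no_opposite[OF disj] \<beta> by auto
      qed
      then show ?thesis by blast
    qed
    have "X \<in> {X. pr [tau X, W]\<^sub>L = 0}"
    proof (rule k_induct[OF _ _ _ X])
      show "cvec.subspace {X. pr [tau X, W]\<^sub>L = 0}"
        by (rule cvec.subspaceI) (simp_all add: lie_linear tau_linear tau_zero pr_linear pr0)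
      show "H \<in> {X. pr [tau X, W]\<^sub>L = 0}" if "H \<in> h" for H
        using gen[of "- H"] that by (simp add: tau_h h_minus)
      show "E \<alpha> \<in> {X. pr [tau X, W]\<^sub>L = 0}" if "\<alpha> \<in> R0" for \<alpha>
        using gen[of "E (- \<alpha>)"] that pr_linear(2)[of "-1"]
        by (auto simp: tau_E R0_roots lie_minus_left lie_linear pr_linear simp flip: cvec.scale_minus_left)
    qed
    then show ?thesis by blast
  qed
  have prks: "pr X \<in> k \<inter> h" "pr W \<in> \<sigma> ` (k \<inter> h)" if "X \<in> k" "W \<in> kbar" for X W
    using that by (simp_all add: sigma_kh_iff k_components kbar_components components(3))
  have e00: "\<epsilon>\<^sub>0 (pr X) 0 = 0" "\<epsilon>\<^sub>0 0 (pr W) = 0" if "X \<in> k" "W \<in> kbar" for X W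
  proof -
    have "0 \<in> k \<inter> h" "0 \<in> \<sigma> ` (k \<inter> h)" using k_zero h_zero by (auto simp: sigma_kh_iff kbar_iff)
    then have "\<epsilon>\<^sub>0 (pr X) (0 *\<^sub>C 0) = 0 * \<epsilon>\<^sub>0 (pr X) 0" "\<epsilon>\<^sub>0 (0 *\<^sub>C 0) (pr W) = 0 * \<epsilon>\<^sub>0 0 (pr W)"
      using e0 prks[OF that] unfolding skew_hermitian_on_def cbilinear_form_on_def by blast+
    then show "\<epsilon>\<^sub>0 (pr X) 0 = 0" "\<epsilon>\<^sub>0 0 (pr W) = 0" by simp_all
  qed
  have e1: "\<epsilon> X [tau Y, W]\<^sub>L = coboundary \<mu> [tau X, [tau Y, W]\<^sub>L]\<^sub>L" if "X \<in> k" "Y \<in> k" for X Y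
    using eps[OF that(1) tau_kbar[OF that(2) W]] coboundary_standard[OF that(1) tau_kbar[OF that(2) W]]
    by (simp add: prt[OF that(2) W] e00(1)[OF that(1) W])
  have e2: "\<epsilon> [X, Y]\<^sub>L W = coboundary \<mu> [tau [X, Y]\<^sub>L, W]\<^sub>L"
    using eps[OF k_bracket[OF X Y] W] coboundary_standard[OF k_bracket[OF X Y] W]
    by (simp add: prk[OF X Y] e00(2)[OF X W])
  \<comment> \<open>With the terms of the Cartan part gone, the cocycle condition is the functional
    applied to the derivation rule for the bracket.\<close>
  show ?thesis
    unfolding e1[OF X Y] e1[OF Y X] e2 tau_bracket lie_derivation[of "tau X" "tau Y" W]
    by (simp add: coboundary_linear)
qed

end

section \<open>The cocycle condition\<close>

locale cocycle_pair = regular_pair h E N a \<sigma> k \<epsilon>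
  for h :: "'g::complex_lie_algebra set" and E N a \<sigma> k \<epsilon> +
  assumes cocycle: "\<And>X Y W. X \<in> k \<Longrightarrow> Y \<in> k \<Longrightarrow> W \<in> kbar \<Longrightarrow>
      \<epsilon> X [tau Y, W]\<^sub>L - \<epsilon> Y [tau X, W]\<^sub>L = \<epsilon> [X, Y]\<^sub>L W"
    and spans: "cartan_spans"
begin

text \<open>Since h is the sum of its part in k and the conjugate of that part, and \<gamma> \<circ>
  \<sigma> is minus the complex conjugate of \<gamma>, a weight vanishing on the part in k would
  vanish on h.\<close>

lemma weight_nonzero:
  assumes add: "\<And>x y. x \<in> h \<Longrightarrow> y \<in> h \<Longrightarrow> \<gamma> (x + y) = \<gamma> x + \<gamma> y"
    and sigma: "\<And>x. \<gamma> (\<sigma> x) = - cnj (\<gamma> x)" and nz: "H \<in> h" "\<gamma> H \<noteq> (0 :: complex)"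
  obtains H where "H \<in> k" "H \<in> h" "\<gamma> H \<noteq> 0"
proof -
  obtain X Y where XY: "X \<in> k \<inter> h" "Y \<in> k \<inter> h" "H = X + \<sigma> Y"
    using spans nz(1) unfolding cartan_spans_def by blast
  then have "\<gamma> H = \<gamma> X + - cnj (\<gamma> Y)" using add[of X "\<sigma> Y"] by (simp add: sigma h_sigma)
  then have "\<gamma> X \<noteq> 0 \<or> \<gamma> Y \<noteq> 0" using nz(2) by auto
  then show thesis using that XY by blast
qed

lemma root_nonzero_k:
  assumes "\<alpha> \<in> roots h"
  obtains H where "H \<in> k" "H \<in> h" "\<alpha> H \<noteq> 0"
proof -
  obtain H where H: "H \<in> h" "\<alpha> H \<noteq> 0" using assms by (rule root_nonzero)
  show thesis
    by (rule weight_nonzero[of \<alpha>, OF _ _ H]) (use assms that in \<open>auto simp: root_linear root_sigma\<close>)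
qed

text \<open>The cocycle condition on two Cartan elements and \<open>E (- \<beta>)\<close> has right
  side zero and says that \<epsilon> at this root vector is proportional to \<beta>.\<close>

lemma eps_H_E_exists:
  assumes \<beta>: "\<beta> \<in> R0"
  obtains m where "\<And>H. H \<in> k \<Longrightarrow> H \<in> h \<Longrightarrow> \<epsilon> H (E (- \<beta>)) = m * \<beta> H"
proof -
  note rb = R0_roots[OF \<beta>]
  have Eb: "E (- \<beta>) \<in> kbar" using kbar_E[OF rb] \<beta> by simp
  obtain H' where H': "H' \<in> k" "H' \<in> h" "\<beta> H' \<noteq> 0" using rb by (rule root_nonzero_k)
  show thesis
  proof (rule that[of "\<epsilon> H' (E (- \<beta>)) / \<beta> H'"])
    fix H assume H: "H \<in> k" "H \<in> h"
    have "[tau Z, E (- \<beta>)]\<^sub>L = \<beta> Z *\<^sub>C E (- \<beta>)" if "Z \<in> h" for Z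
      using that rb by (simp add: tau_h lie_minus_left bracket_H_E)
    then have "\<beta> H' * \<epsilon> H (E (- \<beta>)) - \<beta> H * \<epsilon> H' (E (- \<beta>)) = 0"
      using cocycle[OF H(1) H'(1) Eb] H H' Eb by (simp add: eps_bilinear h_abelian eps_zero)
    then show "\<epsilon> H (E (- \<beta>)) = \<epsilon> H' (E (- \<beta>)) / \<beta> H' * \<beta> H" using H'(3) by (simp add: field_simps)
  qed
qed

text \<open>The constants \<open>\<mu>\<close> are read off from the components on the Cartan subalgebra times a root vector.\<close>

lemma eps_H_E_real:
  assumes \<alpha>: "\<alpha> \<in> R0"
  shows "\<exists>m :: real. (\<forall>H. H \<in> k \<longrightarrow> H \<in> h \<longrightarrow> \<epsilon> H (E (- \<alpha>)) = complex_of_real m * \<alpha> H) \<and>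
    (\<forall>H. H \<in> kbar \<longrightarrow> H \<in> h \<longrightarrow> \<epsilon> (E \<alpha>) H = - complex_of_real (a \<alpha> * m) * \<alpha> H)"
proof -
  note ra = R0_roots[OF \<alpha>]
  have Ea: "E (- \<alpha>) \<in> kbar" using kbar_E[OF ra] \<alpha> by simp
  obtain m where m: "\<And>H. H \<in> k \<Longrightarrow> H \<in> h \<Longrightarrow> \<epsilon> H (E (- \<alpha>)) = m * \<alpha> H" using \<alpha> by (rule eps_H_E_exists) blast
  obtain K where K: "K \<in> k" "K \<in> h" "\<alpha> K \<noteq> 0" using ra by (rule root_nonzero_k)
  have EH: "\<epsilon> (E \<alpha>) H = - complex_of_real (a \<alpha>) * m * \<alpha> H" if H: "H \<in> kbar" "H \<in> h" for H
  proof -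
    have t: "[tau (E \<alpha>), H]\<^sub>L = (- (complex_of_real (a \<alpha>) * \<alpha> H)) *\<^sub>C E (- \<alpha>)"
      using ra H(2) by (simp add: tau_E lie_minus_left lie_linear bracket_E_H scaleC_scaleC)
    have "[tau K, H]\<^sub>L = 0" using K H by (simp add: tau_h lie_minus_left h_abelian)
    \<comment> \<open>The cocycle condition on K, \<open>E \<alpha>\<close> and H ties the
      components with the root vector on the left to those with the root vector on the
      right.\<close>
    then have "\<epsilon> K ((- (complex_of_real (a \<alpha>) * \<alpha> H)) *\<^sub>C E (- \<alpha>)) = \<epsilon> (\<alpha> K *\<^sub>C E \<alpha>) H"
      using cocycle[OF K(1) R0_E[OF \<alpha>] H(1)] R0_E[OF \<alpha>] bracket_H_E[OF ra K(2)] unfolding t by (simp add: eps_zero)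
    then have "\<alpha> K * \<epsilon> (E \<alpha>) H = \<alpha> K * (- complex_of_real (a \<alpha>) * m * \<alpha> H)"
      by (simp only: eps_bilinear(4)[OF K(1) Ea] eps_bilinear(2)[OF R0_E[OF \<alpha>] H(1)] m[OF K(1,2)]) (simp add: mult_ac)
    then show ?thesis using mult_left_cancel[OF K(3)] by blast
  qed
  \<comment> \<open>Skew-Hermitian symmetry exchanges the two kinds of mixed components. Computing
    both from m gives that m equals its own complex conjugate.\<close>
  have "\<epsilon> K (\<sigma> (E \<alpha>)) = - cnj (\<epsilon> (E \<alpha>) (\<sigma> K))"
    using eps_skew[OF K(1), of "\<sigma> (E \<alpha>)"] R0_E[OF \<alpha>] by (simp add: kbar_iff)
  moreover have "\<epsilon> K (\<sigma> (E \<alpha>)) = - complex_of_real (a \<alpha>) * (m * \<alpha> K)"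
    using eps_bilinear(4)[OF K(1) Ea, of "- complex_of_real (a \<alpha>)"] m[OF K(1,2)] by (simp add: sigma_E_neg ra)
  moreover have "\<epsilon> (E \<alpha>) (\<sigma> K) = complex_of_real (a \<alpha>) * m * cnj (\<alpha> K)"
    using EH[of "\<sigma> K"] K by (simp add: kbar_iff h_sigma root_sigma ra)
  ultimately have "m = cnj m" using K(3) a_cases[OF ra] by auto
  then have "m = complex_of_real (Re m)" unfolding complex_eq_iff by simp
  then show ?thesis using m EH by (intro exI[of _ "Re m"]) (simp add: mult_ac)
qed

definition mu :: "('g \<Rightarrow> complex) \<Rightarrow> real" where
  "mu \<alpha> = (SOME m. (\<forall>H. H \<in> k \<longrightarrow> H \<in> h \<longrightarrow> \<epsilon> H (E (- \<alpha>)) = complex_of_real m * \<alpha> H) \<and>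
    (\<forall>H. H \<in> kbar \<longrightarrow> H \<in> h \<longrightarrow> \<epsilon> (E \<alpha>) H = - complex_of_real (a \<alpha> * m) * \<alpha> H))"

lemma eps_H_E: "\<alpha> \<in> R0 \<Longrightarrow> H \<in> k \<Longrightarrow> H \<in> h \<Longrightarrow> \<epsilon> H (E (- \<alpha>)) = complex_of_real (mu \<alpha>) * \<alpha> H"
  and eps_E_H: "\<alpha> \<in> R0 \<Longrightarrow> H \<in> kbar \<Longrightarrow> H \<in> h \<Longrightarrow> \<epsilon> (E \<alpha>) H = - complex_of_real (a \<alpha> * mu \<alpha>) * \<alpha> H"
  using someI_ex[OF eps_H_E_real[of \<alpha>]] unfolding mu_def by blast+

text \<open>The cocycle condition with one Cartan argument. It fixes \<epsilon> on the two root
  vectors wherever the weight \<alpha> + \<beta> is not zero; for opposite roots it restricts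
  \<epsilon> on the Cartan subalgebra instead.\<close>

lemma cocycle_E_E:
  assumes \<alpha>: "\<alpha> \<in> R0" and \<beta>: "\<beta> \<in> R0" and H: "H \<in> k" "H \<in> h"
  shows "(\<alpha> H + \<beta> H) * \<epsilon> (E \<alpha>) (E (- \<beta>)) = - complex_of_real (a \<alpha>) * \<epsilon> H [E (- \<alpha>), E (- \<beta>)]\<^sub>L"
proof -
  note ra = R0_roots[OF \<alpha>] and rb = R0_roots[OF \<beta>]
  have E: "E (- \<alpha>) \<in> kbar" "E (- \<beta>) \<in> kbar" using kbar_E[OF ra] kbar_E[OF rb] \<alpha> \<beta> by simp_all
  have t: "[tau (E \<alpha>), E (- \<beta>)]\<^sub>L = (- complex_of_real (a \<alpha>)) *\<^sub>C [E (- \<alpha>), E (- \<beta>)]\<^sub>L"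
    by (simp add: tau_E ra lie_minus_left lie_linear)
  have br: "[E (- \<alpha>), E (- \<beta>)]\<^sub>L \<in> kbar" using E by (simp add: kbar_iff sigma_bracket k_bracket)
  have "[tau H, E (- \<beta>)]\<^sub>L = \<beta> H *\<^sub>C E (- \<beta>)" using H rb by (simp add: tau_h lie_minus_left bracket_H_E)
  then have "- complex_of_real (a \<alpha>) * \<epsilon> H [E (- \<alpha>), E (- \<beta>)]\<^sub>L - \<beta> H * \<epsilon> (E \<alpha>) (E (- \<beta>)) = \<alpha> H * \<epsilon> (E \<alpha>) (E (- \<beta>))"
    using cocycle[OF H(1) R0_E[OF \<alpha>] E(2)]
    by (simp only: t bracket_H_E[OF ra H(2)] eps_bilinear(4)[OF H(1) br] eps_bilinear(4)[OF R0_E[OF \<alpha>] E(2)]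
        eps_bilinear(2)[OF R0_E[OF \<alpha>] E(2)])
  then show ?thesis by (simp add: algebra_simps)
qed

lemma eps_E_E:
  assumes \<alpha>: "\<alpha> \<in> R0" and \<beta>: "\<beta> \<in> R0" and opp: "\<beta> \<noteq> - \<alpha>"
  shows "\<epsilon> (E \<alpha>) (E (- \<beta>)) = (if \<alpha> + \<beta> \<in> R0 then complex_of_real (a \<alpha> * mu (\<alpha> + \<beta>) * N \<alpha> \<beta>) else 0)"
  using R0_roots[OF \<alpha>] R0_roots[OF \<beta>]
proof (cases rule: E_bracket_cases)
  case sum
  note ra = R0_roots[OF \<alpha>] and rb = R0_roots[OF \<beta>]
  have s: "- \<alpha> + - \<beta> = - (\<alpha> + \<beta>)" by (simp add: fun_eq_iff)
  have R: "\<alpha> + \<beta> \<in> R0" by (rule R0_closed[OF \<alpha> \<beta> sum])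
  obtain H where H: "H \<in> k" "H \<in> h" "(\<alpha> + \<beta>) H \<noteq> 0" using sum by (rule root_nonzero_k)
  have "[E (- \<alpha>), E (- \<beta>)]\<^sub>L = (- complex_of_real (N \<alpha> \<beta>)) *\<^sub>C E (- (\<alpha> + \<beta>))"
    using bracket_E_root(1)[OF roots_neg[OF ra] roots_neg[OF rb]] roots_neg[OF sum]
      bracket_E_root(2)[OF ra rb sum] unfolding s by simp
  moreover have "E (- (\<alpha> + \<beta>)) \<in> kbar" using kbar_E[OF sum] R by blast
  ultimately have "\<epsilon> H [E (- \<alpha>), E (- \<beta>)]\<^sub>L = - complex_of_real (N \<alpha> \<beta>) * (complex_of_real (mu (\<alpha> + \<beta>)) * (\<alpha> + \<beta>) H)"
    by (simp only: eps_bilinear(4)[OF H(1)] eps_H_E[OF R H(1,2)])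
  then have "(\<alpha> + \<beta>) H * \<epsilon> (E \<alpha>) (E (- \<beta>)) = (\<alpha> + \<beta>) H * complex_of_real (a \<alpha> * mu (\<alpha> + \<beta>) * N \<alpha> \<beta>)"
    using cocycle_E_E[OF \<alpha> \<beta> H(1,2)] by (simp add: mult_ac)
  then show ?thesis using H(3) R by simp
next
  case zero
  note ra = R0_roots[OF \<alpha>] and rb = R0_roots[OF \<beta>]
  have s: "- \<alpha> + - \<beta> = - (\<alpha> + \<beta>)" by (simp add: fun_eq_iff)
  have "- \<alpha> + - \<beta> \<notin> roots h" using zero(1) roots_neg[of "- (\<alpha> + \<beta>)"] unfolding s minus_minus by blast
  moreover have "- \<beta> \<noteq> - (- \<alpha>)" using zero(2) by auto
  ultimately have 0: "[E (- \<alpha>), E (- \<beta>)]\<^sub>L = 0" using bracket_E_zero[of "- \<alpha>" "- \<beta>"] ra rb by simp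
  \<comment> \<open>The sum is not a root but still a nonzero weight, so some H in k detects it,
    while the bracket of the root vectors vanishes.\<close>
  have "\<alpha> + \<beta> \<noteq> 0" using opp by (simp add: add_eq_0_iff)
  then obtain H0 where H0: "(\<alpha> + \<beta>) H0 \<noteq> 0" by (auto simp: fun_eq_iff)
  then have H0h: "H0 \<in> h" using root_linear(3)[OF ra] root_linear(3)[OF rb] by fastforce
  obtain H where H: "H \<in> k" "H \<in> h" "(\<alpha> + \<beta>) H \<noteq> 0"
    by (rule weight_nonzero[of "\<alpha> + \<beta>", OF _ _ H0h H0]) (use ra rb in \<open>auto simp: root_linear root_sigma\<close>)
  have "\<alpha> + \<beta> \<notin> R0" using zero(1) R0_roots by blast
  then show ?thesis using cocycle_E_E[OF \<alpha> \<beta> H(1,2)] H by (simp add: 0 eps_zero)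
qed (use opp in simp)

text \<open>For opposite roots the weight in \<open>cocycle_E_E\<close> is zero, which forces the
  other side to vanish.\<close>

lemma eps_H_Hv:
  assumes "\<alpha> \<in> R0" "- \<alpha> \<in> R0" "H \<in> k" "H \<in> h"
  shows "\<epsilon> H (Hv \<alpha>) = 0"
  using cocycle_E_E[of "- \<alpha>" \<alpha> H] assms a_cases[OF R0_roots[OF assms(1)]] a_neg[OF R0_roots[OF assms(1)]] by auto

section \<open>Exclusion of opposite roots\<close>

lemma opposite_in:
  assumes \<alpha>: "\<alpha> \<in> R0" and \<beta>: "- \<alpha> \<in> R0"
  shows "Hv \<alpha> \<in> k" "Hv \<alpha> \<in> kbar" "E \<alpha> \<in> k" "E \<alpha> \<in> kbar" "E (- \<alpha>) \<in> k" "E (- \<alpha>) \<in> kbar"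
proof -
  show E: "E \<alpha> \<in> k" "E (- \<alpha>) \<in> k" using assms R0_E by auto
  show "Hv \<alpha> \<in> k" by (rule k_bracket[OF E])
  then show "Hv \<alpha> \<in> kbar" by (simp add: kbar_iff sigma_Hv R0_roots[OF \<alpha>] cvec.subspace_neg[OF k_subspace])
  show "E \<alpha> \<in> kbar" "E (- \<alpha>) \<in> kbar"
    using kbar_E[OF R0_roots[OF \<beta>]] kbar_E[OF R0_roots[OF \<alpha>]] assms by simp_all
qed

text \<open>These components escape the weight argument. The cocycle condition on
  \<open>E \<alpha>\<close>, \<open>E (- \<alpha>)\<close> and a Cartan element makes the values at
  \<alpha> and - \<alpha> opposite, and skew-Hermitian symmetry turns this into reality.\<close>

lemma eps_E_self_real:
  assumes \<alpha>: "\<alpha> \<in> R0" and \<beta>: "- \<alpha> \<in> R0"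
  shows "\<epsilon> (E \<alpha>) (E \<alpha>) \<in> \<real>"
proof -
  note ra = R0_roots[OF \<alpha>] and op = opposite_in[OF \<alpha> \<beta>]
  obtain K where K: "K \<in> k" "K \<in> h" "\<alpha> K \<noteq> 0" using ra by (rule root_nonzero_k)
  let ?H = "\<sigma> K"
  have H: "?H \<in> kbar" "?H \<in> h" "\<alpha> ?H \<noteq> 0" using K by (simp_all add: kbar_iff h_sigma root_sigma[OF ra])
  have "\<epsilon> (Hv \<alpha>) ?H = - cnj (\<epsilon> K (- Hv \<alpha>))"
    using eps_skew[OF op(1) H(1)] by (simp add: sigma_Hv ra)
  then have z: "\<epsilon> (Hv \<alpha>) ?H = 0" using eps_H_Hv[OF \<alpha> \<beta> K(1,2)] eps_minus[OF K(1) op(2)] by simp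
  have t: "[tau (E (- \<alpha>)), ?H]\<^sub>L = (complex_of_real (a \<alpha>) * \<alpha> ?H) *\<^sub>C E \<alpha>"
    "[tau (E \<alpha>), ?H]\<^sub>L = (- (complex_of_real (a \<alpha>) * \<alpha> ?H)) *\<^sub>C E (- \<alpha>)"
    using ra H(2) by (simp_all add: tau_E a_neg lie_minus_left lie_linear bracket_E_H scaleC_scaleC)
  have "(complex_of_real (a \<alpha>) * \<alpha> ?H) * \<epsilon> (E \<alpha>) (E \<alpha>) - (- (complex_of_real (a \<alpha>) * \<alpha> ?H)) * \<epsilon> (E (- \<alpha>)) (E (- \<alpha>)) = 0"
    using cocycle[OF op(3,5) H(1)] unfolding t z by (simp only: eps_bilinear(4)[OF op(3) op(4)] eps_bilinear(4)[OF op(5) op(6)])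
  then have "(complex_of_real (a \<alpha>) * \<alpha> ?H) * (\<epsilon> (E \<alpha>) (E \<alpha>) + \<epsilon> (E (- \<alpha>)) (E (- \<alpha>))) = 0" by (simp add: distrib_left)
  then have opp: "\<epsilon> (E (- \<alpha>)) (E (- \<alpha>)) = - \<epsilon> (E \<alpha>) (E \<alpha>)"
    using H(3) a_cases[OF ra] by (auto simp: add_eq_0_iff)
  have "\<epsilon> (E \<alpha>) (E \<alpha>) = - cnj (\<epsilon> (\<sigma> (E \<alpha>)) (\<sigma> (E \<alpha>)))" by (rule eps_skew[OF op(3,4)])
  also have "\<sigma> (E \<alpha>) = (- complex_of_real (a \<alpha>)) *\<^sub>C E (- \<alpha>)" by (simp add: sigma_E_neg ra)
  also have "\<epsilon> \<dots> \<dots> = (complex_of_real (a \<alpha>) * complex_of_real (a \<alpha>)) * \<epsilon> (E (- \<alpha>)) (E (- \<alpha>))"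
    unfolding eps_bilinear(2)[OF op(5) cvec.subspace_scale[OF kbar_subspace op(6)]] eps_bilinear(4)[OF op(5,6)] by simp
  also have "- cnj (complex_of_real (a \<alpha>) * complex_of_real (a \<alpha>) * \<epsilon> (E (- \<alpha>)) (E (- \<alpha>))) = cnj (\<epsilon> (E \<alpha>) (E \<alpha>))"
    by (simp add: a_square[OF ra] opp)
  finally have "\<epsilon> (E \<alpha>) (E \<alpha>) = cnj (\<epsilon> (E \<alpha>) (E \<alpha>))" .
  then show ?thesis unfolding Reals_cnj_iff by (rule sym)
qed

lemma eps_E_E_real:
  assumes "\<alpha> \<in> R0" "\<beta> \<in> R0"
  shows "\<epsilon> (E \<alpha>) (E (- \<beta>)) \<in> \<real>"
proof (cases "\<beta> = - \<alpha>")
  case True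
  then show ?thesis using eps_E_self_real[of \<alpha>] assms by simp
qed (simp add: eps_E_E assms)

text \<open>Suppose \<open>R0\<close> contains opposite roots. Then \<open>Im \<epsilon>\<close> vanishes between any two of the vectors
  \<open>\<i> [E \<alpha>, E (- \<alpha>)]\<close> and \<open>V \<beta>\<close> below, and between them and the real part of \<open>k \<inter> h\<close>. So
  a combination of \<open>n + 1\<close> of them only has to satisfy the \<open>n\<close> equations given by the vectors \<open>U \<beta>\<close>
  to lie in the kernel of \<open>Im \<epsilon>\<close>.\<close>

definition opposite :: "('g \<Rightarrow> complex) set" where "opposite = {\<alpha> \<in> R0. - \<alpha> \<in> R0}"
definition U where "U \<beta> = E \<beta> + \<sigma> (E \<beta>)"
definition V where "V \<beta> = \<i> *\<^sub>C E \<beta> + \<sigma> (\<i> *\<^sub>C E \<beta>)"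

lemma opposite_facts:
  assumes "\<alpha> \<in> opposite"
  shows "\<alpha> \<in> roots h" "\<alpha> \<in> R0" "- \<alpha> \<in> R0" "- \<alpha> \<in> opposite"
  using assms by (auto simp: opposite_def R0_roots)

lemma U_eq: "\<beta> \<in> opposite \<Longrightarrow> U \<beta> = E \<beta> + (- complex_of_real (a \<beta>)) *\<^sub>C E (- \<beta>)"
  and V_eq: "\<beta> \<in> opposite \<Longrightarrow> V \<beta> = \<i> *\<^sub>C (E \<beta> + complex_of_real (a \<beta>) *\<^sub>C E (- \<beta>))"
  by (simp_all add: U_def V_def sigma_E_neg opposite_facts sigma_scale scaleC_add_right)

lemma U_V_real: "U \<beta> \<in> rf" "V \<beta> \<in> rf"
  by (simp_all add: U_def V_def rf_iff sigma_add add.commute)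

lemma U_V_k: "\<beta> \<in> opposite \<Longrightarrow> U \<beta> \<in> k" "\<beta> \<in> opposite \<Longrightarrow> V \<beta> \<in> k"
  by (simp_all add: U_eq V_eq k_add k_scale opposite_in opposite_facts del: cvec.scale_minus_left)

lemma real_kbar: "x \<in> k \<Longrightarrow> x \<in> rf \<Longrightarrow> x \<in> kbar"
  by (simp add: kbar_iff rf_iff)

text \<open>The vectors U of opposite roots are real multiples of each other, so each pair of roots
  contributes only one equation.\<close>

lemma U_V_neg: "\<beta> \<in> opposite \<Longrightarrow> U (- \<beta>) = complex_of_real (- a \<beta>) *\<^sub>C U \<beta>"
  by (simp add: U_eq opposite_facts a_neg scaleC_add_right scaleC_scaleC a_square scaleC_one add.commute
      cvec.scale_minus_right cvec.scale_right_diff_distrib)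

text \<open>The roots of a real element of k lie in R0 and, by reality, in its negative. Averaging
  over \<sigma> groups their root vectors into the real vectors U and V.\<close>

lemma real_span:
  assumes y: "y \<in> k" "y \<in> rf"
  shows "y = pr y + (\<Sum>\<alpha>\<in>opposite. complex_of_real (Re (om \<alpha> y) / 2) *\<^sub>C U \<alpha> + complex_of_real (Im (om \<alpha> y) / 2) *\<^sub>C V \<alpha>)"
    "pr y \<in> k" "pr y \<in> h" "pr y \<in> rf"
proof -
  show "pr y \<in> k" "pr y \<in> h" using k_components(1)[OF y(1)] components(3) by auto
  have "om \<alpha> y = 0" if "\<alpha> \<in> roots h - opposite" for \<alpha>
    using that k_components(2)[OF y(1), of \<alpha>] kbar_components(2)[OF real_kbar[OF y], of \<alpha>] by (auto simp: opposite_def)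
  then have s: "(\<Sum>\<alpha>\<in>roots h. om \<alpha> y *\<^sub>C E \<alpha>) = (\<Sum>\<alpha>\<in>opposite. om \<alpha> y *\<^sub>C E \<alpha>)"
    by (intro sum.mono_neutral_right finite_roots) (auto simp: opposite_def R0_roots)
  have sy: "\<sigma> y = y" using y(2) by (simp add: rf_iff)
  have "\<sigma> (pr y) + (\<Sum>\<alpha>\<in>opposite. \<sigma> (om \<alpha> y *\<^sub>C E \<alpha>)) = \<sigma> (pr y + (\<Sum>\<alpha>\<in>opposite. om \<alpha> y *\<^sub>C E \<alpha>))"
    by (simp add: sigma_add sigma_sum)
  also have "\<dots> = y" unfolding s[symmetric] expand by (rule sy)
  finally have y2: "\<sigma> (pr y) + (\<Sum>\<alpha>\<in>opposite. \<sigma> (om \<alpha> y *\<^sub>C E \<alpha>)) = y" .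
  have y1: "pr y + (\<Sum>\<alpha>\<in>opposite. om \<alpha> y *\<^sub>C E \<alpha>) = y" using expand[of y] unfolding s .
  have "pr (\<sigma> (om \<alpha> y *\<^sub>C E \<alpha>)) = 0" if "\<alpha> \<in> opposite" for \<alpha>
    using opposite_facts[OF that] pr_linear(2)[of "- (cnj (om \<alpha> y) * complex_of_real (a \<alpha>))" "E (- \<alpha>)"]
    by (simp add: sigma_scale sigma_E_neg cvec.scale_minus_right scaleC_scaleC components)
  moreover have "pr (\<Sum>i\<in>I. f i) = (\<Sum>i\<in>I. pr (f i))" for I :: "('g \<Rightarrow> complex) set" and f
    using components(4)[OF h_zero] by (induction I rule: infinite_finite_induct) (simp_all add: pr_linear)
  ultimately have "pr (\<sigma> (pr y) + (\<Sum>\<alpha>\<in>opposite. \<sigma> (om \<alpha> y *\<^sub>C E \<alpha>))) = \<sigma> (pr y)"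
    by (simp add: pr_linear components(4) h_sigma components(3))
  then have spr: "\<sigma> (pr y) = pr y" unfolding y2 by (rule sym)
  then show "pr y \<in> rf" by (simp add: rf_iff)
  have half: "(1/2) *\<^sub>C (x + \<sigma> x) = complex_of_real (Re z / 2) *\<^sub>C (e + \<sigma> e) + complex_of_real (Im z / 2) *\<^sub>C (\<i> *\<^sub>C e + \<sigma> (\<i> *\<^sub>C e))"
    if "x = z *\<^sub>C e" for x e z
  proof -
    have "x = complex_of_real (Re z) *\<^sub>C e + complex_of_real (Im z) *\<^sub>C (\<i> *\<^sub>C e)"
      unfolding that scaleC_scaleC scaleC_add_left[symmetric] by (simp add: complex_eq mult.commute)
    then show ?thesis by (simp add: sigma_add sigma_scale scaleC_add_right scaleC_scaleC
        cvec.scale_right_diff_distrib cvec.scale_minus_right ac_simps)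
  qed
  have "(1/2) *\<^sub>C (y + y) = (1/2) *\<^sub>C ((pr y + (\<Sum>\<alpha>\<in>opposite. om \<alpha> y *\<^sub>C E \<alpha>)) +
      (\<sigma> (pr y) + (\<Sum>\<alpha>\<in>opposite. \<sigma> (om \<alpha> y *\<^sub>C E \<alpha>))))"
    by (simp only: y1 y2)
  also have "\<dots> = (1/2) *\<^sub>C (pr y + pr y) + (\<Sum>\<alpha>\<in>opposite. (1/2) *\<^sub>C (om \<alpha> y *\<^sub>C E \<alpha> + \<sigma> (om \<alpha> y *\<^sub>C E \<alpha>)))"
    by (simp add: spr scaleC_add_right cvec.scale_sum_right sum.distrib ac_simps)
  also have "\<dots> = (1/2) *\<^sub>C (pr y + pr y) +
      (\<Sum>\<alpha>\<in>opposite. complex_of_real (Re (om \<alpha> y) / 2) *\<^sub>C U \<alpha> + complex_of_real (Im (om \<alpha> y) / 2) *\<^sub>C V \<alpha>)"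
    unfolding U_def V_def half[OF refl] ..
  finally show "y = pr y + (\<Sum>\<alpha>\<in>opposite. complex_of_real (Re (om \<alpha> y) / 2) *\<^sub>C U \<alpha> + complex_of_real (Im (om \<alpha> y) / 2) *\<^sub>C V \<alpha>)"
  proof -
    have h: "(1/2) *\<^sub>C (v + v) = v" for v :: 'g
      by (simp add: scaleC_add_right scaleC_add_left[symmetric] scaleC_one)
    assume "(1/2) *\<^sub>C (y + y) = (1/2) *\<^sub>C (pr y + pr y) +
      (\<Sum>\<alpha>\<in>opposite. complex_of_real (Re (om \<alpha> y) / 2) *\<^sub>C U \<alpha> + complex_of_real (Im (om \<alpha> y) / 2) *\<^sub>C V \<alpha>)"
    then show ?thesis unfolding h .
  qed
qed

lemma eps_sum_left:
  assumes "\<And>i. i \<in> I \<Longrightarrow> f i \<in> k" "y \<in> kbar"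
  shows "\<epsilon> (\<Sum>i\<in>I. c i *\<^sub>C f i) y = (\<Sum>i\<in>I. c i * \<epsilon> (f i) y)"
  using assms(1)
  by (induction I rule: infinite_finite_induct)
    (simp_all add: eps_zero assms(2) eps_bilinear k_scale cvec.subspace_sum[OF k_subspace])

lemma eps_real_swap: "x \<in> k \<Longrightarrow> x \<in> rf \<Longrightarrow> y \<in> k \<Longrightarrow> y \<in> rf \<Longrightarrow> Im (\<epsilon> x y) = Im (\<epsilon> y x)"
  using eps_skew[of x y] real_kbar[of y] by (simp add: rf_iff)

text \<open>Roots are imaginary on real Cartan elements and \<open>mu\<close> is real, so the factor
  \<i> in V makes the value real.\<close>

lemma eps_V_H:
  assumes \<beta>: "\<beta> \<in> opposite" and H: "H \<in> k" "H \<in> h" "H \<in> rf"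
  shows "Im (\<epsilon> (V \<beta>) H) = 0"
proof -
  note f = opposite_facts[OF \<beta>] and op = opposite_in[OF opposite_facts(2,3)[OF \<beta>]]
  have Hb: "H \<in> kbar" by (rule real_kbar[OF H(1,3)])
  have "\<beta> H = - cnj (\<beta> H)" using root_sigma[OF f(1), of H] H(3) by (simp add: rf_iff)
  then have re: "Re (\<beta> H) = 0" by (simp add: complex_eq_iff)
  have "\<epsilon> (V \<beta>) H = \<i> * (\<epsilon> (E \<beta>) H + complex_of_real (a \<beta>) * \<epsilon> (E (- \<beta>)) H)"
    unfolding V_eq[OF \<beta>] by (simp add: eps_bilinear Hb op k_add k_scale)
  then show ?thesis by (simp add: eps_E_H f Hb H re)
qed

text \<open>The two factors \<i> multiply to -1, and \<epsilon> is real on pairs of root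
  vectors.\<close>

lemma eps_V_V:
  assumes \<beta>: "\<beta> \<in> opposite" and \<gamma>: "\<gamma> \<in> opposite"
  shows "Im (\<epsilon> (V \<beta>) (V \<gamma>)) = 0"
proof -
  note op = opposite_in[OF opposite_facts(2,3)[OF \<beta>]] opposite_in[OF opposite_facts(2,3)[OF \<gamma>]]
  have r: "Im (\<epsilon> (E \<delta>) (E \<eta>)) = 0" if "\<delta> \<in> opposite" "\<eta> \<in> opposite" for \<delta> \<eta>
    using eps_E_E_real[of \<delta> "- \<eta>"] opposite_facts[OF that(1)] opposite_facts[OF that(2)] by (simp add: complex_is_Real_iff)
  have kb: "E \<gamma> + complex_of_real (a \<gamma>) *\<^sub>C E (- \<gamma>) \<in> kbar" "complex_of_real (a \<gamma>) *\<^sub>C E (- \<gamma>) \<in> kbar"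
    by (intro cvec.subspace_add[OF kbar_subspace] cvec.subspace_scale[OF kbar_subspace] op)+
  have "V \<gamma> \<in> kbar" by (intro real_kbar U_V_k U_V_real \<gamma>)
  then have "\<epsilon> (V \<beta>) (V \<gamma>) = \<i> * (\<epsilon> (E \<beta>) (V \<gamma>) + complex_of_real (a \<beta>) * \<epsilon> (E (- \<beta>)) (V \<gamma>))"
    by (simp add: V_eq[OF \<beta>] eps_bilinear op k_add k_scale)
  moreover have "\<epsilon> X (V \<gamma>) = \<i> * (\<epsilon> X (E \<gamma>) + complex_of_real (a \<gamma>) * \<epsilon> X (E (- \<gamma>)))" if "X \<in> k" for X
    unfolding V_eq[OF \<gamma>] by (simp add: eps_bilinear that kb op)
  ultimately show ?thesis using op r opposite_facts(4)[OF \<beta>] opposite_facts(4)[OF \<gamma>] \<beta> \<gamma> by simp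
qed

text \<open>A root and its negative span the same set \<open>{\<alpha>, - \<alpha>}\<close>, so the
  choice made in that set is common to both and picks exactly one of them.\<close>

lemma half_system:
  obtains P where "P \<subseteq> opposite" "\<And>\<alpha>. \<alpha> \<in> opposite \<Longrightarrow> \<alpha> \<in> P \<or> - \<alpha> \<in> P" "\<And>\<alpha>. \<alpha> \<in> P \<Longrightarrow> - \<alpha> \<notin> P"
proof -
  define P where "P = {\<alpha> \<in> opposite. (SOME \<beta>. \<beta> \<in> {\<alpha>, - \<alpha>}) = \<alpha>}"
  have sw: "{- \<alpha>, - (- \<alpha>)} = {\<alpha>, - \<alpha>}" for \<alpha> :: "'g \<Rightarrow> complex" by auto
  show thesis
  proof (rule that[of P])
    show "P \<subseteq> opposite" by (auto simp: P_def)
    show "\<alpha> \<in> P \<or> - \<alpha> \<in> P" if "\<alpha> \<in> opposite" for \<alpha>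
    proof -
      have "(SOME \<beta>. \<beta> \<in> {\<alpha>, - \<alpha>}) \<in> {\<alpha>, - \<alpha>}" by (rule someI[of _ \<alpha>]) simp
      then show ?thesis using that opposite_facts(4)[OF that] unfolding P_def mem_Collect_eq sw by blast
    qed
    show "- \<alpha> \<notin> P" if "\<alpha> \<in> P" for \<alpha>
    proof
      assume "- \<alpha> \<in> P"
      then have "(SOME \<beta>. \<beta> \<in> {\<alpha>, - \<alpha>}) = - \<alpha>" unfolding P_def mem_Collect_eq sw by blast
      moreover have "(SOME \<beta>. \<beta> \<in> {\<alpha>, - \<alpha>}) = \<alpha>" "\<alpha> \<in> roots h" using that opposite_facts(1) unfolding P_def by blast+
      ultimately show False using root_neg_neq by metis
    qed
  qed
qed

lemma no_opposite:
  assumes nd: "nondegenerate_on (k \<inter> rf) (\<lambda>X Y. Im (\<epsilon> X Y))"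
  shows "R0 \<inter> uminus ` R0 = {}"
proof (rule ccontr)
  assume "R0 \<inter> uminus ` R0 \<noteq> {}"
  then obtain \<alpha>\<^sub>0 where \<alpha>\<^sub>0: "\<alpha>\<^sub>0 \<in> opposite" by (auto simp: opposite_def)
  obtain P where P: "P \<subseteq> opposite" "\<And>\<alpha>. \<alpha> \<in> opposite \<Longrightarrow> \<alpha> \<in> P \<or> - \<alpha> \<in> P" "\<And>\<alpha>. \<alpha> \<in> P \<Longrightarrow> - \<alpha> \<notin> P"
    using half_system by blast
  have finP: "finite P" by (rule finite_subset[OF _ finite_R0]) (use P(1) in \<open>auto simp: opposite_def\<close>)
  \<comment> \<open>\<open>None\<close> stands for the Cartan vector. It is what raises the number
    of unknowns above the number of pairs.\<close>
  define vec where "vec i = (case i of None \<Rightarrow> \<i> *\<^sub>C Hv \<alpha>\<^sub>0 | Some \<beta> \<Rightarrow> V \<beta>)" for i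
  define I where "I = insert None (Some ` P)"
  note op0 = opposite_in[OF opposite_facts(2,3)[OF \<alpha>\<^sub>0]] and f0 = opposite_facts[OF \<alpha>\<^sub>0]
  have Hrf: "\<i> *\<^sub>C Hv \<alpha>\<^sub>0 \<in> rf" by (simp add: rf_iff sigma_scale sigma_Hv f0 cvec.scale_minus_right)
  have Hh: "\<i> *\<^sub>C Hv \<alpha>\<^sub>0 \<in> h" and Hk: "\<i> *\<^sub>C Hv \<alpha>\<^sub>0 \<in> k" by (simp_all add: h_scale Hv_h f0 k_scale op0)
  have vec: "vec i \<in> k" "vec i \<in> rf" if "i \<in> I" for i
    using that P(1) by (auto simp: I_def vec_def Hk Hrf U_V_k U_V_real)
  have vecH: "Im (\<epsilon> (vec i) H) = 0" if "i \<in> I" "H \<in> k" "H \<in> h" "H \<in> rf" for i H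
  proof (cases i)
    case None
    have "\<epsilon> H (\<i> *\<^sub>C Hv \<alpha>\<^sub>0) = 0" using eps_H_Hv[OF f0(2,3) that(2,3)] eps_bilinear(4)[OF that(2) op0(2)] by simp
    then show ?thesis using eps_real_swap[OF Hk Hrf that(2,4)] None by (simp add: vec_def)
  next
    case (Some \<beta>)
    then show ?thesis using eps_V_H[OF _ that(2-4)] that(1) P(1) by (auto simp: vec_def I_def)
  qed
  have vecV: "Im (\<epsilon> (vec i) (V \<gamma>)) = 0" if "i \<in> I" "\<gamma> \<in> opposite" for i \<gamma>
  proof (cases i)
    case None
    then show ?thesis
      using eps_real_swap[OF Hk Hrf U_V_k(2)[OF that(2)] U_V_real(2)] eps_V_H[OF that(2) Hk Hh Hrf] by (simp add: vec_def)
  next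
    case (Some \<beta>)
    then show ?thesis using eps_V_V[OF _ that(2)] that(1) P(1) by (auto simp: vec_def I_def)
  qed
  have finI: "finite I" and card: "card P < card I"
    using finP by (auto simp: I_def card_image card_insert_if)
  obtain x :: "('g \<Rightarrow> complex) option \<Rightarrow> real"
    where x: "\<And>\<gamma>. \<gamma> \<in> P \<Longrightarrow> (\<Sum>i\<in>I. Im (\<epsilon> (vec i) (U \<gamma>)) * x i) = 0" and nz: "\<exists>i\<in>I. x i \<noteq> 0"
    using underdetermined_system[OF finP finI card, of "\<lambda>\<gamma> i. Im (\<epsilon> (vec i) (U \<gamma>))"] by blast
  define v where "v = (\<Sum>i\<in>I. complex_of_real (x i) *\<^sub>C vec i)"
  have vk: "v \<in> k" unfolding v_def by (intro cvec.subspace_sum[OF k_subspace] k_scale vec)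
  have vrf: "v \<in> rf" using vec(2) by (simp add: v_def rf_iff sigma_sum sigma_scale cong: sum.cong)
  have eps_v: "Im (\<epsilon> v y) = (\<Sum>i\<in>I. Im (\<epsilon> (vec i) y) * x i)" if "y \<in> kbar" for y
    unfolding v_def by (simp add: eps_sum_left vec that mult.commute)
  have vU: "Im (\<epsilon> v (U \<gamma>)) = 0" if \<gamma>: "\<gamma> \<in> opposite" for \<gamma>
  proof -
    have P0: "Im (\<epsilon> v (U \<gamma>)) = 0" if "\<gamma> \<in> P" for \<gamma>
      using eps_v[OF real_kbar[OF U_V_k(1) U_V_real(1)], of \<gamma>] x[OF that] that P(1) by auto
    consider "\<gamma> \<in> P" | "- \<gamma> \<in> P" using P(2)[OF \<gamma>] by blast
    then show ?thesis
    proof cases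
      case 2
      have "U \<gamma> = complex_of_real (- a (- \<gamma>)) *\<^sub>C U (- \<gamma>)" using U_V_neg[OF opposite_facts(4)[OF \<gamma>]] by simp
      moreover have "\<epsilon> v (c *\<^sub>C U (- \<gamma>)) = c * \<epsilon> v (U (- \<gamma>))" for c
        by (intro eps_bilinear(4)[OF vk] real_kbar U_V_k U_V_real opposite_facts(4)[OF \<gamma>])
      ultimately have "\<epsilon> v (U \<gamma>) = complex_of_real (- a (- \<gamma>)) * \<epsilon> v (U (- \<gamma>))" by metis
      then show ?thesis using P0[OF 2] by simp
    qed (rule P0)
  qed
  have "Im (\<epsilon> v y) = 0" if y: "y \<in> k" "y \<in> rf" for y
  proof -
    note kc = cvec.subspace_add[OF kbar_subspace] cvec.subspace_scale[OF kbar_subspace]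
    let ?t = "\<lambda>\<alpha>. complex_of_real (Re (om \<alpha> y) / 2) *\<^sub>C U \<alpha> + complex_of_real (Im (om \<alpha> y) / 2) *\<^sub>C V \<alpha>"
    have UV: "U \<alpha> \<in> kbar" "V \<alpha> \<in> kbar" if "\<alpha> \<in> opposite" for \<alpha> by (intro real_kbar U_V_k U_V_real that)+
    have t: "?t \<alpha> \<in> kbar" "Im (\<epsilon> v (?t \<alpha>)) = 0" if "\<alpha> \<in> opposite" for \<alpha>
    proof -
      show "?t \<alpha> \<in> kbar" by (intro kc UV that)
      have "\<epsilon> v (?t \<alpha>) = complex_of_real (Re (om \<alpha> y) / 2) * \<epsilon> v (U \<alpha>) + complex_of_real (Im (om \<alpha> y) / 2) * \<epsilon> v (V \<alpha>)"
        by (simp only: eps_bilinear(3)[OF vk kc(2)[OF UV(1)[OF that]] kc(2)[OF UV(2)[OF that]]]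
            eps_bilinear(4)[OF vk UV(1)[OF that]] eps_bilinear(4)[OF vk UV(2)[OF that]])
      moreover have "Im (\<epsilon> v (V \<alpha>)) = 0" by (simp add: eps_v UV(2)[OF that] vecV that)
      ultimately show "Im (\<epsilon> v (?t \<alpha>)) = 0"
        using vU[OF that] by (simp only: plus_complex.simps Im_complex_of_real Re_complex_of_real times_complex.simps)
    qed
    have s: "Im (\<epsilon> v (\<Sum>\<alpha>\<in>Q. ?t \<alpha>)) = 0 \<and> (\<Sum>\<alpha>\<in>Q. ?t \<alpha>) \<in> kbar" if "Q \<subseteq> opposite" for Q
      using that
    proof (induction Q rule: infinite_finite_induct)
      case (insert \<alpha> Q)
      then have IH: "Im (\<epsilon> v (\<Sum>\<alpha>\<in>Q. ?t \<alpha>)) = 0" "(\<Sum>\<alpha>\<in>Q. ?t \<alpha>) \<in> kbar" and \<alpha>: "\<alpha> \<in> opposite" by auto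
      show ?case
        unfolding sum.insert[OF insert.hyps] eps_bilinear(3)[OF vk t(1)[OF \<alpha>] IH(2)]
        using IH(1) t(2)[OF \<alpha>] kc(1)[OF t(1)[OF \<alpha>] IH(2)] by simp
    qed (simp_all add: eps_zero vk cvec.subspace_0[OF kbar_subspace])
    have p: "pr y \<in> kbar" "Im (\<epsilon> v (pr y)) = 0"
      using real_span(2-4)[OF y] real_kbar[of "pr y"] by (simp_all add: eps_v vecH)
    have "\<epsilon> v (pr y + (\<Sum>\<alpha>\<in>opposite. ?t \<alpha>)) = \<epsilon> v (pr y) + \<epsilon> v (\<Sum>\<alpha>\<in>opposite. ?t \<alpha>)"
      using s[OF order_refl] by (intro eps_bilinear(3)[OF vk p(1)]) blast
    then have "Im (\<epsilon> v (pr y + (\<Sum>\<alpha>\<in>opposite. ?t \<alpha>))) = 0" using p(2) s[OF order_refl] by simp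
    then show ?thesis unfolding real_span(1)[OF y, symmetric] .
  qed
  then have v0: "v = 0" using nd vk vrf unfolding nondegenerate_on_def by blast
  \<comment> \<open>It remains to contradict v = 0: the vectors \<open>vec\<close> are linearly
    independent, the V being separated by their components at the roots of P and the last one being
    a nonzero Cartan element.\<close>
  have v: "v = complex_of_real (x None) *\<^sub>C \<i> *\<^sub>C Hv \<alpha>\<^sub>0 + (\<Sum>\<beta>\<in>P. complex_of_real (x (Some \<beta>)) *\<^sub>C V \<beta>)"
    unfolding v_def I_def using finP by (subst sum.insert) (auto simp: sum.reindex vec_def)
  have om_sum: "om \<beta> (\<Sum>i\<in>Q. f i) = (\<Sum>i\<in>Q. om \<beta> (f i))" if "\<beta> \<in> roots h" for \<beta> f and Q :: "('g \<Rightarrow> complex) set"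
    by (induction Q rule: infinite_finite_induct) (simp_all add: om_linear that components(6)[OF that h_zero])
  have pr_sum: "pr (\<Sum>i\<in>Q. f i) = (\<Sum>i\<in>Q. pr (f i))" for f and Q :: "('g \<Rightarrow> complex) set"
    by (induction Q rule: infinite_finite_induct) (simp_all add: pr_linear components(4)[OF h_zero])
  have xP: "x (Some \<beta>) = 0" if \<beta>: "\<beta> \<in> P" for \<beta>
  proof -
    have rb: "\<beta> \<in> roots h" using \<beta> P(1) opposite_facts(1) by blast
    have "om \<beta> (V \<gamma>) = (if \<gamma> = \<beta> then \<i> else 0)" if "\<gamma> \<in> P" for \<gamma>
    proof -
      have "\<gamma> \<in> opposite" using that P(1) by blast
      moreover have "- \<gamma> \<noteq> \<beta>" using P(3)[OF that] \<beta> by auto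
      ultimately show ?thesis by (simp add: V_eq om_linear[OF rb] components opposite_facts rb)
    qed
    then have "om \<beta> v = (\<Sum>\<gamma>\<in>P. complex_of_real (x (Some \<gamma>)) * (if \<gamma> = \<beta> then \<i> else 0))"
      unfolding v by (simp add: om_linear[OF rb] om_sum[OF rb] components(6)[OF rb] Hv_h f0 cong: sum.cong)
    also have "\<dots> = \<i> * complex_of_real (x (Some \<beta>))"
      using finP \<beta> by (simp add: if_distrib[of "\<lambda>c. _ * c"] cong: if_cong)
    finally show ?thesis using v0 components(6)[OF rb h_zero] by simp
  qed
  then have "complex_of_real (x None) *\<^sub>C \<i> *\<^sub>C Hv \<alpha>\<^sub>0 = 0" using v v0 by simp
  then have "x None = 0" using Hv_nonzero[OF f0(1)] by simp
  then show False using nz xP by (auto simp: I_def)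
qed

text \<open>Both sides are compared on weight vectors, where the cocycle condition has determined
  \<epsilon>. Disjointness excludes opposite roots, the only pairs of root vectors that
  \<open>eps_E_E\<close> does not treat.\<close>

lemma standard_when_admissible:
  assumes disj: "R0 \<inter> uminus ` R0 = {}" and X: "X \<in> k" and Y: "Y \<in> kbar"
  shows "\<epsilon> X Y = \<epsilon> (pr X) (pr Y) + standard_form mu X Y"
proof (rule form_eqI[OF eps_form _ _ _ _ _ X Y])
  have c: "pr X \<in> k" "pr Y \<in> kbar" if "X \<in> k" "Y \<in> kbar" for X Y using that k_components kbar_components by auto
  have "cbilinear_form_on k kbar (\<lambda>X Y. \<epsilon> (pr X) (pr Y))"
    by (simp add: cbilinear_form_on_def pr_linear eps_bilinear c)
  then show "cbilinear_form_on k kbar (\<lambda>X Y. \<epsilon> (pr X) (pr Y) + standard_form mu X Y)"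
    using standard_form_bilinear by (rule cbilinear_form_on_add)
  show "\<epsilon> H H' = \<epsilon> (pr H) (pr H') + standard_form mu H H'" if "H \<in> k \<inter> h" "H' \<in> kbar \<inter> h" for H H'
    using that by (simp add: components standard_form_values)
  show "\<epsilon> H (E (- \<beta>)) = \<epsilon> (pr H) (pr (E (- \<beta>))) + standard_form mu H (E (- \<beta>))" if "H \<in> k \<inter> h" "\<beta> \<in> R0" for H \<beta>
    using that by (simp add: components R0_roots standard_form_values eps_H_E eps_zero)
  show "\<epsilon> (E \<alpha>) H = \<epsilon> (pr (E \<alpha>)) (pr H) + standard_form mu (E \<alpha>) H" if "H \<in> kbar \<inter> h" "\<alpha> \<in> R0" for H \<alpha>
    using that by (simp add: components R0_roots standard_form_values eps_E_H eps_zero)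
  show "\<epsilon> (E \<alpha>) (E (- \<beta>)) = \<epsilon> (pr (E \<alpha>)) (pr (E (- \<beta>))) + standard_form mu (E \<alpha>) (E (- \<beta>))"
    if "\<alpha> \<in> R0" "\<beta> \<in> R0" for \<alpha> \<beta>
  proof -
    have "\<beta> \<noteq> - \<alpha>" using R0_no_opposite[OF disj that(1)] that(2) by auto
    then show ?thesis using that by (simp add: components R0_roots standard_form_values eps_E_E eps_zero k_zero)
  qed
qed

end

section \<open>The equivalence for regular subalgebras\<close>

context regular_pair
begin

lemma D_zero_facts:
  "cbilinear_map (D_zero h E a \<sigma>)"
  "X \<in> rf \<Longrightarrow> Y \<in> rf \<Longrightarrow> D_zero h E a \<sigma> X Y \<in> rf"
  unfolding D_zero_eq
  by (auto simp: cbilinear_map_def rf_iff sigma_bracket tau_sigma intro!: clinear_mapI simp: tau_linear lie_linear)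

theorem admissible_iff:
  "symmetric_admissible \<sigma> k (D_zero h E a \<sigma>) \<epsilon> \<longleftrightarrow>
    (positive_root_system (roots h) R0 \<and> cartan_spans) \<and>
    (\<exists>\<epsilon>\<^sub>0 \<mu>. skew_hermitian_on \<sigma> (k \<inter> h) \<epsilon>\<^sub>0 \<and>
       (\<forall>X\<in>k. \<forall>Y\<in>kbar. \<epsilon> X Y = \<epsilon>\<^sub>0 (pr X) (pr Y) + standard_form \<mu> X Y)) \<and>
    nondegenerate_on (k \<inter> h \<inter> {\<i> *\<^sub>C H | H. H \<in> real_cartan h}) (\<lambda>X Y. Im (\<epsilon> X Y))"
    (is "?L \<longleftrightarrow> (?pos \<and> cartan_spans) \<and> ?form \<and> ?nd")
proof
  assume L: ?L
  have spans: "cartan_spans" and R: "R0 \<union> uminus ` R0 = roots h"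
    using L sum_iff unfolding symmetric_admissible_def kbar_def by blast+
  have coc: "\<epsilon> X [tau Y, \<sigma> Z]\<^sub>L - \<epsilon> Y [tau X, \<sigma> Z]\<^sub>L = \<epsilon> [X, Y]\<^sub>L (\<sigma> Z)" if "X \<in> k" "Y \<in> k" "Z \<in> k" for X Y Z
    using L that unfolding symmetric_admissible_def D_zero_eq by blast
  interpret cocycle_pair h E N a \<sigma> k \<epsilon>
  proof
    show "\<epsilon> X [tau Y, W]\<^sub>L - \<epsilon> Y [tau X, W]\<^sub>L = \<epsilon> [X, Y]\<^sub>L W" if "X \<in> k" "Y \<in> k" "W \<in> kbar" for X Y W
      using coc[of X Y "\<sigma> W"] that by (simp add: kbar_iff)
  qed (rule spans)
  have nd: "nondegenerate_on (k \<inter> rf) (\<lambda>X Y. Im (\<epsilon> X Y))" using L unfolding symmetric_admissible_def by blast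
  have disj: "R0 \<inter> uminus ` R0 = {}" by (rule no_opposite[OF nd])
  have "skew_hermitian_on \<sigma> (k \<inter> h) \<epsilon>"
    using skew unfolding skew_hermitian_on_def cbilinear_form_on_def by blast
  \<comment> \<open>The witnesses are \<epsilon> itself, restricted to the Cartan part, and
    \<open>mu\<close>.\<close>
  then have ?form using standard_when_admissible[OF disj] by blast
  moreover have ?nd unfolding nondegenerate_iff[OF disj] by (rule nd)
  moreover have ?pos using R disj positive_iff by blast
  ultimately show "(?pos \<and> cartan_spans) \<and> ?form \<and> ?nd" using spans by blast
next
  assume R: "(?pos \<and> cartan_spans) \<and> ?form \<and> ?nd"
  then obtain \<epsilon>\<^sub>0 \<mu> where e0: "skew_hermitian_on \<sigma> (k \<inter> h) \<epsilon>\<^sub>0"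
      and eps: "\<And>X Y. X \<in> k \<Longrightarrow> Y \<in> kbar \<Longrightarrow> \<epsilon> X Y = \<epsilon>\<^sub>0 (pr X) (pr Y) + standard_form \<mu> X Y" by blast
  have pos: "R0 \<union> uminus ` R0 = roots h" "R0 \<inter> uminus ` R0 = {}" using R positive_iff by blast+
  have coc: "\<epsilon> X [tau Y, W]\<^sub>L - \<epsilon> Y [tau X, W]\<^sub>L = \<epsilon> [X, Y]\<^sub>L W" if "X \<in> k" "Y \<in> k" "W \<in> kbar" for X Y W
    by (rule admissible_standard[OF _ _ e0 eps that]) (use R in auto)
  have "lie_subalgebra k" using k_subspace k_bracket by (simp add: lie_subalgebra_def)
  moreover have "{X + Y | X Y. X \<in> k \<and> Y \<in> kbar} = UNIV" unfolding sum_iff using R pos(1) by blast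
  moreover have "nondegenerate_on (k \<inter> rf) (\<lambda>X Y. Im (\<epsilon> X Y))" using R unfolding nondegenerate_iff[OF pos(2)] by blast
  ultimately show ?L
    unfolding symmetric_admissible_def kbar_def[symmetric]
    using D_zero_facts skew coc tau_kbar tau_flat
    by (simp add: D_zero_eq kbar_iff)
qed

end

section \<open>The generalized complex structure\<close>

interpretation gvec: vector_space "generalized_scale :: complex \<Rightarrow> 'g::complex_lie_algebra \<times> ('g \<Rightarrow> complex) \<Rightarrow> _"
  by unfold_locales
    (auto simp: generalized_scale_def prod_eq_iff fun_eq_iff scaleC_add_right scaleC_add_left scaleC_scaleC scaleC_one algebra_simps)

lemma generalized_scale_simps [simp]:
  "fst (generalized_scale c u) = c *\<^sub>C fst u" "snd (generalized_scale c u) Y = c * snd u Y"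
  by (simp_all add: generalized_scale_def)

locale admissible_pair = cocycle_pair h E N a \<sigma> k \<epsilon>
  for h :: "'g::complex_lie_algebra set" and E N a \<sigma> k \<epsilon> +
  assumes nondeg: "nondegenerate_on (k \<inter> rf) (\<lambda>X Y. Im (\<epsilon> X Y))"
    and k_sum: "{X + Y | X Y. X \<in> k \<and> Y \<in> kbar} = UNIV"
begin

abbreviation gs where "gs \<equiv> generalized_scale :: complex \<Rightarrow> 'g \<times> ('g \<Rightarrow> complex) \<Rightarrow> _"
abbreviation gc where "gc \<equiv> generalized_conj \<sigma>"

definition gV :: "('g \<times> ('g \<Rightarrow> complex)) set" where "gV = UNIV \<times> {\<xi>. cfunctional \<xi>}"

text \<open>The eigenspace for \<i> that the associated structure is required to have.\<close>

definition gL :: "('g \<times> ('g \<Rightarrow> complex)) set" where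
  "gL = {(X, \<xi>). X \<in> k \<and> cfunctional \<xi> \<and> (\<forall>Y\<in>kbar. \<xi> Y = \<epsilon> X Y)}"

lemma gV_iff: "u \<in> gV \<longleftrightarrow> cfunctional (snd u)"
  by (cases u) (simp add: gV_def)

lemma gL_iff: "u \<in> gL \<longleftrightarrow> fst u \<in> k \<and> cfunctional (snd u) \<and> (\<forall>Y\<in>kbar. snd u Y = \<epsilon> (fst u) Y)"
  by (cases u) (simp add: gL_def)

lemma gL_gV: "u \<in> gL \<Longrightarrow> u \<in> gV"
  by (simp add: gL_iff gV_iff)

lemma gV_closed: "u \<in> gV \<Longrightarrow> v \<in> gV \<Longrightarrow> u + v \<in> gV" "u \<in> gV \<Longrightarrow> gs c u \<in> gV" "u \<in> gV \<Longrightarrow> gc u \<in> gV"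
  unfolding gV_iff
  by (auto intro!: cfunctionalI simp: cfunctionalD generalized_conj_def sigma_add sigma_scale algebra_simps)

lemma gL_closed: "u \<in> gL \<Longrightarrow> v \<in> gL \<Longrightarrow> u + v \<in> gL" "u \<in> gL \<Longrightarrow> gs c u \<in> gL"
  using gV_closed(1,2)[of u] by (auto simp: gL_iff gV_iff k_add k_scale eps_bilinear)

lemma gL_subspace: "gvec.subspace gL"
proof (rule gvec.subspaceI)
  have "cfunctional (\<lambda>_ :: 'g. 0)" by (rule cfunctionalI) simp_all
  then show "0 \<in> gL" by (simp add: gL_iff k_zero eps_zero zero_fun_def)
qed (simp_all add: gL_closed)

lemma gc_add: "gc (u + v) = gc u + gc v"
  and gc_scale: "gc (gs c u) = gs (cnj c) (gc u)"
  and gc_gc [simp]: "gc (gc u) = u"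
  by (simp_all add: generalized_conj_def prod_eq_iff fun_eq_iff sigma_add sigma_scale)

lemma gc_diff: "gc (u - v) = gc u - gc v"
  using gc_add[of "u - v" v] by simp

lemma gc_minus: "gc (- u) = - gc u"
  using gc_scale[of "-1" u] by simp

lemma k_kbar_real_parts:
  assumes "X \<in> k" "X \<in> kbar"
  shows "re_part X \<in> k" "im_part X \<in> k"
proof -
  have re: "re_part X \<in> k" if "X \<in> k" "X \<in> kbar" for X
    using that by (simp add: re_part_def k_scale k_add kbar_iff)
  show "re_part X \<in> k" by (rule re[OF assms])
  show "im_part X \<in> k" unfolding im_part_def
    by (intro re cvec.subspace_neg[OF k_subspace] cvec.subspace_neg[OF kbar_subspace] k_scale
        cvec.subspace_scale[OF kbar_subspace] assms)
qed

text \<open>On real vectors this is \<open>2 \<i> Im \<epsilon>\<close>.\<close>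

definition sym_eps where "sym_eps X Y = \<epsilon> X Y + \<epsilon> Y X"

lemma k_inter_subspace: "cvec.subspace (k \<inter> kbar)"
  by (rule cvec.subspace_inter[OF k_subspace kbar_subspace])

lemma sym_eps_bilinear: "cbilinear_form_on (k \<inter> kbar) (k \<inter> kbar) sym_eps"
  by (auto simp: cbilinear_form_on_def sym_eps_def eps_bilinear algebra_simps)

text \<open>The form is complex bilinear and purely imaginary on real elements, so testing against
  real elements puts the real and the imaginary part of X separately in the kernel of Im
  \<epsilon>.\<close>

lemma sym_eps_nondegenerate:
  assumes X: "X \<in> k \<inter> kbar" and z: "\<forall>Y\<in>k \<inter> kbar. sym_eps X Y = 0"
  shows "X = 0"
proof -
  have parts: "re_part X \<in> k \<inter> rf" "im_part X \<in> k \<inter> rf" using k_kbar_real_parts X by simp_all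
  have r: "sym_eps Z Y = 2 * \<i> * complex_of_real (Im (\<epsilon> Z Y))" if "Z \<in> k \<inter> rf" "Y \<in> k \<inter> rf" for Z Y
  proof -
    have "\<epsilon> Y Z = - cnj (\<epsilon> Z Y)" using eps_skew[of Y Z] that real_kbar[of Z] by (simp add: rf_iff)
    then show ?thesis by (simp add: sym_eps_def complex_eq_iff)
  qed
  have rk: "Z \<in> k \<inter> kbar" if "Z \<in> k \<inter> rf" for Z using that real_kbar by blast
  have "Im (\<epsilon> (re_part X) Y) = 0 \<and> Im (\<epsilon> (im_part X) Y) = 0" if Y: "Y \<in> k \<inter> rf" for Y
  proof -
    have b: "sym_eps (U + V) Y = sym_eps U Y + sym_eps V Y" "sym_eps (c *\<^sub>C V) Y = c * sym_eps V Y"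
      if "U \<in> k \<inter> kbar" "V \<in> k \<inter> kbar" for U V c
      using sym_eps_bilinear that rk[OF Y] unfolding cbilinear_form_on_def by blast+
    have "sym_eps (re_part X + \<i> *\<^sub>C im_part X) Y = 0" using z rk[OF Y] by (simp add: re_im)
    then have "sym_eps (re_part X) Y + \<i> * sym_eps (im_part X) Y = 0"
      using b rk parts cvec.subspace_scale[OF k_inter_subspace] by metis
    then show ?thesis unfolding r[OF parts(1) Y] r[OF parts(2) Y] by (simp add: complex_eq_iff)
  qed
  then have "re_part X = 0" "im_part X = 0" using nondeg parts unfolding nondegenerate_on_def by blast+
  then show ?thesis using re_im[of X] by simp
qed

text \<open>Skew-Hermitian symmetry describes the conjugate eigenspace: on k its covectors are given
  by - \<epsilon> with the vector in the second argument.\<close>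

lemma gc_gL:
  assumes "u \<in> gL" and Y: "Y \<in> k"
  shows "snd (gc u) Y = - \<epsilon> Y (fst (gc u))"
proof -
  have "\<sigma> (fst u) \<in> kbar" using assms by (simp add: gL_iff kbar_iff)
  then have "\<epsilon> Y (\<sigma> (fst u)) = - cnj (\<epsilon> (fst u) (\<sigma> Y))" using eps_skew[OF Y] by simp
  moreover have "\<sigma> Y \<in> kbar" using Y by (simp add: kbar_iff)
  ultimately show ?thesis using assms by (simp add: generalized_conj_def gL_iff)
qed

text \<open>The vector part of a common element lies in the kernel of \<open>sym_eps\<close>, so it
  is zero. Its covector then vanishes on k and on \<open>kbar\<close>, which together span.\<close>

lemma gL_inter:
  assumes "u \<in> gL" "gc u \<in> gL"
  shows "u = 0"
proof -
  have kb: "fst u \<in> k \<inter> kbar" using assms by (simp add: gL_iff generalized_conj_def kbar_iff)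
  have eqs: "snd u Y = \<epsilon> (fst u) Y" if "Y \<in> kbar" for Y using assms that by (simp add: gL_iff)
  have eqs': "snd u Y = - \<epsilon> Y (fst u)" if "Y \<in> k" for Y using gc_gL[OF assms(2) that] by simp
  have "sym_eps (fst u) Y = 0" if "Y \<in> k \<inter> kbar" for Y
    using eqs[of Y] eqs'[of Y] that unfolding sym_eps_def by (metis IntD1 IntD2 eq_neg_iff_add_eq_0)
  then have f: "fst u = 0" using sym_eps_nondegenerate kb by blast
  have lin: "cfunctional (snd u)" using assms by (simp add: gL_iff)
  have "snd u x = 0" for x
  proof -
    have "x \<in> {X + Y | X Y. X \<in> k \<and> Y \<in> kbar}" unfolding k_sum by (rule UNIV_I)
    then obtain X Y where "X \<in> k" "Y \<in> kbar" "x = X + Y" by blast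
    then show ?thesis using eqs[of Y] eqs'[of X] by (simp add: cfunctionalD[OF lin] f eps_zero)
  qed
  then show ?thesis using f by (simp add: prod_eq_iff fun_eq_iff)
qed

lemma functional_glue:
  assumes f: "\<And>x y. x \<in> k \<Longrightarrow> y \<in> k \<Longrightarrow> f (x + y) = f x + f y" "\<And>c x. x \<in> k \<Longrightarrow> f (c *\<^sub>C x) = c * f x"
    and g: "\<And>x y. x \<in> kbar \<Longrightarrow> y \<in> kbar \<Longrightarrow> g (x + y) = g x + g y" "\<And>c x. x \<in> kbar \<Longrightarrow> g (c *\<^sub>C x) = c * (g x :: complex)"
    and fg: "\<And>x. x \<in> k \<Longrightarrow> x \<in> kbar \<Longrightarrow> f x = g x"
  obtains F where "cfunctional F" "\<And>x. x \<in> k \<Longrightarrow> F x = f x" "\<And>x. x \<in> kbar \<Longrightarrow> F x = g x"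
proof -
  have "\<exists>X Y. X \<in> k \<and> Y \<in> kbar \<and> x = X + Y" for x
  proof -
    have "x \<in> {X + Y | X Y. X \<in> k \<and> Y \<in> kbar}" unfolding k_sum by (rule UNIV_I)
    then show ?thesis by blast
  qed
  then obtain P Q where PQ: "\<And>x. P x \<in> k" "\<And>x. Q x \<in> kbar" "\<And>x. x = P x + Q x" by metis
  define F where "F x = f (P x) + g (Q x)" for x
  note ks = cvec.subspace_diff[OF k_subspace] cvec.subspace_diff[OF kbar_subspace]
  have fd: "f (x - y) = f x - f y" if "x \<in> k" "y \<in> k" for x y using f(1)[OF ks(1)[OF that] that(2)] by simp
  have gd: "g (x - y) = g x - g y" if "x \<in> kbar" "y \<in> kbar" for x y using g(1)[OF ks(2)[OF that] that(2)] by simp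
  have F: "F (X + Y) = f X + g Y" if XY: "X \<in> k" "Y \<in> kbar" for X Y
  proof -
    have e: "P (X + Y) - X = Y - Q (X + Y)" using PQ(3)[of "X + Y"] by (simp add: algebra_simps)
    have "P (X + Y) - X \<in> k" by (rule ks(1)[OF PQ(1) XY(1)])
    moreover have "P (X + Y) - X \<in> kbar" unfolding e by (rule ks(2)[OF XY(2) PQ(2)])
    ultimately have "f (P (X + Y) - X) = g (P (X + Y) - X)" by (rule fg)
    then have "f (P (X + Y)) - f X = g Y - g (Q (X + Y))"
      unfolding fd[OF PQ(1) XY(1)] unfolding e gd[OF XY(2) PQ(2)] .
    then show ?thesis by (simp add: F_def algebra_simps)
  qed
  have z: "f 0 = 0" "g 0 = 0" using f(2)[of 0 0] g(2)[of 0 0] k_zero cvec.subspace_0[OF kbar_subspace] by simp_all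
  show thesis
  proof (rule that)
    show "cfunctional F"
    proof (rule cfunctionalI)
      fix x y c
      have "F ((P x + P y) + (Q x + Q y)) = f (P x + P y) + g (Q x + Q y)"
        by (intro F k_add cvec.subspace_add[OF kbar_subspace] PQ)
      moreover have "(P x + P y) + (Q x + Q y) = (P x + Q x) + (P y + Q y)" by (simp add: ac_simps)
      ultimately show "F (x + y) = F x + F y" by (simp add: PQ(3)[symmetric] f g PQ(1,2)) (simp add: F_def)
      have "F (c *\<^sub>C P x + c *\<^sub>C Q x) = f (c *\<^sub>C P x) + g (c *\<^sub>C Q x)"
        by (intro F k_scale cvec.subspace_scale[OF kbar_subspace] PQ)
      then show "F (c *\<^sub>C x) = c * F x"
        by (simp add: scaleC_add_right[symmetric] PQ(3)[symmetric] f g PQ(1,2)) (simp add: F_def distrib_left)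
    qed
    show "F x = f x" if "x \<in> k" for x using F[OF that cvec.subspace_0[OF kbar_subspace]] z by simp
    show "F x = g x" if "x \<in> kbar" for x using F[OF k_zero that] z by simp
  qed
qed

text \<open>The two covectors have prescribed values on \<open>kbar\<close> and on k, which must be
  compatible on the intersection. Splitting the vector part leaves a choice C in this intersection,
  and nondegeneracy of \<open>sym_eps\<close> finds the C that makes them compatible.\<close>

lemma gL_sum:
  assumes u: "u \<in> gV"
  obtains l l' where "l \<in> gL" "l' \<in> gL" "u = l + gc l'"
proof -
  have "fst u \<in> {X + Y | X Y. X \<in> k \<and> Y \<in> kbar}" unfolding k_sum by (rule UNIV_I)
  then obtain A B where AB: "A \<in> k" "B \<in> kbar" "fst u = A + B" by blast
  have lin: "cfunctional (snd u)" using u by (simp add: gV_iff)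
  note sk = cvec.subspace_add[OF kbar_subspace] cvec.subspace_scale[OF kbar_subspace]
  obtain C where C: "C \<in> k \<inter> kbar" "\<And>Y. Y \<in> k \<inter> kbar \<Longrightarrow> sym_eps C Y = snd u Y + \<epsilon> Y B - \<epsilon> A Y"
    by (rule nondegenerate_represents[OF semisimple k_inter_subspace sym_eps_bilinear, where f = "\<lambda>Y. snd u Y + \<epsilon> Y B - \<epsilon> A Y"])
      (use sym_eps_nondegenerate AB in \<open>auto simp: cfunctionalD[OF lin] eps_bilinear algebra_simps\<close>)
  define A' B' where "A' = A + C" and "B' = B - C"
  have A': "A' \<in> k" and B': "B' \<in> kbar" and sum: "fst u = A' + B'"
    using AB C(1) by (simp_all add: A'_def B'_def k_add cvec.subspace_diff[OF kbar_subspace])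
  have eB': "\<epsilon> Y B' = \<epsilon> Y B - \<epsilon> Y C" if "Y \<in> k" for Y
    using eps_bilinear(3)[OF that B', of C] C(1) by (simp add: B'_def)
  obtain F where F: "cfunctional F" "\<And>x. x \<in> k \<Longrightarrow> F x = snd u x + \<epsilon> x B'" "\<And>x. x \<in> kbar \<Longrightarrow> F x = \<epsilon> A' x"
  proof (rule functional_glue[where f = "\<lambda>x. snd u x + \<epsilon> x B'" and g = "\<lambda>x. \<epsilon> A' x"])
    show "snd u x + \<epsilon> x B' = \<epsilon> A' x" if "x \<in> k" "x \<in> kbar" for x
      using C(2)[of x] that eps_bilinear(1)[OF AB(1), of C x] C(1)
      by (simp add: sym_eps_def eB' A'_def algebra_simps)
  qed (use A' B' in \<open>simp_all add: eps_bilinear cfunctionalD[OF lin] algebra_simps\<close>)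
  define l where "l = (A', F)"
  have l: "l \<in> gL" using A' F by (simp add: l_def gL_iff)
  have snd: "snd l = F" by (simp add: l_def)
  have "gc (u - l) \<in> gL"
    unfolding gL_iff
  proof (intro conjI ballI)
    have f: "fst u - fst l = B'" by (simp add: l_def sum)
    show "fst (gc (u - l)) \<in> k" using B' by (simp add: generalized_conj_def f kbar_iff)
    have "u - l = u + gs (-1) l" by simp
    then have "u - l \<in> gV" using gV_closed(1)[OF u gV_closed(2)[OF gL_gV[OF l]]] by metis
    then show "cfunctional (snd (gc (u - l)))" using gV_closed(3) by (simp add: gV_iff)
    fix Y assume Y: "Y \<in> kbar"
    then have sY: "\<sigma> Y \<in> k" by (simp add: kbar_iff)
    have "snd (gc (u - l)) Y = cnj (- \<epsilon> (\<sigma> Y) B')"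
      by (simp add: generalized_conj_def snd F(2)[OF sY])
    also have "\<dots> = \<epsilon> (\<sigma> B') Y" using eps_skew[OF sY B'] by simp
    finally show "snd (gc (u - l)) Y = \<epsilon> (fst (gc (u - l))) Y" by (simp add: generalized_conj_def f)
  qed
  then show thesis using that[OF l, of "gc (u - l)"] by simp
qed

text \<open>The projection to \<open>gL\<close> along its conjugate. The operator \<open>gJ\<close>
  built from it is \<i> on \<open>gL\<close> and - \<i> on the conjugate.\<close>

definition gproj where "gproj u = (SOME l. l \<in> gL \<and> gc (u - l) \<in> gL)"
definition gJ where "gJ u = gs (2 * \<i>) (gproj u) - gs \<i> u"

lemma gproj_eq:
  assumes l: "l \<in> gL" "l' \<in> gL"
  shows "gproj (l + gc l') = l"
  unfolding gproj_def
proof (rule some_equality)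
  show "l \<in> gL \<and> gc (l + gc l' - l) \<in> gL" using l by simp
  fix m assume m: "m \<in> gL \<and> gc (l + gc l' - m) \<in> gL"
  have "l - m = 0"
  proof (rule gL_inter)
    show "l - m \<in> gL" using m l gvec.subspace_diff[OF gL_subspace] by blast
    have "gc (l - m) = gc (l + gc l' - m) - l'" by (simp add: gc_add gc_diff)
    also have "\<dots> \<in> gL" using m l gvec.subspace_diff[OF gL_subspace] by blast
    finally show "gc (l - m) \<in> gL" .
  qed
  then show "m = l" by simp
qed

lemma gJ_eq:
  assumes l: "l \<in> gL" "l' \<in> gL"
  shows "gJ (l + gc l') = gs \<i> l + gc (gs \<i> l')"
  using gvec.scale_left_distrib[of \<i> \<i> l]
  by (simp add: gJ_def gproj_eq l gc_scale gvec.scale_right_distrib)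

lemma gJ_V: "u \<in> gV \<Longrightarrow> gJ u \<in> gV"
  by (erule gL_sum) (simp add: gJ_eq gV_closed gL_gV del: gc_scale)

lemma gJ_gJ: "u \<in> gV \<Longrightarrow> gJ (gJ u) = - u"
proof (erule gL_sum)
  fix l l' assume a: "l \<in> gL" "l' \<in> gL" "u = l + gc l'"
  show ?thesis
    unfolding a(3) gJ_eq[OF a(1,2)] gJ_eq[OF gL_closed(2)[OF a(1)] gL_closed(2)[OF a(2)]] by (simp add: gc_minus)
qed

lemma gJ_add: "u \<in> gV \<Longrightarrow> v \<in> gV \<Longrightarrow> gJ (u + v) = gJ u + gJ v"
proof (erule gL_sum, erule gL_sum)
  fix l l' m m' assume a: "l \<in> gL" "l' \<in> gL" "u = l + gc l'" "m \<in> gL" "m' \<in> gL" "v = m + gc m'"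
  have "u + v = (l + m) + gc (l' + m')" by (simp add: a gc_add ac_simps)
  then have "gJ (u + v) = gs \<i> (l + m) + gc (gs \<i> (l' + m'))" using a by (simp only: gJ_eq gL_closed)
  then show ?thesis by (simp add: a(3,6) gJ_eq[OF a(1,2)] gJ_eq[OF a(4,5)] gvec.scale_right_distrib gc_add ac_simps)
qed

lemma gJ_scale: "u \<in> gV \<Longrightarrow> gJ (gs c u) = gs c (gJ u)"
proof (erule gL_sum)
  fix l l' assume a: "l \<in> gL" "l' \<in> gL" "u = l + gc l'"
  have "gs c u = gs c l + gc (gs (cnj c) l')" by (simp add: a(3) gvec.scale_right_distrib gc_scale)
  then have "gJ (gs c u) = gs \<i> (gs c l) + gc (gs \<i> (gs (cnj c) l'))" using a(1,2) by (simp only: gJ_eq gL_closed)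
  then show ?thesis by (simp add: a(3) gJ_eq[OF a(1,2)] gvec.scale_right_distrib gc_scale mult.commute
      gvec.scale_right_diff_distrib)
qed

lemma gJ_gc: "u \<in> gV \<Longrightarrow> gJ (gc u) = gc (gJ u)"
proof (erule gL_sum)
  fix l l' assume a: "l \<in> gL" "l' \<in> gL" "u = l + gc l'"
  have "gc u = l' + gc l" by (simp add: a(3) gc_add ac_simps)
  then show ?thesis by (simp add: a(3) gJ_eq[OF a(1,2)] gJ_eq[OF a(2,1)] gc_add ac_simps)
qed

lemma pairing_linear:
  "generalized_pairing (u + u') v = generalized_pairing u v + generalized_pairing u' v" if "v \<in> gV" for u u' v :: "'g \<times> ('g \<Rightarrow> complex)"
  using that by (simp add: generalized_pairing_def cfunctionalD gV_iff add_divide_distrib algebra_simps)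

lemma pairing_scale: "v \<in> gV \<Longrightarrow> generalized_pairing (gs c u) v = c * generalized_pairing u (v :: 'g \<times> ('g \<Rightarrow> complex))"
  by (simp add: generalized_pairing_def cfunctionalD gV_iff algebra_simps)

lemma pairing_commute: "generalized_pairing u v = generalized_pairing v (u :: 'g \<times> ('g \<Rightarrow> complex))"
  by (simp add: generalized_pairing_def add.commute)

text \<open>Orthogonality of the two eigenspaces, rather than isotropy of each, is what makes the
  structure symmetric for the pairing.\<close>

lemma pairing_gL: "l \<in> gL \<Longrightarrow> m \<in> gL \<Longrightarrow> generalized_pairing l (gc m) = 0"
proof -
  assume l: "l \<in> gL" and m: "m \<in> gL"
  have s: "\<sigma> (fst m) \<in> kbar" "fst l \<in> k" "fst m \<in> k" using l m by (simp_all add: gL_iff kbar_iff)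
  have "snd (gc m) (fst l) = - \<epsilon> (fst l) (fst (gc m))" by (rule gc_gL[OF m s(2)])
  moreover have "snd l (fst (gc m)) = \<epsilon> (fst l) (fst (gc m))" using l s by (simp add: gL_iff generalized_conj_def)
  ultimately show ?thesis by (simp add: generalized_pairing_def)
qed

lemma gJ_pairing:
  assumes "u \<in> gV" "v \<in> gV"
  shows "generalized_pairing (gJ u) v = generalized_pairing u (gJ v)"
proof -
  obtain l l' where l: "l \<in> gL" "l' \<in> gL" "u = l + gc l'" using assms(1) by (rule gL_sum)
  obtain m m' where m: "m \<in> gL" "m' \<in> gL" "v = m + gc m'" using assms(2) by (rule gL_sum)
  have V: "l \<in> gV" "gc l' \<in> gV" "m \<in> gV" "gc m' \<in> gV" using l m gL_gV gV_closed by auto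
  have e: "generalized_pairing (gs c l + gs d (gc l')) (gs c' m + gs d' (gc m')) =
      c * c' * generalized_pairing l m + d * d' * generalized_pairing (gc l') (gc m')" for c d c' d'
  proof -
    have "generalized_pairing (gs c l + gs d (gc l')) w = c * generalized_pairing l w + d * generalized_pairing (gc l') w" if "w \<in> gV" for w
      using that by (simp add: pairing_linear pairing_scale)
    moreover have "generalized_pairing w (gs c' m + gs d' (gc m')) = c' * generalized_pairing w m + d' * generalized_pairing w (gc m')" if "w \<in> gV" for w
      using that by (simp add: pairing_commute[of w] pairing_linear pairing_scale)
    moreover have "gs c' m + gs d' (gc m') \<in> gV" by (intro gV_closed V)
    ultimately show ?thesis
      using V pairing_gL[OF l(1) m(2)] pairing_gL[OF m(1) l(2)] by (simp add: pairing_commute[of "gc l'" m] algebra_simps)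
  qed
  have Ju: "gJ u = gs \<i> l + gs (- \<i>) (gc l')" and Jv: "gJ v = gs \<i> m + gs (- \<i>) (gc m')"
    unfolding l(3) m(3) gJ_eq[OF l(1,2)] gJ_eq[OF m(1,2)] by (simp_all add: gc_scale)
  have uv: "u = gs 1 l + gs 1 (gc l')" "v = gs 1 m + gs 1 (gc m')" by (simp_all add: l m)
  show ?thesis
    using e[of \<i> "- \<i>" 1 1] e[of 1 1 \<i> "- \<i>"] unfolding Ju[symmetric] Jv[symmetric] uv[symmetric] by simp
qed

lemma gJ_eigenspace: "{u \<in> gV. gJ u = gs \<i> u} = gL"
proof (intro equalityI subsetI)
  fix u assume "u \<in> {u \<in> gV. gJ u = gs \<i> u}"
  then have u: "u \<in> gV" "gJ u = gs \<i> u" by auto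
  obtain l l' where l: "l \<in> gL" "l' \<in> gL" "u = l + gc l'" using u(1) by (rule gL_sum)
  have "gs \<i> l + gs (- \<i>) (gc l') = gs \<i> l + gs \<i> (gc l')"
    using u(2) unfolding l(3) gJ_eq[OF l(1,2)] gc_scale gvec.scale_right_distrib by simp
  then have "gs (- \<i>) (gc l') = gs \<i> (gc l')" by (rule add_left_imp_eq)
  then have "gs (\<i> - - \<i>) (gc l') = 0" unfolding gvec.scale_left_diff_distrib by simp
  then have "gc l' = 0" by simp
  then show "u \<in> gL" using l by simp
next
  fix u assume u: "u \<in> gL"
  have z: "0 \<in> gL" by (rule gvec.subspace_0[OF gL_subspace])
  have "gc 0 = 0" by (simp add: generalized_conj_def prod_eq_iff fun_eq_iff)
  then show "u \<in> {u \<in> gV. gJ u = gs \<i> u}" using gJ_eq[OF u z] u gL_gV by simp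
qed

lemma gJ_associated: "associated_generalized_structure \<sigma> k \<epsilon> gJ"
  unfolding associated_generalized_structure_def Let_def gV_def[symmetric] kbar_def[symmetric] gJ_eigenspace
  using gJ_V gJ_gJ gJ_gc gJ_scale gJ_add gJ_pairing by (auto simp: gL_def)

text \<open>The bracket of the semidirect product of the complex algebra with its dual, on which the
  algebra acts by the transpose of \<open>D_zero\<close> up to sign.\<close>

definition gbr :: "'g \<times> ('g \<Rightarrow> complex) \<Rightarrow> 'g \<times> ('g \<Rightarrow> complex) \<Rightarrow> 'g \<times> ('g \<Rightarrow> complex)" where
  "gbr u v = ([fst u, fst v]\<^sub>L, \<lambda>W. snd u [tau (fst v), W]\<^sub>L - snd v [tau (fst u), W]\<^sub>L)"

lemma gbr_linear:
  "w \<in> gV \<Longrightarrow> gbr (u + v) w = gbr u w + gbr v w" "w \<in> gV \<Longrightarrow> gbr w (u + v) = gbr w u + gbr w v"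
  "w \<in> gV \<Longrightarrow> gbr (gs c u) w = gs c (gbr u w)" "w \<in> gV \<Longrightarrow> gbr w (gs c u) = gs c (gbr w u)"
  by (simp_all add: gbr_def prod_eq_iff fun_eq_iff lie_linear tau_linear cfunctionalD gV_iff algebra_simps)

lemma gbr_V: "u \<in> gV \<Longrightarrow> v \<in> gV \<Longrightarrow> gbr u v \<in> gV"
  by (auto simp: gbr_def gV_iff lie_linear cfunctionalD algebra_simps intro!: cfunctionalI)

text \<open>On \<open>kbar\<close> the covector of the bracket is the left side of the cocycle
  condition, whose right side is the value demanded by \<open>gL\<close>.\<close>

lemma gbr_L: "u \<in> gL \<Longrightarrow> v \<in> gL \<Longrightarrow> gbr u v \<in> gL"
  using gbr_V[of u v] gL_gV[of u] gL_gV[of v] cocycle[of "fst u" "fst v"] tau_kbar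
  by (auto simp: gL_iff gbr_def gV_iff k_bracket)

lemma gbr_gc: "gc (gbr u v) = gbr (gc u) (gc v)"
proof -
  have "\<sigma> [tau (\<sigma> x), W]\<^sub>L = [tau x, \<sigma> W]\<^sub>L" for x W by (simp add: sigma_bracket tau_sigma)
  then show ?thesis by (simp add: generalized_conj_def gbr_def sigma_bracket)
qed

text \<open>In the splitting into eigenspaces the brackets of mixed type cancel whatever J does to
  them. The two pure brackets stay in their eigenspaces by \<open>gbr_L\<close> and its conjugate,
  where J is a scalar.\<close>

lemma gbr_integrable:
  assumes "u \<in> gV" "v \<in> gV"
  shows "gbr (gJ u) (gJ v) - gJ (gbr (gJ u) v) - gJ (gbr u (gJ v)) - gbr u v = 0"
proof -
  obtain l l' where l: "l \<in> gL" "l' \<in> gL" "u = l + gc l'" using assms(1) by (rule gL_sum)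
  obtain m m' where m: "m \<in> gL" "m' \<in> gL" "v = m + gc m'" using assms(2) by (rule gL_sum)
  have V: "l \<in> gV" "gc l' \<in> gV" "m \<in> gV" "gc m' \<in> gV" using l m gL_gV gV_closed by auto
  let ?p = "gbr l m" and ?q = "gbr l (gc m')" and ?r = "gbr (gc l') m" and ?s = "gbr (gc l') (gc m')"
  have W: "?p \<in> gV" "?q \<in> gV" "?r \<in> gV" "?s \<in> gV" by (intro gbr_V V)+
  have e: "gbr (gs c l + gs d (gc l')) (gs c' m + gs d' (gc m')) =
      gs (c * c') ?p + gs (c * d') ?q + gs (d * c') ?r + gs (d * d') ?s" for c d c' d'
    by (simp add: gbr_linear gV_closed V gvec.scale_right_distrib ac_simps)
  have Ju: "gJ u = gs \<i> l + gs (- \<i>) (gc l')" and Jv: "gJ v = gs \<i> m + gs (- \<i>) (gc m')"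
    unfolding l(3) m(3) gJ_eq[OF l(1,2)] gJ_eq[OF m(1,2)] by (simp_all add: gc_scale)
  have uv: "u = gs 1 l + gs 1 (gc l')" "v = gs 1 m + gs 1 (gc m')" by (simp_all add: l m)
  have z: "0 \<in> gL" by (rule gvec.subspace_0[OF gL_subspace])
  have gc0: "gc 0 = 0" by (simp add: generalized_conj_def prod_eq_iff fun_eq_iff)
  have Jp: "gJ ?p = gs \<i> ?p" using gJ_eq[OF gbr_L[OF l(1) m(1)] z] by (simp add: gc0)
  have Js: "gJ ?s = gs (- \<i>) ?s" using gJ_eq[OF z gbr_L[OF l(2) m(2)]] by (simp add: gbr_gc gc_scale)
  have J4: "gJ (gs c ?p + gs d ?q + gs d' ?r + gs c' ?s) = gs (c * \<i>) ?p + gs d (gJ ?q) + gs d' (gJ ?r) + gs (- (c' * \<i>)) ?s" for c d c' d'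
    by (simp add: gJ_add gJ_scale gV_closed W Jp Js)
  have 1: "gbr (gJ u) (gJ v) = gs (-1) ?p + gs 1 ?q + gs 1 ?r + gs (-1) ?s" unfolding Ju Jv e by simp
  have 2: "gbr (gJ u) v = gs \<i> ?p + gs \<i> ?q + gs (- \<i>) ?r + gs (- \<i>) ?s" unfolding Ju uv(2) e by simp
  have 3: "gbr u (gJ v) = gs \<i> ?p + gs (- \<i>) ?q + gs \<i> ?r + gs (- \<i>) ?s" unfolding uv(1) Jv e by simp
  have 4: "gbr u v = ?p + ?q + ?r + ?s" using e[of 1 1 1 1] uv by simp
  show ?thesis unfolding 1 2 3 4 J4 by simp
qed

end

section \<open>Transfer to the cotangent bundle of the group\<close>

locale lie_group_of_form = lie_group_atlas G A + conjugated_algebra \<sigma>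
  for G :: "('m, 'b) monoid_scheme" (structure) and A :: "('m, 'e::euclidean_space) chart set"
    and \<sigma> :: "'g::complex_lie_algebra \<Rightarrow> 'g" +
  fixes L :: "'g \<Rightarrow> 'm \<Rightarrow> ('m, 'e) tvec"
  assumes iso: "lie_algebra_iso G A \<sigma> L"
begin

definition coord :: "'g \<Rightarrow> 'e" where "coord X = L X \<one> unit_chart"
definition elem :: "'e \<Rightarrow> 'g" where "elem w = inv_into rf L (linv w)"

lemma L_bij: "bij_betw L rf {X. left_invariant_field G A X}"
  and L_add: "X \<in> rf \<Longrightarrow> Y \<in> rf \<Longrightarrow> L (X + Y) = L X + L Y"
  and L_scale: "X \<in> rf \<Longrightarrow> L (complex_of_real r *\<^sub>C X) = (\<lambda>x c. r *\<^sub>R L X x c)"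
  and L_bracket: "X \<in> rf \<Longrightarrow> Y \<in> rf \<Longrightarrow> L [X, Y]\<^sub>L = vf_bracket A (L X) (L Y)"
  using iso by (simp_all add: lie_algebra_iso_def)

lemma L_inj: "X \<in> rf \<Longrightarrow> Y \<in> rf \<Longrightarrow> L X = L Y \<Longrightarrow> X = Y"
  using L_bij by (auto simp: bij_betw_def inj_on_def)

lemma L_eq: "X \<in> rf \<Longrightarrow> L X = linv (coord X)"
  unfolding coord_def using L_bij by (intro left_invariant_field_eq) (auto simp: bij_betw_def)

lemma elem: "elem w \<in> rf" "L (elem w) = linv w"
proof -
  have "linv w \<in> L ` rf" using L_bij linv_left_invariant by (auto simp: bij_betw_def)
  then show "elem w \<in> rf" "L (elem w) = linv w"
    unfolding elem_def by (rule inv_into_into, rule f_inv_into_f)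
qed

lemma unit_linv: "linv w \<one> unit_chart = w"
  using mc_form_linv[of \<one> w] by (simp add: mc_form_def one_pushforward linv_tangent)

lemma coord_elem: "coord (elem w) = w"
  by (simp add: coord_def elem unit_linv)

lemma elem_coord: "X \<in> rf \<Longrightarrow> elem (coord X) = X"
  by (rule L_inj) (simp_all add: elem L_eq)

lemma coord_add: "X \<in> rf \<Longrightarrow> Y \<in> rf \<Longrightarrow> coord (X + Y) = coord X + coord Y"
  and coord_scale: "X \<in> rf \<Longrightarrow> coord (complex_of_real r *\<^sub>C X) = r *\<^sub>R coord X"
  by (simp_all add: coord_def L_add L_scale)

lemma coord_zero: "coord 0 = 0"
  using coord_scale[of 0 0] by simp

lemma coord_minus: "X \<in> rf \<Longrightarrow> coord (- X) = - coord X"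
  using coord_scale[of X "-1"] by simp

lemma coord_diff: "X \<in> rf \<Longrightarrow> Y \<in> rf \<Longrightarrow> coord (X - Y) = coord X - coord Y"
  using coord_add[of X "- Y"] by (simp add: coord_minus rf_minus)

lemma elem_add: "elem (v + w) = elem v + elem w"
  using elem_coord[OF rf_add[OF elem(1) elem(1)], of v w] by (simp add: coord_add elem coord_elem)

lemma elem_scale: "elem (r *\<^sub>R w) = complex_of_real r *\<^sub>C elem w"
  using elem_coord[OF rf_scale[OF elem(1)], of r w] by (simp add: coord_scale elem coord_elem)

lemma vf_bracket_antisym: "vf_bracket A X Y = - vf_bracket A Y X"
  by (auto simp: fun_eq_iff vf_bracket_def)

text \<open>The bracket of vector fields is visibly antisymmetric, and L is injective. The right
  linearity of the algebraic bracket rests on this.\<close>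

lemma bracket_antisym: "X \<in> rf \<Longrightarrow> Y \<in> rf \<Longrightarrow> [X, Y]\<^sub>L = - [Y, X]\<^sub>L"
proof (rule L_inj)
  assume XY: "X \<in> rf" "Y \<in> rf"
  have "L (complex_of_real (-1) *\<^sub>C [Y, X]\<^sub>L) = - L [Y, X]\<^sub>L"
    by (simp only: L_scale[OF rf_bracket[OF XY(2,1)]]) (simp add: fun_eq_iff)
  then show "L [X, Y]\<^sub>L = L (- [Y, X]\<^sub>L)"
    using vf_bracket_antisym[of "L X" "L Y"] by (simp add: L_bracket XY)
qed (simp_all add: rf_bracket rf_minus)

text \<open>Identifies pairs of model vectors with the real elements of the algebra plus its dual;
  the covector is extended complex linearly from the real form through real and imaginary
  parts.\<close>

definition enc :: "'e \<times> 'e \<Rightarrow> 'g \<times> ('g \<Rightarrow> complex)" where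
  "enc s = (elem (fst s), \<lambda>x. complex_of_real (snd s \<bullet> coord (re_part x)) + \<i> * complex_of_real (snd s \<bullet> coord (im_part x)))"

definition dec :: "'g \<times> ('g \<Rightarrow> complex) \<Rightarrow> 'e \<times> 'e" where
  "dec u = (coord (fst u), \<Sum>b\<in>Basis. Re (snd u (elem b)) *\<^sub>R b)"

abbreviation GR where "GR \<equiv> rf \<times> real_dual \<sigma>"

lemma GR_iff: "u \<in> GR \<longleftrightarrow> fst u \<in> rf \<and> cfunctional (snd u) \<and> (\<forall>X\<in>rf. snd u X \<in> \<real>)"
  by (cases u) (simp add: real_dual_def)

lemma re_im_scale:
  "re_part (c *\<^sub>C x) = complex_of_real (Re c) *\<^sub>C re_part x - complex_of_real (Im c) *\<^sub>C im_part x"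
  "im_part (c *\<^sub>C x) = complex_of_real (Re c) *\<^sub>C im_part x + complex_of_real (Im c) *\<^sub>C re_part x"
proof -
  have "c *\<^sub>C x = complex_of_real (Re c) *\<^sub>C x + \<i> *\<^sub>C (complex_of_real (Im c) *\<^sub>C x)"
    unfolding scaleC_scaleC scaleC_add_left[symmetric] using complex_eq[of c] by simp
  then show "re_part (c *\<^sub>C x) = complex_of_real (Re c) *\<^sub>C re_part x - complex_of_real (Im c) *\<^sub>C im_part x"
    "im_part (c *\<^sub>C x) = complex_of_real (Re c) *\<^sub>C im_part x + complex_of_real (Im c) *\<^sub>C re_part x"
    by (simp_all only: re_part_add im_part_add re_im_i re_im_real) simp_all
qed

lemma enc_real: "X \<in> rf \<Longrightarrow> snd (enc s) X = complex_of_real (snd s \<bullet> coord X)"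
  by (simp add: enc_def re_im_rf coord_zero)

lemma enc_GR: "enc s \<in> GR"
proof -
  have "cfunctional (snd (enc s))"
  proof (rule cfunctionalI)
    show "snd (enc s) (x + y) = snd (enc s) x + snd (enc s) y" for x y
      by (simp add: enc_def re_part_add im_part_add coord_add inner_add_right algebra_simps)
    show "snd (enc s) (c *\<^sub>C x) = c * snd (enc s) x" for c x
      by (simp add: enc_def re_im_scale coord_add coord_diff rf_scale coord_scale inner_add_right inner_diff_right
          complex_eq_iff algebra_simps)
  qed
  then show ?thesis by (simp add: GR_iff enc_real) (simp add: enc_def elem)
qed

lemma enc_add: "enc (s + t) = enc s + enc t"
  by (simp add: enc_def prod_eq_iff fun_eq_iff elem_add inner_add_left algebra_simps)

lemma enc_scale: "enc (r *\<^sub>R s) = generalized_scale (complex_of_real r) (enc s)"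
  by (simp add: enc_def generalized_scale_def prod_eq_iff fun_eq_iff elem_scale algebra_simps)

lemma dec_inner:
  assumes "cfunctional (snd u)"
  shows "snd (dec u) \<bullet> w = Re (snd u (elem w))"
proof -
  have "linear (\<lambda>w. Re (snd u (elem w)))"
    by (rule linearI) (simp_all add: elem_add elem_scale cfunctionalD[OF assms])
  from basis_sum_inner[OF this, of w] show ?thesis by (simp add: dec_def)
qed

lemma dec_enc: "dec (enc s) = s"
proof -
  have "snd (dec (enc s)) \<bullet> w = snd s \<bullet> w" for w
    using dec_inner[of "enc s" w] enc_GR[of s] by (simp only: GR_iff enc_real[OF elem(1)] coord_elem Re_complex_of_real)
  then have "snd (dec (enc s)) = snd s" by (intro vector_eq_rdot[THEN iffD1]) simp
  then show ?thesis by (simp add: prod_eq_iff) (simp add: dec_def enc_def coord_elem)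
qed

lemma enc_dec:
  assumes u: "u \<in> GR"
  shows "enc (dec u) = u"
proof -
  have c: "cfunctional (snd u)" using u by (simp add: GR_iff)
  have r: "complex_of_real (snd (dec u) \<bullet> coord X) = snd u X" if X: "X \<in> rf" for X
  proof -
    have "snd u X \<in> \<real>" using u X by (simp add: GR_iff)
    then show ?thesis by (simp add: dec_inner[OF c] elem_coord[OF X] of_real_Re)
  qed
  have "snd (enc (dec u)) x = snd u x" for x
  proof -
    have "snd u x = snd u (re_part x) + \<i> * snd u (im_part x)"
      using cfunctionalD(1)[OF c, of "re_part x" "\<i> *\<^sub>C im_part x"] by (simp add: cfunctionalD(2)[OF c] re_im)
    then show ?thesis by (simp add: enc_def r)
  qed
  moreover have "fst (enc (dec u)) = fst u" using u by (simp add: enc_def dec_def elem_coord GR_iff)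
  ultimately show ?thesis by (simp add: prod_eq_iff fun_eq_iff)
qed

lemma GR_diff: "u \<in> GR \<Longrightarrow> v \<in> GR \<Longrightarrow> u - v \<in> GR"
proof -
  assume uv: "u \<in> GR" "v \<in> GR"
  then have c: "cfunctional (snd u)" "cfunctional (snd v)" by (simp_all add: GR_iff)
  have "cfunctional (snd u - snd v)" by (rule cfunctionalI) (simp_all add: cfunctionalD[OF c(1)] cfunctionalD[OF c(2)] algebra_simps)
  then show ?thesis using uv by (simp add: GR_iff rf_diff)
qed

lemma dec_add: "u \<in> GR \<Longrightarrow> v \<in> GR \<Longrightarrow> dec (u + v) = dec u + dec v"
  by (simp add: dec_def GR_iff coord_add scaleR_add_left sum.distrib)

lemma dec_diff: "u \<in> GR \<Longrightarrow> v \<in> GR \<Longrightarrow> dec (u - v) = dec u - dec v"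
  by (simp add: dec_def GR_iff coord_diff scaleR_diff_left sum_subtractf)

lemma dec_scale: "u \<in> GR \<Longrightarrow> dec (generalized_scale (complex_of_real r) u) = r *\<^sub>R dec u"
  by (simp add: dec_def GR_iff coord_scale scaleR_sum_right)

text \<open>Matches the trivialization by L with the left-invariant frame and its coframe, so that
  left-invariant endomorphisms have constant matrices.\<close>

lemma left_trivialization_enc:
  assumes x: "x \<in> points A"
  shows "left_trivialization A \<sigma> L x (enc (a, q)) = (linv a x, \<lambda>v. if v \<in> tangent_space A x then q \<bullet> mc_form x v else 0)"
proof -
  have xG: "x \<in> carrier G" using x by (simp add: points_carrier)
  have "Re (snd (enc (a, q)) (inv_into rf (\<lambda>Y. L Y x) v)) = q \<bullet> mc_form x v" if v: "v \<in> tangent_space A x" for v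
  proof -
    have "inj_on (\<lambda>Y. L Y x) rf"
    proof (rule inj_onI)
      fix X Y assume XY: "X \<in> rf" "Y \<in> rf" "L X x = L Y x"
      then have "mc_form x (linv (coord X) x) = mc_form x (linv (coord Y) x)" by (simp add: L_eq)
      then have "elem (coord X) = elem (coord Y)" by (simp add: mc_form_linv[OF xG])
      then show "X = Y" by (simp add: elem_coord XY)
    qed
    moreover have "L (elem (mc_form x v)) x = v" by (simp add: elem linv_mc_form[OF xG v])
    ultimately have "inv_into rf (\<lambda>Y. L Y x) v = elem (mc_form x v)" using elem(1) by (metis inv_into_f_f)
    then show ?thesis by (simp add: enc_real[OF elem(1)] coord_elem)
  qed
  then show ?thesis by (simp add: left_trivialization_def elem fun_eq_iff) (simp add: enc_def elem)
qed

lemma left_trivialization_inj: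
  assumes x: "x \<in> points A"
  shows "inj_on (left_trivialization A \<sigma> L x) GR"
proof (rule inj_onI)
  fix u v assume u: "u \<in> GR" and v: "v \<in> GR" and eq: "left_trivialization A \<sigma> L x u = left_trivialization A \<sigma> L x v"
  have xG: "x \<in> carrier G" using x by (simp add: points_carrier)
  obtain a q where u': "dec u = (a, q)" by fastforce
  obtain b r where v': "dec v = (b, r)" by fastforce
  have e: "left_trivialization A \<sigma> L x (enc (a, q)) = left_trivialization A \<sigma> L x (enc (b, r))"
    using eq enc_dec[OF u] enc_dec[OF v] by (simp only: u' v')
  have lab: "linv a x = linv b x" and
    qr: "(\<lambda>v. if v \<in> tangent_space A x then q \<bullet> mc_form x v else 0) = (\<lambda>v. if v \<in> tangent_space A x then r \<bullet> mc_form x v else 0)"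
    using arg_cong[OF e, of fst] arg_cong[OF e, of snd] unfolding left_trivialization_enc[OF x] fst_conv snd_conv .
  have "a = b" using lab mc_form_linv[OF xG] by metis
  moreover have "q \<bullet> w = r \<bullet> w" for w
    using fun_cong[OF qr, of "linv w x"] by (simp add: linv_tangent[OF xG] mc_form_linv[OF xG])
  then have "q = r" by (intro vector_eq_rdot[THEN iffD1]) simp
  ultimately show "u = v" using enc_dec[OF u] enc_dec[OF v] u' v' by metis
qed

end

section \<open>The algebraic structure in real coordinates, and its transfer to the cotangent
  bundle\<close>

locale admissible_on_group = admissible_pair h E N a \<sigma> k \<epsilon> + lie_group_of_form G A \<sigma> L
  for h :: "'g::complex_lie_algebra set" and E N a \<sigma> k \<epsilon>
    and G :: "('m, 'b) monoid_scheme" (structure) and A :: "('m, 'e::euclidean_space) chart set" and L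
begin

text \<open>Real elements are the fixed points of conjugation, so every operation that commutes with
  conjugation preserves them.\<close>

lemma GR_gc: "u \<in> GR \<longleftrightarrow> u \<in> gV \<and> gc u = u"
proof
  assume u: "u \<in> GR"
  then have c: "cfunctional (snd u)" by (simp add: GR_iff)
  have "cnj (snd u (\<sigma> x)) = snd u x" for x
  proof -
    have r: "cnj (snd u X) = snd u X" if "X \<in> rf" for X using u that by (simp add: GR_iff Reals_cnj_iff)
    have "\<sigma> x = re_part x + (- \<i>) *\<^sub>C im_part x"
      using arg_cong[OF re_im[of x], of \<sigma>] re_part_rf[of x] im_part_rf[of x]
      by (simp add: rf_iff sigma_add sigma_scale)
    then have "snd u (\<sigma> x) = snd u (re_part x) + (- \<i>) * snd u (im_part x)" by (simp only: cfunctionalD[OF c])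
    moreover have "snd u x = snd u (re_part x) + \<i> * snd u (im_part x)"
      using cfunctionalD(1)[OF c, of "re_part x" "\<i> *\<^sub>C im_part x"] by (simp add: cfunctionalD(2)[OF c] re_im)
    ultimately show ?thesis by (simp add: r)
  qed
  then show "u \<in> gV \<and> gc u = u" using u by (simp add: gV_iff GR_iff generalized_conj_def prod_eq_iff rf_iff)
next
  assume u: "u \<in> gV \<and> gc u = u"
  then have f: "\<sigma> (fst u) = fst u" and s: "cnj (snd u (\<sigma> X)) = snd u X" for X
    by (auto simp: generalized_conj_def prod_eq_iff fun_eq_iff)
  have "snd u X \<in> \<real>" if "X \<in> rf" for X using s[of X] that by (simp add: rf_iff Reals_cnj_iff)
  then show "u \<in> GR" using u f by (simp add: GR_iff gV_iff rf_iff)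
qed

lemma gJ_GR: "u \<in> GR \<Longrightarrow> gJ u \<in> GR"
  unfolding GR_gc using gJ_V gJ_gc by metis

lemma gbr_GR: "u \<in> GR \<Longrightarrow> v \<in> GR \<Longrightarrow> gbr u v \<in> GR"
  unfolding GR_gc using gbr_V gbr_gc by metis

lemma tau_rf: "X \<in> rf \<Longrightarrow> tau X \<in> rf"
  by (simp add: rf_iff tau_sigma)

definition DE :: "'e \<Rightarrow> 'e \<Rightarrow> 'e" where "DE v w = coord [tau (elem v), elem w]\<^sub>L"
definition BE :: "'e \<Rightarrow> 'e \<Rightarrow> 'e" where "BE v w = coord [elem v, elem w]\<^sub>L"

lemma DE_rf: "[tau (elem v), elem w]\<^sub>L \<in> rf"
  by (intro rf_bracket tau_rf elem)

lemma DE_bilinear: "bilinear DE"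
  unfolding bilinear_def
  by (intro allI conjI linearI)
    (simp_all add: DE_def elem_add elem_scale tau_linear lie_linear coord_add coord_scale DE_rf)

lemma DE_flat: "DE u (DE v w) - DE v (DE u w) = DE (BE u v) w"
proof -
  have r: "[tau (elem u), [tau (elem v), elem w]\<^sub>L]\<^sub>L \<in> rf" for u v w by (intro rf_bracket tau_rf elem)
  have "[tau (elem u), [tau (elem v), elem w]\<^sub>L]\<^sub>L - [tau (elem v), [tau (elem u), elem w]\<^sub>L]\<^sub>L = [tau [elem u, elem v]\<^sub>L, elem w]\<^sub>L"
    using tau_flat[of "elem u" "elem v" "elem w"] by (simp add: algebra_simps)
  then show ?thesis
    by (simp add: DE_def BE_def elem_coord DE_rf rf_bracket elem coord_diff[OF r r, symmetric])
qed

sublocale conn: parallelized_connection A linv mc_form DE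
  by unfold_locales (rule DE_bilinear)

definition KE :: "'e \<times> 'e \<Rightarrow> 'e \<times> 'e" where "KE s = dec (gJ (enc s))"

lemma enc_KE: "enc (KE s) = gJ (enc s)"
  by (simp add: KE_def enc_dec gJ_GR enc_GR)

lemma enc_gV: "enc s \<in> gV"
  using enc_GR[of s] unfolding GR_gc by blast

lemma KE_linear: "linear KE"
  by (rule linearI)
    (simp_all add: KE_def enc_add enc_scale gJ_add gJ_scale enc_gV dec_add dec_scale gJ_GR enc_GR del: mem_Times_iff)

lemma KE_KE: "KE (KE s) = - s"
proof -
  have "KE (KE s) = dec (gJ (gJ (enc s)))" unfolding KE_def[of "KE s"] enc_KE ..
  also have "\<dots> = dec (generalized_scale (complex_of_real (-1)) (enc s))" by (simp add: gJ_gJ enc_gV)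
  also have "\<dots> = (-1) *\<^sub>R dec (enc s)" by (rule dec_scale[OF enc_GR])
  finally show ?thesis by (simp add: dec_enc)
qed

definition CE :: "'e \<times> 'e \<Rightarrow> 'e \<times> 'e \<Rightarrow> 'e \<times> 'e" where "CE s t = dec (gbr (enc s) (enc t))"

text \<open>Identifies the algebraic bracket \<open>gbr\<close> with the structure coefficients of
  the frame on the cotangent bundle, the meeting point of the two halves of the argument.\<close>

lemma CE_eq: "CE s t = (BE (fst s) (fst t), dual_map (DE (fst t)) (snd s) - dual_map (DE (fst s)) (snd t))"
proof -
  have lin: "linear (DE v)" for v using DE_bilinear by (simp add: bilinear_def)
  have "snd (CE s t) \<bullet> w = (dual_map (DE (fst t)) (snd s) - dual_map (DE (fst s)) (snd t)) \<bullet> w" for w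
  proof -
    have e: "fst (enc s) = elem (fst s)" for s by (simp add: enc_def)
    have "cfunctional (snd (gbr (enc s) (enc t)))" using gbr_GR[OF enc_GR enc_GR] unfolding GR_iff by blast
    then have "snd (CE s t) \<bullet> w = Re (snd (gbr (enc s) (enc t)) (elem w))" unfolding CE_def by (rule dec_inner)
    also have "\<dots> = snd s \<bullet> DE (fst t) w - snd t \<bullet> DE (fst s) w"
      by (simp add: gbr_def e enc_real[OF DE_rf] DE_def)
    also have "\<dots> = (dual_map (DE (fst t)) (snd s) - dual_map (DE (fst s)) (snd t)) \<bullet> w"
      by (simp add: inner_diff_left dual_map_inner lin)
    finally show ?thesis .
  qed
  then have "snd (CE s t) = dual_map (DE (fst t)) (snd s) - dual_map (DE (fst s)) (snd t)" by (intro vector_eq_rdot[THEN iffD1]) simp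
  moreover have "fst (CE s t) = BE (fst s) (fst t)" by (simp add: CE_def dec_def gbr_def BE_def enc_def)
  ultimately show ?thesis by (simp add: prod_eq_iff)
qed

lemma CE_integrable: "CE (KE s) (KE t) - KE (CE (KE s) t) - KE (CE s (KE t)) - CE s t = 0"
proof -
  have K: "KE (CE s t) = dec (gJ (gbr (enc s) (enc t)))" for s t
  proof -
    have "enc (CE s t) = gbr (enc s) (enc t)" unfolding CE_def by (rule enc_dec[OF gbr_GR[OF enc_GR enc_GR]])
    then show ?thesis by (simp only: KE_def)
  qed
  let ?u = "enc s" and ?v = "enc t"
  note m = gbr_GR gJ_GR enc_GR
  have "CE (KE s) (KE t) - KE (CE (KE s) t) - KE (CE s (KE t)) - CE s t =
      dec (gbr (gJ ?u) (gJ ?v)) - dec (gJ (gbr (gJ ?u) ?v)) - dec (gJ (gbr ?u (gJ ?v))) - dec (gbr ?u ?v)"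
    unfolding K unfolding CE_def enc_KE ..
  also have "\<dots> = dec (gbr (gJ ?u) (gJ ?v) - gJ (gbr (gJ ?u) ?v) - gJ (gbr ?u (gJ ?v)) - gbr ?u ?v)"
    by (simp only: dec_diff GR_diff m)
  also have "\<dots> = dec 0" by (simp only: gbr_integrable[OF enc_gV enc_gV])
  also have "\<dots> = 0" by (simp add: dec_def coord_zero zero_prod_def)
  finally show ?thesis .
qed

lemma connection: "left_invariant_connection G A \<sigma> L (D_zero h E a \<sigma>) conn.nab"
  unfolding left_invariant_connection_def D_zero_eq
proof (intro conjI ballI conn.affine_connection_nab)
  fix X Y x assume XY: "X \<in> rf" "Y \<in> rf" and x: "x \<in> carrier G"
  have "conn.nab x (linv (coord X) x) (linv (coord Y)) = linv (DE (mc_form x (linv (coord X) x)) (coord Y)) x"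
    by (rule conn.nab_frame) (simp_all add: points_carrier x linv_tangent)
  then show "conn.nab x (L X x) (L Y) = L [tau X, Y]\<^sub>L x"
    by (simp add: L_eq XY mc_form_linv[OF x] rf_bracket tau_rf) (simp add: DE_def elem_coord XY)
qed

lemma endo:
  assumes x: "x \<in> points A"
  shows "left_invariant_endo A \<sigma> L gJ x (linv v x, conn.frame_covec x w) =
    (linv (fst (KE (v, w))) x, conn.frame_covec x (snd (KE (v, w))))"
proof -
  have t: "left_trivialization A \<sigma> L x (enc s) = (linv (fst s) x, conn.frame_covec x (snd s))" for s
    using left_trivialization_enc[OF x, of "fst s" "snd s"] by (simp add: conn.frame_covec_def)
  have "left_invariant_endo A \<sigma> L gJ x (left_trivialization A \<sigma> L x (enc (v, w))) =
      left_trivialization A \<sigma> L x (gJ (enc (v, w)))"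
    unfolding left_invariant_endo_def inv_into_f_f[OF left_trivialization_inj[OF x] enc_GR] ..
  then show ?thesis unfolding enc_KE[symmetric] t by simp
qed

theorem complex_structure_on_cotangent: "defines_complex_structure G A \<sigma> L k (D_zero h E a \<sigma>) \<epsilon>"
  unfolding defines_complex_structure_def
proof (intro exI conjI)
  show "complex_structure (cotangent_atlas A) (cotangent_structure A conn.nab (left_invariant_endo A \<sigma> L gJ))"
  proof (rule conn.cotangent_complex_structure[where K = KE and B = CE and \<beta> = BE])
    show "vf_bracket A (linv v) (linv w) = linv (BE v w)" for v w
      using L_bracket[OF elem(1) elem(1), of v w] L_eq[OF rf_bracket[OF elem(1) elem(1)], of v w]
      by (simp add: elem BE_def)
  qed (rule DE_flat KE_linear KE_KE CE_eq CE_integrable | erule endo)+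
qed (rule gJ_associated connection)+

end

theorem theorem32:
  fixes h k :: "'g::complex_lie_algebra set"
    and E :: "('g \<Rightarrow> complex) \<Rightarrow> 'g"
    and N :: "('g \<Rightarrow> complex) \<Rightarrow> ('g \<Rightarrow> complex) \<Rightarrow> real"
    and a :: "('g \<Rightarrow> complex) \<Rightarrow> real"
    and \<sigma> :: "'g \<Rightarrow> 'g"
    and \<epsilon> :: "'g \<Rightarrow> 'g \<Rightarrow> complex"
    and G :: "('m, 'b) monoid_scheme"
    and A :: "('m, 'e::euclidean_space) chart set"
    and L :: "'g \<Rightarrow> 'm \<Rightarrow> ('m, 'e) tvec"
  assumes "inner_real_form h E N a \<sigma>"
    and "lie_group G A"
    and "lie_algebra_iso G A \<sigma> L"
    and "regular_subalgebra h \<sigma> k"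
    and "skew_hermitian_on \<sigma> k \<epsilon>"
  shows "(symmetric_admissible \<sigma> k (D_zero h E a \<sigma>) \<epsilon> \<longleftrightarrow>
      (positive_root_system (roots h) (roots_of h k) \<and>
       {X + Y | X Y. X \<in> k \<inter> h \<and> Y \<in> \<sigma> ` (k \<inter> h)} = h) \<and>
      (\<exists>\<epsilon>\<^sub>0 (\<mu> :: ('g \<Rightarrow> complex) \<Rightarrow> real).
         skew_hermitian_on \<sigma> (k \<inter> h) \<epsilon>\<^sub>0 \<and>
         (\<forall>X\<in>k. \<forall>Y\<in>\<sigma> ` k.
            \<epsilon> X Y = \<epsilon>\<^sub>0 (cartan_proj h E X) (cartan_proj h E Y)
              + (\<Sum>\<alpha>\<in>roots_of h k. complex_of_real (\<mu> \<alpha>) *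
                   (root_ext h E \<alpha> X * omega h E (- \<alpha>) Y
                    - complex_of_real (a \<alpha>) * omega h E \<alpha> X * root_ext h E \<alpha> Y))
              + (\<Sum>(\<alpha>, \<beta>) \<in> {(\<alpha>, \<beta>). \<alpha> \<in> roots_of h k \<and> \<beta> \<in> roots_of h k \<and>
                                     \<alpha> + \<beta> \<in> roots_of h k}.
                   complex_of_real (a \<alpha> * \<mu> (\<alpha> + \<beta>) * N \<alpha> \<beta>) *
                   (omega h E \<alpha> X * omega h E (- \<beta>) Y)))) \<and>
      nondegenerate_on (k \<inter> h \<inter> {\<i> *\<^sub>C H | H. H \<in> real_cartan h}) (\<lambda>X Y. Im (\<epsilon> X Y))) \<and>
    (symmetric_admissible \<sigma> k (D_zero h E a \<sigma>) \<epsilon> \<longrightarrow>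
      defines_complex_structure G A \<sigma> L k (D_zero h E a \<sigma>) \<epsilon>)"
proof -
  interpret inner_real_form h E N a \<sigma> by (rule assms(1))
  interpret lie_group_of_form G A \<sigma> L
    by unfold_locales (rule assms(2) conjugation assms(3))+
  \<comment> \<open>Here the group supplies the antisymmetry on the real form that the algebraic
    part presupposes.\<close>
  interpret regular_pair h E N a \<sigma> k \<epsilon>
    by unfold_locales (auto intro: bracket_antisym assms(4,5))
  have "defines_complex_structure G A \<sigma> L k (D_zero h E a \<sigma>) \<epsilon>"
    if adm: "symmetric_admissible \<sigma> k (D_zero h E a \<sigma>) \<epsilon>"
  proof -
    have sum: "{X + Y | X Y. X \<in> k \<and> Y \<in> kbar} = UNIV" using adm unfolding symmetric_admissible_def kbar_def by blast
    have coc: "\<epsilon> X [tau Y, \<sigma> Z]\<^sub>L - \<epsilon> Y [tau X, \<sigma> Z]\<^sub>L = \<epsilon> [X, Y]\<^sub>L (\<sigma> Z)" if "X \<in> k" "Y \<in> k" "Z \<in> k" for X Y Z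
      using adm that unfolding symmetric_admissible_def D_zero_eq by blast
    interpret admissible_on_group h E N a \<sigma> k \<epsilon> G A L
    proof unfold_locales
      show "\<epsilon> X [tau Y, W]\<^sub>L - \<epsilon> Y [tau X, W]\<^sub>L = \<epsilon> [X, Y]\<^sub>L W" if "X \<in> k" "Y \<in> k" "W \<in> kbar" for X Y W
        using coc[of X Y "\<sigma> W"] that by (simp add: kbar_iff)
      show "cartan_spans" using sum unfolding sum_iff by blast
      show "nondegenerate_on (k \<inter> rf) (\<lambda>X Y. Im (\<epsilon> X Y))" using adm unfolding symmetric_admissible_def by blast
    qed (rule sum)
    show ?thesis by (rule complex_structure_on_cotangent)
  qed
  then show ?thesis
    using admissible_iff unfolding standard_form_def cartan_spans_def kbar_def add.assoc by blast
qed

end
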